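(* Let $\mathcal A$ be a locally acyclic cluster variety (over $\mathbb C$) of full rank, and let $T\subset\mathcal A$ be a cluster torus. Then the space of standard forms on $\mathcal A$ is naturally isomorphic (by restriction to $T$) to the space of standard forms on $T$ that extend to regular differential forms on the cluster tori neighboring $T$.
   Context: **Cluster varieties.** An extended exchange matrix is an $(n+m)\times n$ integer matrix $\tilde B$ whose top $n\times n$ submatrix is skew-symmetric. A seed $(\mathbf x,\tilde B)$ consists of $\tilde B$ together with $n+m$ algebraically independent elements $x_1,\dots,x_{n+m}$ generating a rational function field $\mathcal F$ over $\mathbb C$. Write $[a]_+=\max(a,0)$, $[a]_-=\min(a,0)$. For $1\le k\le n$, mutation $\mu_k$ replaces $\tilde B$ by $\tilde B'$ with $\tilde B'_{ij}=-\tilde B_{ij}$ if $i=k$ or $j=k$, and $\tilde B'_{ij}=\tilde B_{ij}+[\tilde B_{ik}]_+[\tilde B_{kj}]_+-[\tilde B_{ik}]_-[\tilde B_{kj}]_-$ otherwise; and replaces $x_k$ by $x_k'=\big(\prod_i x_i^{[\tilde B_{ik}]_+}+\prod_i x_i^{[-\tilde B_{ik}]_+}\big)/x_k$, leaving the other $x_i$ unchanged. The tuples in seeds obtained by iterated mutation are clusters, their entries are cluster variables; $x_{n+1},\dots,x_{n+m}$ are frozen. $A=A(\tilde B)\subset\mathcal F$ is the $\mathbb C$-subalgebra generated by all cluster variables and the inverses of the frozen variables; $\mathcal A=\operatorname{Spec}A$. Full rank means $\operatorname{rank}\tilde B=n$. For each cluster, $A\subset\mathbb C[x_1^{\pm1},\dots,x_{n+m}^{\pm1}]$,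 and the open subset $\operatorname{Spec}\mathbb C[x_1^{\pm1},\dots,x_{n+m}^{\pm1}]\subset\mathcal A$ is called a cluster torus. The cluster tori neighboring $T$ are the $n$ tori of the clusters obtained from the cluster of $T$ by a single mutation $\mu_k$, $1\le k\le n$. A form on $T$ extends to a cluster torus $T'$ if there is a regular differential form on $T'$ agreeing with it on $T\cap T'$. **Local acyclicity.** The quiver of $\tilde B$ has vertices $1,\dots,n$ and an edge $i\to j$ whenever $\tilde B_{ij}>0$. A cluster algebra is acyclic if the quiver of some seed has no directed cycles. For $S\subseteq[n]$ (and any seed), $\tilde B_S$ is the matrix of columns of $\tilde B$ indexed by $S$ (variables $x_i$, $i\notin S$, become frozen). If $A(\tilde B_S)\cong A[x_i^{-1}:i\in[n]\setminus S]$, then $\mathcal A(\tilde B_S)\subset\mathcal A$ is called a cluster chart. $\mathcal A$ is locally acyclic if it is covered by finitely many acyclic cluster charts. **Standard forms.** A differential form on a torus $\operatorname{Spec}\mathbb C[x_1^{\pm1},\dots,x_r^{\pm1}]$ is standard if it is a $\mathbb C$-linear combination of the forms $\frac{dx_{i_1}}{x_{i_1}}\wedge\cdots\wedge\frac{dx_{i_k}}{x_{i_k}}$. A regular (algebraic) differential form on $\mathcal A$ is standard if it restricts to a standard form on every cluster torus of $\mathcal A$. *)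

theory Defs
  imports
    "HOL-Library.Poly_Mapping"
    "HOL-Algebra.Generated_Fields"
    "HOL-Algebra.Ideal"
    "Jordan_Normal_Form.DL_Rank"
begin

section \<open>Seeds and mutation\<close>

text \<open>
  The ground field embeds into the ambient field via \<open>\<iota> :: complex \<Rightarrow> 'f\<close>. A seed is a pair
  of a cluster, of which only the entries with index \<open>< n + m\<close> matter, and an
  \<open>(n + m) \<times> n\<close> integer matrix. Indices are 0-based: \<open>0, \<dots>, n - 1\<close> are mutable and
  \<open>n, \<dots>, n + m - 1\<close> are frozen.
\<close>

type_synonym 'f seed = "(nat \<Rightarrow> 'f) \<times> int mat"

definition mpoly_eval ::
  "(complex \<Rightarrow> 'f::field) \<Rightarrow> (nat \<Rightarrow> 'f) \<Rightarrow> ((nat \<Rightarrow>\<^sub>0 nat) \<Rightarrow>\<^sub>0 complex) \<Rightarrow> 'f" where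
  "mpoly_eval \<iota> x p =
     (\<Sum>\<mu>\<in>Poly_Mapping.keys p. \<iota> (Poly_Mapping.lookup p \<mu>) *
        (\<Prod>i\<in>Poly_Mapping.keys \<mu>. x i ^ Poly_Mapping.lookup \<mu> i))"

definition alg_independent :: "(complex \<Rightarrow> 'f::field) \<Rightarrow> nat \<Rightarrow> (nat \<Rightarrow> 'f) \<Rightarrow> bool" where
  "alg_independent \<iota> r x \<longleftrightarrow>
     (\<forall>p. (\<forall>\<mu>\<in>Poly_Mapping.keys p. Poly_Mapping.keys \<mu> \<subseteq> {..<r}) \<and> mpoly_eval \<iota> x p = 0
        \<longrightarrow> p = 0)"

definition is_seed :: "(complex \<Rightarrow> 'f::field) \<Rightarrow> nat \<Rightarrow> nat \<Rightarrow> 'f seed \<Rightarrow> bool" where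
  "is_seed \<iota> n m = (\<lambda>(x, B).
     B \<in> carrier_mat (n + m) n \<and>
     (\<forall>i<n. \<forall>j<n. B $$ (i, j) = - B $$ (j, i)) \<and>
     alg_independent \<iota> (n + m) x \<and>
     generate_field class_ring (range \<iota> \<union> x ` {..<n + m}) = UNIV)"

definition full_rank :: "int mat \<Rightarrow> bool" where
  "full_rank B \<longleftrightarrow> vec_space.rank (dim_row B) (map_mat rat_of_int B) = dim_col B"

definition mutate_mat :: "nat \<Rightarrow> int mat \<Rightarrow> int mat" where
  "mutate_mat k B = mat (dim_row B) (dim_col B) (\<lambda>(i, j).
     if i = k \<or> j = k then - B $$ (i, j)
     else B $$ (i, j) + max (B $$ (i, k)) 0 * max (B $$ (k, j)) 0
                      - min (B $$ (i, k)) 0 * min (B $$ (k, j)) 0)"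

definition mutate :: "nat \<Rightarrow> 'f::field seed \<Rightarrow> 'f seed" where
  "mutate k = (\<lambda>(x, B).
     (x(k := ((\<Prod>i<dim_row B. x i ^ nat (max (B $$ (i, k)) 0)) +
              (\<Prod>i<dim_row B. x i ^ nat (max (- B $$ (i, k)) 0))) / x k),
      mutate_mat k B))"

text \<open>
  For a set \<open>S\<close> of mutable indices, the seed with exchange matrix \<open>B\<^sub>S\<close> is represented by the
  original seed together with \<open>S\<close>: all columns of \<open>B\<close> are kept, but only mutations in
  directions \<open>k \<in> S\<close> are allowed and indices outside \<open>S\<close> count as frozen. Under these
  mutations neither the columns indexed by \<open>S\<close> nor the clusters depend on the other columns.
\<close>

inductive_set mutation_class :: "nat set \<Rightarrow> 'f::field seed \<Rightarrow> 'f seed set"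
  for S s where
  base: "s \<in> mutation_class S s"
| step: "t \<in> mutation_class S s \<Longrightarrow> k \<in> S \<Longrightarrow> mutate k t \<in> mutation_class S s"

section \<open>Cluster algebras and cluster tori\<close>

text \<open>
  Affine varieties with function field inside \<open>'f\<close> are given by their coordinate rings,
  which are subsets of \<open>'f\<close>.
\<close>

definition subalgebra_gen :: "(complex \<Rightarrow> 'f::field) \<Rightarrow> 'f set \<Rightarrow> 'f set" where
  "subalgebra_gen \<iota> H = generate_ring class_ring (range \<iota> \<union> H)"

definition cluster_algebra :: "(complex \<Rightarrow> 'f::field) \<Rightarrow> nat set \<Rightarrow> 'f seed \<Rightarrow> 'f set" where
  "cluster_algebra \<iota> S s = subalgebra_gen \<iota>
     ({x i |x B i. (x, B) \<in> mutation_class S s \<and> i < dim_row (snd s)} \<union>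
      {inverse (fst s i) |i. i < dim_row (snd s) \<and> i \<notin> S})"

abbreviation mutable :: "'f seed \<Rightarrow> nat set" where
  "mutable s \<equiv> {..<dim_col (snd s)}"

definition torus_ring :: "(complex \<Rightarrow> 'f::field) \<Rightarrow> 'f seed \<Rightarrow> 'f set" where
  "torus_ring \<iota> s = subalgebra_gen \<iota>
     (fst s ` {..<dim_row (snd s)} \<union> (\<lambda>i. inverse (fst s i)) ` {..<dim_row (snd s)})"

section \<open>Local acyclicity\<close>

definition quiver :: "nat set \<Rightarrow> int mat \<Rightarrow> (nat \<times> nat) set" where
  "quiver S B = {(i, j). i \<in> S \<and> j \<in> S \<and> B $$ (i, j) > 0}"

definition acyclic_cluster :: "nat set \<Rightarrow> 'f::field seed \<Rightarrow> bool" where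
  "acyclic_cluster S s \<longleftrightarrow> (\<exists>(x, B)\<in>mutation_class S s. acyclic (quiver S B))"

text \<open>
  \<open>A(B\<^sub>S)\<close> and the localization of \<open>A\<close> are both subalgebras of \<open>'f\<close>, and the isomorphism
  that gives the inclusion of spectra is the identity.
\<close>

definition is_cluster_chart :: "(complex \<Rightarrow> 'f::field) \<Rightarrow> 'f set \<Rightarrow> 'f seed \<Rightarrow> nat set \<Rightarrow> bool" where
  "is_cluster_chart \<iota> A s S \<longleftrightarrow> S \<subseteq> mutable s \<and>
     cluster_algebra \<iota> S s = subalgebra_gen \<iota> (A \<union> {inverse (fst s i) |i. i \<in> mutable s - S})"

definition spec :: "'f::field set \<Rightarrow> 'f set set" where
  "spec R = {p. primeideal p (class_ring\<lparr>carrier := R\<rparr>)}"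

definition locally_acyclic :: "(complex \<Rightarrow> 'f::field) \<Rightarrow> 'f seed \<Rightarrow> bool" where
  "locally_acyclic \<iota> s \<longleftrightarrow> (let A = cluster_algebra \<iota> (mutable s) s in
     \<exists>\<C>. finite \<C> \<and>
       (\<forall>(t, S)\<in>\<C>. t \<in> mutation_class (mutable s) s \<and> is_cluster_chart \<iota> A t S \<and>
          acyclic_cluster S t) \<and>
       spec A = (\<Union>(t, S)\<in>\<C>. (\<lambda>q. q \<inter> A) ` spec (cluster_algebra \<iota> S t)))"

section \<open>Regular differential forms\<close>

definition free_space :: "'s set \<Rightarrow> (complex, 's \<Rightarrow>\<^sub>0 complex) module" where
  "free_space S = \<lparr>carrier = {p. Poly_Mapping.keys p \<subseteq> S}, mult = undefined, one = undefined,
     zero = 0, add = (+), smult = (\<lambda>c. Poly_Mapping.map ((*) c))\<rparr>"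

definition quotient_module :: "('a, 'b) module \<Rightarrow> 'b set \<Rightarrow> ('a, 'b set) module" where
  "quotient_module M N = \<lparr>carrier = a_rcosets\<^bsub>M\<^esub> N, mult = undefined, one = undefined,
     zero = N, add = (\<lambda>X Y. X <+>\<^bsub>M\<^esub> Y), smult = (\<lambda>c X. \<Union>v\<in>X. N +>\<^bsub>M\<^esub> (c \<odot>\<^bsub>M\<^esub> v))\<rparr>"

text \<open>
  Regular forms of all degrees on the affine variety with coordinate ring \<open>R\<close>, i.e. the
  exterior algebra \<open>\<Oplus>\<^sub>k \<Lambda>\<^sup>k \<Omega>\<close> over \<open>R\<close> of the module \<open>\<Omega>\<close> of Kaehler differentials of \<open>R\<close>
  over the complex numbers. As a complex vector space it is presented by generators
  \<open>(a, [b\<^sub>1, \<dots>, b\<^sub>k])\<close>, standing for \<open>a db\<^sub>1 \<and> \<dots> \<and> db\<^sub>k\<close> with all entries in \<open>R\<close>, modulo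
  linearity in \<open>a\<close>, the defining relations of \<open>d\<close> in each \<open>b\<^sub>j\<close>, and \<open>db \<and> db = 0\<close>.
  The ring \<open>R\<close> is part of the presentation: forms are not a priori identified
  with their images in the forms of the function field.
\<close>

definition form_symbol :: "'f \<Rightarrow> 'f list \<Rightarrow> ('f \<times> 'f list) \<Rightarrow>\<^sub>0 complex" where
  "form_symbol a bs = Poly_Mapping.single (a, bs) 1"

inductive_set form_relations ::
  "(complex \<Rightarrow> 'f::field) \<Rightarrow> 'f set \<Rightarrow> (('f \<times> 'f list) \<Rightarrow>\<^sub>0 complex) set"
  for \<iota> R where
  scale: "\<lbrakk>a \<in> R; bs \<in> lists R\<rbrakk> \<Longrightarrow>
    form_symbol (\<iota> c * a) bs - Poly_Mapping.single (a, bs) c \<in> form_relations \<iota> R"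
| add: "\<lbrakk>a \<in> R; a' \<in> R; bs \<in> lists R\<rbrakk> \<Longrightarrow>
    form_symbol (a + a') bs - (form_symbol a bs + form_symbol a' bs) \<in> form_relations \<iota> R"
| d_const: "\<lbrakk>a \<in> R; us \<in> lists R; vs \<in> lists R\<rbrakk> \<Longrightarrow>
    form_symbol a (us @ \<iota> c # vs) \<in> form_relations \<iota> R"
| d_add: "\<lbrakk>a \<in> R; b \<in> R; b' \<in> R; us \<in> lists R; vs \<in> lists R\<rbrakk> \<Longrightarrow>
    form_symbol a (us @ (b + b') # vs)
      - (form_symbol a (us @ b # vs) + form_symbol a (us @ b' # vs)) \<in> form_relations \<iota> R"
| d_mult: "\<lbrakk>a \<in> R; b \<in> R; b' \<in> R; us \<in> lists R; vs \<in> lists R\<rbrakk> \<Longrightarrow>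
    form_symbol a (us @ (b * b') # vs)
      - (form_symbol (a * b) (us @ b' # vs) + form_symbol (a * b') (us @ b # vs))
      \<in> form_relations \<iota> R"
| alternating: "\<lbrakk>a \<in> R; b \<in> R; us \<in> lists R; vs \<in> lists R; ws \<in> lists R\<rbrakk> \<Longrightarrow>
    form_symbol a (us @ b # vs @ b # ws) \<in> form_relations \<iota> R"

definition null_forms ::
  "(complex \<Rightarrow> 'f::field) \<Rightarrow> 'f set \<Rightarrow> (('f \<times> 'f list) \<Rightarrow>\<^sub>0 complex) set" where
  "null_forms \<iota> R =
     LinearCombinations.module.span class_ring (free_space (R \<times> lists R)) (form_relations \<iota> R)"

definition forms ::
  "(complex \<Rightarrow> 'f::field) \<Rightarrow> 'f set \<Rightarrow> (complex, (('f \<times> 'f list) \<Rightarrow>\<^sub>0 complex) set) module" where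
  "forms \<iota> R = quotient_module (free_space (R \<times> lists R)) (null_forms \<iota> R)"

definition elem_form ::
  "(complex \<Rightarrow> 'f::field) \<Rightarrow> 'f set \<Rightarrow> 'f \<Rightarrow> 'f list \<Rightarrow> (('f \<times> 'f list) \<Rightarrow>\<^sub>0 complex) set" where
  "elem_form \<iota> R a bs = null_forms \<iota> R +>\<^bsub>free_space (R \<times> lists R)\<^esub> form_symbol a bs"

text \<open>
  Restriction from \<open>R\<close> to a larger coordinate ring \<open>R'\<close> (a smaller open set): the class of
  a representative over \<open>R\<close> is sent to the class over \<open>R'\<close> of the same representative.
\<close>

definition form_restrict ::
  "(complex \<Rightarrow> 'f::field) \<Rightarrow> 'f set \<Rightarrow> (('f \<times> 'f list) \<Rightarrow>\<^sub>0 complex) set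
     \<Rightarrow> (('f \<times> 'f list) \<Rightarrow>\<^sub>0 complex) set" where
  "form_restrict \<iota> R' \<omega> = (\<Union>v\<in>\<omega>. null_forms \<iota> R' +>\<^bsub>free_space (R' \<times> lists R')\<^esub> v)"

text \<open>
  The coordinate ring of the intersection of two affine open subsets of an affine integral
  scheme is generated, inside the function field, by the two coordinate rings.
\<close>

definition form_extends ::
  "(complex \<Rightarrow> 'f::field) \<Rightarrow> 'f set \<Rightarrow> 'f set \<Rightarrow> (('f \<times> 'f list) \<Rightarrow>\<^sub>0 complex) set \<Rightarrow> bool" where
  "form_extends \<iota> R R' \<omega> \<longleftrightarrow> (\<exists>\<eta>\<in>carrier (forms \<iota> R').
     form_restrict \<iota> (subalgebra_gen \<iota> (R \<union> R')) \<eta> =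
     form_restrict \<iota> (subalgebra_gen \<iota> (R \<union> R')) \<omega>)"

section \<open>Standard forms\<close>

text \<open>
  \<open>dx\<^sub>i/x\<^sub>i \<and> dx\<^sub>j/x\<^sub>j \<and> \<dots>\<close> is the form \<open>(x\<^sub>i x\<^sub>j \<cdots>)\<^sup>-\<^sup>1 dx\<^sub>i \<and> dx\<^sub>j \<and> \<dots>\<close>.
\<close>

definition dlog_form ::
  "(complex \<Rightarrow> 'f::field) \<Rightarrow> 'f seed \<Rightarrow> nat list \<Rightarrow> (('f \<times> 'f list) \<Rightarrow>\<^sub>0 complex) set" where
  "dlog_form \<iota> s is =
     elem_form \<iota> (torus_ring \<iota> s) (\<Prod>i\<leftarrow>is. inverse (fst s i)) (map (fst s) is)"

definition standard_on_torus ::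
  "(complex \<Rightarrow> 'f::field) \<Rightarrow> 'f seed \<Rightarrow> (('f \<times> 'f list) \<Rightarrow>\<^sub>0 complex) set set" where
  "standard_on_torus \<iota> s = LinearCombinations.module.span class_ring (forms \<iota> (torus_ring \<iota> s))
     {dlog_form \<iota> s is |is. set is \<subseteq> {..<dim_row (snd s)}}"

definition standard_on_variety ::
  "(complex \<Rightarrow> 'f::field) \<Rightarrow> 'f seed \<Rightarrow> (('f \<times> 'f list) \<Rightarrow>\<^sub>0 complex) set set" where
  "standard_on_variety \<iota> s =
     {\<omega> \<in> carrier (forms \<iota> (cluster_algebra \<iota> (mutable s) s)).
        \<forall>t\<in>mutation_class (mutable s) s.
          form_restrict \<iota> (torus_ring \<iota> t) \<omega> \<in> standard_on_torus \<iota> t}"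

definition standard_extending ::
  "(complex \<Rightarrow> 'f::field) \<Rightarrow> 'f seed \<Rightarrow> (('f \<times> 'f list) \<Rightarrow>\<^sub>0 complex) set set" where
  "standard_extending \<iota> t =
     {\<omega> \<in> standard_on_torus \<iota> t.
        \<forall>k\<in>mutable t. form_extends \<iota> (torus_ring \<iota> t) (torus_ring \<iota> (mutate k t)) \<omega>}"

end

theory Submission
  imports Defs
begin

text \<open>
  Regular forms over a ring \<open>R\<close> are classes of formal sums of symbols \<open>a db\<^sub>1 \<and> \<dots> \<and> db\<^sub>k\<close>. The whole
  argument works with the formal sums themselves, written as lists of pairs \<open>(a, [b\<^sub>1, \<dots>, b\<^sub>k])\<close>. By
  linear duality two of them represent the same form iff they have the same value under every
  functional that satisfies the defining relations, so all identities between forms become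
  identities for such functionals. Forms over different coordinate rings are compared in the
  function field: \<open>extends_to R v\<close> says that the rational form \<open>v\<close> is regular on the variety of \<open>R\<close>, and
  \<open>torsion_free R\<close> that a form over \<open>R\<close> is zero as soon as it is zero as a rational form.

  Let \<open>A\<close> be the cluster algebra. Restriction to a cluster torus is injective because \<open>A\<close> is torsion
  free, and a form that comes from \<open>A\<close> certainly extends to the neighboring tori. For surjectivity two
  things are needed: a form that is regular on \<open>T\<close> and its neighbors is regular on \<open>A\<close>
  (\<open>locally_acyclic_forms\<close>), and if it is moreover standard on \<open>T\<close>, then it is standard on every
  cluster torus (\<open>standard_mutate\<close>).

  Regularity. Contraction with derivations lowers the degree of a form, and Euler's identity
  \<open>k v = \<Sum> d\<beta> \<and> i\<^sub>E v\<close> for a frame \<open>(E, \<beta>)\<close> of derivations and functions recovers \<open>v\<close> from its contractions.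
  So whenever a coordinate ring has such a frame, statements about forms follow from statements
  about functions. This is applied to the algebra generated by a cluster, the inverses of
  its variables outside \<open>S\<close> and the variables \<open>x'\<^sub>i\<close> exchanged for \<open>x\<^sub>i\<close>, \<open>i \<in> S\<close>, when no two elements of \<open>S\<close> are
  joined in the quiver. Independence of the columns of the exchange matrix makes the exchange
  polynomials \<open>x\<^sub>i x'\<^sub>i\<close> pairwise coprime and supplies the frame; the
  algebra is then the intersection of the Laurent rings of the cluster and of its neighbors in the directions \<open>S\<close>
  (\<open>isolated_upper\<close>), and the same holds for forms (\<open>isolated_extends\<close>). If \<open>S\<close> is
  acyclic with an edge from a source \<open>i\<close> to \<open>j\<close>, then \<open>x\<^sub>i\<close> and \<open>x\<^sub>j\<close> generate the unit ideal, and forms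
  are glued from the localizations at \<open>x\<^sub>i\<close> and \<open>x\<^sub>j\<close>, which belong to smaller sets
  (\<open>acyclic_good_chart\<close>). Two mutable vertices always form an acyclic set, and the two-element
  case shows that regularity on a cluster torus and its neighbors is invariant under mutation
  (\<open>good_seed_mutate\<close>). In degree 0 this is the Laurent phenomenon, which in turn
  identifies each acyclic cluster chart with one of the algebras above (\<open>chart_eq_lower\<close>). Finally
  the charts cover the spectrum, so the functions inverted on them generate the unit ideal
  of \<open>A\<close>, and forms are glued once more.

  Standardness. With \<open>P = x\<^sub>k x'\<^sub>k = M (1 + y)\<close> for monomials \<open>M\<close> and \<open>y\<close> in the other variables, the form
  \<open>dlog x\<^sub>k\<close> equals \<open>dlog M - dlog x'\<^sub>k + u dlog y\<close> with \<open>u = y / (1 + y)\<close>. So a standard form on \<open>T\<close> is \<open>\<sigma> + u \<tau>\<close>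
  with \<open>\<sigma>\<close>, \<open>\<tau>\<close> standard on the neighbor \<open>T'\<close>. If it is regular on \<open>T'\<close>, so is \<open>u \<tau>\<close>; contracting
  with the logarithmic vector fields of \<open>T'\<close> reduces the vanishing of \<open>\<tau>\<close> to degree 0, where it says that
  \<open>u\<close> has a pole along \<open>1 + y = 0\<close> (\<open>residue_vanishes\<close>).
\<close>

section \<open>Calculus of formal sums of differential forms\<close>

text \<open>The field \<open>'f\<close> is a complex algebra through \<open>\<iota>\<close>, as in the definition of seeds.\<close>

locale complex_field = field_hom \<iota> for \<iota> :: "complex \<Rightarrow> 'f::field"
begin

definition subalg :: "'f set \<Rightarrow> bool" where
  "subalg R \<longleftrightarrow> range \<iota> \<subseteq> R \<and> (\<forall>a\<in>R. \<forall>b\<in>R. a + b \<in> R \<and> a * b \<in> R)"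

text \<open>The relations of \<open>form_relations\<close>, read as conditions on a functional on symbols: these are the
  complex linear functionals on the forms over \<open>R\<close>, not only the alternating multilinear maps of \<open>R\<close>-modules.\<close>

definition alt :: "'f set \<Rightarrow> ('f \<Rightarrow> 'f list \<Rightarrow> complex) \<Rightarrow> bool" where
  "alt R G \<longleftrightarrow>
    (\<forall>a c bs. a \<in> R \<longrightarrow> set bs \<subseteq> R \<longrightarrow> G (\<iota> c * a) bs = c * G a bs) \<and>
    (\<forall>a a' bs. a \<in> R \<longrightarrow> a' \<in> R \<longrightarrow> set bs \<subseteq> R \<longrightarrow> G (a + a') bs = G a bs + G a' bs) \<and>
    (\<forall>a c us vs. a \<in> R \<longrightarrow> set us \<subseteq> R \<longrightarrow> set vs \<subseteq> R \<longrightarrow> G a (us @ \<iota> c # vs) = 0) \<and>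
    (\<forall>a b b' us vs. a \<in> R \<longrightarrow> b \<in> R \<longrightarrow> b' \<in> R \<longrightarrow> set us \<subseteq> R \<longrightarrow> set vs \<subseteq> R \<longrightarrow>
       G a (us @ (b + b') # vs) = G a (us @ b # vs) + G a (us @ b' # vs)) \<and>
    (\<forall>a b b' us vs. a \<in> R \<longrightarrow> b \<in> R \<longrightarrow> b' \<in> R \<longrightarrow> set us \<subseteq> R \<longrightarrow> set vs \<subseteq> R \<longrightarrow>
       G a (us @ (b * b') # vs) = G (a * b) (us @ b' # vs) + G (a * b') (us @ b # vs)) \<and>
    (\<forall>a b us vs ws. a \<in> R \<longrightarrow> b \<in> R \<longrightarrow> set us \<subseteq> R \<longrightarrow> set vs \<subseteq> R \<longrightarrow> set ws \<subseteq> R \<longrightarrow>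
       G a (us @ b # vs @ b # ws) = 0)"

definition pair :: "('f \<Rightarrow> 'f list \<Rightarrow> complex) \<Rightarrow> ('f \<times> 'f list) list \<Rightarrow> complex" where
  "pair G v = (\<Sum>(a, bs)\<leftarrow>v. G a bs)"

definition over :: "'f set \<Rightarrow> ('f \<times> 'f list) list \<Rightarrow> bool" where
  "over R v \<longleftrightarrow> (\<forall>(a, bs)\<in>set v. a \<in> R \<and> set bs \<subseteq> R)"

definition eqv :: "'f set \<Rightarrow> ('f \<times> 'f list) list \<Rightarrow> ('f \<times> 'f list) list \<Rightarrow> bool" where
  "eqv R v w \<longleftrightarrow> (\<forall>G. alt R G \<longrightarrow> pair G v = pair G w)"

definition extends_to :: "'f set \<Rightarrow> ('f \<times> 'f list) list \<Rightarrow> bool" where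
  "extends_to R v \<longleftrightarrow> (\<exists>w. over R w \<and> eqv UNIV v w)"

definition torsion_free :: "'f set \<Rightarrow> bool" where
  "torsion_free R \<longleftrightarrow> (\<forall>v. over R v \<longrightarrow> eqv UNIV v [] \<longrightarrow> eqv R v [])"

definition fmul :: "'f \<Rightarrow> ('f \<times> 'f list) list \<Rightarrow> ('f \<times> 'f list) list" where
  "fmul c v = map (\<lambda>(a, bs). (c * a, bs)) v"

definition fwedge :: "'f \<Rightarrow> ('f \<times> 'f list) list \<Rightarrow> ('f \<times> 'f list) list" where
  "fwedge b v = map (\<lambda>(a, bs). (a, b # bs)) v"

text \<open>The contraction of \<open>a db\<^sub>1 \<and> \<dots> \<and> db\<^sub>k\<close> with the derivation \<open>E\<close>, by the rule
  \<open>i\<^sub>E (db \<and> \<omega>) = E(b) \<omega> - db \<and> i\<^sub>E \<omega>\<close>.\<close>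

primrec contr1 :: "('f \<Rightarrow> 'f) \<Rightarrow> 'f \<Rightarrow> 'f list \<Rightarrow> ('f \<times> 'f list) list" where
  "contr1 E a [] = []"
| "contr1 E a (b # bs) = (a * E b, bs) # fmul (-1) (fwedge b (contr1 E a bs))"

definition contr :: "('f \<Rightarrow> 'f) \<Rightarrow> ('f \<times> 'f list) list \<Rightarrow> ('f \<times> 'f list) list" where
  "contr E v = concat (map (\<lambda>(a, bs). contr1 E a bs) v)"

definition derivation :: "('f \<Rightarrow> 'f) \<Rightarrow> bool" where
  "derivation E \<longleftrightarrow> (\<forall>c. E (\<iota> c) = 0) \<and> (\<forall>a b. E (a + b) = E a + E b) \<and>
    (\<forall>a b. E (a * b) = a * E b + b * E a)"

subsection \<open>Basic rules\<close>

lemma subalg_const [simp]: "subalg R \<Longrightarrow> \<iota> c \<in> R"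
  and subalg_add: "subalg R \<Longrightarrow> a \<in> R \<Longrightarrow> b \<in> R \<Longrightarrow> a + b \<in> R"
  and subalg_mult: "subalg R \<Longrightarrow> a \<in> R \<Longrightarrow> b \<in> R \<Longrightarrow> a * b \<in> R"
  by (auto simp: subalg_def)

lemma subalg_0 [simp]: "subalg R \<Longrightarrow> 0 \<in> R" and subalg_1 [simp]: "subalg R \<Longrightarrow> 1 \<in> R"
  using subalg_const[of R 0] subalg_const[of R 1] by auto

lemma subalg_uminus: "subalg R \<Longrightarrow> a \<in> R \<Longrightarrow> - a \<in> R"
  using subalg_mult[of R "\<iota> (-1)" a] subalg_const[of R "-1"] by (simp add: hom_distribs)

lemma subalg_diff: "subalg R \<Longrightarrow> a \<in> R \<Longrightarrow> b \<in> R \<Longrightarrow> a - b \<in> R"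
  using subalg_add[of R a "- b"] subalg_uminus[of R b] by simp

lemma subalg_power: "subalg R \<Longrightarrow> a \<in> R \<Longrightarrow> a ^ n \<in> R"
  by (induction n) (auto intro: subalg_mult)

lemma subalg_sum: "subalg R \<Longrightarrow> (\<And>i. i \<in> I \<Longrightarrow> f i \<in> R) \<Longrightarrow> sum f I \<in> R"
  by (induction I rule: infinite_finite_induct) (auto intro: subalg_add)

lemma subalg_prod: "subalg R \<Longrightarrow> (\<And>i. i \<in> I \<Longrightarrow> f i \<in> R) \<Longrightarrow> prod f I \<in> R"
  by (induction I rule: infinite_finite_induct) (auto intro: subalg_mult)

lemma subalg_UNIV [simp]: "subalg UNIV"
  by (auto simp: subalg_def)

lemma subalg_Inter: "(\<And>R. R \<in> \<R> \<Longrightarrow> subalg R) \<Longrightarrow> subalg (\<Inter>\<R>)"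
  by (auto simp: subalg_def)

lemma alt_scale: "alt R G \<Longrightarrow> a \<in> R \<Longrightarrow> set bs \<subseteq> R \<Longrightarrow> G (\<iota> c * a) bs = c * G a bs"
  and alt_add: "alt R G \<Longrightarrow> a \<in> R \<Longrightarrow> a' \<in> R \<Longrightarrow> set bs \<subseteq> R \<Longrightarrow> G (a + a') bs = G a bs + G a' bs"
  and alt_const: "alt R G \<Longrightarrow> a \<in> R \<Longrightarrow> set us \<subseteq> R \<Longrightarrow> set vs \<subseteq> R \<Longrightarrow> G a (us @ \<iota> c # vs) = 0"
  and alt_d_add: "alt R G \<Longrightarrow> a \<in> R \<Longrightarrow> b \<in> R \<Longrightarrow> b' \<in> R \<Longrightarrow> set us \<subseteq> R \<Longrightarrow> set vs \<subseteq> R \<Longrightarrow>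
       G a (us @ (b + b') # vs) = G a (us @ b # vs) + G a (us @ b' # vs)"
  and alt_d_mult: "alt R G \<Longrightarrow> a \<in> R \<Longrightarrow> b \<in> R \<Longrightarrow> b' \<in> R \<Longrightarrow> set us \<subseteq> R \<Longrightarrow> set vs \<subseteq> R \<Longrightarrow>
       G a (us @ (b * b') # vs) = G (a * b) (us @ b' # vs) + G (a * b') (us @ b # vs)"
  and alt_alternating: "alt R G \<Longrightarrow> a \<in> R \<Longrightarrow> b \<in> R \<Longrightarrow> set us \<subseteq> R \<Longrightarrow> set vs \<subseteq> R \<Longrightarrow> set ws \<subseteq> R \<Longrightarrow>
       G a (us @ b # vs @ b # ws) = 0"
  unfolding alt_def by - (elim conjE, simp)+

lemma alt_subset: "alt R G \<Longrightarrow> Q \<subseteq> R \<Longrightarrow> alt Q G"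
  unfolding alt_def by (meson subset_trans subsetD)

lemma alt_fwedge:
  assumes G: "alt R G" and b: "b \<in> R" shows "alt R (\<lambda>a bs. G a (b # bs))"
proof -
  have s: "set (b # us) \<subseteq> R" if "set us \<subseteq> R" for us using that b by simp
  show ?thesis unfolding alt_def
    using alt_scale[OF G _ s] alt_add[OF G _ _ s] alt_const[OF G _ s]  alt_d_add[OF G _ _ _ s]
     alt_d_mult[OF G _ _ _ s] alt_alternating[OF G _ _ s]
    by simp
qed

lemma alt_fmul:
  assumes "subalg R" "alt R G" "c \<in> R" shows "alt R (\<lambda>a bs. G (c * a) bs)"
proof -
  have *: "c * a \<in> R" if "a \<in> R" for a using that assms by (auto intro: subalg_mult)
  show ?thesis
    unfolding alt_def
    by (auto simp: * distrib_left mult.left_commute[of c] alt_scale[OF assms(2)] alt_add[OF assms(2)]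
        alt_const[OF assms(2)] alt_d_add[OF assms(2)] alt_d_mult[OF assms(2)] alt_alternating[OF assms(2)])
      (simp add: mult_ac)
qed

lemma alt_degree:
  assumes "alt R G" shows "alt R (\<lambda>a bs. if length bs = k then G a bs else 0)"
  unfolding alt_def
  by (auto simp: alt_scale[OF assms] alt_add[OF assms]
        alt_const[OF assms] alt_d_add[OF assms] alt_d_mult[OF assms] alt_alternating[OF assms])

lemma alt_zero: "alt R G \<Longrightarrow> subalg R \<Longrightarrow> set bs \<subseteq> R \<Longrightarrow> G 0 bs = 0"
  using alt_scale[of R G 0 bs 0] by simp

lemma alt_uminus: "alt R G \<Longrightarrow> a \<in> R \<Longrightarrow> set bs \<subseteq> R \<Longrightarrow> G (- a) bs = - G a bs"
  using alt_scale[of R G a bs "-1"] by (simp add: hom_distribs)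

lemma alt_swap:
  assumes G: "alt R G" and "a \<in> R" "b \<in> R" "b' \<in> R" "set us \<subseteq> R" "set vs \<subseteq> R" and R: "subalg R"
  shows "G a (us @ b # b' # vs) = - G a (us @ b' # b # vs)"
proof -
  have s: "b + b' \<in> R" using assms by (auto intro: subalg_add)
  have "G a (us @ (b + b') # (b + b') # vs) = 0"
    using alt_alternating[OF G, of a "b+b'" us "[]" vs] assms s by simp
  moreover have "G a (us @ (b + b') # (b + b') # vs) = G a (us @ b # (b + b') # vs) + G a (us @ b' # (b + b') # vs)"
    using alt_d_add[OF G, of a b b' us "(b+b') # vs"] assms s by simp
  moreover have "G a (us @ b # (b + b') # vs) = G a (us @ b # b # vs) + G a (us @ b # b' # vs)"
    using alt_d_add[OF G, of a b b' "us @ [b]" "vs"] assms s by simp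
  moreover have "G a (us @ b' # (b + b') # vs) = G a (us @ b' # b # vs) + G a (us @ b' # b' # vs)"
    using alt_d_add[OF G, of a b b' "us @ [b']" "vs"] assms s by simp
  moreover have "G a (us @ b # b # vs) = 0" "G a (us @ b' # b' # vs) = 0"
    using alt_alternating[OF G, of a _ us "[]" vs] assms s by auto
  ultimately show ?thesis by (simp add: add_eq_0_iff)
qed

lemma alt_move:
  assumes G: "alt R G" and "a \<in> R" "b \<in> R" "set us \<subseteq> R" "set vs \<subseteq> R" and R: "subalg R"
  shows "G a (us @ b # vs) = (-1) ^ length us * G a (b # us @ vs)"
  using G assms(4)
proof (induction us arbitrary: G)
  case (Cons u us)
  have "G a ((u # us) @ b # vs) = (-1) ^ length us * G a (u # b # us @ vs)"
    using Cons.IH[OF alt_fwedge[OF Cons.prems(1), of u]] Cons.prems by simp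
  also have "G a (u # b # us @ vs) = - G a (b # u # us @ vs)"
    using alt_swap[OF Cons.prems(1), of a u b "[]" "us @ vs"] Cons.prems assms by auto
  finally show ?case by simp
qed simp

lemma pair_Nil [simp]: "pair G [] = 0"
  and pair_Cons [simp]: "pair G ((a, bs) # v) = G a bs + pair G v"
  and pair_append [simp]: "pair G (v @ w) = pair G v + pair G w"
  by (auto simp: pair_def)

lemma pair_fwedge: "pair G (fwedge b v) = pair (\<lambda>a bs. G a (b # bs)) v"
  by (induction v) (auto simp: fwedge_def pair_def)

lemma pair_fmul: "pair G (fmul c v) = pair (\<lambda>a bs. G (c * a) bs) v"
  by (induction v) (auto simp: fmul_def pair_def)

lemma pair_scale: "alt R G \<Longrightarrow> over R v \<Longrightarrow> pair G (fmul (\<iota> c) v) = c * pair G v"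
  by (induction v) (auto simp: fmul_def pair_def over_def alt_scale distrib_left)

lemma pair_neg: "alt R G \<Longrightarrow> over R v \<Longrightarrow> pair G (fmul (-1) v) = - pair G v"
  using pair_scale[of R G v "-1"] by (simp add: hom_distribs)

lemma pair_cong: "over R v \<Longrightarrow> (\<And>a bs. a \<in> R \<Longrightarrow> set bs \<subseteq> R \<Longrightarrow> G a bs = H a bs) \<Longrightarrow> pair G v = pair H v"
  unfolding pair_def over_def by (induction v) auto

lemma over_Nil [simp]: "over R []" and over_Cons [simp]: "over R ((a, bs) # v) \<longleftrightarrow> a \<in> R \<and> set bs \<subseteq> R \<and> over R v"
  and over_append [simp]: "over R (v @ w) \<longleftrightarrow> over R v \<and> over R w"
  by (auto simp: over_def)

lemma over_UNIV [simp]: "over UNIV v"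
  by (auto simp: over_def)

lemma over_mono: "over R v \<Longrightarrow> R \<subseteq> Q \<Longrightarrow> over Q v"
  unfolding over_def by blast

lemma over_fwedge: "over R v \<Longrightarrow> b \<in> R \<Longrightarrow> over R (fwedge b v)"
  by (induction v) (auto simp: fwedge_def over_def)

lemma over_fmul: "subalg R \<Longrightarrow> over R v \<Longrightarrow> c \<in> R \<Longrightarrow> over R (fmul c v)"
  by (induction v) (auto simp: fmul_def over_def intro: subalg_mult)

lemma over_contr1: "subalg R \<Longrightarrow> a \<in> R \<Longrightarrow> set bs \<subseteq> R \<Longrightarrow> (\<And>b. b \<in> R \<Longrightarrow> E b \<in> R) \<Longrightarrow> over R (contr1 E a bs)"
proof (induction bs)
  case (Cons b bs)
  have "- 1 \<in> R" using Cons.prems(1) subalg_uminus[of R 1] by simp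
  then show ?case using Cons by (auto intro!: over_fmul over_fwedge subalg_mult)
qed simp

lemma contr_Nil [simp]: "contr E [] = []" and contr_Cons [simp]: "contr E ((a,bs) # v) = contr1 E a bs @ contr E v"
  and contr_append [simp]: "contr E (v @ w) = contr E v @ contr E w"
  by (auto simp: contr_def)

lemma over_contr: "subalg R \<Longrightarrow> over R v \<Longrightarrow> (\<And>b. b \<in> R \<Longrightarrow> E b \<in> R) \<Longrightarrow> over R (contr E v)"
  by (induction v) (auto intro!: over_contr1)

lemma eqv_refl [simp]: "eqv R v v" and eqv_sym: "eqv R v w \<Longrightarrow> eqv R w v"
  and eqv_trans [trans]: "eqv R u v \<Longrightarrow> eqv R v w \<Longrightarrow> eqv R u w"
  by (auto simp: eqv_def)

lemma eqv_append: "eqv R v w \<Longrightarrow> eqv R v' w' \<Longrightarrow> eqv R (v @ v') (w @ w')"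
  by (auto simp: eqv_def)

lemma eqv_mono: "eqv R v w \<Longrightarrow> R \<subseteq> Q \<Longrightarrow> eqv Q v w"
  unfolding eqv_def using alt_subset by blast

lemma eqv_fwedge: "eqv R v w \<Longrightarrow> b \<in> R \<Longrightarrow> eqv R (fwedge b v) (fwedge b w)"
  unfolding eqv_def pair_fwedge using alt_fwedge by blast

lemma eqv_fmul: "subalg R \<Longrightarrow> eqv R v w \<Longrightarrow> b \<in> R \<Longrightarrow> eqv R (fmul b v) (fmul b w)"
  unfolding eqv_def pair_fmul using alt_fmul by blast

subsection \<open>Contraction\<close>

text \<open>The transpose of contraction. Contraction is defined on formal sums, and it descends to forms
  exactly because its transpose preserves \<open>alt\<close> (\<open>alt_cocontr\<close>).\<close>

primrec cocontr :: "('f \<Rightarrow> 'f) \<Rightarrow> 'f list \<Rightarrow> ('f \<Rightarrow> 'f list \<Rightarrow> complex) \<Rightarrow> 'f \<Rightarrow> complex" where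
  "cocontr E [] G a = 0"
| "cocontr E (b # bs) G a = G (a * E b) bs - cocontr E bs (\<lambda>a' bs'. G a' (b # bs')) a"

lemma pair_contr1: "subalg R \<Longrightarrow> alt R G \<Longrightarrow> a \<in> R \<Longrightarrow> set bs \<subseteq> R \<Longrightarrow> (\<And>b. b \<in> R \<Longrightarrow> E b \<in> R) \<Longrightarrow>
   pair G (contr1 E a bs) = cocontr E bs G a"
proof (induction bs arbitrary: G)
  case (Cons b bs)
  have "pair G (fmul (- 1) (fwedge b (contr1 E a bs))) = - pair (\<lambda>a bs. G a (b # bs)) (contr1 E a bs)"
    using Cons.prems by (subst pair_neg[of R]) (auto simp: pair_fwedge intro!: over_fwedge over_contr1)
  then show ?case using Cons.IH[OF Cons.prems(1) alt_fwedge[OF Cons.prems(2)], of b] Cons.prems by simp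
qed simp

lemma cocontr_cong:
  "\<lbrakk>subalg R; a \<in> R; set bs \<subseteq> R; \<And>b. b \<in> R \<Longrightarrow> E b \<in> R;
   \<And>a bs. a \<in> R \<Longrightarrow> set bs \<subseteq> R \<Longrightarrow> G a bs = H a bs\<rbrakk> \<Longrightarrow> cocontr E bs G a = cocontr E bs H a"
proof (induction bs arbitrary: G H)
  case (Cons b bs)
  have "cocontr E bs (\<lambda>a' bs'. G a' (b # bs')) a = cocontr E bs (\<lambda>a' bs'. H a' (b # bs')) a"
    using Cons.prems by (intro Cons.IH) auto
  then show ?case using Cons.prems by (simp add: subalg_mult)
qed simp

lemma cocontr_add: "cocontr E bs (\<lambda>a bs. G a bs + H a bs) a = cocontr E bs G a + cocontr E bs H a"
  by (induction bs arbitrary: G H) auto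

lemma cocontr_scale: "cocontr E bs (\<lambda>a bs. c * G a bs) a = c * cocontr E bs G a"
  by (induction bs arbitrary: G) (auto simp: algebra_simps)

lemma cocontr_neg: "cocontr E bs (\<lambda>a bs. - G a bs) a = - cocontr E bs G a"
  using cocontr_scale[of E bs "-1" G a] by simp

lemma cocontr_zero [simp]: "cocontr E bs (\<lambda>a bs. 0) a = 0"
  by (induction bs) auto

lemma cocontr_fmul: "cocontr E bs (\<lambda>a bs. G (a * c) bs) a = cocontr E bs G (a * c)"
proof (induction bs arbitrary: G)
  case (Cons b bs)
  then show ?case using Cons[of "\<lambda>a' bs'. G a' (b # bs')"] by (simp add: mult_ac)
qed simp

text \<open>If inserting \<open>b\<close> kills \<open>H\<close>, only the term that contracts \<open>b\<close> itself survives.\<close>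

lemma cocontr_kill:
  assumes R: "subalg R" and E: "\<And>b. b \<in> R \<Longrightarrow> E b \<in> R" and "a \<in> R" "b \<in> R" "set vs \<subseteq> R" "set ws \<subseteq> R"
    and H: "\<And>a ys zs. a \<in> R \<Longrightarrow> set ys \<subseteq> R \<Longrightarrow> set zs \<subseteq> R \<Longrightarrow> H a (ys @ b # zs) = 0"
  shows "cocontr E (vs @ b # ws) H a = (-1) ^ length vs * H (a * E b) (vs @ ws)"
  using assms(5) H
proof (induction vs arbitrary: H)
  case Nil
  have "cocontr E ws (\<lambda>a' bs'. H a' (b # bs')) a = cocontr E ws (\<lambda>a' bs'. 0) a"
    using assms Nil(2)[of _ "[]"] by (intro cocontr_cong[of R]) auto
  then show ?case by simp
next
  case (Cons v vs)
  have "cocontr E (vs @ b # ws) (\<lambda>a' bs'. H a' (v # bs')) a = (-1) ^ length vs * H (a * E b) (v # vs @ ws)"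
    using Cons.prems(1) Cons.prems(2)[of _ "v # _"] by (intro Cons.IH) auto
  moreover have "H (a * E v) (vs @ b # ws) = 0"
    using Cons.prems assms by (auto intro!: Cons.prems(2) subalg_mult)
  ultimately show ?case by simp
qed

lemma alt_cocontr:
  assumes R: "subalg R" and G: "alt R G" and E: "\<And>b. b \<in> R \<Longrightarrow> E b \<in> R" and D: "derivation E"
  shows "alt R (\<lambda>a bs. cocontr E bs G a)"
proof -
  have m: "a * E b \<in> R" if "a \<in> R" "b \<in> R" for a b using that R E by (auto intro: subalg_mult)
  have m2: "a * b \<in> R" if "a \<in> R" "b \<in> R" for a b using that R E by (auto intro: subalg_mult)
  have s: "a + b \<in> R" if "a \<in> R" "b \<in> R" for a b using that R E by (auto intro: subalg_add)
  have scale: "cocontr E bs G (\<iota> c * a) = c * cocontr E bs G a" if "a \<in> R" "set bs \<subseteq> R" for a c bs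
    using G that(2)
  proof (induction bs arbitrary: G)
    case (Cons b bs)
    have "G (\<iota> c * a * E b) bs = c * G (a * E b) bs"
      using alt_scale[OF Cons.prems(1), of "a * E b" bs c] Cons.prems that m by (simp add: mult.assoc)
    then show ?case using Cons.IH[OF alt_fwedge[OF Cons.prems(1), of b]] Cons.prems by (simp add: algebra_simps)
  qed simp
  have add: "cocontr E bs G (a + a') = cocontr E bs G a + cocontr E bs G a'" if "a \<in> R" "a' \<in> R" "set bs \<subseteq> R" for a a' bs
    using G that(3)
  proof (induction bs arbitrary: G)
    case (Cons b bs)
    have "G ((a + a') * E b) bs = G (a * E b) bs + G (a' * E b) bs"
      using alt_add[OF Cons.prems(1), of "a * E b" "a' * E b" bs] Cons.prems that m by (simp add: distrib_right)
    then show ?case using Cons.IH[OF alt_fwedge[OF Cons.prems(1), of b]] Cons.prems by (simp add: algebra_simps)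
  qed simp
  have const: "cocontr E (us @ \<iota> c # vs) G a = 0" if "a \<in> R" "set us \<subseteq> R" "set vs \<subseteq> R" for a c us vs
    using G that(2)
  proof (induction us arbitrary: G)
    case Nil
    have "cocontr E vs (\<lambda>a' bs'. G a' (\<iota> c # bs')) a = cocontr E vs (\<lambda>a' bs'. 0) a"
      using alt_const[OF Nil(1), of _ "[]"] that R E by (intro cocontr_cong[of R]) auto
    moreover have "G 0 vs = 0" using alt_zero Nil R that by auto
    ultimately show ?case using D by (simp add: derivation_def)
  next
    case (Cons u us)
    have "G (a * E u) (us @ \<iota> c # vs) = 0" using Cons.prems that m by (intro alt_const[OF Cons.prems(1)]) auto
    then show ?case using Cons.IH[OF alt_fwedge[OF Cons.prems(1), of u]] Cons.prems by simp
  qed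
  have d_add: "cocontr E (us @ (b + b') # vs) G a = cocontr E (us @ b # vs) G a + cocontr E (us @ b' # vs) G a"
    if "a \<in> R" "b \<in> R" "b' \<in> R" "set us \<subseteq> R" "set vs \<subseteq> R" for a b b' us vs
    using G that(4)
  proof (induction us arbitrary: G)
    case Nil
    have "cocontr E vs (\<lambda>a' bs'. G a' ((b + b') # bs')) a = cocontr E vs (\<lambda>a' bs'. G a' (b # bs') + G a' (b' # bs')) a"
      using alt_d_add[OF Nil(1), of _ b b' "[]"] that R E by (intro cocontr_cong[of R]) auto
    moreover have "G (a * E b + a * E b') vs = G (a * E b) vs + G (a * E b') vs"
      using alt_add[OF Nil(1), of "a * E b" "a * E b'" vs] that m by simp
    ultimately show ?case using D by (simp add: derivation_def cocontr_add distrib_left)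
  next
    case (Cons u us)
    have "G (a * E u) (us @ (b + b') # vs) = G (a * E u) (us @ b # vs) + G (a * E u) (us @ b' # vs)"
      using Cons.prems that m by (intro alt_d_add[OF Cons.prems(1)]) auto
    then show ?case using Cons.IH[OF alt_fwedge[OF Cons.prems(1), of u]] Cons.prems by simp
  qed
  have d_mult: "cocontr E (us @ (b * b') # vs) G a = cocontr E (us @ b' # vs) G (a * b) + cocontr E (us @ b # vs) G (a * b')"
    if "a \<in> R" "b \<in> R" "b' \<in> R" "set us \<subseteq> R" "set vs \<subseteq> R" for a b b' us vs
    using G that(4)
  proof (induction us arbitrary: G)
    case Nil
    have "cocontr E vs (\<lambda>a' bs'. G a' ((b * b') # bs')) a = cocontr E vs (\<lambda>a' bs'. G (a' * b) (b' # bs') + G (a' * b') (b # bs')) a"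
      using alt_d_mult[OF Nil(1), of _ b b' "[]"] that R E by (intro cocontr_cong[of R]) auto
    also have "\<dots> = cocontr E vs (\<lambda>a' bs'. G a' (b' # bs')) (a * b) + cocontr E vs (\<lambda>a' bs'. G a' (b # bs')) (a * b')"
      using cocontr_fmul[of E vs "\<lambda>a' bs'. G a' (b' # bs')" b a] cocontr_fmul[of E vs "\<lambda>a' bs'. G a' (b # bs')" b' a]
      by (simp add: cocontr_add)
    finally have 1: "cocontr E vs (\<lambda>a' bs'. G a' ((b * b') # bs')) a = \<dots>" .
    have "G (a * b * E b' + a * b' * E b) vs = G (a * b * E b') vs + G (a * b' * E b) vs"
      using alt_add[OF Nil(1), of "a * b * E b'" "a * b' * E b" vs] that m m2 by simp
    then show ?case using D 1 by (simp add: derivation_def algebra_simps)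
  next
    case (Cons u us)
    have "G (a * E u) (us @ (b * b') # vs) = G (a * b * E u) (us @ b' # vs) + G (a * b' * E u) (us @ b # vs)"
      using Cons.prems that m alt_d_mult[OF Cons.prems(1), of "a * E u" b b' us vs] by (simp add: mult_ac)
    then show ?case using Cons.IH[OF alt_fwedge[OF Cons.prems(1), of u]] Cons.prems by simp
  qed
  have alternating: "cocontr E (us @ b # vs @ b # ws) G a = 0"
    if "a \<in> R" "b \<in> R" "set us \<subseteq> R" "set vs \<subseteq> R" "set ws \<subseteq> R" for a b us vs ws
    using G that(3)
  proof (induction us arbitrary: G)
    case Nil
    have "cocontr E (vs @ b # ws) (\<lambda>a' bs'. G a' (b # bs')) a = (-1) ^ length vs * G (a * E b) (b # vs @ ws)"
      using alt_alternating[OF Nil(1), of _ b "[]"] that by (intro cocontr_kill[OF R E]) auto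
    also have "\<dots> = G (a * E b) (vs @ b # ws)"
      using that m by (intro alt_move[OF Nil(1) _ _ _ _ R, symmetric]) auto
    finally show ?case by simp
  next
    case (Cons u us)
    have "G (a * E u) (us @ b # vs @ b # ws) = 0"
      using Cons.prems that m by (intro alt_alternating[OF Cons.prems(1)]) auto
    then show ?case using Cons.IH[OF alt_fwedge[OF Cons.prems(1), of u]] Cons.prems by simp
  qed
  show ?thesis unfolding alt_def
    using scale add const d_add d_mult alternating by blast
qed

lemma pair_contr: "subalg R \<Longrightarrow> alt R G \<Longrightarrow> over R v \<Longrightarrow> (\<And>b. b \<in> R \<Longrightarrow> E b \<in> R) \<Longrightarrow>
   pair G (contr E v) = pair (\<lambda>a bs. cocontr E bs G a) v"
  by (induction v) (auto simp: pair_contr1[of R])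

lemma eqv_contr: "\<lbrakk>subalg R; over R v; over R w; \<And>b. b \<in> R \<Longrightarrow> E b \<in> R; derivation E; eqv R v w\<rbrakk> \<Longrightarrow> eqv R (contr E v) (contr E w)"
  unfolding eqv_def using alt_cocontr by (simp add: pair_contr[of R])

lemma eqv_contr_UNIV: "\<lbrakk>derivation E; eqv UNIV v w\<rbrakk> \<Longrightarrow> eqv UNIV (contr E v) (contr E w)"
  by (rule eqv_contr) auto

subsection \<open>Homogeneous components\<close>

definition homog :: "nat \<Rightarrow> ('f \<times> 'f list) list \<Rightarrow> bool" where
  "homog k v \<longleftrightarrow> (\<forall>(a, bs)\<in>set v. length bs = k)"

definition part :: "nat \<Rightarrow> ('f \<times> 'f list) list \<Rightarrow> ('f \<times> 'f list) list" where
  "part k v = filter (\<lambda>(a, bs). length bs = k) v"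

lemma homog_part: "homog k (part k v)" by (auto simp: homog_def part_def)

lemma over_part: "over R v \<Longrightarrow> over R (part k v)" by (auto simp: over_def part_def)

lemma pair_part: "pair G (part k v) = pair (\<lambda>a bs. if length bs = k then G a bs else 0) v"
  by (induction v) (auto simp: part_def)

lemma eqv_part: "eqv R v w \<Longrightarrow> eqv R (part k v) (part k w)"
  unfolding eqv_def pair_part using alt_degree by blast

lemma homog_Nil [simp]: "homog k []" and homog_Cons [simp]: "homog k ((a,bs) # v) \<longleftrightarrow> length bs = k \<and> homog k v"
  and homog_append [simp]: "homog k (v @ w) \<longleftrightarrow> homog k v \<and> homog k w"
  by (auto simp: homog_def)

lemma homog_fmul: "homog k v \<Longrightarrow> homog k (fmul c v)"
  and homog_fwedge: "homog k v \<Longrightarrow> homog (Suc k) (fwedge b v)"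
  by (auto simp: homog_def fmul_def fwedge_def)

lemma homog_contr1: "length bs = Suc k \<Longrightarrow> homog k (contr1 E a bs)"
proof (induction bs arbitrary: k)
  case (Cons b bs)
  show ?case
  proof (cases k)
    case 0
    then show ?thesis using Cons by (simp add: fmul_def fwedge_def)
  next
    case (Suc l)
    then show ?thesis using Cons.IH[of l] Cons.prems by (auto intro!: homog_fmul homog_fwedge)
  qed
qed simp

lemma homog_contr: "homog (Suc k) v \<Longrightarrow> homog k (contr E v)"
  by (induction v) (auto intro: homog_contr1)

lemma pair_parts: "\<exists>N. pair G v = (\<Sum>k<N. pair G (part k v)) \<and> (\<forall>k\<ge>N. part k v = [])"
proof -
  define N where "N = Suc (Max (insert 0 ((\<lambda>(a,bs). length bs) ` set v)))"
  have N: "length bs < N" if "(a, bs) \<in> set v" for a bs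
    using that by (auto simp: N_def less_Suc_eq_le intro!: Max_ge)
  have "pair G w = (\<Sum>k<N. pair G (part k w))" if "set w \<subseteq> set v" for w
    using that
  proof (induction w)
    case (Cons p w)
    obtain a bs where p: "p = (a, bs)" by force
    have "(\<Sum>k<N. pair G (part k (p # w))) = (\<Sum>k<N. (if k = length bs then G a bs else 0) + pair G (part k w))"
      by (intro sum.cong) (auto simp: p part_def)
    also have "\<dots> = G a bs + (\<Sum>k<N. pair G (part k w))"
      using N[of a bs] Cons.prems by (simp add: sum.distrib p)
    finally show ?case using Cons by (simp add: p)
  qed (simp add: part_def)
  moreover have "part k v = []" if "k \<ge> N" for k
    using that N by (force simp: part_def filter_empty_conv)
  ultimately show ?thesis by blast
qed

lemma eqv_by_parts:
  assumes "\<And>k. eqv R (part k v) (part k w)"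
  shows "eqv R v w"
  unfolding eqv_def
proof (intro allI impI)
  fix G assume G: "alt R G"
  obtain N where N: "pair G v = (\<Sum>k<N. pair G (part k v))" "\<And>k. k \<ge> N \<Longrightarrow> part k v = []"
    using pair_parts by metis
  obtain M where M: "pair G w = (\<Sum>k<M. pair G (part k w))" "\<And>k. k \<ge> M \<Longrightarrow> part k w = []"
    using pair_parts by metis
  have "(\<Sum>k<N. pair G (part k v)) = (\<Sum>k<max N M. pair G (part k v))"
    using N by (intro sum.mono_neutral_left) auto
  also have "\<dots> = (\<Sum>k<max N M. pair G (part k w))"
    using assms G by (auto simp: eqv_def)
  also have "\<dots> = (\<Sum>k<M. pair G (part k w))"
    using M by (intro sum.mono_neutral_right) auto
  finally show "pair G v = pair G w" using N M by simp
qed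

lemma extends_append: "extends_to R v \<Longrightarrow> extends_to R w \<Longrightarrow> extends_to R (v @ w)"
  unfolding extends_to_def by (meson eqv_append over_append)

lemma extends_eqv: "extends_to R v \<Longrightarrow> eqv UNIV v w \<Longrightarrow> extends_to R w"
  unfolding extends_to_def using eqv_sym eqv_trans by blast

lemma extends_mono: "extends_to R v \<Longrightarrow> R \<subseteq> Q \<Longrightarrow> extends_to Q v"
  unfolding extends_to_def using over_mono by blast

lemma extends_over: "over R v \<Longrightarrow> extends_to R v"
  unfolding extends_to_def using eqv_refl by blast

lemma extends_part: "extends_to R v \<Longrightarrow> extends_to R (part k v)"
  unfolding extends_to_def using over_part eqv_part by blast

text \<open>Only finitely many homogeneous parts of a formal sum are nonzero, so the extensions of the parts
  can be added up.\<close>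

lemma extends_by_parts:
  assumes "\<And>k. extends_to R (part k v)"
  shows "extends_to R v"
proof -
  obtain w where w: "\<And>k. over R (w k)" "\<And>k. eqv UNIV (part k v) (w k)"
    using assms unfolding extends_to_def by metis
  obtain N where N: "\<And>k. k \<ge> N \<Longrightarrow> part k v = []"
    using pair_parts by metis
  let ?w = "concat (map (\<lambda>k. part k (w k)) [0..<N])"
  have "over R ?w" using w(1) by (fastforce simp: over_def part_def)
  moreover have "eqv UNIV v ?w"
  proof (rule eqv_by_parts)
    fix k
    have *: "part k (concat (map (\<lambda>k. part k (w k)) ks)) = (if k \<in> set ks then part k (w k) else [])"
      if "distinct ks" for ks
      using that
    proof (induction ks)
      case (Cons l ks)
      have "part k (part l (w l)) = (if k = l then part l (w l) else [])"
        by (auto simp: part_def filter_empty_conv)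
      then show ?case using Cons by (auto simp: part_def)
    qed (simp add: part_def)
    have "eqv UNIV (part k (part k v)) (part k (w k))" by (intro eqv_part w)
    moreover have "part k (part k v) = part k v" by (simp add: part_def)
    ultimately have "eqv UNIV (part k v) (part k (w k))" by simp
    moreover have "eqv UNIV (part k v) []" if "k \<ge> N" using N[OF that] by simp
    ultimately show "eqv UNIV (part k v) (part k ?w)"
      by (subst *) auto
  qed
  ultimately show ?thesis unfolding extends_to_def by blast
qed

lemma over_contr_extends:
  assumes "extends_to R v" "subalg R" "derivation E" "\<And>b. b \<in> R \<Longrightarrow> E b \<in> R"
  shows "extends_to R (contr E v)"
  using assms over_contr eqv_contr_UNIV unfolding extends_to_def by meson

lemma extends_fwedge: "extends_to R v \<Longrightarrow> b \<in> R \<Longrightarrow> extends_to R (fwedge b v)"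
  unfolding extends_to_def using over_fwedge eqv_fwedge by (meson UNIV_I)

lemma extends_fmul: "extends_to R v \<Longrightarrow> subalg R \<Longrightarrow> b \<in> R \<Longrightarrow> extends_to R (fmul b v)"
  unfolding extends_to_def using over_fmul eqv_fmul by (meson UNIV_I subalg_UNIV)

lemma extends_concat: "(\<And>v. v \<in> set vs \<Longrightarrow> extends_to R v) \<Longrightarrow> extends_to R (concat vs)"
  by (induction vs) (auto intro: extends_append extends_over)

end

context complex_field
begin

section \<open>Frames and Euler's identity\<close>

text \<open>The identity \<open>db = \<Sum> E(b) d\<beta>\<close> over \<open>R\<close>, where \<open>(E, \<beta>)\<close> runs through \<open>F\<close>. The list plays the role of
  coordinates \<open>\<beta>\<close> with their partial derivatives \<open>E\<close>.\<close>

definition frame :: "'f set \<Rightarrow> (('f \<Rightarrow> 'f) \<times> 'f) list \<Rightarrow> bool" where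
  "frame R F \<longleftrightarrow> (\<forall>(E, \<beta>)\<in>set F. \<beta> \<in> R \<and> derivation E \<and> (\<forall>b\<in>R. E b \<in> R)) \<and>
    (\<forall>G a b vs. alt R G \<longrightarrow> a \<in> R \<longrightarrow> b \<in> R \<longrightarrow> set vs \<subseteq> R \<longrightarrow>
       G a (b # vs) = (\<Sum>(E, \<beta>)\<leftarrow>F. G (a * E b) (\<beta> # vs)))"

lemma sum_list_pair_add: "(\<Sum>(x, y)\<leftarrow>F. f x y + g x y) = (\<Sum>(x, y)\<leftarrow>F. f x y) + (\<Sum>(x, y)\<leftarrow>F. g x y :: 'c :: comm_monoid_add)"
  by (induction F) (auto simp: add_ac)

lemma sum_list_pair_0 [simp]: "(\<Sum>(x, y)\<leftarrow>F. 0) = (0 :: 'c :: comm_monoid_add)"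
  by (induction F) auto

lemma sum_list_pair_cong: "(\<And>x y. (x, y) \<in> set F \<Longrightarrow> f x y = g x y) \<Longrightarrow> (\<Sum>(x, y)\<leftarrow>F. f x y) = (\<Sum>(x, y)\<leftarrow>F. g x y :: 'c :: comm_monoid_add)"
  by (induction F) auto

lemma frameD: "frame R F \<Longrightarrow> (E, \<beta>) \<in> set F \<Longrightarrow> \<beta> \<in> R"
  "frame R F \<Longrightarrow> (E, \<beta>) \<in> set F \<Longrightarrow> derivation E"
  "frame R F \<Longrightarrow> (E, \<beta>) \<in> set F \<Longrightarrow> b \<in> R \<Longrightarrow> E b \<in> R"
  unfolding frame_def by fast+

lemma frame_expand: "frame R F \<Longrightarrow> alt R G \<Longrightarrow> a \<in> R \<Longrightarrow> b \<in> R \<Longrightarrow> set vs \<subseteq> R \<Longrightarrow>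
  (\<Sum>(E, \<beta>)\<leftarrow>F. G (a * E b) (\<beta> # vs)) = G a (b # vs)"
  unfolding frame_def by simp

text \<open>Induction on the list \<open>bs\<close>: contracting the first entry gives \<open>\<Sum> E(b) d\<beta> \<and> \<dots>\<close>, which the frame turns back into \<open>db \<and> \<dots>\<close>, and
  contracting a later entry commutes with the first one up to the sign that swaps \<open>db\<close> and \<open>d\<beta>\<close>.\<close>

lemma frame_euler:
  assumes R: "subalg R" and F: "frame R F" and a: "a \<in> R"
  shows "alt R G \<Longrightarrow> set bs \<subseteq> R \<Longrightarrow>
    (\<Sum>(E, \<beta>)\<leftarrow>F. cocontr E bs (\<lambda>a bs. G a (\<beta> # bs)) a) = of_nat (length bs) * G a bs"
proof (induction bs arbitrary: G)
  case Nil
  show ?case by (simp add: case_prod_beta)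
next
  case (Cons b bs)
  note G = Cons.prems(1)
  have b: "b \<in> R" "set bs \<subseteq> R" using Cons.prems by auto
  have 1: "cocontr E bs (\<lambda>a' bs'. G a' (\<beta> # b # bs')) a = - cocontr E bs (\<lambda>a' bs'. G a' (b # \<beta> # bs')) a"
    if "(E, \<beta>) \<in> set F" for E \<beta>
  proof -
    have "\<beta> \<in> R" "\<And>b. b \<in> R \<Longrightarrow> E b \<in> R" using frameD[OF F that] by auto
    then have "cocontr E bs (\<lambda>a' bs'. G a' (\<beta> # b # bs')) a = cocontr E bs (\<lambda>a' bs'. - G a' (b # \<beta> # bs')) a"
      using alt_swap[OF G, of _ \<beta> b "[]"] b R a by (intro cocontr_cong[of R]) auto
    then show ?thesis by (simp add: cocontr_neg)
  qed
  have "(\<Sum>(E, \<beta>)\<leftarrow>F. cocontr E (b # bs) (\<lambda>a bs. G a (\<beta> # bs)) a)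
    = (\<Sum>(E, \<beta>)\<leftarrow>F. G (a * E b) (\<beta> # bs) + cocontr E bs (\<lambda>a' bs'. G a' (b # \<beta> # bs')) a)"
    using 1 by (intro arg_cong[of _ _ sum_list] map_cong) auto
  also have "\<dots> = (\<Sum>(E, \<beta>)\<leftarrow>F. G (a * E b) (\<beta> # bs)) + (\<Sum>(E, \<beta>)\<leftarrow>F. cocontr E bs (\<lambda>a' bs'. G a' (b # \<beta> # bs')) a)"
    by (rule sum_list_pair_add)
  also have "(\<Sum>(E, \<beta>)\<leftarrow>F. cocontr E bs (\<lambda>a' bs'. G a' (b # \<beta> # bs')) a) = of_nat (length bs) * G a (b # bs)"
    using Cons.IH[OF alt_fwedge[OF G b(1)] b(2)] by simp
  also have "(\<Sum>(E, \<beta>)\<leftarrow>F. G (a * E b) (\<beta> # bs)) = G a (b # bs)"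
    using frame_expand[OF F G a b] .
  finally show ?case by (simp add: algebra_simps)
qed

lemma frame_euler_pair:
  assumes R: "subalg R" and F: "frame R F" and G: "alt R G" and v: "over R v" "homog k v"
  shows "(\<Sum>(E, \<beta>)\<leftarrow>F. pair (\<lambda>a bs. G a (\<beta> # bs)) (contr E v)) = of_nat k * pair G v"
proof -
  have "(\<Sum>(E, \<beta>)\<leftarrow>F. pair (\<lambda>a bs. G a (\<beta> # bs)) (contr E v)) =
     (\<Sum>(E, \<beta>)\<leftarrow>F. pair (\<lambda>a bs. cocontr E bs (\<lambda>a bs. G a (\<beta> # bs)) a) v)"
  proof (intro arg_cong[of _ _ sum_list] map_cong, goal_cases)
    case (2 p)
    then obtain E \<beta> where p: "p = (E, \<beta>)" "\<beta> \<in> R" "\<And>b. b \<in> R \<Longrightarrow> E b \<in> R"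
      using frameD[OF F] by (metis surj_pair)
    then show ?case using pair_contr[OF R alt_fwedge[OF G p(2)] v(1) p(3)] by simp
  qed simp
  also have "\<dots> = of_nat k * pair G v"
    using v
  proof (induction v)
    case (Cons p v)
    obtain a bs where p: "p = (a, bs)" by force
    then show ?case
      using Cons frame_euler[OF R F _ G, of a bs] by (simp add: sum_list_pair_add distrib_left)
  qed simp
  finally show ?thesis .
qed

lemma vector_space_iota: "vector_space (\<lambda>c (z::'f). \<iota> c * z)"
  by standard (auto simp: algebra_simps hom_distribs)

text \<open>In degree 0 there are no relations beyond linearity, so every complex linear functional on the field
  gives an admissible functional on forms.\<close>

lemma functions_are_separated:
  fixes a :: 'f assumes "a \<noteq> 0"
  shows "\<exists>G. alt UNIV G \<and> G a [] \<noteq> 0 \<and> (\<forall>b bs. bs \<noteq> [] \<longrightarrow> G b bs = 0)"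
proof -
  interpret v: vector_space "\<lambda>c (z::'f). \<iota> c * z" by (rule vector_space_iota)
  interpret p: vector_space_pair "\<lambda>c (z::'f). \<iota> c * z" "(*) :: complex \<Rightarrow> complex \<Rightarrow> complex"
    by (intro vector_space_pair.intro vector_space_iota) (unfold_locales, auto simp: algebra_simps)
  have "\<not> v.dependent {a}" using assms by (simp add: v.dependent_single)
  then obtain g where g: "Vector_Spaces.linear (\<lambda>c (z::'f). \<iota> c * z) (*) g" "g a = (1::complex)"
    using p.linear_independent_extend[of "{a}" "\<lambda>_. 1"] by blast
  interpret g: Vector_Spaces.linear "\<lambda>c (z::'f). \<iota> c * z" "(*)" g by fact
  let ?G = "\<lambda>b bs. if bs = [] then g b else 0"
  have "alt UNIV ?G" by (auto simp: alt_def g.add g.scale)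
  then show ?thesis using g(2) by (intro exI[of _ ?G]) auto
qed

lemma homog0_eqv:
  assumes "subalg R" "over R v" "homog 0 v"
  shows "\<exists>a\<in>R. eqv R v [(a, [])]"
  using assms(2,3)
proof (induction v)
  case Nil
  have "eqv R [] [(0, [])]" using alt_zero[OF _ assms(1), of _ "[]"] by (simp add: eqv_def)
  then show ?case using assms by auto
next
  case (Cons p v)
  obtain b where p: "p = (b, [])" "b \<in> R" using Cons.prems by (cases p) auto
  obtain a where a: "a \<in> R" "eqv R v [(a, [])]" using Cons p by auto
  have "eqv R (p # v) [(b + a, [])]"
    unfolding eqv_def
  proof (intro allI impI)
    fix G assume G: "alt R G"
    have "pair G v = G a []" using a(2) G by (simp add: eqv_def)
    then show "pair G (p # v) = pair G [(b + a, [])]" using alt_add[OF G p(2) a(1), of "[]"] p by simp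
  qed
  then show ?case using a p assms by (auto intro: subalg_add)
qed

lemma eqv_functionD:
  assumes "eqv UNIV [(a, [])] [(b, [])]" shows "a = b"
proof (rule ccontr)
  assume "a \<noteq> b"
  then obtain G where G: "alt UNIV G" "G (a - b) [] \<noteq> 0" using functions_are_separated[of "a - b"] by auto
  have "G (a + (-b)) [] = G a [] + - G b []" using alt_add[OF G(1), of a "-b" "[]"] alt_uminus[OF G(1), of b "[]"] by simp
  then show False using assms G by (simp add: eqv_def)
qed

lemma extends_function_iff: assumes "subalg R" shows "extends_to R [(a, [])] \<longleftrightarrow> a \<in> R"
proof
  assume "extends_to R [(a, [])]"
  then have "extends_to R (part 0 [(a, [])])" by (rule extends_part)
  then obtain w where w: "over R w" "eqv UNIV [(a, [])] w" by (auto simp: extends_to_def part_def)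
  have "eqv UNIV [(a, [])] (part 0 w)" using eqv_part[OF w(2), of 0] by (simp add: part_def)
  moreover obtain b where b: "b \<in> R" "eqv R (part 0 w) [(b, [])]"
    using homog0_eqv[OF assms over_part[OF w(1)] homog_part] by auto
  ultimately have "eqv UNIV [(a, [])] [(b, [])]" using eqv_trans[OF _ eqv_mono[OF b(2) subset_UNIV]] by simp
  then have "a = b" by (rule eqv_functionD)
  then show "a \<in> R" using b(1) by simp
qed (auto intro!: extends_over)

lemma eqv_UNIV_Nil_functionD: "eqv UNIV [(a, [])] [] \<Longrightarrow> a = 0"
  using functions_are_separated[of a] by (auto simp: eqv_def)

text \<open>A form over \<open>R\<close> that vanishes over the field has contractions that vanish over the field, hence over \<open>R\<close> by
  induction on the degree; Euler's identity over \<open>R\<close> then gives the form itself. Degree 0 is trivial as \<open>R\<close> is a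
  subset of the field.\<close>

theorem frame_torsion_free:
  assumes R: "subalg R" and F: "frame R F"
  shows "torsion_free R"
proof -
  have main: "eqv R v []" if "homog k v" "over R v" "eqv UNIV v []" for k v
    using that
  proof (induction k arbitrary: v)
    case 0
    obtain a where a: "a \<in> R" "eqv R v [(a, [])]" using homog0_eqv[OF R 0(2,1)] by auto
    then have "eqv UNIV [(a, [])] []" using eqv_trans[OF eqv_sym[OF eqv_mono[OF a(2) subset_UNIV]] 0(3)] by simp
    then have "a = 0" by (rule eqv_UNIV_Nil_functionD)
    then show ?case using a R alt_zero[of R _ "[]"] by (simp add: eqv_def)
  next
    case (Suc k)
    show ?case unfolding eqv_def
    proof (intro allI impI)
      fix G assume G: "alt R G"
      have "pair (\<lambda>a bs. G a (\<beta> # bs)) (contr E v) = 0" if "(E, \<beta>) \<in> set F" for E \<beta>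
      proof -
        have E: "\<beta> \<in> R" "derivation E" "\<And>b. b \<in> R \<Longrightarrow> E b \<in> R" using frameD[OF F that] by auto
        have "eqv UNIV (contr E v) (contr E [])" by (intro eqv_contr_UNIV E Suc)
        then have "eqv R (contr E v) []"
          using Suc.IH[OF homog_contr[OF Suc.prems(1)] over_contr[OF R Suc.prems(2) E(3)]] by simp
        then show ?thesis using alt_fwedge[OF G E(1)] by (auto simp: eqv_def)
      qed
      then have "(\<Sum>(E, \<beta>)\<leftarrow>F. pair (\<lambda>a bs. G a (\<beta> # bs)) (contr E v)) = (\<Sum>(E, \<beta>)\<leftarrow>F. 0)"
        by (intro arg_cong[of _ _ sum_list] map_cong) auto
      then show "pair G v = pair G []"
        using frame_euler_pair[OF R F G Suc.prems(2,1)] by (simp del: of_nat_Suc)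
    qed
  qed
  show ?thesis unfolding torsion_free_def
  proof (intro allI impI)
    fix v assume v: "over R v" "eqv UNIV v []"
    show "eqv R v []"
    proof (rule eqv_by_parts)
      fix k
      have "eqv UNIV (part k v) []" using eqv_part[OF v(2), of k] by (simp add: part_def)
      then show "eqv R (part k v) (part k [])"
        using main[OF homog_part over_part[OF v(1)]] by (simp add: part_def)
    qed
  qed
qed

lemma of_nat_Suc_neq_0: "complex_of_nat (Suc k) \<noteq> 0"
  using of_nat_eq_0_iff by blast

text \<open>Here the frame is a frame of the whole field whose derivations preserve each of the rings. A form that
  is regular over each ring has contractions with the same property, and Euler's identity
  writes it with functions and contractions that are regular over the intersection.\<close>

theorem frame_extends_Inter:
  assumes F: "frame UNIV F" and ne: "\<R> \<noteq> {}" and R: "\<And>R. R \<in> \<R> \<Longrightarrow> subalg R"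
    and FR: "\<And>R E \<beta>. R \<in> \<R> \<Longrightarrow> (E, \<beta>) \<in> set F \<Longrightarrow> \<beta> \<in> R \<and> (\<forall>b\<in>R. E b \<in> R)"
    and v: "\<And>R. R \<in> \<R> \<Longrightarrow> extends_to R v"
  shows "extends_to (\<Inter>\<R>) v"
proof -
  have S: "subalg (\<Inter>\<R>)" using R by (rule subalg_Inter)
  have main: "extends_to (\<Inter>\<R>) v" if "homog k v" "\<And>R. R \<in> \<R> \<Longrightarrow> extends_to R v" for k v
    using that
  proof (induction k arbitrary: v)
    case 0
    obtain a where a: "eqv UNIV v [(a, [])]" using homog0_eqv[OF subalg_UNIV over_UNIV 0(1)] by auto
    have "a \<in> R" if "R \<in> \<R>" for R
      using extends_eqv[OF 0(2)[OF that] a] extends_function_iff[OF R[OF that]] by blast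
    then have "over (\<Inter>\<R>) [(a, [])]" by simp
    then have "extends_to (\<Inter>\<R>) [(a, [])]" by (rule extends_over)
    then show ?case using eqv_sym[OF a] by (rule extends_eqv)
  next
    case (Suc k)
    have E: "extends_to (\<Inter>\<R>) (contr E v)" if "(E, \<beta>) \<in> set F" for E \<beta>
    proof (rule Suc.IH)
      show "homog k (contr E v)" by (intro homog_contr Suc)
      fix R assume R': "R \<in> \<R>"
      show "extends_to R (contr E v)"
        by (rule over_contr_extends[OF Suc.prems(2)[OF R'] R[OF R'] frameD(2)[OF F that]]) (use FR[OF R' that] in blast)
    qed
    \<comment> \<open>Euler's identity produces \<open>(k + 1) v\<close>, which is divided by the degree.\<close>
    let ?c = "\<iota> (1 / of_nat (Suc k))"
    let ?w = "fmul ?c (concat (map (\<lambda>(E, \<beta>). fwedge \<beta> (contr E v)) F))"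
    have "extends_to (\<Inter>\<R>) ?w"
    proof (intro extends_fmul extends_concat S subalg_const)
      fix w assume "w \<in> set (map (\<lambda>(E, \<beta>). fwedge \<beta> (contr E v)) F)"
      then obtain E' \<beta> where w: "(E', \<beta>) \<in> set F" "w = fwedge \<beta> (contr E' v)" by auto
      then show "extends_to (\<Inter>\<R>) w" using extends_fwedge[OF E[OF w(1)]] FR[OF _ w(1)] by blast
    qed
    moreover have "eqv UNIV v ?w"
      unfolding eqv_def
    proof (intro allI impI)
      fix G assume G: "alt UNIV G"
      have "pair G ?w = 1 / of_nat (Suc k) * pair G (concat (map (\<lambda>(E, \<beta>). fwedge \<beta> (contr E v)) F))"
        by (rule pair_scale[OF G]) simp
      also have "pair G (concat (map (\<lambda>(E, \<beta>). fwedge \<beta> (contr E v)) L)) = (\<Sum>(E, \<beta>)\<leftarrow>L. pair (\<lambda>a bs. G a (\<beta> # bs)) (contr E v))" for L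
        by (induction L) (auto simp: pair_fwedge)
      also have "(\<Sum>(E, \<beta>)\<leftarrow>F. pair (\<lambda>a bs. G a (\<beta> # bs)) (contr E v)) = of_nat (Suc k) * pair G v"
        by (intro frame_euler_pair[of UNIV] F G Suc.prems(1)) auto
      finally show "pair G v = pair G ?w"
        using of_nat_Suc_neq_0[of k] by (simp only: mult.assoc[symmetric] times_divide_eq_left nonzero_divide_eq_eq divide_self mult_1_left not_False_eq_True)
    qed
    ultimately show ?case by (rule extends_eqv[OF _ eqv_sym])
  qed
  show ?thesis
    by (rule extends_by_parts, rule main[OF homog_part], rule extends_part, rule v)
qed

subsection \<open>Frames from generators\<close>

lemma derivationD: assumes "derivation E"
  shows der_const: "E (\<iota> c) = 0" and der_add: "E (a + b) = E a + E b" and der_mult: "E (a * b) = a * E b + b * E a"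
  using assms by (auto simp: derivation_def)

lemma der_0: "derivation E \<Longrightarrow> E 0 = 0" and der_1: "derivation E \<Longrightarrow> E 1 = 0"
  using der_const[of E 0] der_const[of E 1] by auto

lemma der_minus: assumes "derivation E" shows "E (- a) = - E a"
  using der_mult[OF assms, of "\<iota> (-1)" a] der_const[OF assms, of "-1"] by (simp add: hom_distribs)

lemma der_diff: assumes "derivation E" shows "E (a - b) = E a - E b"
  using der_add[OF assms, of a "-b"] der_minus[OF assms, of b] by simp

lemma der_inverse: assumes E: "derivation E" shows "E (inverse a) = - E a * (inverse a)\<^sup>2"
proof (cases "a = 0")
  case False
  have "0 = E (a * inverse a)" using False der_1[OF E] by simp
  also have "\<dots> = a * E (inverse a) + inverse a * E a" by (rule der_mult[OF E])
  finally have *: "a * E (inverse a) = - (inverse a * E a)" by (simp only: eq_neg_iff_add_eq_0)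
  have "E (inverse a) = inverse a * (a * E (inverse a))" using False by (simp flip: mult.assoc)
  then show ?thesis unfolding * by (simp add: power2_eq_square mult_ac)
qed (use der_0[OF E] in simp)

lemma der_sum: "derivation E \<Longrightarrow> E (sum f I) = (\<Sum>i\<in>I. E (f i))"
  by (induction I rule: infinite_finite_induct) (auto simp: der_add der_0)

text \<open>The elements on which a candidate frame computes the differential form a subalgebra closed
  under the inverses that exist in it.\<close>

definition framed :: "'f set \<Rightarrow> (('f \<Rightarrow> 'f) \<times> 'f) list \<Rightarrow> 'f \<Rightarrow> bool" where
  "framed R F b \<longleftrightarrow> (\<forall>G a vs. alt R G \<longrightarrow> a \<in> R \<longrightarrow> set vs \<subseteq> R \<longrightarrow>
       G a (b # vs) = (\<Sum>(E, \<beta>)\<leftarrow>F. G (a * E b) (\<beta> # vs)))"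

lemma framed_expand: "framed R F b \<Longrightarrow> alt R G \<Longrightarrow> a \<in> R \<Longrightarrow> set vs \<subseteq> R \<Longrightarrow>
  (\<Sum>(E, \<beta>)\<leftarrow>F. G (a * E b) (\<beta> # vs)) = G a (b # vs)"
  unfolding framed_def by simp

context
  fixes R F
  assumes R: "subalg R" and F: "\<And>E \<beta>. (E, \<beta>) \<in> set F \<Longrightarrow> \<beta> \<in> R \<and> derivation E \<and> (\<forall>b\<in>R. E b \<in> R)"
begin

lemma framed_const: "framed R F (\<iota> c)"
  unfolding framed_def
proof (intro allI impI)
  fix G a vs assume G: "alt R G" "a \<in> R" "set vs \<subseteq> R"
  have "(\<Sum>(E, \<beta>)\<leftarrow>F. G (a * E (\<iota> c)) (\<beta> # vs)) = (\<Sum>(E, \<beta>)\<leftarrow>F. 0)"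
    using F G R by (intro arg_cong[of _ _ sum_list] map_cong) (auto simp: der_const alt_zero[OF G(1)])
  then show "G a (\<iota> c # vs) = (\<Sum>(E, \<beta>)\<leftarrow>F. G (a * E (\<iota> c)) (\<beta> # vs))"
    using alt_const[OF G(1,2), of "[]" vs c] G by simp
qed

lemma framed_add:
  assumes "framed R F b" "framed R F b'" "b \<in> R" "b' \<in> R"
  shows "framed R F (b + b')"
  unfolding framed_def
proof (intro allI impI)
  fix G a vs assume G: "alt R G" "a \<in> R" "set vs \<subseteq> R"
  have "(\<Sum>(E, \<beta>)\<leftarrow>F. G (a * E (b + b')) (\<beta> # vs)) = (\<Sum>(E, \<beta>)\<leftarrow>F. G (a * E b) (\<beta> # vs) + G (a * E b') (\<beta> # vs))"
  proof (rule sum_list_pair_cong)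
    fix E \<beta> assume "(E, \<beta>) \<in> set F"
    then have E: "\<beta> \<in> R" "derivation E" "E b \<in> R" "E b' \<in> R" using F assms by auto
    then show "G (a * E (b + b')) (\<beta> # vs) = G (a * E b) (\<beta> # vs) + G (a * E b') (\<beta> # vs)"
      using alt_add[OF G(1), of "a * E b" "a * E b'" "\<beta> # vs"] G R
      by (simp add: der_add distrib_left subalg_mult)
  qed
  also have "\<dots> = G a (b # vs) + G a (b' # vs)"
    by (simp only: sum_list_pair_add framed_expand[OF assms(1) G] framed_expand[OF assms(2) G])
  also have "\<dots> = G a ((b + b') # vs)"
    using alt_d_add[OF G(1,2) assms(3,4), of "[]" vs] G by simp
  finally show "G a ((b + b') # vs) = (\<Sum>(E, \<beta>)\<leftarrow>F. G (a * E (b + b')) (\<beta> # vs))" by simp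
qed

lemma framed_mult:
  assumes "framed R F b" "framed R F b'" "b \<in> R" "b' \<in> R"
  shows "framed R F (b * b')"
  unfolding framed_def
proof (intro allI impI)
  fix G a vs assume G: "alt R G" "a \<in> R" "set vs \<subseteq> R"
  have "G (a * E (b * b')) (\<beta> # vs) = G (a * b * E b') (\<beta> # vs) + G (a * b' * E b) (\<beta> # vs)" if "(E, \<beta>) \<in> set F" for E \<beta>
  proof -
    have E: "\<beta> \<in> R" "derivation E" "\<And>b. b \<in> R \<Longrightarrow> E b \<in> R" using F[OF that] by auto
    have "a * E (b * b') = a * b * E b' + a * b' * E b" by (simp add: der_mult[OF E(2)] algebra_simps)
    moreover have "a * b * E b' \<in> R" "a * b' * E b \<in> R" "set (\<beta> # vs) \<subseteq> R"
      using E G R assms(3,4) by (auto simp: subalg_mult)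
    ultimately show ?thesis using alt_add[OF G(1), of "a * b * E b'" "a * b' * E b" "\<beta> # vs"] by simp
  qed
  then have "(\<Sum>(E, \<beta>)\<leftarrow>F. G (a * E (b * b')) (\<beta> # vs)) = (\<Sum>(E, \<beta>)\<leftarrow>F. G (a * b * E b') (\<beta> # vs) + G (a * b' * E b) (\<beta> # vs))"
    by (intro arg_cong[of _ _ sum_list] map_cong) auto
  also have "\<dots> = G (a * b) (b' # vs) + G (a * b') (b # vs)"
    using assms(3,4) G R by (simp only: sum_list_pair_add framed_expand[OF assms(1) G(1) _ G(3)] framed_expand[OF assms(2) G(1) _ G(3)] subalg_mult)
  also have "\<dots> = G a ((b * b') # vs)"
    using alt_d_mult[OF G(1,2) assms(3,4), of "[]" vs] G by simp
  finally show "G a ((b * b') # vs) = (\<Sum>(E, \<beta>)\<leftarrow>F. G (a * E (b * b')) (\<beta> # vs))" by simp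
qed

lemma framed_inverse:
  assumes "framed R F b" "b \<in> R" "inverse b \<in> R"
  shows "framed R F (inverse b)"
proof (cases "b = 0")
  case True then show ?thesis using assms by simp
next
  case False
  show ?thesis
  unfolding framed_def
  proof (intro allI impI)
    fix G a vs assume G: "alt R G" "a \<in> R" "set vs \<subseteq> R"
    let ?b = "inverse b"
    have 1: "G (- (a * ?b * ?b)) (b # vs) = G a (?b # vs)"
    proof -
      have "G (a * ?b) ((b * ?b) # vs) = G (a * ?b * b) (?b # vs) + G (a * ?b * ?b) (b # vs)"
        using alt_d_mult[OF G(1), of "a * ?b" b ?b "[]" vs] G R assms by (auto simp: subalg_mult)
      moreover have "b * ?b = \<iota> 1" using False by simp
      ultimately have "0 = G (a * ?b * b) (?b # vs) + G (a * ?b * ?b) (b # vs)"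
        using alt_const[OF G(1), of "a * ?b" "[]" vs 1] G R assms by (auto simp: subalg_mult)
      moreover have "a * ?b * b = a" using False by (simp add: mult.assoc)
      ultimately show ?thesis using G R assms alt_uminus[OF G(1), of "a * ?b * ?b" "b # vs"] by (auto simp: subalg_mult add_eq_0_iff)
    qed
    have "(\<Sum>(E, \<beta>)\<leftarrow>F. G (a * E ?b) (\<beta> # vs)) = (\<Sum>(E, \<beta>)\<leftarrow>F. G (- (a * ?b * ?b) * E b) (\<beta> # vs))"
      using F by (intro arg_cong[of _ _ sum_list] map_cong) (auto simp: der_inverse power2_eq_square mult_ac)
    also have "\<dots> = G (- (a * ?b * ?b)) (b # vs)"
      using assms(2,3) G R by (intro framed_expand[OF assms(1) G(1) _ G(3)] subalg_uminus subalg_mult)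
    finally show "G a (?b # vs) = (\<Sum>(E, \<beta>)\<leftarrow>F. G (a * E ?b) (\<beta> # vs))" using 1 by simp
  qed
qed

lemma frameI:
  assumes "\<And>b. b \<in> R \<Longrightarrow> framed R F b" shows "frame R F"
  unfolding frame_def
proof (intro conjI allI impI)
  show "\<forall>(E, \<beta>)\<in>set F. \<beta> \<in> R \<and> derivation E \<and> (\<forall>b\<in>R. E b \<in> R)" by (auto dest!: F)
qed (rule framed_expand[OF assms, symmetric])

end

subsection \<open>Generated subalgebras\<close>

lemma subalg_gen [simp]: "subalg (subalgebra_gen \<iota> H)"
  unfolding subalg_def subalgebra_gen_def
  using generate_ring.incl[of _ "range \<iota> \<union> H" class_ring] generate_ring.eng_add[of _ class_ring "range \<iota> \<union> H"]
    generate_ring.eng_mult[of _ class_ring "range \<iota> \<union> H"]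
  by (auto simp: class_ring_simps)

lemma gen_incl: "h \<in> H \<Longrightarrow> h \<in> subalgebra_gen \<iota> H"
  unfolding subalgebra_gen_def by (rule generate_ring.incl) auto

lemma gen_induct [consumes 1, case_names const incl add mult]:
  assumes "b \<in> subalgebra_gen \<iota> H"
    and "\<And>c. P (\<iota> c)" "\<And>h. h \<in> H \<Longrightarrow> P h"
    and add: "\<And>a b. a \<in> subalgebra_gen \<iota> H \<Longrightarrow> b \<in> subalgebra_gen \<iota> H \<Longrightarrow> P a \<Longrightarrow> P b \<Longrightarrow> P (a + b)"
    and mult: "\<And>a b. a \<in> subalgebra_gen \<iota> H \<Longrightarrow> b \<in> subalgebra_gen \<iota> H \<Longrightarrow> P a \<Longrightarrow> P b \<Longrightarrow> P (a * b)"
  shows "P b"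
proof -
  let ?g = "generate_ring class_ring (range \<iota> \<union> H)"
  have "b \<in> ?g" using assms(1) by (simp add: subalgebra_gen_def)
  then show ?thesis
  proof (induction rule: generate_ring.induct)
    case one then show ?case using assms(2)[of 1] by (simp add: class_ring_simps)
  next
    case (incl h) then show ?case using assms(2,3) by auto
  next
    case (a_inv h)
    have "P (\<iota> (-1) * h)"
      using a_inv assms(2) by (intro mult) (auto simp: subalgebra_gen_def intro!: generate_ring.incl)
    then show ?case by (simp add: hom_distribs class_ring_simps)
  next
    case (eng_add a b) then show ?case using add[of a b] by (simp add: class_ring_simps subalgebra_gen_def)
  next
    case (eng_mult a b) then show ?case using mult[of a b] by (simp add: class_ring_simps subalgebra_gen_def)
  qed
qed

lemma gen_least: "subalg R \<Longrightarrow> H \<subseteq> R \<Longrightarrow> subalgebra_gen \<iota> H \<subseteq> R"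
  by (rule subsetI, erule gen_induct) (auto intro: subalg_add subalg_mult)

lemma der_gen_closed:
  assumes "derivation E" "subalg R" "subalgebra_gen \<iota> H \<subseteq> R" "\<And>h. h \<in> H \<Longrightarrow> E h \<in> R"
    "b \<in> subalgebra_gen \<iota> H" shows "E b \<in> R"
  using assms(5)
proof (induction rule: gen_induct)
  case (const c) then show ?case using assms by (simp add: der_const)
next
  case (add a b) then show ?case using assms by (auto simp: der_add intro: subalg_add)
next
  case (mult a b)
  then have "a \<in> R" "b \<in> R" using assms by auto
  then show ?case using assms mult by (auto simp: der_mult intro!: subalg_add subalg_mult)
qed (use assms in auto)

lemma frame_gen:
  assumes F: "\<And>E \<beta>. (E, \<beta>) \<in> set F \<Longrightarrow> \<beta> \<in> subalgebra_gen \<iota> H \<and> derivation E \<and> (\<forall>h\<in>H. E h \<in> subalgebra_gen \<iota> H)"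
    and H: "\<And>h. h \<in> H \<Longrightarrow> framed (subalgebra_gen \<iota> H) F h"
  shows "frame (subalgebra_gen \<iota> H) F"
proof -
  let ?R = "subalgebra_gen \<iota> H"
  have F': "\<beta> \<in> ?R \<and> derivation E \<and> (\<forall>b\<in>?R. E b \<in> ?R)" if "(E, \<beta>) \<in> set F" for E \<beta>
    using F[OF that] der_gen_closed[of E ?R H] by auto
  have "framed ?R F b" if "b \<in> ?R" for b
    using that
  proof (induction rule: gen_induct)
    case (const c) then show ?case using framed_const[of ?R F] F' by simp
  next
    case (add a b) then show ?case using framed_add[of ?R F a b] F' by simp
  next
    case (mult a b) then show ?case using framed_mult[of ?R F a b] F' by simp
  qed (rule H)
  then show ?thesis using frameI[of ?R F] F' by simp
qed

lemma field_gen_induct: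
  assumes K: "generate_field class_ring (range \<iota> \<union> X) = (UNIV :: 'f set)"
    and P: "\<And>c. P (\<iota> c)" "\<And>h. h \<in> X \<Longrightarrow> P h" "\<And>a b. P a \<Longrightarrow> P b \<Longrightarrow> P (a + b)" "\<And>a b. P a \<Longrightarrow> P b \<Longrightarrow> P (a * b)"
     "\<And>a. P a \<Longrightarrow> a \<noteq> 0 \<Longrightarrow> P (inverse a)"
  shows "P (b::'f)"
proof -
  have "b \<in> generate_field class_ring (range \<iota> \<union> X)" using K by simp
  then show ?thesis
  proof (induction rule: generate_field.induct)
    case one then show ?case using P(1)[of 1] by (simp add: class_ring_simps)
  next
    case (incl h) then show ?case using P by auto
  next
    case (a_inv h)
    have "P (\<iota> (-1) * h)" using a_inv P by blast
    then show ?case by (simp add: hom_distribs class_ring_simps)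
  next
    case (m_inv h)
    then have "h \<noteq> 0" by (simp add: class_ring_simps)
    then show ?case using P(5)[of h] m_inv.IH by (simp add: class_ring_simps)
  next
    case (eng_add a b) then show ?case using P(3)[of a b] by (simp add: class_ring_simps)
  next
    case (eng_mult a b) then show ?case using P(4)[of a b] by (simp add: class_ring_simps)
  qed
qed

section \<open>Partitions of unity\<close>

definition ideal_in :: "'f set \<Rightarrow> 'f set \<Rightarrow> bool" where
  "ideal_in R I \<longleftrightarrow> I \<subseteq> R \<and> 0 \<in> I \<and> (\<forall>x\<in>I. \<forall>y\<in>I. x + y \<in> I) \<and> (\<forall>r\<in>R. \<forall>x\<in>I. r * x \<in> I)"

definition comaximal :: "'f set \<Rightarrow> 'f set \<Rightarrow> bool" where
  "comaximal R F \<longleftrightarrow> (\<forall>I. ideal_in R I \<longrightarrow> F \<subseteq> I \<longrightarrow> 1 \<in> I)"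

text \<open>The radical of an ideal is an ideal. It contains \<open>F\<close>, hence 1.\<close>

lemma comaximal_power:
  assumes R: "subalg R" and F: "comaximal R F" "F \<subseteq> R" and I: "ideal_in R I" and p: "\<And>f. f \<in> F \<Longrightarrow> \<exists>N. f ^ N \<in> I"
  shows "1 \<in> I"
proof -
  let ?J = "{x \<in> R. \<exists>N. x ^ N \<in> I}"
  have IR: "I \<subseteq> R" "0 \<in> I" "\<And>x y. x \<in> I \<Longrightarrow> y \<in> I \<Longrightarrow> x + y \<in> I" "\<And>r x. r \<in> R \<Longrightarrow> x \<in> I \<Longrightarrow> r * x \<in> I"
    using I by (auto simp: ideal_in_def)
  have sumI: "sum g A \<in> I" if "\<And>k. k \<in> A \<Longrightarrow> g k \<in> I" for g and A :: "nat set"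
    using that by (induction A rule: infinite_finite_induct) (auto simp: IR)
  have "ideal_in R ?J"
    unfolding ideal_in_def
  proof (intro conjI ballI)
    show "0 \<in> ?J" using R IR by (auto intro!: exI[of _ 1])
  next
    fix x y assume "x \<in> ?J" "y \<in> ?J"
    then obtain N M where xy: "x \<in> R" "y \<in> R" "x ^ N \<in> I" "y ^ M \<in> I" by auto
    \<comment> \<open>In each term of the binomial expansion the exponent of \<open>x\<close> is at least \<open>N\<close> or that of \<open>y\<close> is at least \<open>M\<close>.\<close>
    have "(x + y) ^ (N + M) = (\<Sum>k\<le>N + M. of_nat (N + M choose k) * x ^ k * y ^ (N + M - k))"
      by (simp add: binomial_ring)
    also have "\<dots> \<in> I"
    proof (rule sumI)
      fix k assume "k \<in> {..N + M}"
      have n: "of_nat q \<in> R" for q using subalg_const[OF R, of "of_nat q"] by (simp add: hom_distribs)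
      show "of_nat (N + M choose k) * x ^ k * y ^ (N + M - k) \<in> I"
      proof (cases "k \<ge> N")
        case True
        then have "x ^ k = x ^ (k - N) * x ^ N" by (simp flip: power_add)
        then have "of_nat (N + M choose k) * x ^ k * y ^ (N + M - k) = (of_nat (N + M choose k) * x ^ (k - N) * y ^ (N + M - k)) * x ^ N"
          by (simp add: mult_ac)
        then show ?thesis by (simp only:) (intro IR(4) xy subalg_mult subalg_power R n)
      next
        case False
        then have "y ^ (N + M - k) = y ^ (N - k) * y ^ M" by (simp flip: power_add)
        then have "of_nat (N + M choose k) * x ^ k * y ^ (N + M - k) = (of_nat (N + M choose k) * x ^ k * y ^ (N - k)) * y ^ M"
          by (simp add: mult_ac)
        then show ?thesis by (simp only:) (intro IR(4) xy subalg_mult subalg_power R n)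
      qed
    qed
    finally show "x + y \<in> ?J" using xy R by (auto intro: subalg_add)
  next
    fix r x assume "r \<in> R" "x \<in> ?J"
    then obtain N where "r \<in> R" "x \<in> R" "x ^ N \<in> I" by auto
    then have "(r * x) ^ N \<in> I" "r * x \<in> R" using R IR(4) by (auto simp: power_mult_distrib subalg_power subalg_mult)
    then show "r * x \<in> ?J" by blast
  qed auto
  moreover have "F \<subseteq> ?J" using p F by auto
  ultimately have "1 \<in> ?J" using F unfolding comaximal_def by blast
  then show ?thesis by auto
qed

lemma pair_fmul_add: "alt UNIV G \<Longrightarrow> pair G (fmul (x + y) v) = pair G (fmul x v) + pair G (fmul y v)"
  by (induction v) (auto simp: fmul_def distrib_right alt_add)

lemma pair_fmul_add': "subalg R \<Longrightarrow> over R v \<Longrightarrow> x \<in> R \<Longrightarrow> y \<in> R \<Longrightarrow> alt R G \<Longrightarrow> pair G (fmul (x + y) v) = pair G (fmul x v) + pair G (fmul y v)"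
  by (induction v) (auto simp: fmul_def distrib_right alt_add subalg_mult)

lemma fmul_fmul: "fmul a (fmul b v) = fmul (a * b) v" and fmul_1 [simp]: "fmul 1 v = v"
  by (auto simp: fmul_def case_prod_beta mult_ac)

text \<open>The functions \<open>x\<close> for which \<open>x v\<close> extends form an ideal of \<open>R\<close>.\<close>

theorem extends_local:
  assumes R: "subalg R" and F: "comaximal R F" "F \<subseteq> R"
    and v: "\<And>f. f \<in> F \<Longrightarrow> \<exists>N. extends_to R (fmul (f ^ N) v)"
  shows "extends_to R v"
proof -
  let ?I = "{x \<in> R. extends_to R (fmul x v)}"
  have "ideal_in R ?I"
    unfolding ideal_in_def
  proof (intro conjI ballI)
    have "eqv UNIV [] (fmul 0 v)" unfolding eqv_def
      using pair_fmul_add[of _ 0 0 v] by auto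
    then show "0 \<in> ?I" using R extends_over[of R "[]"] by (auto intro: extends_eqv)
  next
    fix x y assume "x \<in> ?I" "y \<in> ?I"
    moreover have "eqv UNIV (fmul x v @ fmul y v) (fmul (x + y) v)"
      unfolding eqv_def using pair_fmul_add by auto
    ultimately show "x + y \<in> ?I" using R extends_eqv[OF extends_append] by (auto intro!: subalg_add)
  next
    fix r x assume "r \<in> R" "x \<in> ?I"
    then have "extends_to R (fmul r (fmul x v))" "r * x \<in> R" using R by (auto intro: extends_fmul subalg_mult)
    then show "r * x \<in> ?I" by (simp add: fmul_fmul)
  qed auto
  then have "1 \<in> ?I"
  proof (rule comaximal_power[OF R F])
    fix f assume "f \<in> F"
    then show "\<exists>N. f ^ N \<in> ?I" using v[of f] F(2) subalg_power[OF R] by blast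
  qed
  then show ?thesis by simp
qed

theorem null_local:
  assumes R: "subalg R" and F: "comaximal R F" "F \<subseteq> R" and vR: "over R v"
    and v: "\<And>f. f \<in> F \<Longrightarrow> \<exists>N. eqv R (fmul (f ^ N) v) []"
  shows "eqv R v []"
proof -
  let ?I = "{x \<in> R. eqv R (fmul x v) []}"
  have "ideal_in R ?I"
    unfolding ideal_in_def
  proof (intro conjI ballI)
    have "eqv R [] (fmul 0 v)" unfolding eqv_def
      using pair_fmul_add'[OF R vR, of 0 0] R by auto
    then show "0 \<in> ?I" using R by (auto intro: eqv_sym)
  next
    fix x y assume "x \<in> ?I" "y \<in> ?I"
    then show "x + y \<in> ?I" using R pair_fmul_add'[OF R vR, of x y] by (auto intro!: subalg_add simp: eqv_def)
  next
    fix r x assume *: "r \<in> R" "x \<in> ?I"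
    then have "eqv R (fmul r (fmul x v)) (fmul r [])" using R by (auto intro!: eqv_fmul)
    then show "r * x \<in> ?I" using R * by (auto intro!: subalg_mult simp: fmul_fmul) (simp add: fmul_def)
  qed auto
  then have "1 \<in> ?I"
  proof (rule comaximal_power[OF R F])
    fix f assume "f \<in> F"
    then show "\<exists>N. f ^ N \<in> ?I" using v[of f] F(2) subalg_power[OF R] by blast
  qed
  then show ?thesis by simp
qed

text \<open>Over \<open>Q\<close>, a localization of \<open>R\<close> at \<open>f\<close>, each entry is \<open>b = r / f\<^sup>p\<close>, and the quotient rule expresses \<open>db\<close> by
  \<open>dr\<close> and \<open>df\<close> with a power of \<open>f\<close> in the denominator.\<close>

theorem extends_clear_denominators:
  assumes R: "subalg R" and f: "f \<in> R" "f \<noteq> 0" and Q: "\<And>b. b \<in> Q \<Longrightarrow> \<exists>p. f ^ p * b \<in> R" "subalg Q" "R \<subseteq> Q"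
    and v: "extends_to Q v"
  shows "\<exists>N. extends_to R (fmul (f ^ N) v)"
proof -
  let ?P = "\<lambda>v. \<exists>N. extends_to R (fmul (f ^ N) v)"
  have fp: "f ^ p \<in> R" for p using f R by (auto intro: subalg_power)
  have up: "extends_to R (fmul (f ^ (N + M)) v)" if "extends_to R (fmul (f ^ N) v)" for N M v
    using extends_fmul[OF that R fp, of M] by (simp add: fmul_fmul power_add mult.commute)
  have P_append: "?P (v @ w)" if v: "?P v" and w: "?P w" for v w
  proof -
    obtain N M where NM: "extends_to R (fmul (f ^ N) v)" "extends_to R (fmul (f ^ M) w)" using v w by auto
    have "extends_to R (fmul (f ^ (N + M)) v @ fmul (f ^ (N + M)) w)"
      using up[OF NM(1), of M] up[OF NM(2), of N] by (intro extends_append) (auto simp: add.commute)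
    then have "extends_to R (fmul (f ^ (N + M)) (v @ w))" by (simp add: fmul_def)
    then show ?thesis by blast
  qed
  have P_eqv: "?P w" if v: "?P v" and e: "eqv UNIV v w" for v w
  proof -
    obtain N where "extends_to R (fmul (f ^ N) v)" using v by auto
    then have "extends_to R (fmul (f ^ N) w)" using eqv_fmul[OF subalg_UNIV e UNIV_I] by (rule extends_eqv)
    then show ?thesis by auto
  qed
  have P_neg: "?P (fmul (-1) v)" if v: "?P v" for v
  proof -
    obtain N where "extends_to R (fmul (f ^ N) v)" using v by auto
    then have "extends_to R (fmul (-1) (fmul (f ^ N) v))" using subalg_uminus[OF R, of 1] R by (auto intro!: extends_fmul)
    then have "extends_to R (fmul (f ^ N) (fmul (-1) v))" by (simp add: fmul_fmul mult.commute)
    then show ?thesis by blast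
  qed
  have P_div: "?P v" if h: "?P (fmul (f ^ p) v)" for v p
  proof -
    obtain N where "extends_to R (fmul (f ^ N) (fmul (f ^ p) v))" using h by blast
    then have "extends_to R (fmul (f ^ (N + p)) v)" by (simp add: fmul_fmul power_add)
    then show ?thesis by blast
  qed
  have sym: "?P [(a, us @ bs)]" if "a \<in> Q" "set us \<subseteq> R" "set bs \<subseteq> Q" for a us bs
    using that
  proof (induction bs arbitrary: a us)
    case Nil
    obtain p where "f ^ p * a \<in> R" using Q(1)[of a] Nil.prems(1) by blast
    then have "extends_to R (fmul (f ^ p) [(a, us)])" using Nil by (auto simp: fmul_def intro!: extends_over)
    then show ?case by auto
  next
    case (Cons b bs)
    obtain p where p: "f ^ p * b \<in> R" using Q(1)[of b] Cons.prems by auto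
    have 1: "?P [(a, us @ (f ^ p * b) # bs)]"
      using Cons.IH[of a "us @ [f ^ p * b]"] Cons.prems p by auto
    have 2: "?P [(a * b, us @ (f ^ p) # bs)]"
      using Cons.IH[of "a * b" "us @ [f ^ p]"] Cons.prems fp Q by (auto intro: subalg_mult)
    have "?P ([(a, us @ (f ^ p * b) # bs)] @ fmul (-1) [(a * b, us @ (f ^ p) # bs)])"
      using 1 P_neg[OF 2] by (rule P_append)
    moreover have "eqv UNIV ([(a, us @ (f ^ p * b) # bs)] @ fmul (-1) [(a * b, us @ (f ^ p) # bs)]) (fmul (f ^ p) [(a, us @ b # bs)])"
      unfolding eqv_def
    proof (intro allI impI)
      fix G assume G: "alt UNIV G"
      show "pair G ([(a, us @ (f ^ p * b) # bs)] @ fmul (-1) [(a * b, us @ (f ^ p) # bs)]) = pair G (fmul (f ^ p) [(a, us @ b # bs)])"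
        using alt_d_mult[OF G, of a "f ^ p" b us bs] alt_uminus[OF G, of "a * b" "us @ (f ^ p) # bs"]
        by (simp add: fmul_def mult.commute)
    qed
    ultimately have "?P (fmul (f ^ p) [(a, us @ b # bs)])" by (rule P_eqv)
    then show ?case by (rule P_div)
  qed
  obtain w where w: "over Q w" "eqv UNIV v w" using v by (auto simp: extends_to_def)
  have "?P w" using w(1)
  proof (induction w)
    case Nil then show ?case using extends_over[of R "[]"] by (auto simp: fmul_def)
  next
    case (Cons p w)
    obtain a bs where p: "p = (a, bs)" by force
    have "?P ([(a, bs)] @ w)"
      using Cons p sym[of a "[]" bs] by (intro P_append) auto
    then show ?case by (simp add: p)
  qed
  then show ?thesis using P_eqv[OF _ eqv_sym[OF w(2)]] by blast
qed

end

section \<open>Formal sums and the vector space of symbols\<close>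

abbreviation pscale :: "'k::field \<Rightarrow> ('s \<Rightarrow>\<^sub>0 'k) \<Rightarrow> ('s \<Rightarrow>\<^sub>0 'k)" where
  "pscale c \<equiv> Poly_Mapping.map ((*) c)"

lemma lookup_pscale [simp]: "Poly_Mapping.lookup (pscale c p) k = c * Poly_Mapping.lookup p k"
  by (simp add: Poly_Mapping.map.rep_eq when_def)

interpretation pm: vector_space "pscale :: 'k::field \<Rightarrow> ('s \<Rightarrow>\<^sub>0 'k) \<Rightarrow> ('s \<Rightarrow>\<^sub>0 'k)"
  by standard (auto intro!: poly_mapping_eqI simp: lookup_add algebra_simps)

definition evaluate :: "('s \<Rightarrow> complex) \<Rightarrow> ('s \<Rightarrow>\<^sub>0 complex) \<Rightarrow> complex" where
  "evaluate G p = (\<Sum>k\<in>Poly_Mapping.keys p. Poly_Mapping.lookup p k * G k)"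

lemma evaluate_superset: "finite S \<Longrightarrow> Poly_Mapping.keys p \<subseteq> S \<Longrightarrow> evaluate G p = (\<Sum>k\<in>S. Poly_Mapping.lookup p k * G k)"
  unfolding evaluate_def by (rule sum.mono_neutral_left) (auto simp: in_keys_iff)

lemma evaluate_add: "evaluate G (p + q) = evaluate G p + evaluate G q"
proof -
  let ?S = "Poly_Mapping.keys p \<union> Poly_Mapping.keys q"
  have "evaluate G r = (\<Sum>k\<in>?S. Poly_Mapping.lookup r k * G k)" if "Poly_Mapping.keys r \<subseteq> ?S" for r
    using that by (intro evaluate_superset) auto
  then show ?thesis
    using Poly_Mapping.keys_add[of p q] by (simp add: lookup_add distrib_right sum.distrib)
qed

lemma evaluate_scale: "evaluate G (pscale c p) = c * evaluate G p"
proof -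
  have "Poly_Mapping.keys (pscale c p) \<subseteq> Poly_Mapping.keys p" by (auto simp: in_keys_iff)
  then have "evaluate G (pscale c p) = (\<Sum>k\<in>Poly_Mapping.keys p. c * Poly_Mapping.lookup p k * G k)"
    by (subst evaluate_superset[of "Poly_Mapping.keys p"]) auto
  then show ?thesis by (simp add: evaluate_def sum_distrib_left mult.assoc)
qed

lemma evaluate_single [simp]: "evaluate G (Poly_Mapping.single k c) = c * G k"
  by (simp add: evaluate_def)

lemma evaluate_0 [simp]: "evaluate G 0 = 0"
  by (simp add: evaluate_def)

lemma evaluate_diff: "evaluate G (p - q) = evaluate G p - evaluate G q"
  using evaluate_add[of G "p - q" q] by simp

lemma pm_single: "Poly_Mapping.single k c = pscale c (Poly_Mapping.single k 1)"
  by (rule poly_mapping_eqI) (simp add: lookup_single when_def)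

lemma poly_mapping_expand: "(p :: 's \<Rightarrow>\<^sub>0 complex) = (\<Sum>k\<in>Poly_Mapping.keys p. pscale (Poly_Mapping.lookup p k) (Poly_Mapping.single k 1))"
proof (rule poly_mapping_eqI)
  fix k
  have "Poly_Mapping.lookup (\<Sum>l\<in>S. pscale (Poly_Mapping.lookup p l) (Poly_Mapping.single l 1)) k = (if k \<in> S then Poly_Mapping.lookup p k else 0)"
    if "finite S" for S
    using that by (induction S rule: finite_induct) (auto simp: lookup_add lookup_single when_def)
  from this[of "Poly_Mapping.keys p"] show "Poly_Mapping.lookup p k = Poly_Mapping.lookup (\<Sum>l\<in>Poly_Mapping.keys p. pscale (Poly_Mapping.lookup p l) (Poly_Mapping.single l 1)) k"
    by (auto simp: in_keys_iff)
qed

lemma linear_is_evaluate: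
  assumes "Vector_Spaces.linear pscale (*) g"
  shows "g p = evaluate (\<lambda>k. g (Poly_Mapping.single k 1)) p"
proof -
  interpret g: Vector_Spaces.linear pscale "(*)" g by fact
  show ?thesis
    by (subst poly_mapping_expand) (simp only: g.sum g.scale evaluate_def)
qed

text \<open>A vector outside a span is separated from it by a linear functional, and a linear functional on
  finitely supported functions is determined by its values on the symbols.\<close>

lemma span_iff_functionals:
  "x \<in> pm.span X \<longleftrightarrow> (\<forall>G. (\<forall>r\<in>X. evaluate G r = 0) \<longrightarrow> evaluate G x = 0)"
proof
  assume x: "x \<in> pm.span X"
  show "\<forall>G. (\<forall>r\<in>X. evaluate G r = 0) \<longrightarrow> evaluate G x = 0"
  proof (intro allI impI)
    fix G assume G: "\<forall>r\<in>X. evaluate G r = 0"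
    show "evaluate G x = 0" using x
      by (induction rule: pm.span_induct_alt) (auto simp: evaluate_add evaluate_scale G)
  qed
next
  assume *: "\<forall>G. (\<forall>r\<in>X. evaluate G r = 0) \<longrightarrow> evaluate G x = 0"
  show "x \<in> pm.span X"
  proof (rule ccontr)
    assume x: "x \<notin> pm.span X"
    interpret p: vector_space_pair "pscale :: complex \<Rightarrow> ('a \<Rightarrow>\<^sub>0 complex) \<Rightarrow> ('a \<Rightarrow>\<^sub>0 complex)" "(*) :: complex \<Rightarrow> complex \<Rightarrow> complex"
      by (intro vector_space_pair.intro) (unfold_locales, auto simp: algebra_simps)
    obtain B where B: "B \<subseteq> X" "pm.independent B" "pm.span B = pm.span X"
      using pm.maximal_independent_subset[of X] pm.span_mono pm.span_minimal pm.subspace_span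
      by (metis subset_antisym pm.span_subspace)
    have "pm.independent (insert x B)" using B x by (simp add: pm.independent_insert)
    then obtain g where g: "Vector_Spaces.linear pscale (*) g" "\<forall>y\<in>insert x B. g y = (if y = x then 1 else (0::complex))"
      using p.linear_independent_extend[of "insert x B" "\<lambda>y. if y = x then 1 else 0"] by blast
    interpret g: Vector_Spaces.linear pscale "(*)" g by (rule g(1))
    have xB: "x \<notin> B" using x B pm.span_base by blast
    have "g y = 0" if "y \<in> pm.span B" for y
      using that
    proof (induction rule: pm.span_induct_alt)
      case base show ?case by simp
    next
      case (step c b z)
      have "b \<noteq> x" using step xB by auto
      then show ?case using step g(2) by (simp add: g.add g.scale)
    qed
    then have "\<forall>r\<in>X. evaluate (\<lambda>k. g (Poly_Mapping.single k 1)) r = 0"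
      using B pm.span_base by (metis linear_is_evaluate[OF g(1)])
    then have "g x = 0" using * linear_is_evaluate[OF g(1), of x] by auto
    then show False using g(2) by simp
  qed
qed

context complex_field
begin

definition to_poly :: "('f \<times> 'f list) list \<Rightarrow> ('f \<times> 'f list \<Rightarrow>\<^sub>0 complex)" where
  "to_poly v = (\<Sum>(a, bs)\<leftarrow>v. form_symbol a bs)"

lemma evaluate_to_poly: "evaluate (\<lambda>(a, bs). G a bs) (to_poly v) = pair G v"
  by (induction v) (auto simp: to_poly_def evaluate_add form_symbol_def)

lemma alt_iff_relations:
  "alt R G \<longleftrightarrow> (\<forall>r\<in>form_relations \<iota> R. evaluate (\<lambda>(a, bs). G a bs) r = 0)"
proof
  assume G: "alt R G"
  show "\<forall>r\<in>form_relations \<iota> R. evaluate (\<lambda>(a, bs). G a bs) r = 0"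
  proof
    fix r assume "r \<in> form_relations \<iota> R"
    then show "evaluate (\<lambda>(a, bs). G a bs) r = 0"
    proof (induction rule: form_relations.induct)
      case (scale a bs c)
      then show ?case using alt_scale[OF G, of a bs c] by (auto simp: evaluate_diff form_symbol_def in_lists_conv_set subset_iff)
    next
      case (add a a' bs)
      then show ?case using alt_add[OF G, of a a' bs] by (auto simp: evaluate_diff evaluate_add form_symbol_def in_lists_conv_set subset_iff)
    next
      case (d_const a us vs c)
      then show ?case using alt_const[OF G, of a us vs c] by (auto simp: form_symbol_def in_lists_conv_set subset_iff)
    next
      case (d_add a b b' us vs)
      then show ?case using alt_d_add[OF G, of a b b' us vs] by (auto simp: evaluate_diff evaluate_add form_symbol_def in_lists_conv_set subset_iff)
    next
      case (d_mult a b b' us vs)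
      then show ?case using alt_d_mult[OF G, of a b b' us vs] by (auto simp: evaluate_diff evaluate_add form_symbol_def in_lists_conv_set subset_iff)
    next
      case (alternating a b us vs ws)
      then show ?case using alt_alternating[OF G, of a b us vs ws] by (auto simp: form_symbol_def in_lists_conv_set subset_iff)
    qed
  qed
next
  assume *: "\<forall>r\<in>form_relations \<iota> R. evaluate (\<lambda>(a, bs). G a bs) r = 0"
  have l: "us \<in> lists R" if "set us \<subseteq> R" for us using that by auto
  show "alt R G"
    unfolding alt_def
  proof (intro conjI allI impI, goal_cases)
    case (1 a c bs) then show ?case using *[rule_format, OF form_relations.scale[OF _ l], of a bs c] by (simp add: evaluate_diff form_symbol_def)
  next
    case (2 a a' bs) then show ?case using *[rule_format, OF form_relations.add[OF _ _ l], of a a' bs] by (simp add: evaluate_diff evaluate_add form_symbol_def)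
  next
    case (3 a c us vs) then show ?case using *[rule_format, OF form_relations.d_const[OF _ l l], of a us vs] by (simp add: form_symbol_def)
  next
    case (4 a b b' us vs) then show ?case using *[rule_format, OF form_relations.d_add[OF _ _ _ l l], of a b b' us vs] by (simp add: evaluate_diff evaluate_add form_symbol_def)
  next
    case (5 a b b' us vs) then show ?case using *[rule_format, OF form_relations.d_mult[OF _ _ _ l l], of a b b' us vs] by (simp add: evaluate_diff evaluate_add form_symbol_def)
  next
    case (6 a b us vs ws) then show ?case using *[rule_format, OF form_relations.alternating[OF _ _ l l l], of a b us vs ws] by (simp add: form_symbol_def)
  qed
qed

lemma span_relations_iff:
  "x \<in> pm.span (form_relations \<iota> R) \<longleftrightarrow> (\<forall>G. alt R G \<longrightarrow> evaluate (\<lambda>(a, bs). G a bs) x = 0)"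
proof -
  have "G = (\<lambda>(a, bs). curry G a bs)" for G :: "'f \<times> 'f list \<Rightarrow> complex" by auto
  then show ?thesis unfolding span_iff_functionals alt_iff_relations by (metis (no_types))
qed

lemma eqv_Nil_iff_span: "eqv R v [] \<longleftrightarrow> to_poly v \<in> pm.span (form_relations \<iota> R)"
  unfolding span_relations_iff eqv_def by (simp add: evaluate_to_poly)

section \<open>Torsion after localization\<close>

text \<open>In the localization at a denominator \<open>h\<close> with \<open>h b \<in> R\<close>, the one-form \<open>h\<^sup>2 db\<close> is
  \<open>h d(h b) - h b dh\<close>, an expression over \<open>R\<close>. Replacing every \<open>db\<close> in this way turns a functional on forms
  over \<open>R\<close> into one on symbols whose entries have denominator \<open>h\<close>; the accumulator \<open>us\<close> holds the entries already treated.\<close>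

primrec clear :: "'f \<Rightarrow> ('f \<Rightarrow> 'f list \<Rightarrow> complex) \<Rightarrow> 'f list \<Rightarrow> 'f \<Rightarrow> 'f list \<Rightarrow> complex" where
  "clear h G [] c us = G c us"
| "clear h G (b # bs) c us = clear h G bs (h * c) (us @ [h * b]) - clear h G bs (h * b * c) (us @ [h])"

lemma alt_append:
  assumes G: "alt R G" and b: "b \<in> R" shows "alt R (\<lambda>a bs. G a (bs @ [b]))"
proof -
  have s: "set (us @ [b]) \<subseteq> R" if "set us \<subseteq> R" for us using that b by simp
  show ?thesis unfolding alt_def
    using alt_scale[OF G _ s] alt_add[OF G _ _ s] alt_const[OF G _ _ s]  alt_d_add[OF G _ _ _ _ s]
     alt_d_mult[OF G _ _ _ _ s] alt_alternating[OF G _ _ _ _ s]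
    by simp
qed

lemma alt_minus:
  assumes G: "alt R G" and H: "alt R H" shows "alt R (\<lambda>a bs. G a bs - H a bs)"
  unfolding alt_def
  by (simp add: alt_scale[OF G] alt_scale[OF H] alt_add[OF G] alt_add[OF H] alt_const[OF G] alt_const[OF H]
   alt_d_add[OF G] alt_d_add[OF H] alt_d_mult[OF G] alt_d_mult[OF H] alt_alternating[OF G] alt_alternating[OF H] right_diff_distrib)

lemma alt_clear:
  assumes R: "subalg R" and h: "h \<in> R" and G: "alt R G"
  shows "(\<And>b. b \<in> set bs \<Longrightarrow> h * b \<in> R) \<Longrightarrow> alt R (clear h G bs)"
proof (induction bs)
  case Nil
  have "clear h G [] = G" by (intro ext) simp
  then show ?case using G by simp
next
  case (Cons b bs)
  have F: "alt R (clear h G bs)" using Cons by simp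
  have b: "h * b \<in> R" using Cons by simp
  have "alt R (\<lambda>c us. clear h G bs (h * c) (us @ [h * b]) - clear h G bs (h * b * c) (us @ [h]))"
    using alt_fmul[OF R alt_append[OF F b] h] alt_fmul[OF R alt_append[OF F h] b] by (rule alt_minus)
  moreover have "clear h G (b # bs) = (\<lambda>c us. clear h G bs (h * c) (us @ [h * b]) - clear h G bs (h * b * c) (us @ [h]))"
    by (intro ext) simp
  ultimately show ?case by simp
qed

lemma alt_swap_far:
  assumes G: "alt R G" and "a \<in> R" "b \<in> R" "b' \<in> R" "set us \<subseteq> R" "set vs \<subseteq> R" "set ws \<subseteq> R" and R: "subalg R"
  shows "G a (us @ b # ws @ b' # vs) = - G a (us @ b' # ws @ b # vs)"
proof -
  have s: "b + b' \<in> R" using assms by (auto intro: subalg_add)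
  have "G a (us @ (b + b') # ws @ (b + b') # vs) = 0"
    using alt_alternating[OF G, of a "b+b'" us ws vs] assms s by simp
  moreover have "G a (us @ (b + b') # ws @ (b + b') # vs) = G a (us @ b # ws @ (b + b') # vs) + G a (us @ b' # ws @ (b + b') # vs)"
    using alt_d_add[OF G, of a b b' us "ws @ (b+b') # vs"] assms s by simp
  moreover have "G a (us @ b # ws @ (b + b') # vs) = G a (us @ b # ws @ b # vs) + G a (us @ b # ws @ b' # vs)"
    using alt_d_add[OF G, of a b b' "us @ b # ws" "vs"] assms s by simp
  moreover have "G a (us @ b' # ws @ (b + b') # vs) = G a (us @ b' # ws @ b # vs) + G a (us @ b' # ws @ b' # vs)"
    using alt_d_add[OF G, of a b b' "us @ b' # ws" "vs"] assms s by simp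
  moreover have "G a (us @ b # ws @ b # vs) = 0" "G a (us @ b' # ws @ b' # vs) = 0"
    using alt_alternating[OF G, of a _ us ws vs] assms s by auto
  ultimately show ?thesis by (simp add: add_eq_0_iff)
qed

context
  fixes R h G
  assumes R: "subalg R" and h: "h \<in> R" and G: "alt R G"
begin

lemma clear_const:
  "\<lbrakk>c \<in> R; set us \<subseteq> R; \<And>b. b \<in> set (pre @ post) \<Longrightarrow> h * b \<in> R\<rbrakk> \<Longrightarrow> clear h G (pre @ \<iota> k # post) c us = 0"
proof (induction pre arbitrary: c us)
  case Nil
  note F = alt_clear[OF R h G, of post]
  have F: "alt R (clear h G post)" using F Nil by simp
  have "clear h G post (h * c) (us @ [\<iota> k * h]) = clear h G post (h * c * \<iota> k) (us @ [h]) + clear h G post (h * c * h) (us @ [\<iota> k])"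
    using alt_d_mult[OF F, of "h * c" "\<iota> k" h us "[]"] Nil R h by (simp add: subalg_mult)
  also have "clear h G post (h * c * h) (us @ [\<iota> k]) = 0"
    using alt_const[OF F, of "h * c * h" us "[]" k] Nil R h by (simp add: subalg_mult)
  finally show ?case by (simp add: mult_ac)
next
  case (Cons p pre)
  then show ?case using R h by (simp add: subalg_mult)
qed

lemma clear_d_add:
  "\<lbrakk>c \<in> R; set us \<subseteq> R; h * b \<in> R; h * b' \<in> R; \<And>b. b \<in> set (pre @ post) \<Longrightarrow> h * b \<in> R\<rbrakk> \<Longrightarrow>
   clear h G (pre @ (b + b') # post) c us = clear h G (pre @ b # post) c us + clear h G (pre @ b' # post) c us"
proof (induction pre arbitrary: c us)
  case Nil
  note F = alt_clear[OF R h G, of post]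
  have F: "alt R (clear h G post)" using F Nil by simp
  show ?case
    using alt_d_add[OF F, of "h * c" "h * b" "h * b'" us "[]"] alt_add[OF F, of "h * b * c" "h * b' * c" "us @ [h]"] Nil R h
    by (simp add: subalg_mult distrib_left distrib_right)
next
  case (Cons p pre)
  then show ?case using R h by (simp add: subalg_mult)
qed

lemma clear_d_mult:
  "\<lbrakk>c \<in> R; set us \<subseteq> R; h * b \<in> R; h * b' \<in> R; h * (b * b') \<in> R; \<And>b. b \<in> set (pre @ post) \<Longrightarrow> h * b \<in> R\<rbrakk> \<Longrightarrow>
   clear h G (pre @ (b * b') # post) (h * c) us = clear h G (pre @ b' # post) (h * b * c) us + clear h G (pre @ b # post) (h * b' * c) us"
proof (induction pre arbitrary: c us)
  case Nil
  note F = alt_clear[OF R h G, of post]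
  have F: "alt R (clear h G post)" using F Nil by simp
  let ?A = "\<lambda>c w. clear h G post c (us @ [w])"
  have mult: "?A c (x * y) = ?A (c * x) y + ?A (c * y) x" if "c \<in> R" "x \<in> R" "y \<in> R" for c x y
    using alt_d_mult[OF F, of c x y us "[]"] Nil that by simp
  have "?A (h * c) (h * (h * (b * b'))) = ?A (h * c * h) (h * (b * b')) + ?A (h * c * (h * (b * b'))) h"
    using Nil R h by (intro mult) (simp_all add: subalg_mult)
  moreover have "?A (h * c) ((h * b) * (h * b')) = ?A (h * c * (h * b)) (h * b') + ?A (h * c * (h * b')) (h * b)"
    using Nil R h by (intro mult) (simp_all add: subalg_mult)
  moreover have "h * (h * (b * b')) = (h * b) * (h * b')" by (simp add: mult_ac)
  moreover have e: "h * c * h = h * (h * c)" "h * c * (h * (b * b')) = h * (b * b') * (h * c)" "h * c * (h * b) = h * (h * b * c)"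
    "h * c * (h * b') = h * (h * b' * c)" "h * b' * (h * b * c) = h * (b * b') * (h * c)" "h * b * (h * b' * c) = h * (b * b') * (h * c)"
    by (simp_all add: mult_ac)
  ultimately show ?case by (simp add: e)
next
  case (Cons p pre)
  have e: "h * p * (h * c) = h * (h * p * c)" "h * p * (h * b * c) = h * b * (h * p * c)" "h * p * (h * b' * c) = h * b' * (h * p * c)"
    "h * (h * b * c) = h * b * (h * c)" "h * (h * b' * c) = h * b' * (h * c)"
    by (auto simp: mult_ac)
  show ?case using Cons.IH[of "h * c" "us @ [h * p]"] Cons.IH[of "h * p * c" "us @ [h]"] Cons.prems R h by (simp add: subalg_mult e)
qed

lemma clear_push:
  "\<lbrakk>c \<in> R; set us \<subseteq> R; set us' \<subseteq> R; h * b \<in> R; \<And>b. b \<in> set (mid @ post) \<Longrightarrow> h * b \<in> R\<rbrakk> \<Longrightarrow>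
   clear h G (mid @ b # post) (h * c) (us @ h * b # us') = clear h G (mid @ b # post) (h * b * c) (us @ h # us')"
proof (induction mid arbitrary: c us')
  case Nil
  note F = alt_clear[OF R h G, of post]
  have F: "alt R (clear h G post)" using F Nil by simp
  have "clear h G post (h * (h * c)) (us @ h * b # us' @ [h * b]) = 0" "clear h G post (h * b * (h * b * c)) (us @ h # us' @ [h]) = 0"
    using Nil R h alt_alternating[OF F, of _ "h * b" us us' "[]"] alt_alternating[OF F, of _ "h" us us' "[]"] by (auto simp: subalg_mult)
  moreover have "clear h G post (h * b * (h * c)) (us @ h * b # us' @ [h]) = - clear h G post (h * b * (h * c)) (us @ h # us' @ [h * b])"
    using Nil R h by (intro alt_swap_far[OF F]) (simp_all add: subalg_mult)
  moreover have e: "h * b * (h * c) = h * (h * b * c)" by (simp add: mult_ac)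
  ultimately show ?case by (simp add: e)
next
  case (Cons m mid)
  have e: "h * m * (h * c) = h * (h * m * c)" "h * m * (h * b * c) = h * b * (h * m * c)"
    "h * (h * b * c) = h * b * (h * c)"
    by (auto simp: mult_ac)
  show ?case using Cons.IH[of "h * c" "us' @ [h * m]"] Cons.IH[of "h * m * c" "us' @ [h]"] Cons.prems R h by (simp add: subalg_mult e)
qed

lemma clear_alternating:
  "\<lbrakk>c \<in> R; set us \<subseteq> R; h * b \<in> R; \<And>b. b \<in> set (pre @ mid @ post) \<Longrightarrow> h * b \<in> R\<rbrakk> \<Longrightarrow>
   clear h G (pre @ b # mid @ b # post) c us = 0"
proof (induction pre arbitrary: c us)
  case Nil
  then show ?case using clear_push[of c us "[]" b mid post] by simp
next
  case (Cons p pre)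
  then show ?case using R h by (simp add: subalg_mult)
qed

lemma clear_over: "\<lbrakk>c \<in> R; set us \<subseteq> R; set bs \<subseteq> R\<rbrakk> \<Longrightarrow> clear h G bs c us = G (h ^ (2 * length bs) * c) (us @ bs)"
proof (induction bs arbitrary: c us)
  case (Cons b bs)
  let ?k = "h ^ (2 * length bs)"
  have k: "?k \<in> R" using R h by (rule subalg_power)
  have "G (?k * (h * c)) (us @ (h * b) # bs) = G (?k * (h * c) * h) (us @ b # bs) + G (?k * (h * c) * b) (us @ h # bs)"
    using Cons.prems R h k by (intro alt_d_mult[OF G] subalg_mult) auto
  moreover have "?k * (h * c) * h = h ^ (2 * length (b # bs)) * c" "?k * (h * c) * b = ?k * (h * b * c)"
    by (simp_all add: mult_ac)
  ultimately show ?case using Cons.IH[of "h * c" "us @ [h * b]"] Cons.IH[of "h * b * c" "us @ [h]"] Cons.prems R h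
    by (simp add: subalg_mult)
qed simp

text \<open>The relations are only needed for entries in the set \<open>P\<close> of elements with denominator \<open>h\<close>, which is
  not a ring; this is why \<open>alt\<close> is defined for arbitrary sets. The two extra factors of \<open>h\<close> clear the coefficient,
  which in the product rule is a product of two elements of \<open>P\<close>.\<close>

lemma alt_clear_denominators:
  assumes P: "\<And>b. b \<in> P \<Longrightarrow> h * b \<in> R" "\<And>b b'. b \<in> P \<Longrightarrow> b' \<in> P \<Longrightarrow> h * (b * b') \<in> R"
  shows "alt P (\<lambda>a bs. clear h G bs (h * (h * a)) [])"
proof -
  have *: "h * (h * a) \<in> R" if "a \<in> P" for a using that P R h by (auto intro: subalg_mult)
  have C: "alt R (clear h G bs)" if "set bs \<subseteq> P" for bs using that P by (intro alt_clear[OF R h G]) auto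
  show ?thesis
    unfolding alt_def
  proof (intro conjI allI impI, goal_cases)
    case (1 a c bs)
    then show ?case using alt_scale[OF C *, of bs a "[]" c] by (simp add: mult.left_commute)
  next
    case (2 a a' bs)
    then show ?case using alt_add[OF C * *, of bs a a' "[]"] by (simp add: distrib_left)
  next
    case (3 a c us vs)
    then show ?case using P * by (intro clear_const) auto
  next
    case (4 a b b' us vs)
    then show ?case using P * by (intro clear_d_add) auto
  next
    case (5 a b b' us vs)
    have e: "h * (h * (a * b)) = h * b * (h * a)" "h * (h * (a * b')) = h * b' * (h * a)" by (auto simp: mult_ac)
    have "clear h G (us @ b * b' # vs) (h * (h * a)) [] = clear h G (us @ b' # vs) (h * b * (h * a)) [] + clear h G (us @ b # vs) (h * b' * (h * a)) []"
      using 5 P * by (intro clear_d_mult) auto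
    then show ?case by (simp only: e)
  next
    case (6 a b us vs ws)
    then show ?case using P * by (intro clear_alternating) auto
  qed
qed

end

text \<open>A relation over the localization \<open>Q\<close> is a finite combination of defining relations, so it is a relation
  over the elements with denominator \<open>f\<^sup>p\<close> for one fixed \<open>p\<close>. Replacing \<open>db\<close> by \<open>h d(h b) - h b dh\<close> with \<open>h = f\<^sup>2\<^sup>p\<close>
  maps it to a relation over \<open>R\<close>, and on symbols over \<open>R\<close> this replacement is multiplication by a power of \<open>h\<close>.\<close>

theorem null_clear_denominators:
  assumes R: "subalg R" and f: "f \<in> R" and Q: "\<And>b. b \<in> Q \<Longrightarrow> \<exists>p. f ^ p * b \<in> R"
    and v: "over R v" "eqv Q v []"
  shows "\<exists>N. eqv R (fmul (f ^ N) v) []"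
proof -
  define P where "P p = {b. f ^ p * b \<in> R}" for p
  have Pmono: "P p \<subseteq> P q" if "p \<le> q" for p q
  proof
    fix b assume "b \<in> P p"
    then have "f ^ (q - p) * (f ^ p * b) \<in> R" using R f by (auto simp: P_def intro: subalg_mult subalg_power)
    then show "b \<in> P q" using that by (simp add: P_def flip: mult.assoc power_add)
  qed
  have span_mono: "pm.span (form_relations \<iota> (P p)) \<subseteq> pm.span (form_relations \<iota> (P q))" if "p \<le> q" for p q
  proof
    fix x assume "x \<in> pm.span (form_relations \<iota> (P p))"
    then show "x \<in> pm.span (form_relations \<iota> (P q))"
      unfolding span_relations_iff using alt_subset[OF _ Pmono[OF that]] by blast
  qed
  have fin: "\<exists>p. set bs \<subseteq> P p" if "set bs \<subseteq> Q" for bs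
    using that
  proof (induction bs)
    case (Cons b bs)
    then obtain p q where "set bs \<subseteq> P p" "b \<in> P q" using Q[of b] by (auto simp: P_def)
    then show ?case using Pmono[of p "max p q"] Pmono[of q "max p q"] by (intro exI[of _ "max p q"]) auto
  qed auto
  have rel: "\<exists>p. r \<in> pm.span (form_relations \<iota> (P p))" if "r \<in> form_relations \<iota> Q" for r
    using that
  proof (cases rule: form_relations.cases)
    case (scale a bs c)
    then obtain p where "set (a # bs) \<subseteq> P p" using fin[of "a # bs"] by (auto simp: in_lists_conv_set)
    then show ?thesis using form_relations.scale[of a "P p" bs \<iota> c] scale(1) by (auto intro!: exI[of _ p] pm.span_base)
  next
    case (add a a' bs)
    then obtain p where "set (a # a' # bs) \<subseteq> P p" using fin[of "a # a' # bs"] by (auto simp: in_lists_conv_set)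
    then show ?thesis using form_relations.add[of a "P p" a' bs \<iota>] add(1) by (auto intro!: exI[of _ p] pm.span_base)
  next
    case (d_const a us vs c)
    then obtain p where "set (a # us @ vs) \<subseteq> P p" using fin[of "a # us @ vs"] by (auto simp: in_lists_conv_set)
    then show ?thesis using form_relations.d_const[of a "P p" us vs \<iota> c] d_const(1) by (auto intro!: exI[of _ p] pm.span_base)
  next
    case (d_add a b b' us vs)
    then obtain p where "set (a # b # b' # us @ vs) \<subseteq> P p" using fin[of "a # b # b' # us @ vs"] by (auto simp: in_lists_conv_set)
    then show ?thesis using form_relations.d_add[of a "P p" b b' us vs \<iota>] d_add(1) by (auto intro!: exI[of _ p] pm.span_base)
  next
    case (d_mult a b b' us vs)
    then obtain p where "set (a # b # b' # us @ vs) \<subseteq> P p" using fin[of "a # b # b' # us @ vs"] by (auto simp: in_lists_conv_set)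
    then show ?thesis using form_relations.d_mult[of a "P p" b b' us vs \<iota>] d_mult(1) by (auto intro!: exI[of _ p] pm.span_base)
  next
    case (alternating a b us vs ws)
    then obtain p where "set (a # b # us @ vs @ ws) \<subseteq> P p" using fin[of "a # b # us @ vs @ ws"] by (auto simp: in_lists_conv_set)
    then show ?thesis using form_relations.alternating[of a "P p" b us vs ws \<iota>] alternating(1) by (auto intro!: exI[of _ p] pm.span_base)
  qed
  have span: "\<exists>p. x \<in> pm.span (form_relations \<iota> (P p))" if "x \<in> pm.span (form_relations \<iota> Q)" for x
    using that
  proof (induction rule: pm.span_induct_alt)
    case base show ?case using pm.span_zero by blast
  next
    case (step c r y)
    obtain p q where pq: "r \<in> pm.span (form_relations \<iota> (P p))" "y \<in> pm.span (form_relations \<iota> (P q))"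
      using rel[OF step(1)] step(2) by auto
    then have "r \<in> pm.span (form_relations \<iota> (P (max p q)))" "y \<in> pm.span (form_relations \<iota> (P (max p q)))"
      using span_mono[of p "max p q"] span_mono[of q "max p q"] by auto
    then show ?case using pm.span_add pm.span_scale by blast
  qed
  have homog: "\<exists>N. eqv R (fmul (f ^ N) w) []" if w: "over R w" "homog k w" "eqv Q w []" for k w
  proof -
    obtain p where "to_poly w \<in> pm.span (form_relations \<iota> (P p))"
      using span w(3) unfolding eqv_Nil_iff_span by blast
    then have p: "eqv (P p) w []" by (simp add: eqv_Nil_iff_span)
    \<comment> \<open>With this exponent the product of two elements of denominator \<open>f\<^sup>p\<close> has denominator \<open>h\<close>.\<close>
    define h where "h = f ^ (2 * p)"
    have h: "h \<in> R" using R f by (auto simp: h_def intro: subalg_power)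
    have hP: "h * (b * b') \<in> R" if "b \<in> P p" "b' \<in> P p" for b b'
    proof -
      have e: "h = f ^ p * f ^ p" by (simp add: h_def power_add mult_2)
      have e2: "h * (b * b') = (f ^ p * b) * (f ^ p * b')" unfolding e by (simp only: mult_ac)
      show ?thesis unfolding e2 using that R by (auto simp: P_def intro: subalg_mult)
    qed
    have P1: "1 \<in> P p" using R f by (auto simp: P_def intro: subalg_power)
    have hP': "h * b \<in> R" if "b \<in> P p" for b using hP[OF that P1] by simp
    have "eqv R (fmul (h ^ (2 * k + 2)) w) []"
      unfolding eqv_def
    proof (intro allI impI)
      fix G assume G: "alt R G"
      have "0 = pair (\<lambda>a bs. clear h G bs (h * (h * a)) []) w"
        using p alt_clear_denominators[OF R h G hP' hP] by (simp add: eqv_def)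
      also have "\<dots> = pair (\<lambda>a bs. G (h ^ (2 * k + 2) * a) bs) w"
        using w(1,2)
      proof (induction w)
        case (Cons q w)
        obtain a bs where q: "q = (a, bs)" by force
        have "clear h G bs (h * (h * a)) [] = G (h ^ (2 * length bs) * (h * (h * a))) bs"
          using clear_over[OF R h G, of "h * (h * a)" "[]" bs] Cons.prems q R h by (simp add: subalg_mult)
        also have "h ^ (2 * length bs) * (h * (h * a)) = h ^ (2 * k + 2) * a" using Cons.prems q by (simp add: mult_ac)
        finally show ?case using Cons q by simp
      qed simp
      finally show "pair G (fmul (h ^ (2 * k + 2)) w) = pair G []" by (simp add: pair_fmul)
    qed
    then have "eqv R (fmul (f ^ (2 * p * (2 * k + 2))) w) []" unfolding h_def power_mult[symmetric] .
    then show ?thesis by blast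
  qed
  have "\<exists>N. eqv R (fmul (f ^ N) (part k v)) []" for k
  proof (rule homog)
    show "eqv Q (part k v) []" using eqv_part[OF v(2), of k] by (simp add: part_def)
    show "homog k (part k v)" by (rule homog_part)
  qed (simp add: over_part v)
  then obtain N where N: "\<And>k. eqv R (fmul (f ^ N k) (part k v)) []" by metis
  obtain M where M: "\<And>k. k \<ge> M \<Longrightarrow> part k v = []" using pair_parts by metis
  define L where "L = Max (insert 0 (N ` {..<M}))"
  have "eqv R (fmul (f ^ L) v) []"
  proof (rule eqv_by_parts)
    fix k
    have e: "part k (fmul (f ^ L) v) = fmul (f ^ L) (part k v)"
      by (induction v) (auto simp: part_def fmul_def)
    show "eqv R (part k (fmul (f ^ L) v)) (part k [])"
    proof (cases "k < M")
      case True
      then have "N k \<le> L" by (auto simp: L_def)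
      then have "fmul (f ^ L) (part k v) = fmul (f ^ (L - N k)) (fmul (f ^ N k) (part k v))"
        by (simp add: fmul_fmul flip: power_add)
      also have "eqv R \<dots> (fmul (f ^ (L - N k)) [])" using R f N by (intro eqv_fmul subalg_power)
      also have "fmul (f ^ (L - N k)) [] = part k []" by (simp add: fmul_def part_def)
      finally show ?thesis unfolding e .
    qed (use M e in \<open>simp add: part_def fmul_def\<close>)
  qed
  then show ?thesis by blast
qed

corollary torsion_free_local:
  assumes R: "subalg R" and F: "comaximal R F" "F \<subseteq> R"
    and Q: "\<And>f. f \<in> F \<Longrightarrow> torsion_free (Q f) \<and> R \<subseteq> Q f \<and> (\<forall>b\<in>Q f. \<exists>p. f ^ p * b \<in> R)"
  shows "torsion_free R"
  unfolding torsion_free_def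
proof (intro allI impI)
  fix v assume v: "over R v" "eqv UNIV v []"
  show "eqv R v []"
  proof (rule null_local[OF R F v(1)])
    fix f assume f: "f \<in> F"
    have "over (Q f) v" using over_mono[OF v(1)] Q[OF f] by simp
    then have "eqv (Q f) v []" using Q[OF f] v(2) by (simp add: torsion_free_def)
    then show "\<exists>N. eqv R (fmul (f ^ N) v) []"
      using Q[OF f] F(2) f by (intro null_clear_denominators[OF R _ _ v(1)]) auto
  qed
qed

corollary extends_local':
  assumes R: "subalg R" and F: "comaximal R F" "F \<subseteq> R" "0 \<notin> F"
    and Q: "\<And>f. f \<in> F \<Longrightarrow> subalg (Q f) \<and> R \<subseteq> Q f \<and> (\<forall>b\<in>Q f. \<exists>p. f ^ p * b \<in> R)"
    and v: "\<And>f. f \<in> F \<Longrightarrow> extends_to (Q f) v"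
  shows "extends_to R v"
proof (rule extends_local[OF R F(1,2)])
  fix f assume f: "f \<in> F"
  show "\<exists>N. extends_to R (fmul (f ^ N) v)"
    using extends_clear_denominators[OF R _ _ _ _ _ v[OF f]] Q[OF f] F f by blast
qed

end

section \<open>Derivations of a rational function field\<close>

text \<open>Independence of a family, in contrast to independence of its range, includes injectivity; so values can be
  prescribed at the indices.\<close>

lemma (in vector_space_pair) linear_extend_family:
  fixes v :: "'i \<Rightarrow> 'b" and f :: "'i \<Rightarrow> 'c"
  assumes indep: "\<And>T c j. finite T \<Longrightarrow> T \<subseteq> J \<Longrightarrow> (\<Sum>j\<in>T. s1 (c j) (v j)) = 0 \<Longrightarrow> j \<in> T \<Longrightarrow> c j = 0"
  shows "\<exists>g. Vector_Spaces.linear s1 s2 g \<and> (\<forall>j\<in>J. g (v j) = f j)"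
proof -
  have inj: "inj_on v J"
  proof (rule inj_onI, rule ccontr)
    fix i j assume ij: "i \<in> J" "j \<in> J" "v i = v j" "i \<noteq> j"
    then have "(\<Sum>l\<in>{i, j}. s1 (if l = i then 1 else - 1) (v l)) = 0"
      by (simp add: vs1.scale_minus_left)
    then have "(if i = i then 1 else - 1 :: 'a) = 0" using ij by (intro indep[of "{i, j}" _ i]) auto
    then show False by simp
  qed
  have "vs1.independent (v ` J)"
    unfolding vs1.independent_explicit_module
  proof (intro allI impI)
    fix t u x assume t: "finite t" "t \<subseteq> v ` J" "(\<Sum>w\<in>t. s1 (u w) w) = 0" "x \<in> t"
    define T where "T = J \<inter> v -` t"
    have vT: "v ` T = t" using t by (auto simp: T_def)
    have injT: "inj_on v T" using inj by (rule inj_on_subset) (auto simp: T_def)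
    have "finite T" using t(1) injT vT finite_imageD by blast
    moreover have "(\<Sum>j\<in>T. s1 (u (v j)) (v j)) = 0"
      using t(3) sum.reindex[OF injT, of "\<lambda>w. s1 (u w) w"] vT by (simp add: comp_def)
    moreover obtain j where "j \<in> T" "x = v j" using t(4) vT by auto
    ultimately show "u x = 0" using indep[of T "\<lambda>j. u (v j)" j] by (auto simp: T_def)
  qed
  then obtain g where g: "Vector_Spaces.linear s1 s2 g" "\<forall>x\<in>v ` J. g x = f (inv_into J v x)"
    using linear_independent_extend[of "v ` J" "\<lambda>x. f (inv_into J v x)"] by blast
  then show ?thesis using inj by (intro exI[of _ g]) simp
qed

context complex_field
begin

text \<open>The derivations are \<open>D\<^sub>i = x\<^sub>i \<partial>/\<partial>x\<^sub>i\<close>, the logarithmic vector fields of the torus with coordinates \<open>x\<close>. Contraction with them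
  maps standard forms to standard forms.\<close>

definition coords :: "nat \<Rightarrow> (nat \<Rightarrow> 'f) \<Rightarrow> (nat \<Rightarrow> 'f \<Rightarrow> 'f) \<Rightarrow> bool" where
  "coords r x D \<longleftrightarrow> (\<forall>i<r. derivation (D i)) \<and> (\<forall>i<r. \<forall>j<r. D i (x j) = (if i = j then x j else 0)) \<and>
    (\<forall>j<r. x j \<noteq> 0) \<and> generate_field class_ring (range \<iota> \<union> x ` {..<r}) = UNIV"

text \<open>A derivation of a ring of which the field is the field of fractions extends by the quotient rule.\<close>

lemma derivation_extend:
  assumes S: "subalg S" and frac: "\<And>z. \<exists>a\<in>S. \<exists>b\<in>S. b \<noteq> 0 \<and> z = a / b"
    and L: "\<And>c. L (\<iota> c) = 0" "\<And>a b. a \<in> S \<Longrightarrow> b \<in> S \<Longrightarrow> L (a + b) = L a + L b"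
      "\<And>a b. a \<in> S \<Longrightarrow> b \<in> S \<Longrightarrow> L (a * b) = a * L b + b * L a"
  shows "\<exists>D. derivation D \<and> (\<forall>a\<in>S. D a = L a)"
proof -
  obtain nm dn where nd: "\<And>z. nm z \<in> S" "\<And>z. dn z \<in> S" "\<And>z. dn z \<noteq> 0" "\<And>z. z = nm z / dn z"
    using frac by metis
  define D where "D z = (dn z * L (nm z) - nm z * L (dn z)) / (dn z)\<^sup>2" for z
  have D: "D (a / b) = (b * L a - a * L b) / b\<^sup>2" if ab: "a \<in> S" "b \<in> S" "b \<noteq> 0" for a b
  proof -
    define n d where "n = nm (a / b)" and "d = dn (a / b)"
    have 1: "n \<in> S" "d \<in> S" "d \<noteq> 0" "a / b = n / d" using nd by (auto simp: n_def d_def)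
    have e: "n * b = a * d" using 1 ab by (simp add: frac_eq_eq)
    have "L (n * b) = L (a * d)" by (simp add: e)
    then have "n * L b + b * L n = a * L d + d * L a" using L 1 ab by simp
    then have l: "b * L n = a * L d + d * L a - n * L b" by (simp add: algebra_simps)
    have "b\<^sup>2 * (d * L n - n * L d) = b * d * (b * L n) - b * (n * b) * L d" by (simp add: power2_eq_square algebra_simps)
    also have "\<dots> = b * d * (a * L d + d * L a - n * L b) - b * (a * d) * L d" by (simp only: l e)
    also have "\<dots> = b * d * d * L a - d * (n * b) * L b" by (simp add: algebra_simps)
    also have "\<dots> = b * d * d * L a - d * (a * d) * L b" by (simp only: e)
    also have "\<dots> = d\<^sup>2 * (b * L a - a * L b)" by (simp add: power2_eq_square algebra_simps)
    finally show ?thesis using 1 ab unfolding D_def n_def[symmetric] d_def[symmetric] by (simp add: frac_eq_eq mult.commute)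
  qed
  have DS: "D a = L a" if "a \<in> S" for a using D[of a 1] that S L(1)[of 1] by simp
  have "derivation D"
    unfolding derivation_def
  proof (intro conjI allI)
    fix c show "D (\<iota> c) = 0" using DS[of "\<iota> c"] S L by simp
  next
    fix z w
    define a b c e where "a = nm z" and "b = dn z" and "c = nm w" and "e = dn w"
    have z: "a \<in> S" "b \<in> S" "b \<noteq> 0" "z = a / b" and w: "c \<in> S" "e \<in> S" "e \<noteq> 0" "w = c / e"
      using nd by (auto simp: a_def b_def c_def e_def)
    have p: "a * e \<in> S" "c * b \<in> S" "b * e \<in> S" "a * c \<in> S" "a * e + c * b \<in> S" using z w S by (auto simp: subalg_mult subalg_add)
    have "z + w = (a * e + c * b) / (b * e)" using z w by (simp add: add_frac_eq)
    then have "D (z + w) = (b * e * L (a * e + c * b) - (a * e + c * b) * L (b * e)) / (b * e)\<^sup>2"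
      using D[of "a * e + c * b" "b * e"] p z w by simp
    also have "\<dots> = (e\<^sup>2 * (b * L a - a * L b) + b\<^sup>2 * (e * L c - c * L e)) / (b * e)\<^sup>2"
      using z w p by (simp add: L power2_eq_square algebra_simps)
    also have "\<dots> = (b * L a - a * L b) / b\<^sup>2 + (e * L c - c * L e) / e\<^sup>2"
      using z w by (simp add: add_frac_eq power_mult_distrib mult.commute)
    also have "\<dots> = D z + D w" using D z w by simp
    finally show "D (z + w) = D z + D w" .
    have "D (z * w) = (b * e * L (a * c) - (a * c) * L (b * e)) / (b * e)\<^sup>2"
      using D[of "a * c" "b * e"] p z w by simp
    also have "\<dots> = (a * b * (e * L c - c * L e) + c * e * (b * L a - a * L b)) / (b * e)\<^sup>2"
      using z w p by (simp add: L algebra_simps)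
    also have "\<dots> = (a / b) * ((e * L c - c * L e) / e\<^sup>2) + (c / e) * ((b * L a - a * L b) / b\<^sup>2)"
      using z w by (simp add: add_frac_eq power2_eq_square) (simp add: field_simps)
    also have "\<dots> = z * D w + w * D z" using D z w by simp
    finally show "D (z * w) = z * D w + w * D z" .
  qed
  then show ?thesis using DS by blast
qed

text \<open>By algebraic independence the monomials are a basis of the polynomial algebra, so a linear map can be
  prescribed on them: \<open>x\<^sup>\<mu>\<close> goes to \<open>\<mu>\<^sub>i x\<^sup>\<mu>\<close>. It is a derivation and extends to the field of fractions.\<close>

lemma coords_exist:
  assumes A: "alg_independent \<iota> r x" and K: "generate_field class_ring (range \<iota> \<union> x ` {..<r}) = UNIV"
  shows "\<exists>D. coords r x D"
proof -
  define M where "M = {\<mu> :: nat \<Rightarrow>\<^sub>0 nat. Poly_Mapping.keys \<mu> \<subseteq> {..<r}}"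
  define mon where "mon \<mu> = (\<Prod>i\<in>Poly_Mapping.keys \<mu>. x i ^ Poly_Mapping.lookup \<mu> i)" for \<mu>
  have mon': "mon \<mu> = (\<Prod>i<r. x i ^ Poly_Mapping.lookup \<mu> i)" if "\<mu> \<in> M" for \<mu>
    unfolding mon_def using that by (intro prod.mono_neutral_left) (auto simp: M_def in_keys_iff)
  have M_add: "\<mu> + \<nu> \<in> M" if "\<mu> \<in> M" "\<nu> \<in> M" for \<mu> \<nu>
    using that Poly_Mapping.keys_add[of \<mu> \<nu>] by (auto simp: M_def)
  have mon_add: "mon (\<mu> + \<nu>) = mon \<mu> * mon \<nu>" if "\<mu> \<in> M" "\<nu> \<in> M" for \<mu> \<nu>
    using that by (simp add: mon' M_add lookup_add power_add prod.distrib)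
  have indep: "c \<mu> = 0" if "finite T" "T \<subseteq> M" "(\<Sum>\<mu>\<in>T. \<iota> (c \<mu>) * mon \<mu>) = 0" "\<mu> \<in> T" for T c \<mu>
  proof -
    define p where "p = (\<Sum>\<mu>\<in>T. Poly_Mapping.single \<mu> (c \<mu>))"
    have lp: "Poly_Mapping.lookup p \<nu> = (if \<nu> \<in> T then c \<nu> else 0)" for \<nu>
    proof -
      have "Poly_Mapping.lookup (\<Sum>\<mu>\<in>T. Poly_Mapping.single \<mu> (c \<mu>)) \<nu> = (\<Sum>\<mu>\<in>T. if \<mu> = \<nu> then c \<nu> else 0)"
        unfolding lookup_sum by (intro sum.cong) (auto simp: lookup_single when_def)
      then show ?thesis using that(1) by (simp add: p_def)
    qed
    then have keys: "Poly_Mapping.keys p = {\<nu> \<in> T. c \<nu> \<noteq> 0}" by (auto simp: in_keys_iff split: if_splits)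
    have "mpoly_eval \<iota> x p = (\<Sum>\<nu>\<in>{\<nu> \<in> T. c \<nu> \<noteq> 0}. \<iota> (c \<nu>) * mon \<nu>)"
      unfolding mpoly_eval_def keys mon_def[symmetric] by (intro sum.cong) (auto simp: lp)
    also have "\<dots> = (\<Sum>\<nu>\<in>T. \<iota> (c \<nu>) * mon \<nu>)"
      using that(1) by (intro sum.mono_neutral_left) auto
    finally have "mpoly_eval \<iota> x p = 0" using that(3) by simp
    moreover have "\<forall>\<mu>\<in>Poly_Mapping.keys p. Poly_Mapping.keys \<mu> \<subseteq> {..<r}" using that(2) unfolding keys by (auto simp: M_def)
    ultimately have "p = 0" using A by (simp add: alg_independent_def)
    then show ?thesis using lp[of \<mu>] that(4) by simp
  qed
  interpret p: vector_space_pair "\<lambda>c (z::'f). \<iota> c * z" "\<lambda>c (z::'f). \<iota> c * z"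
    by (intro vector_space_pair.intro vector_space_iota)
  \<comment> \<open>The polynomial algebra, of which the field is the field of fractions.\<close>
  define S where "S = p.vs1.span (mon ` M)"
  have monS: "mon \<mu> \<in> S" if "\<mu> \<in> M" for \<mu> using that by (auto simp: S_def intro: p.vs1.span_base)
  have M0: "0 \<in> M" "mon 0 = 1" by (auto simp: M_def mon_def)
  have S_induct [consumes 1, case_names zero step]: "P a"
    if "a \<in> S" "P 0" "\<And>c \<mu> b. \<mu> \<in> M \<Longrightarrow> P b \<Longrightarrow> P (\<iota> c * mon \<mu> + b)" for P a
    using that(1) unfolding S_def
  proof (induction rule: p.vs1.span_induct_alt)
    case (step c z y)
    then show ?case using that(3) by auto
  qed (rule that(2))
  have S_add: "a + b \<in> S" if "a \<in> S" "b \<in> S" for a b using that by (auto simp: S_def intro: p.vs1.span_add)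
  have S_scale: "\<iota> c * a \<in> S" if "a \<in> S" for a c using that by (auto simp: S_def intro: p.vs1.span_scale)
  have S_mon: "mon \<mu> * b \<in> S" if "\<mu> \<in> M" "b \<in> S" for \<mu> b
    using that(2)
  proof (induction rule: S_induct)
    case zero show ?case by (simp add: S_def p.vs1.span_zero)
  next
    case (step c \<nu> b)
    have "mon \<mu> * (\<iota> c * mon \<nu> + b) = \<iota> c * mon (\<mu> + \<nu>) + mon \<mu> * b"
      using that step by (simp add: mon_add algebra_simps)
    then show ?case using step that by (simp add: S_add S_scale monS M_add)
  qed
  have S_mult: "a * b \<in> S" if "a \<in> S" "b \<in> S" for a b
    using that(1)
  proof (induction rule: S_induct)
    case zero show ?case by (simp add: S_def p.vs1.span_zero)
  next
    case (step c \<nu> a)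
    have "(\<iota> c * mon \<nu> + a) * b = \<iota> c * (mon \<nu> * b) + a * b" by (simp add: algebra_simps)
    then show ?case using step that by (simp add: S_add S_scale S_mon)
  qed
  have S: "subalg S"
    using S_scale[OF monS[OF M0(1)]] M0 S_add S_mult by (auto simp: subalg_def)
  have xmon: "mon (Poly_Mapping.single i 1) = x i" "Poly_Mapping.single i 1 \<in> M" if "i < r" for i
    using that by (auto simp: mon_def M_def)
  have frac: "\<exists>a\<in>S. \<exists>b\<in>S. b \<noteq> 0 \<and> z = a / b" for z
  proof (induction z rule: field_gen_induct[OF K])
    case (1 c) then show ?case using S by (intro bexI[of _ "\<iota> c"] bexI[of _ 1]) auto
  next
    case (2 h)
    then obtain i where "i < r" "h = x i" by auto
    then have "h \<in> S" using monS[OF xmon(2)] xmon(1) by auto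
    then show ?case using S by (intro bexI[of _ h] bexI[of _ 1]) auto
  next
    case (3 y z)
    then obtain a b c e where "a \<in> S" "b \<in> S" "b \<noteq> 0" "y = a / b" "c \<in> S" "e \<in> S" "e \<noteq> 0" "z = c / e" by metis
    then show ?case using S
      by (intro bexI[of _ "a * e + c * b"] bexI[of _ "b * e"]) (auto simp: add_frac_eq subalg_mult subalg_add)
  next
    case (4 y z)
    then obtain a b c e where "a \<in> S" "b \<in> S" "b \<noteq> 0" "y = a / b" "c \<in> S" "e \<in> S" "e \<noteq> 0" "z = c / e" by metis
    then show ?case using S
      by (intro bexI[of _ "a * c"] bexI[of _ "b * e"]) (auto simp: subalg_mult)
  next
    case (5 y)
    then obtain a b where "a \<in> S" "b \<in> S" "b \<noteq> 0" "y = a / b" by metis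
    then show ?case using 5 by (intro bexI[of _ b] bexI[of _ a]) auto
  qed
  have "\<exists>D. derivation D \<and> (\<forall>j<r. D (x j) = (if i = j then x j else 0))" for i
  proof -
    obtain L where L: "Vector_Spaces.linear (\<lambda>c (z::'f). \<iota> c * z) (\<lambda>c (z::'f). \<iota> c * z) L"
      "\<And>\<mu>. \<mu> \<in> M \<Longrightarrow> L (mon \<mu>) = of_nat (Poly_Mapping.lookup \<mu> i) * mon \<mu>"
      using p.linear_extend_family[of M mon "\<lambda>\<mu>. of_nat (Poly_Mapping.lookup \<mu> i) * mon \<mu>"] indep by blast
    interpret L: Vector_Spaces.linear "\<lambda>c (z::'f). \<iota> c * z" "\<lambda>c (z::'f). \<iota> c * z" L by (rule L(1))
    have Lmon: "L (mon \<mu> * b) = mon \<mu> * L b + b * L (mon \<mu>)" if "\<mu> \<in> M" "b \<in> S" for \<mu> b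
      using that(2)
    proof (induction rule: S_induct)
      case (step c \<nu> b)
      have "mon \<mu> * (\<iota> c * mon \<nu> + b) = \<iota> c * mon (\<mu> + \<nu>) + mon \<mu> * b"
        using that step by (simp add: mon_add algebra_simps)
      then have "L (mon \<mu> * (\<iota> c * mon \<nu> + b)) = \<iota> c * L (mon (\<mu> + \<nu>)) + L (mon \<mu> * b)" by (simp only: L.add L.scale)
      moreover have "L (mon (\<mu> + \<nu>)) = (of_nat (Poly_Mapping.lookup \<mu> i) + of_nat (Poly_Mapping.lookup \<nu> i)) * (mon \<mu> * mon \<nu>)"
        unfolding L(2)[OF M_add[OF that(1) step(1)]] using that step by (simp add: mon_add lookup_add)
      ultimately have "L (mon \<mu> * (\<iota> c * mon \<nu> + b)) = \<iota> c * ((of_nat (Poly_Mapping.lookup \<mu> i) + of_nat (Poly_Mapping.lookup \<nu> i)) * (mon \<mu> * mon \<nu>)) + (mon \<mu> * L b + b * L (mon \<mu>))"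
        using step by simp
      then show ?case using step that by (simp add: L.add L.scale L(2) algebra_simps)
    qed (simp add: L.zero)
    have "\<exists>D. derivation D \<and> (\<forall>a\<in>S. D a = L a)"
    proof (rule derivation_extend[OF S frac])
      fix c
      have "L (\<iota> c * mon 0) = \<iota> c * L (mon 0)" by (rule L.scale)
      then show "L (\<iota> c) = 0" using L(2)[OF M0(1)] M0(2) by simp
    next
      fix a b assume "a \<in> S" "b \<in> S"
      show "L (a + b) = L a + L b" by (rule L.add)
      show "L (a * b) = a * L b + b * L a" using \<open>a \<in> S\<close>
      proof (induction rule: S_induct)
        case (step c \<mu> a)
        have "(\<iota> c * mon \<mu> + a) * b = \<iota> c * (mon \<mu> * b) + a * b" by (simp add: algebra_simps)
        then have "L ((\<iota> c * mon \<mu> + a) * b) = \<iota> c * L (mon \<mu> * b) + L (a * b)" by (simp only: L.add L.scale)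
        then show ?case using step Lmon[OF step(1) \<open>b \<in> S\<close>] by (simp add: L.add L.scale algebra_simps)
      qed (simp add: L.zero)
    qed
    then obtain D where D: "derivation D" "\<forall>a\<in>S. D a = L a" by blast
    have "D (x j) = (if i = j then x j else 0)" if "j < r" for j
      using D(2) monS[OF xmon(2)[OF that]] xmon[OF that] L(2)[OF xmon(2)[OF that]] by (simp add: lookup_single when_def)
    then show ?thesis using D by blast
  qed
  then obtain D where D: "\<And>i. derivation (D i)" "\<And>i j. j < r \<Longrightarrow> D i (x j) = (if i = j then x j else 0)" by metis
  moreover have "x j \<noteq> 0" if "j < r" for j
  proof
    assume "x j = 0"
    then have "(\<Sum>\<mu>\<in>{Poly_Mapping.single j 1}. \<iota> 1 * mon \<mu>) = 0" using xmon[OF that] by simp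
    then have "(1::complex) = 0" using xmon[OF that] by (intro indep[of "{Poly_Mapping.single j 1}" "\<lambda>_. 1"]) auto
    then show False by simp
  qed
  ultimately show ?thesis using K by (intro exI[of _ D]) (auto simp: coords_def)
qed

end

section \<open>Independence of the columns of the exchange matrix\<close>

text \<open>Coefficients are rational because the rank in \<open>full_rank\<close> is taken over the rationals; the resulting dual weights are later used as
  complex numbers.\<close>

definition independent_columns :: "int mat \<Rightarrow> bool" where
  "independent_columns B \<longleftrightarrow> (\<forall>c :: nat \<Rightarrow> rat.
     (\<forall>i<dim_row B. (\<Sum>j<dim_col B. c j * of_int (B $$ (i, j))) = 0) \<longrightarrow> (\<forall>j<dim_col B. c j = 0))"

lemma full_rank_independent_columns:
  assumes "full_rank B" shows "independent_columns B"
proof -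
  define A where "A = map_mat rat_of_int B"
  let ?n = "dim_row B" and ?m = "dim_col B"
  have A: "A \<in> carrier_mat ?n ?m" by (simp add: A_def)
  interpret vec_space "TYPE(rat)" ?n .
  have rk: "rank A = ?m" using assms by (simp add: full_rank_def A_def)
  have "card (set (cols A)) \<ge> ?m"
  proof -
    \<comment> \<open>The rank counts independent elements of the set of columns, so full rank first of all says that the columns are distinct.\<close>
    obtain S where S: "maximal S (\<lambda>T. T \<subseteq> set (cols A) \<and> lin_indpt T)"
      using maximal_exists[of "(\<lambda>T. T \<subseteq> set (cols A) \<and> lin_indpt T)" "card (set (cols A))" "{}"]
      by (meson List.finite_set card_mono empty_iff empty_subsetI finite_lin_indpt2 rev_finite_subset)
    then have "rank A = card S" by (rule rank_card_indpt[OF A])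
    moreover have "card S \<le> card (set (cols A))" using S by (auto simp: maximal_def intro: card_mono)
    ultimately show ?thesis using rk by simp
  qed
  then have dist: "distinct (cols A)"
    using A card_length[of "cols A"] by (intro card_distinct) auto
  have li: "lin_indpt (set (cols A))" by (rule full_rank_lin_indpt[OF A rk dist])
  show ?thesis
    unfolding independent_columns_def
  proof (intro allI impI)
    fix c :: "nat \<Rightarrow> rat" and j
    assume c: "\<forall>i<?n. (\<Sum>j<?m. c j * of_int (B $$ (i, j))) = 0" and j: "j < ?m"
    define a where "a w = c (find_first w (cols A))" for w
    have a: "a (col A j) = c j" if "j < ?m" for j
      using find_first_unique[OF dist, of j] that A by (simp add: a_def)
    have "lincomb a (set (cols A)) = A *\<^sub>v (vec ?m (\<lambda>i. a (col A i)))"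
      by (rule mat_mult_eq_lincomb[OF A dist, symmetric])
    also have "\<dots> = 0\<^sub>v ?n"
    proof (rule eq_vecI)
      fix i assume "i < dim_vec (0\<^sub>v ?n)"
      then have i: "i < ?n" by simp
      have "(A *\<^sub>v vec ?m (\<lambda>i. a (col A i))) $ i = (\<Sum>j<?m. of_int (B $$ (i, j)) * a (col A j))"
        using i by (simp add: A_def scalar_prod_def atLeast0LessThan)
      also have "\<dots> = (\<Sum>j<?m. c j * of_int (B $$ (i, j)))"
        using a by (intro sum.cong) auto
      finally show "(A *\<^sub>v vec ?m (\<lambda>i. a (col A i))) $ i = 0\<^sub>v ?n $ i" using c i by simp
    qed (simp add: A_def)
    finally have z: "lincomb a (set (cols A)) = 0\<^sub>v ?n" .
    have "col A j \<in> set (cols A)" using j A by (auto simp: cols_def)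
    then have "a (col A j) = 0"
      using li z unfolding lin_dep_def by (metis List.finite_set Pi_I UNIV_I module_vec_simps(2) order_refl class_ring_simps(1))
    then show "c j = 0" using a j by simp
  qed
qed

text \<open>A linearly independent family has a dual family of functionals. Its role is to produce, for each mutable
  \<open>i\<close>, a grading of the torus in which \<open>y\<^sub>i\<close> has weight 1 and every other \<open>y\<^sub>j\<close> has weight 0.\<close>

lemma independent_columns_dual:
  assumes "independent_columns B"
  shows "\<exists>w :: nat \<Rightarrow> nat \<Rightarrow> rat. \<forall>i<dim_col B. \<forall>j<dim_col B. (\<Sum>g<dim_row B. w i g * of_int (B $$ (g, j))) = (if i = j then 1 else 0)"
proof -
  interpret p: vector_space_pair "pscale :: rat \<Rightarrow> (nat \<Rightarrow>\<^sub>0 rat) \<Rightarrow> (nat \<Rightarrow>\<^sub>0 rat)" "(*) :: rat \<Rightarrow> rat \<Rightarrow> rat"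
    by (intro vector_space_pair.intro; unfold_locales) (auto simp: algebra_simps)
  define v where "v j = (\<Sum>k<dim_row B. pscale (rat_of_int (B $$ (k, j))) (Poly_Mapping.single k 1))" for j
  have lookup_v: "Poly_Mapping.lookup (v j) i = of_int (B $$ (i, j))" if "i < dim_row B" for i j
  proof -
    have "Poly_Mapping.lookup (v j) i = (\<Sum>k<dim_row B. if k = i then of_int (B $$ (i, j)) else 0)"
      unfolding v_def lookup_sum by (intro sum.cong) (auto simp: lookup_single when_def)
    then show ?thesis using that by simp
  qed
  have indep: "c j = 0" if T: "finite T" "T \<subseteq> {..<dim_col B}" "(\<Sum>j\<in>T. pscale (c j) (v j)) = 0" "j \<in> T" for T and c :: "nat \<Rightarrow> rat" and j
  proof -
    define c' where "c' j = (if j \<in> T then c j else 0)" for j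
    have "(\<Sum>j<dim_col B. c' j * of_int (B $$ (i, j))) = 0" if "i < dim_row B" for i
    proof -
      have "(\<Sum>j<dim_col B. c' j * of_int (B $$ (i, j))) = (\<Sum>j\<in>T. c j * Poly_Mapping.lookup (v j) i)"
        using T(2) that by (intro sum.mono_neutral_cong_right) (auto simp: c'_def lookup_v)
      also have "\<dots> = Poly_Mapping.lookup (\<Sum>j\<in>T. pscale (c j) (v j)) i" by (simp add: lookup_sum)
      finally show ?thesis using T(3) by simp
    qed
    moreover have "j < dim_col B" using T by auto
    ultimately have "c' j = 0" using assms by (auto simp: independent_columns_def)
    then show ?thesis using T(4) by (simp add: c'_def)
  qed
  have "\<exists>w :: nat \<Rightarrow> rat. \<forall>j<dim_col B. (\<Sum>g<dim_row B. w g * of_int (B $$ (g, j))) = (if i = j then 1 else 0)" for i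
  proof -
    obtain g where g: "Vector_Spaces.linear pscale (*) g" "\<And>j. j < dim_col B \<Longrightarrow> g (v j) = (if i = j then 1 else (0::rat))"
      using p.linear_extend_family[of "{..<dim_col B}" v "\<lambda>j. if i = j then 1 else 0"] indep by blast
    interpret g: Vector_Spaces.linear pscale "(*)" g by (rule g(1))
    have "(\<Sum>k<dim_row B. g (Poly_Mapping.single k 1) * of_int (B $$ (k, j))) = g (v j)" for j
      by (simp only: v_def g.sum g.scale mult.commute)
    then show ?thesis using g(2) by (intro exI[of _ "\<lambda>k. g (Poly_Mapping.single k 1)"]) auto
  qed
  then show ?thesis by metis
qed

section \<open>Eigenvectors of derivations\<close>

context complex_field
begin

definition subspace :: "'f set \<Rightarrow> bool" where
  "subspace V \<longleftrightarrow> 0 \<in> V \<and> (\<forall>a\<in>V. \<forall>b\<in>V. a + b \<in> V) \<and> (\<forall>c. \<forall>a\<in>V. \<iota> c * a \<in> V)"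

lemma subspace_sum: "subspace V \<Longrightarrow> (\<And>i. i \<in> I \<Longrightarrow> f i \<in> V) \<Longrightarrow> sum f I \<in> V"
  by (induction I rule: infinite_finite_induct) (auto simp: subspace_def)

lemma subspace_diff: "subspace V \<Longrightarrow> a \<in> V \<Longrightarrow> b \<in> V \<Longrightarrow> a - b \<in> V"
proof -
  assume V: "subspace V" "a \<in> V" "b \<in> V"
  then have "a + \<iota> (-1) * b \<in> V" unfolding subspace_def by blast
  then show ?thesis by (simp add: hom_distribs)
qed

lemma subspace_subalg: "subalg R \<Longrightarrow> subspace R"
  unfolding subspace_def by (auto intro: subalg_add subalg_mult)

lemma subspace_zero: "subspace {0}"
  by (auto simp: subspace_def)

definition eigen :: "('f \<Rightarrow> 'f) \<Rightarrow> complex \<Rightarrow> 'f \<Rightarrow> bool" where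
  "eigen E c a \<longleftrightarrow> E a = \<iota> c * a"

lemma eigen_mult: "derivation E \<Longrightarrow> eigen E c a \<Longrightarrow> eigen E d b \<Longrightarrow> eigen E (c + d) (a * b)"
  unfolding eigen_def using der_mult[of E a b] by (simp add: hom_distribs algebra_simps)

lemma eigen_const: "derivation E \<Longrightarrow> eigen E 0 (\<iota> c)"
  unfolding eigen_def using der_const[of E c] by simp

lemma eigen_1: "derivation E \<Longrightarrow> eigen E 0 1"
  using eigen_const[of E 1] by simp

lemma eigen_inverse: "derivation E \<Longrightarrow> eigen E c a \<Longrightarrow> eigen E (- c) (inverse a)"
  unfolding eigen_def using der_inverse[of E a] by (cases "a = 0") (auto simp: hom_distribs power2_eq_square)

lemma eigen_divide: "derivation E \<Longrightarrow> eigen E c a \<Longrightarrow> eigen E d b \<Longrightarrow> eigen E (c - d) (a / b)"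
  using eigen_mult[of E c a "-d" "inverse b"] eigen_inverse[of E d b] by (simp add: divide_inverse)

lemma eigen_power: "derivation E \<Longrightarrow> eigen E c a \<Longrightarrow> eigen E (of_nat k * c) (a ^ k)"
proof (induction k)
  case (Suc k)
  then show ?case using eigen_mult[of E c a "of_nat k * c" "a ^ k"] by (simp add: distrib_right)
qed (simp add: eigen_1)

lemma eigen_power_int: "derivation E \<Longrightarrow> eigen E c a \<Longrightarrow> eigen E (of_int k * c) (a powi k)"
proof (cases "k \<ge> 0")
  case True
  assume "derivation E" "eigen E c a"
  then show ?thesis using eigen_power[of E c a "nat k"] True by (simp add: power_int_def of_nat_nat)
next
  case False
  assume "derivation E" "eigen E c a"
  then show ?thesis using eigen_power[of E "-c" "inverse a" "nat (-k)"] eigen_inverse[of E c a] False by (simp add: power_int_def of_nat_nat)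
qed

lemma eigen_prod: "derivation E \<Longrightarrow> (\<And>i. i \<in> I \<Longrightarrow> eigen E (c i) (a i)) \<Longrightarrow> eigen E (\<Sum>i\<in>I. c i) (\<Prod>i\<in>I. a i)"
  by (induction I rule: infinite_finite_induct) (auto simp: eigen_1 intro: eigen_mult)

lemma eigen_add: "derivation E \<Longrightarrow> eigen E c a \<Longrightarrow> eigen E c b \<Longrightarrow> eigen E c (a + b)"
  unfolding eigen_def using der_add[of E a b] by (simp add: distrib_left)

lemma eigen_zero: "derivation E \<Longrightarrow> eigen E c 0"
  unfolding eigen_def using der_0[of E] by simp

text \<open>Applying \<open>E - c\<^sub>k\<close> to a sum of eigenvectors removes one summand and multiplies the others by nonzero
  constants.\<close>

lemma eigen_components:
  assumes E: "derivation E" and V: "subspace V" and EV: "\<And>a. a \<in> V \<Longrightarrow> E a \<in> V"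
  shows "finite I \<Longrightarrow> inj_on c I \<Longrightarrow> (\<And>i. i \<in> I \<Longrightarrow> eigen E (c i) (f i)) \<Longrightarrow> sum f I \<in> V \<Longrightarrow> i \<in> I \<Longrightarrow> f i \<in> V"
proof (induction I arbitrary: f i rule: finite_induct)
  case (insert k I)
  have scale: "\<iota> c * a \<in> V" if "a \<in> V" for c a using V that by (auto simp: subspace_def)
  have eig: "E (f i) = \<iota> (c i) * f i" if "i \<in> insert k I" for i using insert.prems(2)[OF that] by (simp add: eigen_def)
  have "E (sum f (insert k I)) - \<iota> (c k) * sum f (insert k I) \<in> V"
    using insert.prems(3) EV scale V by (intro subspace_diff)
  also have "E (sum f (insert k I)) - \<iota> (c k) * sum f (insert k I) = (\<Sum>i\<in>I. \<iota> (c i - c k) * f i)"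
    using insert.hyps eig by (simp add: der_sum[OF E] der_add[OF E] sum_distrib_left distrib_left hom_distribs left_diff_distrib sum_subtractf)
  finally have 1: "(\<Sum>i\<in>I. \<iota> (c i - c k) * f i) \<in> V" .
  have 2: "f i \<in> V" if "i \<in> I" for i
  proof -
    have "\<iota> (c i - c k) * f i \<in> V"
    proof (rule insert.IH[OF _ _ 1 that])
      show "inj_on c I" using insert.prems by auto
      show "eigen E (c j) (\<iota> (c j - c k) * f j)" if "j \<in> I" for j
        using eigen_mult[OF E eigen_const[OF E] insert.prems(2)[of j]] that by simp
    qed
    then have "\<iota> (1 / (c i - c k)) * (\<iota> (c i - c k) * f i) \<in> V" by (rule scale)
    also have "\<iota> (1 / (c i - c k)) * (\<iota> (c i - c k) * f i) = \<iota> (1 / (c i - c k) * (c i - c k)) * f i"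
      by (simp only: hom_mult mult.assoc)
    also have "1 / (c i - c k) * (c i - c k) = 1"
      using insert.prems(1) insert.hyps(2) that by (auto simp: inj_on_def)
    finally show ?thesis by simp
  qed
  have "f k = sum f (insert k I) - sum f I" using insert.hyps by simp
  also have "\<dots> \<in> V" using insert.prems(3) subspace_sum[OF V 2] V by (intro subspace_diff)
  finally show ?case using insert.prems(4) 2 by auto
qed simp

lemma sum_list_group:
  "finite L \<Longrightarrow> snd ` set fs \<subseteq> L \<Longrightarrow> (\<Sum>(q, l)\<leftarrow>fs. q * X l) = (\<Sum>l\<in>L. (\<Sum>(q, k)\<leftarrow>fs. if k = l then q else 0) * (X l :: 'f))"
proof (induction fs)
  case (Cons p fs)
  obtain q k where p: "p = (q, k)" by force
  have "(\<Sum>l\<in>L. (\<Sum>(q, k)\<leftarrow>p # fs. if k = l then q else 0) * X l) = (\<Sum>l\<in>L. (if l = k then q * X k else 0) + (\<Sum>(q, k)\<leftarrow>fs. if k = l then q else 0) * X l)"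
    by (intro sum.cong) (auto simp: p distrib_right)
  also have "\<dots> = q * X k + (\<Sum>l\<in>L. (\<Sum>(q, k)\<leftarrow>fs. if k = l then q else 0) * X l)"
    using Cons.prems p by (simp add: sum.distrib)
  finally show ?case using Cons p by simp
qed simp

lemma sum_list_mult_pairs:
  "(\<Sum>(a, k)\<leftarrow>fs. u a k) * (\<Sum>(b, l)\<leftarrow>gs. v b l) = (\<Sum>(p, q)\<leftarrow>List.product fs gs. (case p of (a, k) \<Rightarrow> u a k) * (case q of (b, l) \<Rightarrow> (v b l :: 'f)))"
proof (induction fs)
  case (Cons p fs)
  then show ?case by (simp add: distrib_right sum_list_const_mult comp_def case_prod_beta)
qed simp

text \<open>Products of eigenvectors are eigenvectors, so eigenvectors span the algebra that they generate.\<close>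

lemma eigen_decomposition:
  assumes E: "derivation E" and H: "\<And>h. h \<in> H \<Longrightarrow> \<exists>c. eigen E c h" and f: "f \<in> subalgebra_gen \<iota> H"
  shows "\<exists>I g. finite I \<and> (\<forall>c. g c \<in> subalgebra_gen \<iota> H \<and> eigen E c (g c)) \<and> (\<forall>c. c \<notin> I \<longrightarrow> g c = 0) \<and> f = (\<Sum>c\<in>I. g c)"
proof -
  let ?R = "subalgebra_gen \<iota> H"
  have "\<exists>fs. (\<forall>(q, c)\<in>set fs. q \<in> ?R \<and> eigen E c q) \<and> f = (\<Sum>(q, c)\<leftarrow>fs. q)"
    using f
  proof (induction rule: gen_induct)
    case (const c)
    then show ?case by (intro exI[of _ "[(\<iota> c, 0)]"]) (simp add: eigen_const[OF E])
  next
    case (incl h)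
    then obtain c where "eigen E c h" using H by blast
    then show ?case using incl by (intro exI[of _ "[(h, c)]"]) (simp add: gen_incl)
  next
    case (add a b)
    then obtain fs gs where "(\<forall>(q, c)\<in>set fs. q \<in> ?R \<and> eigen E c q) \<and> a = (\<Sum>(q, c)\<leftarrow>fs. q)"
      "(\<forall>(q, c)\<in>set gs. q \<in> ?R \<and> eigen E c q) \<and> b = (\<Sum>(q, c)\<leftarrow>gs. q)" by blast
    then show ?case by (intro exI[of _ "fs @ gs"]) auto
  next
    case (mult a b)
    then obtain fs gs where fs: "\<forall>(q, c)\<in>set fs. q \<in> ?R \<and> eigen E c q" "a = (\<Sum>(q, c)\<leftarrow>fs. q)"
      and gs: "\<forall>(q, c)\<in>set gs. q \<in> ?R \<and> eigen E c q" "b = (\<Sum>(q, c)\<leftarrow>gs. q)" by blast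
    let ?hs = "map (\<lambda>((a, k), (b, l)). (a * b, k + l)) (List.product fs gs)"
    have "\<forall>(q, c)\<in>set ?hs. q \<in> ?R \<and> eigen E c q"
      using fs(1) gs(1) by (auto intro!: subalg_mult eigen_mult[OF E])
    moreover have "a * b = (\<Sum>(q, c)\<leftarrow>?hs. q)"
      unfolding fs gs sum_list_mult_pairs by (simp add: comp_def split_def)
    ultimately show ?case by blast
  qed
  then obtain fs where fs: "\<And>q c. (q, c) \<in> set fs \<Longrightarrow> q \<in> ?R \<and> eigen E c q" "f = (\<Sum>(q, c)\<leftarrow>fs. q)" by blast
  define g where "g l = (\<Sum>(q, k)\<leftarrow>fs. if k = l then q else 0)" for l
  have "f = (\<Sum>l\<in>snd ` set fs. g l)"
    using sum_list_group[of "snd ` set fs" fs "\<lambda>_. 1"] fs(2) by (simp add: g_def)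
  moreover have "(\<Sum>(q, k)\<leftarrow>gs. if k = l then q else 0) \<in> ?R \<and> eigen E l (\<Sum>(q, k)\<leftarrow>gs. if k = l then q else 0)"
    if "set gs \<subseteq> set fs" for gs l
    using that by (induction gs) (auto simp: eigen_zero[OF E] fs(1) intro!: subalg_add eigen_add[OF E])
  moreover have "(\<Sum>(q, k)\<leftarrow>gs. if k = l then q else 0) = 0" if "l \<notin> snd ` set gs" for gs l
    using that by (induction gs) auto
  ultimately show ?thesis by (intro exI[of _ "snd ` set fs"] exI[of _ g]) (auto simp: g_def)
qed

lemma laurent_expansion:
  assumes X: "X \<noteq> 0" and f: "f \<in> subalgebra_gen \<iota> (H \<union> {X, inverse X})"
  shows "\<exists>(L :: int set) q. finite L \<and> (\<forall>l. q l \<in> subalgebra_gen \<iota> H) \<and> (\<forall>l. l \<notin> L \<longrightarrow> q l = 0) \<and> f = (\<Sum>l\<in>L. q l * X powi l)"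
proof -
  let ?R = "subalgebra_gen \<iota> H"
  have "\<exists>fs :: ('f \<times> int) list. (\<forall>(q, l)\<in>set fs. q \<in> ?R) \<and> f = (\<Sum>(q, l)\<leftarrow>fs. q * X powi l)"
    using f
  proof (induction rule: gen_induct)
    case (const c)
    then show ?case by (intro exI[of _ "[(\<iota> c, 0)]"]) simp
  next
    case (incl h)
    then consider "h \<in> H" | "h = X" | "h = inverse X" by auto
    then show ?case
    proof cases
      case 1 then show ?thesis by (intro exI[of _ "[(h, 0)]"]) (simp add: gen_incl)
    next
      case 2 then show ?thesis by (intro exI[of _ "[(1, 1)]"]) simp
    next
      case 3 then show ?thesis by (intro exI[of _ "[(1, -1)]"]) (simp add: power_int_minus)
    qed
  next
    case (add a b)
    then obtain fs gs :: "('f \<times> int) list" where "(\<forall>(q, c)\<in>set fs. q \<in> ?R) \<and> a = (\<Sum>(q, c)\<leftarrow>fs. q * X powi c)"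
      "(\<forall>(q, c)\<in>set gs. q \<in> ?R) \<and> b = (\<Sum>(q, c)\<leftarrow>gs. q * X powi c)" by blast
    then show ?case by (intro exI[of _ "fs @ gs"]) auto
  next
    case (mult a b)
    then obtain fs gs :: "('f \<times> int) list" where fs: "\<forall>(q, c)\<in>set fs. q \<in> ?R" "a = (\<Sum>(q, c)\<leftarrow>fs. q * X powi c)"
      and gs: "\<forall>(q, c)\<in>set gs. q \<in> ?R" "b = (\<Sum>(q, c)\<leftarrow>gs. q * X powi c)" by blast
    let ?hs = "map (\<lambda>((a, k), (b, l)). (a * b, k + l)) (List.product fs gs)"
    have "\<forall>(q, c)\<in>set ?hs. q \<in> ?R"
      using fs(1) gs(1) by (auto intro!: subalg_mult)
    moreover have "a * b = (\<Sum>(q, c)\<leftarrow>?hs. q * X powi c)"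
      unfolding fs gs sum_list_mult_pairs using X by (simp add: comp_def split_def power_int_add mult_ac)
    ultimately show ?case by blast
  qed
  then obtain fs :: "('f \<times> int) list" where fs: "\<And>q c. (q, c) \<in> set fs \<Longrightarrow> q \<in> ?R" "f = (\<Sum>(q, c)\<leftarrow>fs. q * X powi c)" by blast
  define g where "g l = (\<Sum>(q, k)\<leftarrow>fs. if k = l then q else 0)" for l
  have "f = (\<Sum>l\<in>snd ` set fs. g l * X powi l)"
    using sum_list_group[of "snd ` set fs" fs "\<lambda>l. X powi l"] fs(2) by (simp add: g_def)
  moreover have "(\<Sum>(q, k)\<leftarrow>gs. if k = l then q else 0) \<in> ?R"
    if "set gs \<subseteq> set fs" for gs l
    using that by (induction gs) (auto simp: fs(1) intro!: subalg_add)
  moreover have "(\<Sum>(q, k)\<leftarrow>gs. if k = l then q else 0) = 0" if "l \<notin> snd ` set gs" for gs l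
    using that by (induction gs) auto
  ultimately show ?thesis by (intro exI[of _ "snd ` set fs"] exI[of _ g]) (auto simp: g_def)
qed

lemma eigen_laurent_term:
  assumes E: "derivation E" and EH: "\<And>h. h \<in> H \<Longrightarrow> E h = 0" and EX: "eigen E c X" and q: "q \<in> subalgebra_gen \<iota> H"
  shows "E q = 0" "eigen E (of_int l * c) (q * X powi l)"
proof -
  show Eq: "E q = 0" using q
  proof (induction rule: gen_induct)
    case (const c) show ?case by (rule der_const[OF E])
  next
    case (incl h) then show ?case by (rule EH)
  next
    case (add a b) then show ?case using der_add[OF E, of a b] by simp
  next
    case (mult a b) then show ?case using der_mult[OF E, of a b] by simp
  qed
  then have "eigen E 0 q" by (simp add: eigen_def)
  then show "eigen E (of_int l * c) (q * X powi l)" using eigen_mult[OF E _ eigen_power_int[OF E EX]] by fastforce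
qed

text \<open>The terms of the Laurent expansion in \<open>X\<close> are eigenvectors with distinct eigenvalues, so only the constant
  term of an element of the kernel survives.\<close>

lemma laurent_kernel:
  assumes E: "derivation E" and EH: "\<And>h. h \<in> H \<Longrightarrow> E h = 0" and EX: "eigen E c X" "c \<noteq> 0" "X \<noteq> 0"
    and f: "f \<in> subalgebra_gen \<iota> (H \<union> {X, inverse X})" "E f = 0"
  shows "f \<in> subalgebra_gen \<iota> H"
proof -
  obtain L :: "int set" and q where q: "finite L" "\<And>l. q l \<in> subalgebra_gen \<iota> H" "\<And>l. l \<notin> L \<Longrightarrow> q l = 0" "f = (\<Sum>l\<in>L. q l * X powi l)"
    using laurent_expansion[OF EX(3) f(1)] by blast
  let ?g = "\<lambda>l. q l * X powi l - (if l = 0 then f else 0)"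
  have s: "(\<Sum>l\<in>insert 0 L. q l * X powi l) = f"
    using q by (cases "0 \<in> L") (auto simp: insert_absorb)
  have "?g 0 \<in> {0}"
  proof (rule eigen_components[OF E subspace_zero, where I = "insert 0 L" and c = "\<lambda>l. of_int l * c" and f = ?g and i = 0])
    show "finite (insert 0 L)" using q by simp
    show "inj_on (\<lambda>l. of_int l * c) (insert 0 L)" using EX by (auto simp: inj_on_def)
    show "sum ?g (insert 0 L) \<in> {0}" using q(1) s by (simp only: sum_subtractf) simp
  next
    fix l
    have "eigen E (of_int l * c) (if l = 0 then f else 0)" using f(2) eigen_zero[OF E] by (auto simp: eigen_def)
    moreover have "eigen E (of_int l * c) (q l * X powi l)" by (rule eigen_laurent_term[OF E EH EX(1) q(2)])
    ultimately show "eigen E (of_int l * c) (?g l)"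
      unfolding eigen_def using der_diff[OF E, of "q l * X powi l" "if l = 0 then f else 0"] by (simp add: right_diff_distrib)
  qed (use der_0[OF E] in auto)
  then show ?thesis using q(2)[of 0] by simp
qed

text \<open>If \<open>u\<close> has weight 1 and \<open>v\<close> weight 0, then \<open>1 + u\<close> is a nonzerodivisor modulo \<open>1 + v\<close>:
  a component of lowest weight outside the ideal of \<open>1 + v\<close> cannot be cancelled.\<close>

lemma weight_coprime:
  assumes E: "derivation E" and H: "\<And>h. h \<in> H \<Longrightarrow> \<exists>c. eigen E c h"
    and u: "u \<in> subalgebra_gen \<iota> H" "eigen E 1 u" and v: "v \<in> subalgebra_gen \<iota> H" "eigen E 0 v"
    and h: "h \<in> subalgebra_gen \<iota> H" "(1 + u) * h \<in> (*) (1 + v) ` subalgebra_gen \<iota> H"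
  shows "h \<in> (*) (1 + v) ` subalgebra_gen \<iota> H"
proof -
  let ?R = "subalgebra_gen \<iota> H"
  let ?V = "(*) (1 + v) ` ?R"
  have V: "subspace ?V"
    unfolding subspace_def
  proof (intro conjI allI ballI)
    show "0 \<in> ?V" by (auto intro!: image_eqI[of _ _ 0])
    fix a b assume "a \<in> ?V" "b \<in> ?V"
    then obtain a' b' where "a = (1 + v) * a'" "b = (1 + v) * b'" "a' \<in> ?R" "b' \<in> ?R" by auto
    then show "a + b \<in> ?V" by (auto intro!: image_eqI[of _ _ "a' + b'"] subalg_add simp: distrib_left)
  next
    fix c a assume "a \<in> ?V"
    then obtain a' where "a = (1 + v) * a'" "a' \<in> ?R" by auto
    then show "\<iota> c * a \<in> ?V" by (auto intro!: image_eqI[of _ _ "\<iota> c * a'"] subalg_mult)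
  qed
  have EH: "E h \<in> ?R" if hH: "h \<in> H" for h
  proof -
    obtain c where "E h = \<iota> c * h" using H[OF hH] by (auto simp: eigen_def)
    then show ?thesis using gen_incl[OF hH] by (simp add: subalg_mult)
  qed
  have ER: "E b \<in> ?R" if "b \<in> ?R" for b
    by (rule der_gen_closed[OF E subalg_gen subset_refl EH that])
  have EV: "E a \<in> ?V" if aV: "a \<in> ?V" for a
  proof -
    obtain a' where a: "a = (1 + v) * a'" "a' \<in> ?R" using aV by auto
    have "E (1 + v) = 0" using v(2) der_add[OF E, of 1 v] der_1[OF E] by (simp add: eigen_def)
    then have "E a = (1 + v) * E a'" using a der_mult[OF E, of "1 + v" a'] by simp
    then show ?thesis using ER[OF a(2)] by auto
  qed
  have VR: "r * a \<in> ?V" if rR: "r \<in> ?R" and aV: "a \<in> ?V" for r a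
  proof -
    obtain a' where a: "a = (1 + v) * a'" "a' \<in> ?R" using aV by auto
    then show ?thesis using rR by (auto intro!: image_eqI[of _ _ "r * a'"] subalg_mult)
  qed
  obtain I g where g: "finite I" "\<And>c. g c \<in> ?R \<and> eigen E c (g c)" "\<And>c. c \<notin> I \<Longrightarrow> g c = 0" "h = (\<Sum>c\<in>I. g c)"
    using eigen_decomposition[OF E H h(1)] by blast
  have gV: "g c + u * g (c - 1) \<in> ?V" if "c \<in> I" for c
  proof (rule eigen_components[OF E V EV, where I = "I \<union> (\<lambda>c. c + 1) ` I" and c = "\<lambda>c. c" and f = "\<lambda>c. g c + u * g (c - 1)" and i = c])
    show "finite (I \<union> (\<lambda>c. c + 1) ` I)" using g by simp
    show "eigen E c (g c + u * g (c - 1))" for c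
      using eigen_mult[OF E u(2), of "c - 1" "g (c - 1)"] g(2) by (auto intro!: eigen_add[OF E])
    have "(\<Sum>c\<in>I \<union> (\<lambda>c. c + 1) ` I. g c + u * g (c - 1)) = (\<Sum>c\<in>I \<union> (\<lambda>c. c + 1) ` I. g c) + u * (\<Sum>c\<in>I \<union> (\<lambda>c. c + 1) ` I. g (c - 1))"
      by (simp add: sum.distrib sum_distrib_left)
    also have "(\<Sum>c\<in>I \<union> (\<lambda>c. c + 1) ` I. g c) = (\<Sum>c\<in>I. g c)"
      using g by (intro sum.mono_neutral_right) auto
    also have "(\<Sum>c\<in>I \<union> (\<lambda>c. c + 1) ` I. g (c - 1)) = (\<Sum>c\<in>(\<lambda>c. c + 1) ` I. g (c - 1))"
    proof (intro sum.mono_neutral_right)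
      show "\<forall>c\<in>I \<union> (\<lambda>c. c + 1) ` I - (\<lambda>c. c + 1) ` I. g (c - 1) = 0"
      proof
        fix c assume "c \<in> I \<union> (\<lambda>c. c + 1) ` I - (\<lambda>c. c + 1) ` I"
        then have "c - 1 \<notin> I" by (auto simp: image_iff)
        then show "g (c - 1) = 0" by (rule g(3))
      qed
    qed (use g in auto)
    also have "\<dots> = (\<Sum>c\<in>I. g c)" by (subst sum.reindex) (auto simp: inj_on_def)
    finally show "(\<Sum>c\<in>I \<union> (\<lambda>c. c + 1) ` I. g c + u * g (c - 1)) \<in> ?V"
      using h(2) g(4) by (simp add: distrib_right)
  qed (use that in auto)
  have "g c \<in> ?V" for c
  proof (rule ccontr)
    assume c: "g c \<notin> ?V"
    \<comment> \<open>Eigenvalues are complex; a component with minimal real part serves as the one of lowest weight.\<close>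
    let ?J = "{c \<in> I. g c \<notin> ?V}"
    have "c \<in> ?J" using c g(3)[of c] V by (auto simp: subspace_def)
    then have "finite ?J" "?J \<noteq> {}" using g by auto
    then have "Min (Re ` ?J) \<in> Re ` ?J" by (intro Min_in) auto
    then obtain d where d0: "d \<in> ?J" "Re d = Min (Re ` ?J)" by (metis (no_types, lifting) imageE)
    have d: "d \<in> ?J" "\<And>e. e \<in> ?J \<Longrightarrow> Re d \<le> Re e"
      using d0 \<open>finite ?J\<close> by (auto intro!: Min_le)
    have "g (d - 1) \<in> ?V"
    proof (rule ccontr)
      assume n: "g (d - 1) \<notin> ?V"
      then have "d - 1 \<in> ?J" using g(3)[of "d - 1"] V by (auto simp: subspace_def)
      then show False using d(2)[of "d - 1"] by simp
    qed
    then have "u * g (d - 1) \<in> ?V" by (rule VR[OF u(1)])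
    then have "(g d + u * g (d - 1)) - u * g (d - 1) \<in> ?V" using gV d(1) V by (intro subspace_diff) auto
    then show False using d(1) by simp
  qed
  then show ?thesis unfolding g(4) by (intro subspace_sum[OF V])
qed

end

section \<open>Seeds with log derivations\<close>

context complex_field
begin

lemma derivation_smult: "derivation E \<Longrightarrow> derivation (\<lambda>b. c * E b)"
  unfolding derivation_def by (auto simp: algebra_simps)

lemma derivation_add: "derivation E \<Longrightarrow> derivation F \<Longrightarrow> derivation (\<lambda>b. E b + F b)"
  unfolding derivation_def by (auto simp: algebra_simps)

lemma derivation_zero: "derivation (\<lambda>b. 0)"
  unfolding derivation_def by auto

lemma derivation_sum: "(\<And>i. i \<in> I \<Longrightarrow> derivation (E i)) \<Longrightarrow> derivation (\<lambda>b. \<Sum>i\<in>I. E i b)"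
  by (induction I rule: infinite_finite_induct) (auto simp: derivation_zero intro: derivation_add)

lemma derivation_diff: "derivation E \<Longrightarrow> derivation F \<Longrightarrow> derivation (\<lambda>b. E b - F b)"
  using derivation_add[of E "\<lambda>b. - 1 * F b"] derivation_smult[of F "- 1"] by simp

lemma subalg_prod_power:
  assumes "subalg R" "\<And>i. i \<in> I \<Longrightarrow> e i > 0 \<Longrightarrow> u i \<in> R" shows "(\<Prod>i\<in>I. u i ^ e i) \<in> R"
proof (rule subalg_prod[OF assms(1)])
  fix i assume "i \<in> I" then show "u i ^ e i \<in> R" using assms by (cases "e i > 0") (auto intro: subalg_power)
qed

lemma subalg_inverse_prod_power:
  assumes "subalg R" "\<And>i. i \<in> I \<Longrightarrow> e i > 0 \<Longrightarrow> inverse (u i) \<in> R" shows "inverse (\<Prod>i\<in>I. u i ^ e i) \<in> R"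
  using subalg_prod_power[of R I e "\<lambda>i. inverse (u i)"] assms by (simp add: power_inverse flip: prod_inversef[unfolded comp_def])

text \<open>The form \<open>dlog u = du / u\<close> turns products into sums. These are relations over any ring in which the factors are
  invertible.\<close>

lemma alt_dlog_mult:
  assumes R: "subalg R" and G: "alt R G" and c: "c \<in> R" "set vs \<subseteq> R"
    and u: "u \<in> R" "inverse u \<in> R" "u \<noteq> 0" "v \<in> R" "inverse v \<in> R" "v \<noteq> 0"
  shows "G (c * inverse (u * v)) (u * v # vs) = G (c * inverse u) (u # vs) + G (c * inverse v) (v # vs)"
proof -
  have "c * inverse (u * v) \<in> R" using assms by (auto intro!: subalg_mult simp: inverse_mult_distrib)
  then have *: "G (c * inverse (u * v)) (u * v # vs) = G (c * inverse (u * v) * u) (v # vs) + G (c * inverse (u * v) * v) (u # vs)"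
    using alt_d_mult[OF G, of "c * inverse (u * v)" u v "[]" vs] c u by simp
  have "c * inverse (u * v) * u = c * inverse v" "c * inverse (u * v) * v = c * inverse u"
    using u by (simp_all add: field_simps)
  then show ?thesis using * by (simp only: add.commute)
qed

lemma alt_dlog_1:
  assumes "subalg R" "alt R G" "c \<in> R" "set vs \<subseteq> R"
  shows "G c (1 # vs) = 0"
  using alt_const[OF assms(2,3), of "[]" vs 1] assms by simp

lemma alt_dlog_power:
  assumes R: "subalg R" and G: "alt R G" and c: "c \<in> R" "set vs \<subseteq> R" and u: "u \<in> R" "inverse u \<in> R" "u \<noteq> 0"
  shows "G (c * inverse (u ^ k)) (u ^ k # vs) = of_nat k * G (c * inverse u) (u # vs)"
proof (induction k)
  case 0 show ?case using alt_dlog_1[OF R G c] by simp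
next
  case (Suc k)
  have "u ^ k \<in> R" "inverse (u ^ k) \<in> R" using R u by (auto simp: subalg_power simp flip: power_inverse)
  then show ?case using alt_dlog_mult[OF R G c u, of "u ^ k"] u Suc by (simp add: distrib_right)
qed

lemma alt_dlog_prod:
  assumes R: "subalg R" and G: "alt R G" and c: "c \<in> R" "set vs \<subseteq> R" and I: "finite I"
    and u: "\<And>i. i \<in> I \<Longrightarrow> e i > 0 \<Longrightarrow> u i \<in> R \<and> inverse (u i) \<in> R" "\<And>i. i \<in> I \<Longrightarrow> u i \<noteq> 0"
  shows "G (c * inverse (\<Prod>i\<in>I. u i ^ e i)) ((\<Prod>i\<in>I. u i ^ e i) # vs) = (\<Sum>i\<in>I. of_nat (e i) * G (c * inverse (u i)) (u i # vs))"
  using I u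
proof (induction I rule: finite_induct)
  case empty then show ?case using alt_dlog_1[OF R G c] by simp
next
  case (insert i I)
  let ?p = "\<Prod>i\<in>I. u i ^ e i"
  have p: "?p \<in> R" "inverse ?p \<in> R" "?p \<noteq> 0"
    using insert by (auto intro!: subalg_prod_power[OF R] subalg_inverse_prod_power[OF R])
  have IH: "G (c * inverse ?p) (?p # vs) = (\<Sum>i\<in>I. of_nat (e i) * G (c * inverse (u i)) (u i # vs))"
    using insert by auto
  show ?case
  proof (cases "e i = 0")
    case True then show ?thesis using IH insert.hyps by simp
  next
    case False
    then have i: "u i \<in> R" "inverse (u i) \<in> R" "u i \<noteq> 0" using insert.prems by auto
    have "u i ^ e i \<in> R" "inverse (u i ^ e i) \<in> R" using R i by (auto simp: subalg_power simp flip: power_inverse)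
    then show ?thesis using alt_dlog_mult[OF R G c, of "u i ^ e i" ?p] p i insert.hyps IH alt_dlog_power[OF R G c i] by simp
  qed
qed

lemma alt_dlog_divide:
  assumes R: "subalg R" and G: "alt R G" and c: "c \<in> R" "set vs \<subseteq> R"
    and u: "u \<in> R" "inverse u \<in> R" "u \<noteq> 0" "v \<in> R" "inverse v \<in> R" "v \<noteq> 0"
  shows "G (c * inverse (u / v)) (u / v # vs) = G (c * inverse u) (u # vs) - G (c * inverse v) (v # vs)"
proof -
  have "u / v \<in> R" "inverse (u / v) \<in> R" using u R subalg_mult[of R u "inverse v"] subalg_mult[of R v "inverse u"] by (auto simp: divide_inverse mult.commute)
  then have "G (c * inverse (u / v * v)) (u / v * v # vs) = G (c * inverse (u / v)) (u / v # vs) + G (c * inverse v) (v # vs)"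
    using u by (intro alt_dlog_mult[OF R G c]) auto
  then show ?thesis using u by simp
qed

end

text \<open>The logarithmic vector fields \<open>D\<close> of the cluster are part of the locale; they express the algebraic independence
  of the cluster in the form in which the arguments use it.\<close>

locale seed = complex_field \<iota> for \<iota> :: "complex \<Rightarrow> 'f::field" +
  fixes n m :: nat and x :: "nat \<Rightarrow> 'f" and B :: "int mat" and D :: "nat \<Rightarrow> 'f \<Rightarrow> 'f"
  assumes B: "B \<in> carrier_mat (n + m) n" and skew: "i < n \<Longrightarrow> j < n \<Longrightarrow> B $$ (i, j) = - B $$ (j, i)"
    and independent: "independent_columns B" and coords: "coords (n + m) x D"
begin

abbreviation N :: nat where "N \<equiv> n + m"

text \<open>Here \<open>P k = pos k + neg k\<close> is the exchange polynomial, and the exchange relation reads \<open>x k * x' k = P k\<close>. The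
  element \<open>z k\<close> is \<open>x' k\<close> normalized such that \<open>x k * z k = 1 + y k\<close>. The rings \<open>Tor\<close> and \<open>Tor' k\<close> belong to the torus
  of the seed and its neighbor in direction \<open>k\<close>, and \<open>lower S\<close> is the lower bound of the cluster algebra in which only
  the directions in \<open>S\<close> are mutable.\<close>

definition pos :: "nat \<Rightarrow> 'f" where "pos k = (\<Prod>i<N. x i ^ nat (max (B $$ (i, k)) 0))"
definition neg :: "nat \<Rightarrow> 'f" where "neg k = (\<Prod>i<N. x i ^ nat (max (- B $$ (i, k)) 0))"
definition P :: "nat \<Rightarrow> 'f" where "P k = pos k + neg k"
definition y :: "nat \<Rightarrow> 'f" where "y k = pos k / neg k"
definition x' :: "nat \<Rightarrow> 'f" where "x' k = P k / x k"
definition z :: "nat \<Rightarrow> 'f" where "z k = x' k / neg k"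
definition Tor :: "'f set" where "Tor = torus_ring \<iota> (x, B)"
definition Tor' :: "nat \<Rightarrow> 'f set" where "Tor' k = torus_ring \<iota> (mutate k (x, B))"
definition lower :: "nat set \<Rightarrow> 'f set" where
  "lower S = subalgebra_gen \<iota> (x ` {..<N} \<union> {inverse (x g) |g. g < N \<and> g \<notin> S} \<union> x' ` S)"

lemma dims [simp]: "dim_row B = N" "dim_col B = n"
  using B by auto

lemma D: "i < N \<Longrightarrow> derivation (D i)" and D_x: "i < N \<Longrightarrow> j < N \<Longrightarrow> D i (x j) = (if i = j then x j else 0)"
  and x_nz: "j < N \<Longrightarrow> x j \<noteq> 0" and K: "generate_field class_ring (range \<iota> \<union> x ` {..<N}) = UNIV"
  using coords by (auto simp: coords_def)

lemma skew_diag: "i < n \<Longrightarrow> B $$ (i, i) = 0"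
  using skew[of i i] by simp

lemma mutate_seed: "mutate k (x, B) = (x(k := x' k), mutate_mat k B)"
  by (simp add: mutate_def x'_def P_def pos_def neg_def)

lemma pos_nz [simp]: "pos k \<noteq> 0" and neg_nz [simp]: "neg k \<noteq> 0"
  using x_nz by (auto simp: pos_def neg_def)

lemma y_nz [simp]: "y k \<noteq> 0" by (simp add: y_def)

lemma P_y: "P k = neg k * (1 + y k)" by (simp add: P_def y_def field_simps)

definition weighted :: "(nat \<Rightarrow> complex) \<Rightarrow> 'f \<Rightarrow> 'f" where
  "weighted w b = (\<Sum>g<N. \<iota> (w g) * D g b)"

lemma derivation_weighted: "derivation (weighted w)"
  unfolding weighted_def by (intro derivation_sum derivation_smult D) auto

lemma eigen_D: "i < N \<Longrightarrow> j < N \<Longrightarrow> eigen (D i) (if i = j then 1 else 0) (x j)"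
  by (auto simp: eigen_def D_x)

lemma eigen_weighted: assumes "i < N" shows "eigen (weighted w) (w i) (x i)"
proof -
  have "weighted w (x i) = (\<Sum>g<N. if g = i then \<iota> (w i) * x i else 0)"
    unfolding weighted_def using assms by (intro sum.cong) (auto simp: D_x)
  then show ?thesis using assms by (simp add: eigen_def)
qed

context
  fixes E c assumes E: "derivation E" and c: "\<And>i. i < N \<Longrightarrow> eigen E (c i) (x i)"
begin

lemma eigen_pos: "eigen E (\<Sum>i<N. of_nat (nat (max (B $$ (i, k)) 0)) * c i) (pos k)"
  and eigen_neg: "eigen E (\<Sum>i<N. of_nat (nat (max (- B $$ (i, k)) 0)) * c i) (neg k)"
  unfolding pos_def neg_def by (intro eigen_prod[OF E] eigen_power[OF E] c; simp)+

lemma eigen_y: "eigen E (\<Sum>i<N. of_int (B $$ (i, k)) * c i) (y k)"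
proof -
  have "(\<Sum>i<N. of_nat (nat (max (B $$ (i, k)) 0)) * c i) - (\<Sum>i<N. of_nat (nat (max (- B $$ (i, k)) 0)) * c i) = (\<Sum>i<N. of_int (B $$ (i, k)) * c i)"
    unfolding sum_subtractf[symmetric] by (intro sum.cong) (auto simp: max_def)
  then show ?thesis using eigen_divide[OF E eigen_pos[of k] eigen_neg[of k]] unfolding y_def by metis
qed

lemma eigen_P:
  assumes "(\<Sum>i<N. of_int (B $$ (i, k)) * c i) = 0"
  shows "eigen E (\<Sum>i<N. of_nat (nat (max (- B $$ (i, k)) 0)) * c i) (P k)"
proof -
  have "eigen E 0 (1 + y k)" using eigen_y[of k] assms by (auto intro: eigen_add[OF E] eigen_1[OF E])
  then show ?thesis using eigen_mult[OF E eigen_neg[of k], of 0 "1 + y k"] by (simp add: P_y)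
qed

lemma eigen_x':
  assumes "(\<Sum>i<N. of_int (B $$ (i, k)) * c i) = 0" "k < N"
  shows "\<exists>d. eigen E d (x' k)"
  using eigen_divide[OF E eigen_P[OF assms(1)] c[OF assms(2)]] by (auto simp: x'_def)

end

lemma sum_indicator: "i < N \<Longrightarrow> (\<Sum>j<N. f j * (if i = j then 1 else 0)) = (f i :: complex)"
proof -
  assume "i < N"
  moreover have "(\<Sum>j<N. f j * (if i = j then 1 else 0)) = (\<Sum>j<N. if j = i then f i else 0)" by (intro sum.cong) auto
  ultimately show ?thesis by simp
qed

lemma D_y: "i < N \<Longrightarrow> D i (y k) = \<iota> (of_int (B $$ (i, k))) * y k"
  using eigen_y[OF D eigen_D, of i k] by (simp only: eigen_def sum_indicator simp_thms)

lemma D_P0: assumes "i < N" "B $$ (i, k) = 0" shows "D i (P k) = 0"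
proof -
  have "(\<Sum>j<N. of_int (B $$ (j, k)) * (if i = j then 1 else 0)) = (0::complex)" using assms by (simp only: sum_indicator of_int_0)
  moreover have "(\<Sum>j<N. of_nat (nat (max (- B $$ (j, k)) 0)) * (if i = j then 1 else 0)) = (0::complex)" using assms by (simp only: sum_indicator) simp
  ultimately show ?thesis using eigen_P[OF D[OF assms(1)] eigen_D[OF assms(1)], of k] by (simp add: eigen_def)
qed

lemma D_x'0: assumes "i < N" "B $$ (i, k) = 0" "k < N" "i \<noteq> k" shows "D i (x' k) = 0"
proof -
  have "eigen (D i) 0 (P k)" using D_P0[OF assms(1,2)] by (simp add: eigen_def)
  then show ?thesis using eigen_divide[OF D[OF assms(1)], of 0 "P k" 0 "x k"] eigen_D[of i k] assms by (simp add: eigen_def x'_def)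
qed

lemma D_x'_same: assumes "i < n" shows "eigen (D i) (- 1) (x' i)"
proof -
  have "eigen (D i) 0 (P i)" using D_P0[of i i] assms skew_diag by (simp add: eigen_def)
  then show ?thesis using eigen_divide[OF D[of i], of 0 "P i" 1 "x i"] eigen_D[of i i] assms by (simp add: x'_def)
qed

lemma dual_weights: "\<exists>w :: nat \<Rightarrow> nat \<Rightarrow> complex. \<forall>i<n. \<forall>j<n. (\<Sum>g<N. of_int (B $$ (g, j)) * w i g) = (if i = j then 1 else 0)"
proof -
  obtain w :: "nat \<Rightarrow> nat \<Rightarrow> rat" where w: "\<forall>i<n. \<forall>j<n. (\<Sum>g<N. w i g * of_int (B $$ (g, j))) = (if i = j then 1 else 0)"
    using independent_columns_dual[OF independent] by auto
  have "(\<Sum>g<N. of_int (B $$ (g, j)) * (of_rat (w i g) :: complex)) = of_rat (\<Sum>g<N. w i g * of_int (B $$ (g, j)))" for i j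
    by (simp add: of_rat_sum of_rat_mult mult.commute)
  then show ?thesis using w by (intro exI[of _ "\<lambda>i g. of_rat (w i g)"]) simp
qed

definition dual :: "nat \<Rightarrow> nat \<Rightarrow> complex" where
  "dual = (SOME w. \<forall>i<n. \<forall>j<n. (\<Sum>g<N. of_int (B $$ (g, j)) * w i g) = (if i = j then 1 else 0))"

lemma dual: "i < n \<Longrightarrow> j < n \<Longrightarrow> (\<Sum>g<N. of_int (B $$ (g, j)) * dual i g) = (if i = j then 1 else 0)"
  using someI_ex[OF dual_weights] unfolding dual_def by blast

lemma eigen_dual_y: "i < n \<Longrightarrow> j < n \<Longrightarrow> eigen (weighted (dual i)) (if i = j then 1 else 0) (y j)"
  using eigen_y[OF derivation_weighted eigen_weighted, of "dual i" j] by (simp add: dual)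

text \<open>A weight that is 1 on \<open>y k\<close> exists by independence of the columns, whereas constants have weight 0.\<close>

lemma y_neq_const: assumes "k < n" shows "y k \<noteq> \<iota> c"
proof
  assume "y k = \<iota> c"
  then have "weighted (dual k) (y k) = 0" using der_const[OF derivation_weighted] by simp
  then show False using eigen_dual_y[OF assms assms] by (simp add: eigen_def)
qed

lemma one_plus_y: "k < n \<Longrightarrow> 1 + y k \<noteq> 0"
  using y_neq_const[of k "-1"] by (auto simp: add_eq_0_iff hom_distribs)

lemma P_nz: "k < n \<Longrightarrow> P k \<noteq> 0" and x'_nz: "k < n \<Longrightarrow> x' k \<noteq> 0"
  using one_plus_y x_nz by (auto simp: P_y x'_def)

lemma P_eq: "k < n \<Longrightarrow> P k = x k * x' k"
  using x_nz[of k] by (simp add: x'_def)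

subsection \<open>Generators\<close>

definition others :: "nat \<Rightarrow> 'f set" where
  "others j = x ` ({..<N} - {j}) \<union> (\<lambda>g. inverse (x g)) ` ({..<N} - {j})"

lemma Tor_gen: "Tor = subalgebra_gen \<iota> (x ` {..<N} \<union> (\<lambda>i. inverse (x i)) ` {..<N})"
  by (simp add: Tor_def torus_ring_def)

lemma Tor_lower: "Tor = lower {}"
proof -
  have "x ` {..<N} \<union> (\<lambda>i. inverse (x i)) ` {..<N} = x ` {..<N} \<union> {inverse (x g) |g. g < N \<and> g \<notin> {}} \<union> x' ` {}" by auto
  then show ?thesis unfolding Tor_gen lower_def by simp
qed

lemma Tor_others: "j < N \<Longrightarrow> Tor = subalgebra_gen \<iota> (others j \<union> {x j, inverse (x j)})"
proof -
  assume "j < N"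
  then have "x ` {..<N} \<union> (\<lambda>i. inverse (x i)) ` {..<N} = others j \<union> {x j, inverse (x j)}" by (auto simp: others_def)
  then show ?thesis unfolding Tor_gen by simp
qed

lemma Tor'_others: "j < N \<Longrightarrow> Tor' j = subalgebra_gen \<iota> (others j \<union> {x' j, inverse (x' j)})"
proof -
  assume j: "j < N"
  have "(x(j := x' j)) ` {..<N} \<union> (\<lambda>i. inverse ((x(j := x' j)) i)) ` {..<N} = others j \<union> {x' j, inverse (x' j)}"
    using j by (auto simp: others_def split: if_splits)
  moreover have "dim_row (mutate_mat j B) = N" by (simp add: mutate_mat_def)
  ultimately show ?thesis by (simp add: Tor'_def torus_ring_def mutate_seed)
qed

lemma subalg_Tor [simp]: "subalg Tor" and subalg_lower [simp]: "subalg (lower S)"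
  by (simp_all add: Tor_gen lower_def)

lemma subalg_Tor' [simp]: "subalg (Tor' j)"
  by (simp add: Tor'_def torus_ring_def)

lemma x_Tor: "g < N \<Longrightarrow> x g \<in> Tor" "g < N \<Longrightarrow> inverse (x g) \<in> Tor"
  unfolding Tor_gen by (auto intro: gen_incl)

lemma x_others: "g < N \<Longrightarrow> g \<noteq> j \<Longrightarrow> x g \<in> subalgebra_gen \<iota> (others j)"
  "g < N \<Longrightarrow> g \<noteq> j \<Longrightarrow> inverse (x g) \<in> subalgebra_gen \<iota> (others j)"
  by (auto intro!: gen_incl simp: others_def)

lemma gen_mono: "H \<subseteq> H' \<Longrightarrow> subalgebra_gen \<iota> H \<subseteq> subalgebra_gen \<iota> H'"
  by (rule gen_least) (auto intro: gen_incl)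

lemma others_Tor: "j < N \<Longrightarrow> subalgebra_gen \<iota> (others j) \<subseteq> Tor" "j < N \<Longrightarrow> subalgebra_gen \<iota> (others j) \<subseteq> Tor' j"
  using gen_mono[of "others j" "others j \<union> {x j, inverse (x j)}"] gen_mono[of "others j" "others j \<union> {x' j, inverse (x' j)}"]
    Tor_others[of j] Tor'_others[of j] by blast+

lemma x_Tor': "g < N \<Longrightarrow> g \<noteq> j \<Longrightarrow> j < N \<Longrightarrow> x g \<in> Tor' j" "g < N \<Longrightarrow> g \<noteq> j \<Longrightarrow> j < N \<Longrightarrow> inverse (x g) \<in> Tor' j"
  using x_others others_Tor by blast+

lemma x'_Tor': "j < N \<Longrightarrow> x' j \<in> Tor' j" "j < N \<Longrightarrow> inverse (x' j) \<in> Tor' j"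
  by (auto simp: Tor'_others intro: gen_incl)

lemma monomials_unit:
  assumes R: "subalg R" and u: "\<And>g. g < N \<Longrightarrow> B $$ (g, k) \<noteq> 0 \<Longrightarrow> x g \<in> R \<and> inverse (x g) \<in> R"
  shows "pos k \<in> R" "inverse (pos k) \<in> R" "neg k \<in> R" "inverse (neg k) \<in> R" "y k \<in> R" "inverse (y k) \<in> R" "P k \<in> R"
proof -
  have u': "nat (max (B $$ (i, k)) 0) > 0 \<Longrightarrow> B $$ (i, k) \<noteq> 0" "nat (max (- B $$ (i, k)) 0) > 0 \<Longrightarrow> B $$ (i, k) \<noteq> 0" for i by auto
  show 1: "pos k \<in> R" "inverse (pos k) \<in> R" "neg k \<in> R" "inverse (neg k) \<in> R"
    unfolding pos_def neg_def using u u' by (auto intro!: subalg_prod_power[OF R] subalg_inverse_prod_power[OF R])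
  show "y k \<in> R" "inverse (y k) \<in> R" "P k \<in> R"
    using subalg_mult[OF R 1(1,4)] subalg_mult[OF R 1(3,2)] subalg_add[OF R 1(1,3)] by (auto simp: y_def P_def divide_inverse mult.commute)
qed

lemma P_others: "j < n \<Longrightarrow> P j \<in> subalgebra_gen \<iota> (others j)"
  using skew_diag[of j] by (intro monomials_unit(7)) (auto intro!: x_others)

lemma der_gen_inverse_closed:
  assumes E: "derivation E" and R: "subalg R" and u: "E u \<in> R" "inverse u \<in> R" shows "E (inverse u) \<in> R"
  using assms by (auto simp: der_inverse[OF E] intro!: subalg_mult subalg_uminus subalg_power)

subsection \<open>The upper bound of an isolated seed\<close>

definition isolated :: "nat set \<Rightarrow> bool" where
  "isolated S \<longleftrightarrow> S \<subseteq> {..<n} \<and> (\<forall>i\<in>S. \<forall>j\<in>S. B $$ (i, j) = 0)"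

lemma Tor_clear_P:
  assumes j: "j < n" and f: "f \<in> Tor" shows "\<exists>M. f * P j ^ M \<in> Tor' j"
proof -
  have jN: "j < N" using j by simp
  have Pj: "P j \<in> Tor' j" using P_others[OF j] others_Tor(2)[OF jN] by blast
  have up: "f * P j ^ (M + L) \<in> Tor' j" if "f * P j ^ M \<in> Tor' j" for f M L
    using subalg_mult[OF subalg_Tor' that subalg_power[OF subalg_Tor' Pj, of L]] by (simp add: power_add mult.assoc)
  show ?thesis using f unfolding Tor_others[OF jN]
  proof (induction rule: gen_induct)
    case (const c) then show ?case by (intro exI[of _ 0]) simp
  next
    case (incl h)
    then consider "h \<in> others j" | "h = x j" | "h = inverse (x j)" by auto
    then show ?case
    proof cases
      case 1
      then have "h \<in> Tor' j" using gen_incl others_Tor(2)[OF jN] by blast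
      then show ?thesis by (intro exI[of _ 0]) simp
    next
      case 2
      have "x j = P j * inverse (x' j)" using P_eq[OF j] x'_nz[OF j] by simp
      then show ?thesis using 2 Pj x'_Tor'[OF jN] by (intro exI[of _ 0]) (auto intro: subalg_mult)
    next
      case 3
      have "inverse (x j) * P j = x' j" using x_nz[OF jN] P_eq[OF j] by simp
      then show ?thesis using 3 x'_Tor'[OF jN] by (intro exI[of _ 1]) simp
    qed
  next
    case (add a b)
    then obtain M L where nn: "a * P j ^ M \<in> Tor' j" "b * P j ^ L \<in> Tor' j" by auto
    then show ?case using up[OF nn(1), of L] up[OF nn(2), of M]
      by (intro exI[of _ "M + L"]) (simp add: distrib_right add.commute subalg_add)
  next
    case (mult a b)
    then obtain M L where nn: "a * P j ^ M \<in> Tor' j" "b * P j ^ L \<in> Tor' j" by auto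
    have e: "a * b * P j ^ (M + L) = (a * P j ^ M) * (b * P j ^ L)" by (simp only: power_add mult_ac)
    show ?case by (rule exI[of _ "M + L"], subst e, rule subalg_mult[OF subalg_Tor' nn])
  qed
qed

text \<open>The exchange polynomials of two unconnected vertices are coprime: the dual weight of \<open>i\<close> is 1 on \<open>y i\<close> and 0 on
  \<open>y j\<close>, so \<open>1 + y i\<close> is not a zero divisor modulo \<open>1 + y j\<close>. An element \<open>g\<close> of the torus ring has a power of \<open>P j\<close>
  as denominator in \<open>Tor' j\<close>, and coprimality cancels it once a power of \<open>P i\<close> times \<open>g\<close> has no denominator.\<close>

lemma exchange_coprime:
  assumes ij: "i < n" "j < n" "i \<noteq> j" "B $$ (i, j) = 0" and g: "g \<in> Tor" "g * P i ^ k \<in> Tor' j"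
  shows "g \<in> Tor' j"
proof -
  have jN: "j < N" and iN: "i < N" using ij by auto
  have ji: "B $$ (j, i) = 0" using skew[of j i] ij by simp
  let ?R = "Tor' j" and ?E = "weighted (dual i)" and ?H = "others j \<union> {x' j, inverse (x' j)}"
  let ?V = "(*) (1 + y j) ` ?R"
  have R: "?R = subalgebra_gen \<iota> ?H" by (rule Tor'_others[OF jN])
  have Ex': "\<exists>d. eigen ?E d (x' j)"
    using eigen_x'[OF derivation_weighted eigen_weighted, of j "dual i"] dual[OF ij(1,2)] ij by auto
  have H: "\<exists>c. eigen ?E c h" if h: "h \<in> ?H" for h
  proof -
    consider g where "g < N" "h = x g" | g where "g < N" "h = inverse (x g)" | "h = x' j" | "h = inverse (x' j)"
      using h by (auto simp: others_def)
    then show ?thesis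
      using Ex' eigen_weighted[of _ "dual i"] eigen_inverse[OF derivation_weighted, of "dual i"] by cases blast+
  qed
  have u: "y i \<in> ?R" "neg i \<in> ?R" "inverse (neg i) \<in> ?R" "y j \<in> ?R" "neg j \<in> ?R" "inverse (neg j) \<in> ?R" "P j \<in> ?R"
  proof -
    have "x g \<in> ?R \<and> inverse (x g) \<in> ?R" if "g < N" "B $$ (g, i) \<noteq> 0" for g
      using that ji x_Tor'[of g j] jN by (cases "g = j") auto
    then show "y i \<in> ?R" "neg i \<in> ?R" "inverse (neg i) \<in> ?R" by (simp_all add: monomials_unit[of ?R i])
    have "x g \<in> ?R \<and> inverse (x g) \<in> ?R" if "g < N" "B $$ (g, j) \<noteq> 0" for g
      using that skew_diag[of j] ij x_Tor'[of g j] jN by (cases "g = j") auto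
    then show "y j \<in> ?R" "neg j \<in> ?R" "inverse (neg j) \<in> ?R" "P j \<in> ?R" by (simp_all add: monomials_unit[of ?R j])
  qed
  have coprime: "h \<in> ?V" if h: "h \<in> ?R" "(1 + y i) * h \<in> ?V" for h
    using weight_coprime[where E = ?E and H = ?H and u = "y i" and v = "y j" and h = h, OF derivation_weighted H]
      eigen_dual_y[OF ij(1,1)] eigen_dual_y[OF ij(1,2)] h u(1,4) ij(3) unfolding R[symmetric] by simp
  have coprime1: "h \<in> ?V" if h: "h \<in> ?R" "(1 + y i) ^ k * h \<in> ?V" for h k
    using h
  proof (induction k arbitrary: h)
    case (Suc k)
    have 1: "(1 + y i) * h \<in> ?R" using Suc.prems(1) u by (simp add: subalg_mult subalg_add)
    have "(1 + y i) ^ k * ((1 + y i) * h) = (1 + y i) ^ Suc k * h" by simp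
    then have "(1 + y i) * h \<in> ?V" using Suc.IH[OF 1] Suc.prems(2) by metis
    then show ?case using coprime Suc.prems(1) by simp
  next
    case 0 then show ?case by (simp only: power_0 mult_1)
  qed
  have coprimeM: "\<exists>q\<in>?R. h = (1 + y j) ^ M * q" if "h \<in> ?R" "r \<in> ?R" "(1 + y i) ^ k * h = (1 + y j) ^ M * r" for h r k M
    using that
  proof (induction M arbitrary: h)
    case (Suc M)
    have "(1 + y i) ^ k * h = (1 + y j) * ((1 + y j) ^ M * r)" using Suc.prems by simp
    moreover have "(1 + y j) ^ M * r \<in> ?R" using Suc.prems(2) u by (simp add: subalg_mult subalg_power subalg_add)
    ultimately have "(1 + y i) ^ k * h \<in> ?V" by (rule image_eqI)
    then have "h \<in> ?V" by (rule coprime1[OF Suc.prems(1)])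
    then obtain h' where h': "h = (1 + y j) * h'" "h' \<in> ?R" by (rule imageE)
    have "(1 + y j) * ((1 + y i) ^ k * h') = (1 + y j) * ((1 + y j) ^ M * r)" using Suc.prems(3) h' by (simp add: mult_ac)
    then have "(1 + y i) ^ k * h' = (1 + y j) ^ M * r" using one_plus_y[OF ij(2)] by simp
    then obtain q where "q \<in> ?R" "h' = (1 + y j) ^ M * q" using Suc.IH[OF h'(2) Suc.prems(2)] by blast
    then show ?case using h' by (intro bexI[of _ q]) (simp_all add: mult.assoc)
  qed simp
  \<comment> \<open>Multiplying by \<open>1 + y j\<close> instead of \<open>P j\<close> changes the product by a unit only.\<close>
  obtain M where M: "g * P j ^ M \<in> ?R" using Tor_clear_P[OF ij(2) g(1)] by blast
  define h where "h = g * (1 + y j) ^ M"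
  have h: "h = g * P j ^ M * inverse (neg j) ^ M" by (simp add: h_def P_y power_mult_distrib power_inverse)
  define r where "r = g * (1 + y i) ^ k"
  have r: "r = g * P i ^ k * inverse (neg i) ^ k" by (simp add: r_def P_y power_mult_distrib power_inverse)
  have "h \<in> ?R" "r \<in> ?R" unfolding h r using M g u by (auto intro!: subalg_mult subalg_power)
  moreover have "(1 + y i) ^ k * h = (1 + y j) ^ M * r" by (simp add: h_def r_def mult_ac)
  ultimately obtain q where "q \<in> ?R" "h = (1 + y j) ^ M * q" using coprimeM by blast
  then have "g = q" using one_plus_y[OF ij(2)] by (simp add: h_def)
  then show ?thesis using \<open>q \<in> ?R\<close> by simp
qed

lemma lower_subset: "S \<subseteq> T \<Longrightarrow> T \<subseteq> {..<n} \<Longrightarrow> lower T \<subseteq> lower S"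
proof -
  assume ST: "S \<subseteq> T" "T \<subseteq> {..<n}"
  have x: "x g \<in> lower S" if "g < N" for g using that unfolding lower_def by (auto intro: gen_incl)
  have xi: "inverse (x g) \<in> lower S" if "g < N" "g \<notin> S" for g using that unfolding lower_def by (auto intro!: gen_incl)
  have P: "P i \<in> lower S" for i unfolding P_def pos_def neg_def
    using x by (auto intro!: subalg_add subalg_prod subalg_power)
  have "x' i \<in> lower S" if "i \<in> T" for i
  proof (cases "i \<in> S")
    case True then show ?thesis unfolding lower_def by (auto intro: gen_incl)
  next
    case False
    then show ?thesis using P[of i] xi[of i] that ST by (auto simp: x'_def divide_inverse intro!: subalg_mult)
  qed
  then show ?thesis using x xi ST unfolding lower_def[of T] by (intro gen_least) auto
qed

text \<open>Induction on \<open>S\<close>. The function is expanded in powers of \<open>x i\<close>. The rings are stable under \<open>D i\<close>, so they contain the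
  single terms \<open>q l * x i powi l\<close>, and the coefficients lie in the lower bound of \<open>insert i S\<close> by induction. For negative \<open>l\<close>, regularity on
  the neighbor in direction \<open>i\<close> makes \<open>q l\<close> divisible by \<open>P i ^ (- l)\<close> there, and the term is the quotient times a power of
  \<open>x' i\<close>; coprimality of the exchange polynomials keeps the quotient regular on the other neighbors.\<close>

theorem isolated_upper:
  assumes S: "isolated S" and f: "f \<in> Tor" "\<And>i. i \<in> S \<Longrightarrow> f \<in> Tor' i"
  shows "f \<in> lower S"
proof -
  have "finite S" using S finite_subset[of S "{..<n}"] by (auto simp: isolated_def)
  then show ?thesis using S f
  proof (induction S arbitrary: f rule: finite_induct)
    case empty then show ?case using Tor_lower by simp
  next
    case (insert i S)
    have i: "i < n" "i < N" "i \<notin> S" and S: "isolated S" "S \<subseteq> {..<n}" using insert by (auto simp: isolated_def)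
    have Bij: "B $$ (i, j) = 0" "j < n" "j < N" "i \<noteq> j" if "j \<in> S" for j using insert that by (auto simp: isolated_def)
    let ?E = "D i"
    have E: "derivation ?E" using i D by simp
    have Eothers: "?E h = 0" if h: "h \<in> others i" for h
    proof -
      obtain g where "g < N" "g \<noteq> i" "h = x g \<or> h = inverse (x g)" using h by (auto simp: others_def)
      then show ?thesis using D_x[OF i(2), of g] by (auto simp: der_inverse[OF E])
    qed
    have Ex: "eigen ?E 1 (x i)" using eigen_D[of i i] i by simp
    obtain L :: "int set" and q where q: "finite L" "\<And>l. q l \<in> subalgebra_gen \<iota> (others i)" "\<And>l. l \<notin> L \<Longrightarrow> q l = 0" "f = (\<Sum>l\<in>L. q l * x i powi l)"
      using laurent_expansion[of "x i" f "others i"] insert.prems(2) Tor_others[of i] x_nz i by metis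
    have trm: "eigen ?E (of_int l) (q l * x i powi l)" for l
      using eigen_laurent_term(2)[OF E Eothers Ex q(2)] by simp
    have Eq: "?E (q l) = 0" for l by (rule eigen_laurent_term(1)[OF E Eothers Ex q(2)])
    \<comment> \<open>The terms have distinct eigenvalues \<open>l\<close> under \<open>D i\<close>, so every stable ring containing \<open>f\<close> contains each term.\<close>
    have comp: "q l * x i powi l \<in> R" if R: "subalg R" and ER: "\<And>b. b \<in> R \<Longrightarrow> ?E b \<in> R" and fR: "f \<in> R" for R l
    proof (cases "l \<in> L")
      case True
      show ?thesis
        by (rule eigen_components[OF E subspace_subalg[OF R] ER, where I = L and c = of_int and f = "\<lambda>l. q l * x i powi l"])
          (use q trm fR True in \<open>auto simp: inj_on_def\<close>)
    qed (use q R in simp)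
    have qTor: "q l \<in> Tor" for l using q(2) others_Tor[OF i(2)] by blast
    have ETor': "?E b \<in> Tor' j" if j: "j \<in> insert i S" and b: "b \<in> Tor' j" for j b
    proof -
      have jn: "j < n" "j < N" using Bij j i by auto
      have E0: "\<exists>c. eigen ?E c h" if "h \<in> insert (x' j) (x ` ({..<N} - {j}))" for h
      proof -
        have "\<exists>c. eigen ?E c (x' j)"
          using D_x'0[OF i(2) Bij(1,3,4)] D_x'_same[OF i(1)] j by (cases "j = i") (auto simp: eigen_def intro: exI[of _ 0])
        then show ?thesis using that eigen_D[OF i(2)] by (auto; blast)
      qed
      have E1: "\<exists>c. eigen ?E c h" if "h \<in> others j \<union> {x' j, inverse (x' j)}" for h
        using that E0[of "x' j"] E0[of "x _"] eigen_inverse[OF E] by (auto simp: others_def; blast)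
      have "?E h \<in> Tor' j" if h: "h \<in> others j \<union> {x' j, inverse (x' j)}" for h
      proof -
        have "h \<in> Tor' j" using h unfolding Tor'_others[OF jn(2)] by (rule gen_incl)
        then show ?thesis using E1[OF h] by (auto simp: eigen_def subalg_mult)
      qed
      then show ?thesis using der_gen_closed[OF E subalg_Tor', of "others j \<union> {x' j, inverse (x' j)}" j b] b Tor'_others[OF jn(2)] by auto
    qed
    have xpow: "q l \<in> Tor' j" if "j \<in> S" for j l
    proof -
      have "q l * x i powi l * (x i powi (-l)) \<in> Tor' j"
      proof (rule subalg_mult[OF subalg_Tor'])
        show "q l * x i powi l \<in> Tor' j" using comp[OF subalg_Tor' ETor' insert.prems(3)] that by simp
        show "x i powi (- l) \<in> Tor' j" using x_Tor'[of i j] Bij[OF that] i subalg_power[OF subalg_Tor']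
          by (simp add: power_int_def)
      qed
      then show ?thesis using x_nz[OF i(2)] by (simp add: mult.assoc flip: power_int_add)
    qed
    let ?H = "x ` ({..<N} - {i}) \<union> {inverse (x g) |g. g < N \<and> g \<notin> insert i S} \<union> x' ` S"
    have EH: "?E h = 0" if h: "h \<in> ?H" for h
    proof -
      consider g where "g < N" "g \<noteq> i" "h = x g \<or> h = inverse (x g)" | j where "j \<in> S" "h = x' j"
        using h by auto
      then show ?thesis
      proof cases
        case 1 then show ?thesis using D_x[OF i(2), of g] by (auto simp: der_inverse[OF E])
      next
        case 2 then show ?thesis using D_x'0[OF i(2) Bij(1,3,4)] by simp
      qed
    qed
    have "x ` {..<N} \<union> {inverse (x g) |g. g < N \<and> g \<notin> S} \<union> x' ` S = ?H \<union> {x i, inverse (x i)}"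
      using i by auto
    then have lowerS: "lower S = subalgebra_gen \<iota> (?H \<union> {x i, inverse (x i)})" by (simp add: lower_def)
    \<comment> \<open>Over \<open>lower S\<close> the variable \<open>x i\<close> is invertible. Elements of weight 0 do not involve it, so they already lie in the smaller algebra.\<close>
    have kernel: "g \<in> lower (insert i S)" if g: "g \<in> lower S" "?E g = 0" for g
    proof -
      have "g \<in> subalgebra_gen \<iota> ?H"
        using laurent_kernel[where H = ?H and f = g, OF E EH Ex] g lowerS x_nz[OF i(2)] by simp
      moreover have "subalgebra_gen \<iota> ?H \<subseteq> lower (insert i S)" unfolding lower_def by (rule gen_mono) auto
      ultimately show ?thesis by blast
    qed
    have qlow: "q l \<in> lower (insert i S)" for l
      using insert.IH[of "q l", OF S(1) qTor xpow] Eq by (rule kernel)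
    have xl: "x i \<in> lower (insert i S)" "x' i \<in> lower (insert i S)" using i by (auto simp: lower_def intro!: gen_incl)
    have "q l * x i powi l \<in> lower (insert i S)" for l
    proof (cases "l \<ge> 0")
      case True
      then show ?thesis using qlow xl by (auto simp: power_int_def intro!: subalg_mult subalg_power)
    next
      case False
      define k where "k = nat (- l)"
      \<comment> \<open>As \<open>inverse (x i) = x' i / P i\<close>, the coefficient of the power of \<open>x' i\<close> in this term is \<open>q l / P i ^ k\<close>.\<close>
      define g where "g = q l * inverse (P i) ^ k"
      have e: "q l * x i powi l = g * x' i ^ k"
      proof -
        have "q l * x i powi l = q l * inverse (x i) ^ k" using False by (simp add: k_def power_int_def power_inverse)
        also have "inverse (x i) = inverse (P i) * x' i" using P_nz[OF i(1)] by (simp add: x'_def divide_inverse)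
        also have "q l * (inverse (P i) * x' i) ^ k = g * x' i ^ k" by (simp only: g_def power_mult_distrib mult.assoc)
        finally show ?thesis .
      qed
      have Eg: "?E g = 0"
      proof -
        have "eigen ?E 0 (P i)" using D_P0[OF i(2) skew_diag[OF i(1)]] by (simp add: eigen_def)
        then have "eigen ?E 0 (inverse (P i) ^ k)" using eigen_power[OF E eigen_inverse[OF E], of 0 "P i" k] by simp
        moreover have "eigen ?E 0 (q l)" using Eq by (simp add: eigen_def)
        ultimately have "eigen ?E 0 g" unfolding g_def using eigen_mult[OF E] by fastforce
        then show ?thesis by (simp add: eigen_def)
      qed
      have "g * x' i ^ k * inverse (x' i) ^ k \<in> Tor' i"
        using comp[OF subalg_Tor' ETor' insert.prems(3), of i l] e x'_Tor'[OF i(2)] by (auto intro!: subalg_mult subalg_power)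
      moreover have "g * x' i ^ k * inverse (x' i) ^ k = g" using x'_nz[OF i(1)] by (simp add: power_inverse)
      ultimately have "g \<in> Tor' i" by simp
      then have "g \<in> subalgebra_gen \<iota> (others i)"
        using laurent_kernel[where H = "others i" and f = g, OF E Eothers D_x'_same[OF i(1)]] Eg x'_nz[OF i(1)] Tor'_others[OF i(2)] by simp
      then have gTor: "g \<in> Tor" using others_Tor[OF i(2)] by blast
      have "g \<in> Tor' j" if j: "j \<in> S" for j
      proof (rule exchange_coprime[OF i(1) Bij(2)[OF j] Bij(4)[OF j] Bij(1)[OF j] gTor])
        show "g * P i ^ k \<in> Tor' j" using xpow[OF j, of l] P_nz[OF i(1)] by (simp add: g_def mult.assoc flip: power_mult_distrib)
      qed
      then have "g \<in> lower S" by (intro insert.IH S gTor)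
      then have "g \<in> lower (insert i S)" using Eg by (rule kernel)
      then show ?thesis unfolding e using xl by (intro subalg_mult subalg_power subalg_lower)
    qed
    then show ?case unfolding q(4) by (intro subalg_sum subalg_lower)
  qed
qed

end

section \<open>The frame of an isolated seed\<close>

context seed
begin

lemma x_lower: "g < N \<Longrightarrow> x g \<in> lower S" "g < N \<Longrightarrow> g \<notin> S \<Longrightarrow> inverse (x g) \<in> lower S" "i \<in> S \<Longrightarrow> x' i \<in> lower S"
  unfolding lower_def by (auto intro!: gen_incl)

lemma lower_Tor: "S \<subseteq> {..<n} \<Longrightarrow> lower S \<subseteq> Tor"
  using lower_subset[of "{}" S] Tor_lower by simp

lemma lower_Tor': assumes "S \<subseteq> {..<n}" "j \<in> S" shows "lower S \<subseteq> Tor' j"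
proof -
  have j: "j < n" "j < N" using assms by auto
  have x: "x g \<in> Tor' j" if "g < N" for g
  proof (cases "g = j")
    case True
    have "x j = P j * inverse (x' j)" using P_eq[OF j(1)] x'_nz[OF j(1)] by simp
    then show ?thesis using True x'_Tor'[OF j(2)] P_others[OF j(1)] others_Tor(2)[OF j(2)] by (auto intro!: subalg_mult)
  qed (use x_Tor' that j in auto)
  have "inverse (x g) \<in> Tor' j" if "g < N" "g \<notin> S" for g using x_Tor'[of g j] that assms j by auto
  moreover have "x' i \<in> Tor' j" if "i \<in> S" for i
  proof (cases "i = j")
    case False
    have i: "i < n" "i < N" using that assms by auto
    have "P i \<in> Tor' j"
      unfolding P_def pos_def neg_def using x by (auto intro!: subalg_add subalg_prod subalg_power)
    then show ?thesis using x_Tor'[of i j] False i j by (auto simp: x'_def divide_inverse intro!: subalg_mult)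
  qed (use x'_Tor' j in auto)
  ultimately show ?thesis unfolding lower_def using x by (intro gen_least) auto
qed

context
  fixes S assumes S: "isolated S"
begin

lemma S_n: "i \<in> S \<Longrightarrow> i < n" "i \<in> S \<Longrightarrow> i < N" "i \<in> S \<Longrightarrow> j \<in> S \<Longrightarrow> B $$ (i, j) = 0" and finite_S: "finite S"
  using S finite_subset[of S "{..<n}"] by (auto simp: isolated_def)

text \<open>The weights dual to the columns in \<open>S\<close>, modified to vanish on \<open>S\<close>. Since the entries of an isolated seed inside \<open>S\<close> are 0,
  they are still dual to these columns, and now \<open>DS i\<close> kills all \<open>x l\<close> with \<open>l \<in> S\<close>.\<close>

definition dualS :: "nat \<Rightarrow> nat \<Rightarrow> complex" where "dualS i g = (if g \<in> S then 0 else dual i g)"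
definition DS :: "nat \<Rightarrow> 'f \<Rightarrow> 'f" where "DS i = weighted (dualS i)"

lemma derivation_DS: "derivation (DS i)" unfolding DS_def by (rule derivation_weighted)

lemma DS_x: "g < N \<Longrightarrow> DS i (x g) = (if g \<in> S then 0 else \<iota> (dual i g) * x g)"
  using eigen_weighted[of g "dualS i"] by (simp add: DS_def eigen_def dualS_def)

lemma DS_y: assumes "i \<in> S" "l \<in> S" shows "DS i (y l) = (if i = l then y l else 0)"
proof -
  have "(\<Sum>g<N. of_int (B $$ (g, l)) * dualS i g) = (\<Sum>g<N. of_int (B $$ (g, l)) * dual i g)"
    using S_n(3)[OF _ assms(2)] by (intro sum.cong) (auto simp: dualS_def)
  then show ?thesis using eigen_y[OF derivation_weighted eigen_weighted, of "dualS i" l] dual[OF S_n(1) S_n(1), OF assms]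
    by (simp add: DS_def eigen_def)
qed

lemma xz: "l \<in> S \<Longrightarrow> x l * z l = 1 + y l"
  using x_nz[OF S_n(2)] by (simp add: z_def x'_def P_y)

lemma der_z:
  assumes "l \<in> S" and E: "derivation E" shows "x l * E (z l) = E (y l) - z l * E (x l)"
proof -
  have "E (x l * z l) = x l * E (z l) + z l * E (x l)" by (rule der_mult[OF E])
  moreover have "E (x l * z l) = E (y l)" using xz[OF assms(1)] der_add[OF E, of 1 "y l"] der_1[OF E] by simp
  ultimately show ?thesis by (simp add: algebra_simps)
qed

lemma DS_z: assumes "i \<in> S" "l \<in> S" shows "DS i (z l) = (if i = l then y l / x l else 0)"
  using der_z[OF assms(2) derivation_DS, of i] DS_y[OF assms] DS_x[OF S_n(2)[OF assms(2)], of i] assms x_nz[OF S_n(2)[OF assms(2)]]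
  by (auto simp: field_simps)

lemma D_z: assumes "g < N" "l \<in> S" shows "D g (z l) = (if g = l then - z l else \<iota> (of_int (B $$ (g, l))) * y l / x l)"
proof -
  have "x l * D g (z l) = \<iota> (of_int (B $$ (g, l))) * y l - z l * (if g = l then x l else 0)"
    using der_z[OF assms(2) D[OF assms(1)]] D_y[OF assms(1)] D_x[OF assms(1) S_n(2)[OF assms(2)]] by simp
  also have "\<dots> = x l * (if g = l then - z l else \<iota> (of_int (B $$ (g, l))) * y l / x l)"
    using x_nz[OF S_n(2)[OF assms(2)]] S_n(3)[OF assms(2,2)] by auto
  finally show ?thesis using x_nz[OF S_n(2)[OF assms(2)]] by (simp only: mult_left_cancel not_False_eq_True)
qed

text \<open>The lower bound of an isolated seed is cut out by the equations \<open>x i * z i = 1 + y i\<close>, and has as coordinates all \<open>x g\<close>, and the \<open>z i\<close> for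
  \<open>i \<in> S\<close>. These are more functions than the dimension, but the differentials are generated by them, and
  \<open>y i\<close> can be moved freely in the torus of frozen variables by \<open>DS i\<close>. The derivation \<open>E1 i\<close> moves \<open>x i\<close> with fixed \<open>z i\<close>
  and \<open>E2 i\<close> moves \<open>z i\<close> with fixed \<open>x i\<close>, both adjusting \<open>y i\<close> accordingly; \<open>E3 g\<close> moves the frozen \<open>x g\<close>, corrected such that all
  \<open>y i\<close> are constant.\<close>

definition E1 :: "nat \<Rightarrow> 'f \<Rightarrow> 'f" where "E1 i b = inverse (x i) * D i b + z i / y i * DS i b"
definition E2 :: "nat \<Rightarrow> 'f \<Rightarrow> 'f" where "E2 i b = x i / y i * DS i b"
definition E3 :: "nat \<Rightarrow> 'f \<Rightarrow> 'f" where "E3 g b = inverse (x g) * (D g b - (\<Sum>i\<in>S. \<iota> (of_int (B $$ (g, i))) * DS i b))"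

lemma derivation_E: "i \<in> S \<Longrightarrow> derivation (E1 i)" "derivation (E2 i)" "g < N \<Longrightarrow> derivation (E3 g)"
proof -
  show "derivation (E1 i)" if "i \<in> S"
    unfolding E1_def by (intro derivation_add derivation_smult derivation_DS D S_n(2) that)
  show "derivation (E2 i)" unfolding E2_def by (intro derivation_smult derivation_DS)
  show "derivation (E3 g)" if "g < N"
    unfolding E3_def by (intro derivation_smult derivation_diff derivation_sum derivation_DS D that)
qed

lemma E1_values: assumes "i \<in> S"
  shows "l \<in> S \<Longrightarrow> E1 i (x l) = (if i = l then 1 else 0)"
    "h < N \<Longrightarrow> h \<notin> S \<Longrightarrow> E1 i (x h) = z i / y i * (\<iota> (dual i h) * x h)" "l \<in> S \<Longrightarrow> E1 i (z l) = 0"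
proof -
  show "E1 i (x l) = (if i = l then 1 else 0)" if "l \<in> S"
    using that assms S_n x_nz by (simp add: E1_def D_x DS_x)
  show "E1 i (x h) = z i / y i * (\<iota> (dual i h) * x h)" if "h < N" "h \<notin> S"
    using that assms S_n(2)[OF assms] by (auto simp: E1_def D_x DS_x)
  show "E1 i (z l) = 0" if "l \<in> S"
    using that assms S_n(2)[OF assms] S_n(3)[OF assms that] x_nz[OF S_n(2)[OF assms]] by (auto simp: E1_def D_z DS_z field_simps)
qed

lemma E2_values: assumes "i \<in> S"
  shows "l \<in> S \<Longrightarrow> E2 i (x l) = 0"
    "h < N \<Longrightarrow> h \<notin> S \<Longrightarrow> E2 i (x h) = x i / y i * (\<iota> (dual i h) * x h)" "l \<in> S \<Longrightarrow> E2 i (z l) = (if i = l then 1 else 0)"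
  using assms S_n(2)[OF assms] x_nz[OF S_n(2)[OF assms]] by (auto simp: E2_def DS_x DS_z S_n)

lemma E3_values: assumes "g < N" "g \<notin> S"
  shows "l \<in> S \<Longrightarrow> E3 g (x l) = 0"
    "h < N \<Longrightarrow> h \<notin> S \<Longrightarrow> E3 g (x h) = inverse (x g) * ((if g = h then x h else 0) - (\<Sum>i\<in>S. \<iota> (of_int (B $$ (g, i))) * (\<iota> (dual i h) * x h)))"
    "l \<in> S \<Longrightarrow> E3 g (z l) = 0"
proof -
  show "E3 g (x l) = 0" if "l \<in> S" using that assms S_n by (auto simp: E3_def D_x DS_x)
  show "E3 g (x h) = inverse (x g) * ((if g = h then x h else 0) - (\<Sum>i\<in>S. \<iota> (of_int (B $$ (g, i))) * (\<iota> (dual i h) * x h)))" if "h < N" "h \<notin> S"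
    using that assms by (simp add: E3_def D_x DS_x)
  show "E3 g (z l) = 0" if l: "l \<in> S"
  proof -
    have "(\<Sum>i\<in>S. \<iota> (of_int (B $$ (g, i))) * DS i (z l)) = (\<Sum>i\<in>S. if i = l then \<iota> (of_int (B $$ (g, l))) * (y l / x l) else 0)"
      using l by (intro sum.cong) (auto simp: DS_z)
    then show ?thesis using l assms finite_S by (auto simp: E3_def D_z)
  qed
qed

definition FS :: "(('f \<Rightarrow> 'f) \<times> 'f) list" where
  "FS = map (\<lambda>i. (E1 i, x i)) (sorted_list_of_set S) @ map (\<lambda>i. (E2 i, z i)) (sorted_list_of_set S) @
     map (\<lambda>g. (E3 g, x g)) (sorted_list_of_set ({..<N} - S))"

lemma sum_FS: "(\<Sum>(E, \<beta>)\<leftarrow>FS. f E \<beta>) = (\<Sum>i\<in>S. f (E1 i) (x i)) + (\<Sum>i\<in>S. f (E2 i) (z i)) + (\<Sum>g\<in>{..<N} - S. f (E3 g) (x g) :: complex)"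
  using finite_S by (simp add: FS_def comp_def sum_list_distinct_conv_sum_set add.assoc)

lemma set_FS: "(E, \<beta>) \<in> set FS \<Longrightarrow> (\<exists>i\<in>S. E = E1 i \<and> \<beta> = x i) \<or> (\<exists>i\<in>S. E = E2 i \<and> \<beta> = z i) \<or> (\<exists>g<N. g \<notin> S \<and> E = E3 g \<and> \<beta> = x g)"
  using finite_S by (auto simp: FS_def)

lemma frozen_units: assumes "i \<in> S"
  shows "neg i \<in> lower S" "inverse (neg i) \<in> lower S" "y i \<in> lower S" "inverse (y i) \<in> lower S" "pos i \<in> lower S" "inverse (pos i) \<in> lower S"
    "z i \<in> lower S"
proof -
  have "x g \<in> lower S \<and> inverse (x g) \<in> lower S" if "g < N" "B $$ (g, i) \<noteq> 0" for g
    using that S_n(3)[OF _ assms] x_lower[of g] by (cases "g \<in> S") auto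
  then show "neg i \<in> lower S" "inverse (neg i) \<in> lower S" "y i \<in> lower S" "inverse (y i) \<in> lower S" "pos i \<in> lower S" "inverse (pos i) \<in> lower S"
    by (simp_all add: monomials_unit[of "lower S" i])
  then show "z i \<in> lower S" using x_lower(3)[OF assms] by (auto simp: z_def divide_inverse intro!: subalg_mult)
qed

lemma FS_values:
  assumes "(E, \<beta>) \<in> set FS"
  shows "derivation E" "\<beta> \<in> lower S" "h < N \<Longrightarrow> E (x h) \<in> lower S" "l \<in> S \<Longrightarrow> E (z l) \<in> lower S"
proof -
  from set_FS[OF assms] have "derivation E \<and> \<beta> \<in> lower S \<and> (h < N \<longrightarrow> E (x h) \<in> lower S) \<and> (l \<in> S \<longrightarrow> E (z l) \<in> lower S)"
  proof (elim disjE bexE exE conjE)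
    fix i assume i: "i \<in> S" "E = E1 i" "\<beta> = x i"
    then show ?thesis
      using derivation_E E1_values[OF i(1)] frozen_units[OF i(1)] x_lower S_n by (cases "h \<in> S") (auto intro!: subalg_mult simp: divide_inverse)
  next
    fix i assume i: "i \<in> S" "E = E2 i" "\<beta> = z i"
    then show ?thesis
      using derivation_E E2_values[OF i(1)] frozen_units[OF i(1)] x_lower S_n by (cases "h \<in> S") (auto intro!: subalg_mult simp: divide_inverse)
  next
    fix g assume g: "g < N" "g \<notin> S" "E = E3 g" "\<beta> = x g"
    then show ?thesis
      using derivation_E E3_values[OF g(1,2)] x_lower S_n by (cases "h \<in> S") (auto intro!: subalg_mult subalg_diff subalg_sum subalg_uminus)
  qed
  then show "derivation E" "\<beta> \<in> lower S" "h < N \<Longrightarrow> E (x h) \<in> lower S" "l \<in> S \<Longrightarrow> E (z l) \<in> lower S" by auto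
qed

lemma x'_z: "i \<in> S \<Longrightarrow> x' i = z i * neg i"
  by (simp add: z_def)

lemma FS_closed:
  assumes E: "(E, \<beta>) \<in> set FS" and b: "b \<in> lower S" shows "E b \<in> lower S"
proof -
  note D = FS_values(1)[OF E] and v = FS_values(3,4)[OF E]
  have inv: "E (inverse (x g)) \<in> lower S" if "g < N" "g \<notin> S" for g
    using der_gen_inverse_closed[OF D, of "lower S" "x g"] v(1)[OF that(1)] x_lower(2)[OF that] by simp
  have neg: "E (neg i) \<in> lower S" if "i \<in> S" for i
  proof -
    have "neg i \<in> subalgebra_gen \<iota> (x ` {..<N})"
      unfolding neg_def by (intro subalg_prod_power subalg_gen gen_incl) auto
    then show ?thesis
      using der_gen_closed[OF D subalg_lower, of "x ` {..<N}" S "neg i"] v(1) gen_least[of "lower S" "x ` {..<N}"] x_lower(1) by auto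
  qed
  have "E (x' i) \<in> lower S" if "i \<in> S" for i
    unfolding x'_z[OF that] der_mult[OF D] using neg[OF that] v(2)[OF that] frozen_units[OF that] by (auto intro!: subalg_add subalg_mult)
  then show ?thesis
    using der_gen_closed[OF D subalg_lower, of "x ` {..<N} \<union> {inverse (x g) |g. g < N \<and> g \<notin> S} \<union> x' ` S" S b] b inv v(1)
    unfolding lower_def by auto
qed

text \<open>For a frozen variable \<open>x h\<close> the corrections in \<open>E3\<close> contribute \<open>- x h * \<Sum> dual i h dlog (y i)\<close>, and \<open>E1\<close>, \<open>E2\<close> together contribute
  \<open>d (x i * z i) / y i = dlog (y i)\<close> with the opposite coefficients.\<close>

lemma framed_FS:
  assumes R: "subalg R" and RS: "lower S \<subseteq> R"
  shows "h < N \<Longrightarrow> framed R FS (x h)" "l \<in> S \<Longrightarrow> framed R FS (z l)"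
proof -
  show "framed R FS (z l)" if l: "l \<in> S"
    unfolding framed_def
  proof (intro allI impI)
    fix G a vs assume G: "alt R G" "a \<in> R" "set vs \<subseteq> R"
    have z: "G 0 (z i # vs) = 0" if "i \<in> S" for i
      using alt_zero[OF G(1) R] G frozen_units[OF that(1)] RS by auto
    have zx: "G 0 (x g # vs) = 0" if "g < N" for g
      using alt_zero[OF G(1) R] G x_lower(1)[OF that, of S] RS by auto
    have "(\<Sum>i\<in>S. G (a * E1 i (z l)) (x i # vs)) = 0" "(\<Sum>g\<in>{..<N} - S. G (a * E3 g (z l)) (x g # vs)) = 0"
      using zx l S_n by (auto simp: E1_values E3_values intro!: sum.neutral)
    moreover have "(\<Sum>i\<in>S. G (a * E2 i (z l)) (z i # vs)) = (\<Sum>i\<in>S. if i = l then G a (z l # vs) else 0)"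
      using z l S_n by (intro sum.cong) (auto simp: E2_values)
    ultimately show "G a (z l # vs) = (\<Sum>(E, \<beta>)\<leftarrow>FS. G (a * E (z l)) (\<beta> # vs))"
      unfolding sum_FS using l finite_S by simp
  qed
  show "framed R FS (x h)" if h: "h < N"
    unfolding framed_def
  proof (intro allI impI)
    fix G a vs assume G: "alt R G" "a \<in> R" "set vs \<subseteq> R"
    have zR: "z i \<in> R" "y i \<in> R" "inverse (y i) \<in> R" "pos i \<in> R" "inverse (pos i) \<in> R" "neg i \<in> R" "inverse (neg i) \<in> R" if "i \<in> S" for i using frozen_units[OF that] RS by auto
    have xR: "x g \<in> R" if "g < N" for g using x_lower(1)[OF that, of S] RS by auto
    have xiR: "inverse (x g) \<in> R" if "g < N" "g \<notin> S" for g using x_lower(2)[OF that] RS by auto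
    have z: "G 0 (z i # vs) = 0" if "i \<in> S" for i using alt_zero[OF G(1) R] G zR[OF that] by auto
    have z': "G 0 (x g # vs) = 0" if "g < N" for g using alt_zero[OF G(1) R] G xR[OF that] by auto
    show "G a (x h # vs) = (\<Sum>(E, \<beta>)\<leftarrow>FS. G (a * E (x h)) (\<beta> # vs))"
    proof (cases "h \<in> S")
      case True
      have "(\<Sum>i\<in>S. G (a * E2 i (x h)) (z i # vs)) = 0" "(\<Sum>g\<in>{..<N} - S. G (a * E3 g (x h)) (x g # vs)) = 0"
        using z z' True S_n by (auto simp: E2_values E3_values intro!: sum.neutral)
      moreover have "(\<Sum>i\<in>S. G (a * E1 i (x h)) (x i # vs)) = (\<Sum>i\<in>S. if i = h then G a (x h # vs) else 0)"
        using z' True S_n by (intro sum.cong) (auto simp: E1_values)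
      ultimately show ?thesis unfolding sum_FS using True finite_S by simp
    next
      case False
      define c where "c i = a * (\<iota> (dual i h) * x h)" for i
      have cR: "c i \<in> R" for i unfolding c_def using G(2) R xR[OF h] by (simp add: subalg_mult)
      have dlog_y: "G (c i * inverse (y i)) (y i # vs) = (\<Sum>g\<in>{..<N} - S. of_int (B $$ (g, i)) * G (c i * inverse (x g)) (x g # vs))" if i: "i \<in> S" for i
      proof -
        have B0: "B $$ (g, i) = 0" if "g \<in> S" for g using S_n(3)[OF that i] .
        have c1: "x g \<in> R \<and> inverse (x g) \<in> R" if "g \<in> {..<N}" "B $$ (g, i) \<noteq> 0" for g
          using xR xiR B0[of g] that by auto
        have c2: "x g \<noteq> 0" if "g \<in> {..<N}" for g using x_nz that by auto
        have "G (c i * inverse (pos i)) (pos i # vs) = (\<Sum>g<N. of_nat (nat (max (B $$ (g, i)) 0)) * G (c i * inverse (x g)) (x g # vs))"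
          unfolding pos_def by (rule alt_dlog_prod[OF R G(1) cR G(3) _ c1 c2]) auto
        moreover have "G (c i * inverse (neg i)) (neg i # vs) = (\<Sum>g<N. of_nat (nat (max (- B $$ (g, i)) 0)) * G (c i * inverse (x g)) (x g # vs))"
          unfolding neg_def by (rule alt_dlog_prod[OF R G(1) cR G(3) _ c1 c2]) auto
        ultimately have "G (c i * inverse (y i)) (y i # vs) = (\<Sum>g<N. of_nat (nat (max (B $$ (g, i)) 0)) * G (c i * inverse (x g)) (x g # vs) - of_nat (nat (max (- B $$ (g, i)) 0)) * G (c i * inverse (x g)) (x g # vs))"
          unfolding y_def sum_subtractf using alt_dlog_divide[OF R G(1) cR G(3), of "pos i" "neg i" i] zR[OF i] by simp
        also have "\<dots> = (\<Sum>g<N. of_int (B $$ (g, i)) * G (c i * inverse (x g)) (x g # vs))"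
          by (intro sum.cong) (auto simp: max_def simp flip: left_diff_distrib)
        also have "\<dots> = (\<Sum>g\<in>{..<N} - S. of_int (B $$ (g, i)) * G (c i * inverse (x g)) (x g # vs))"
          using B0 by (intro sum.mono_neutral_right) auto
        finally show ?thesis .
      qed
      have "(\<Sum>i\<in>S. G (a * E1 i (x h)) (x i # vs)) + (\<Sum>i\<in>S. G (a * E2 i (x h)) (z i # vs)) = (\<Sum>i\<in>S. G (c i * inverse (y i)) (y i # vs))"
        unfolding sum.distrib[symmetric]
      proof (rule sum.cong)
        fix i assume i: "i \<in> S"
        have ci: "c i * inverse (y i) \<in> R" using cR zR[OF i] R by (simp add: subalg_mult)
        have "G (c i * inverse (y i)) ((x i * z i) # vs) = G (c i * inverse (y i) * x i) (z i # vs) + G (c i * inverse (y i) * z i) (x i # vs)"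
          using alt_d_mult[OF G(1) ci, of "x i" "z i" "[]" vs] xR[OF S_n(2)[OF i]] zR[OF i] G(3) by simp
        moreover have "G (c i * inverse (y i)) ((1 + y i) # vs) = G (c i * inverse (y i)) (y i # vs)"
          using alt_d_add[OF G(1) ci, of 1 "y i" "[]" vs] alt_dlog_1[OF R G(1) ci G(3)] zR[OF i] G(3) R by simp
        moreover have "a * E1 i (x h) = c i * inverse (y i) * z i" "a * E2 i (x h) = c i * inverse (y i) * x i"
          unfolding c_def E1_values(2)[OF i h False] E2_values(2)[OF i h False] by (simp_all add: divide_inverse mult_ac)
        ultimately show "G (a * E1 i (x h)) (x i # vs) + G (a * E2 i (x h)) (z i # vs) = G (c i * inverse (y i)) (y i # vs)"
          using xz[OF i] by (simp add: add.commute)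
      qed simp
      also have "\<dots> = (\<Sum>i\<in>S. \<Sum>g\<in>{..<N} - S. of_int (B $$ (g, i)) * G (c i * inverse (x g)) (x g # vs))"
        using dlog_y by (intro sum.cong) auto
      also have "\<dots> = (\<Sum>g\<in>{..<N} - S. \<Sum>i\<in>S. of_int (B $$ (g, i)) * G (c i * inverse (x g)) (x g # vs))"
        by (rule sum.swap)
      finally have 1: "(\<Sum>i\<in>S. G (a * E1 i (x h)) (x i # vs)) + (\<Sum>i\<in>S. G (a * E2 i (x h)) (z i # vs)) = \<dots>" .
      have "(\<Sum>g\<in>{..<N} - S. G (a * E3 g (x h)) (x g # vs)) = (\<Sum>g\<in>{..<N} - S. (if g = h then G a (x h # vs) else 0) - (\<Sum>i\<in>S. of_int (B $$ (g, i)) * G (c i * inverse (x g)) (x g # vs)))"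
      proof (rule sum.cong)
        fix g assume g: "g \<in> {..<N} - S"
        then have gR: "x g \<in> R" "inverse (x g) \<in> R" "set (x g # vs) \<subseteq> R" using xR xiR G(3) by auto
        have sm: "G (sum f T) (x g # vs) = (\<Sum>i\<in>T. G (f i) (x g # vs))" if "finite T" "\<And>i. i \<in> T \<Longrightarrow> f i \<in> R" for f and T :: "nat set"
          using that
        proof (induction T rule: finite_induct)
          case empty then show ?case using alt_zero[OF G(1) R gR(3)] by simp
        next
          case (insert i T)
          then show ?case using alt_add[OF G(1) _ _ gR(3), of "f i" "sum f T"] subalg_sum[OF R, of T f] by simp
        qed
        let ?s = "\<Sum>i\<in>S. \<iota> (of_int (B $$ (g, i))) * (c i * inverse (x g))"
        let ?t = "if g = h then a else 0"
        have "a * E3 g (x h) = a * inverse (x g) * (if g = h then x h else 0) - a * inverse (x g) * (\<Sum>i\<in>S. \<iota> (of_int (B $$ (g, i))) * (\<iota> (dual i h) * x h))"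
          using E3_values(2)[of g h] g h False by (simp add: right_diff_distrib mult.assoc)
        also have "a * inverse (x g) * (if g = h then x h else 0) = ?t" using x_nz[of g] g by (cases "g = h") (auto simp: mult.assoc)
        also have "a * inverse (x g) * (\<Sum>i\<in>S. \<iota> (of_int (B $$ (g, i))) * (\<iota> (dual i h) * x h)) = ?s"
          unfolding c_def by (simp add: sum_distrib_left mult_ac)
        finally have e: "a * E3 g (x h) = ?t + (- ?s)" by simp
        have tR: "\<iota> (of_int (B $$ (g, i))) * (c i * inverse (x g)) \<in> R" for i using cR gR R by (simp add: subalg_mult)
        have tsR: "?t \<in> R" "?s \<in> R" using G(2) R tR by (auto intro: subalg_sum)
        have "G (a * E3 g (x h)) (x g # vs) = G ?t (x g # vs) - G ?s (x g # vs)"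
          unfolding e using alt_add[OF G(1) tsR(1) subalg_uminus[OF R tsR(2)] gR(3)] alt_uminus[OF G(1) tsR(2) gR(3)] by (simp only: diff_conv_add_uminus)
        also have "G (\<Sum>i\<in>S. \<iota> (of_int (B $$ (g, i))) * (c i * inverse (x g))) (x g # vs) = (\<Sum>i\<in>S. of_int (B $$ (g, i)) * G (c i * inverse (x g)) (x g # vs))"
          using sm[OF finite_S tR] alt_scale[OF G(1) _ gR(3)] cR gR R by (simp add: subalg_mult)
        also have "G (if g = h then a else 0) (x g # vs) = (if g = h then G a (x h # vs) else 0)" using z'[of g] g by auto
        finally show "G (a * E3 g (x h)) (x g # vs) = (if g = h then G a (x h # vs) else 0) - (\<Sum>i\<in>S. of_int (B $$ (g, i)) * G (c i * inverse (x g)) (x g # vs))" .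
      qed simp
      also have "\<dots> = G a (x h # vs) - (\<Sum>g\<in>{..<N} - S. \<Sum>i\<in>S. of_int (B $$ (g, i)) * G (c i * inverse (x g)) (x g # vs))"
        using h False by (simp add: sum_subtractf)
      finally show ?thesis unfolding sum_FS 1 by simp
    qed
  qed
qed

lemma frame_lower: "frame (lower S) FS"
proof -
  let ?R = "lower S"
  have F: "\<beta> \<in> ?R \<and> derivation E \<and> (\<forall>b\<in>?R. E b \<in> ?R)" if "(E, \<beta>) \<in> set FS" for E \<beta>
    using FS_values(1,2)[OF that] FS_closed[OF that] by simp
  have x: "framed ?R FS (x h)" if "h < N" for h using framed_FS(1)[of ?R h] that by simp
  have xi: "framed ?R FS (inverse (x g))" if "g < N" "g \<notin> S" for g
    using framed_inverse[of ?R FS "x g"] F x[OF that(1)] x_lower(1)[OF that(1)] x_lower(2)[OF that] by simp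
  have framed_mult': "framed ?R FS (b * b')" if "framed ?R FS b" "framed ?R FS b'" "b \<in> ?R" "b' \<in> ?R" for b b'
    using framed_mult[of ?R FS b b'] F that by simp
  have neg: "framed ?R FS (neg i)" for i
  proof -
    have "framed ?R FS (x h ^ k) \<and> x h ^ k \<in> ?R" if "h < N" for h k
    proof (induction k)
      case 0 then show ?case using framed_const[of ?R FS 1] F by simp
    next
      case (Suc k) then show ?case using framed_mult'[OF x[OF that], of "x h ^ k"] x_lower(1)[OF that] by (simp add: subalg_mult)
    qed
    note pw = this
    have "framed ?R FS (\<Prod>j\<in>J. x j ^ e j) \<and> (\<Prod>j\<in>J. x j ^ e j) \<in> ?R" if "finite J" "J \<subseteq> {..<N}" for J and e :: "nat \<Rightarrow> nat"
      using that
    proof (induction J rule: finite_induct)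
      case empty then show ?case using framed_const[of ?R FS 1] F by simp
    next
      case (insert j J)
      then show ?case using pw[of j "e j"] framed_mult'[of "x j ^ e j" "\<Prod>j\<in>J. x j ^ e j"] by (simp add: subalg_mult)
    qed
    then show ?thesis unfolding neg_def by simp
  qed
  have x': "framed ?R FS (x' i)" if "i \<in> S" for i
    unfolding x'_z[OF that] using framed_FS(2)[of ?R i] that frozen_units[OF that] neg by (intro framed_mult') auto
  show ?thesis
    unfolding lower_def
  proof (rule frame_gen)
    fix E \<beta> assume "(E, \<beta>) \<in> set FS"
    then show "\<beta> \<in> subalgebra_gen \<iota> (x ` {..<N} \<union> {inverse (x g) |g. g < N \<and> g \<notin> S} \<union> x' ` S) \<and> derivation E \<and>
      (\<forall>h\<in>x ` {..<N} \<union> {inverse (x g) |g. g < N \<and> g \<notin> S} \<union> x' ` S. E h \<in> subalgebra_gen \<iota> (x ` {..<N} \<union> {inverse (x g) |g. g < N \<and> g \<notin> S} \<union> x' ` S))"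
      using F unfolding lower_def by (blast intro: gen_incl)
  next
    fix h assume "h \<in> x ` {..<N} \<union> {inverse (x g) |g. g < N \<and> g \<notin> S} \<union> x' ` S"
    then show "framed (subalgebra_gen \<iota> (x ` {..<N} \<union> {inverse (x g) |g. g < N \<and> g \<notin> S} \<union> x' ` S)) FS h"
      using x xi x' unfolding lower_def by auto
  qed
qed

lemma frame_UNIV: "frame UNIV FS"
proof -
  have F: "\<beta> \<in> UNIV \<and> derivation E \<and> (\<forall>b\<in>UNIV. E b \<in> UNIV)" if "(E, \<beta>) \<in> set FS" for E \<beta>
    using FS_values(1)[OF that] by simp
  have "framed UNIV FS b" for b
  proof (induction b rule: field_gen_induct[OF K])
    case (1 c) then show ?case using framed_const[of UNIV FS] F by simp
  next
    case (2 h) then show ?case using framed_FS(1)[of UNIV] by auto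
  next
    case (3 a b) then show ?case using framed_add[of UNIV FS] F by simp
  next
    case (4 a b) then show ?case using framed_mult[of UNIV FS] F by simp
  next
    case (5 a) then show ?case using framed_inverse[of UNIV FS] F by simp
  qed
  then show ?thesis using frameI[of UNIV FS] F by simp
qed

theorem isolated_torsion_free: "torsion_free (lower S)"
  by (rule frame_torsion_free[OF subalg_lower frame_lower])

text \<open>The derivations of the frame preserve the ring of the torus and of each neighbor, and by \<open>isolated_upper\<close> the
  intersection of these rings is \<open>lower S\<close>.\<close>

theorem isolated_extends:
  assumes v: "extends_to Tor v" "\<And>i. i \<in> S \<Longrightarrow> extends_to (Tor' i) v"
  shows "extends_to (lower S) v"
proof -
  let ?\<R> = "insert Tor (Tor' ` S)"
  have Sn: "S \<subseteq> {..<n}" using S by (auto simp: isolated_def)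
  have low: "lower S \<subseteq> Tor" "\<And>j. j \<in> S \<Longrightarrow> lower S \<subseteq> Tor' j"
    using lower_Tor[OF Sn] lower_Tor'[OF Sn] by auto
  have x'R: "x' i \<in> R" "z i \<in> R" "neg i \<in> R" "inverse (neg i) \<in> R" if "lower S \<subseteq> R" "i \<in> S" for R i
    using that x_lower(3)[of i S] frozen_units[OF that(2)] by auto
  have "extends_to (\<Inter>?\<R>) v"
  proof (rule frame_extends_Inter[OF frame_UNIV])
    fix R E \<beta> assume R: "R \<in> ?\<R>" and E: "(E, \<beta>) \<in> set FS"
    note v = FS_values[OF E]
    have lR: "lower S \<subseteq> R" using R low by auto
    have "E b \<in> R" if b: "b \<in> R" for b
    proof (cases "R = Tor")
      case True
      have "E h \<in> Tor" if h: "h \<in> x ` {..<N} \<union> (\<lambda>i. inverse (x i)) ` {..<N}" for h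
      proof -
        consider g where "g < N" "h = x g" | g where "g < N" "h = inverse (x g)" using h by auto
        then show ?thesis
        proof cases
          case 1 then show ?thesis using v(3) low(1) by auto
        next
          case 2 then show ?thesis using v(3)[of g] low(1) x_Tor(2)[of g] der_gen_inverse_closed[OF v(1) subalg_Tor, of "x g"] by auto
        qed
      qed
      then show ?thesis using der_gen_closed[OF v(1) subalg_Tor _ _ b[unfolded True Tor_gen]] Tor_gen True by auto
    next
      case False
      then obtain j where j: "j \<in> S" "R = Tor' j" using R by auto
      have jN: "j < n" "j < N" using j S_n by auto
      have Ex': "E (x' j) \<in> R" using FS_closed[OF E x_lower(3)[OF j(1)]] lR by auto
      have "E h \<in> Tor' j" if h: "h \<in> others j \<union> {x' j, inverse (x' j)}" for h
      proof -
        consider g where "g < N" "g \<noteq> j" "h = x g" | g where "g < N" "g \<noteq> j" "h = inverse (x g)" | "h = x' j" | "h = inverse (x' j)"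
          using h by (auto simp: others_def)
        then show ?thesis
        proof cases
          case 1 then show ?thesis using v(3) lR j by auto
        next
          case 2
          then show ?thesis using v(3)[of g] lR j jN x_Tor'(2)[of g j] der_gen_inverse_closed[OF v(1) subalg_Tor', of "x g" j] by auto
        next
          case 3 then show ?thesis using Ex' j by simp
        next
          case 4 then show ?thesis using Ex' j jN x'_Tor'(2)[of j] der_gen_inverse_closed[OF v(1) subalg_Tor', of "x' j" j] by auto
        qed
      qed
      then show ?thesis using der_gen_closed[OF v(1) subalg_Tor', of "others j \<union> {x' j, inverse (x' j)}" j b] Tor'_others[OF jN(2)] b j(2) by auto
    qed
    then show "\<beta> \<in> R \<and> (\<forall>b\<in>R. E b \<in> R)" using v(2) lR by auto
  qed (use v in auto)
  moreover have "\<Inter>?\<R> \<subseteq> lower S" using isolated_upper[OF S] by auto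
  ultimately show ?thesis by (rule extends_mono)
qed

end
end

section \<open>Acyclic seeds\<close>

context complex_field
begin

text \<open>The multipliers that move \<open>b\<close> into \<open>R\<close> form an ideal.\<close>

lemma membership_local:
  assumes R: "subalg R" and F: "comaximal R F" "F \<subseteq> R" and b: "\<And>f. f \<in> F \<Longrightarrow> \<exists>N. f ^ N * b \<in> R"
  shows "b \<in> R"
proof -
  have "ideal_in R {r \<in> R. r * b \<in> R}"
    unfolding ideal_in_def using R by (auto simp: distrib_right mult.assoc intro: subalg_add subalg_mult)
  then have "1 \<in> {r \<in> R. r * b \<in> R}"
  proof (rule comaximal_power[OF R F])
    fix f assume f: "f \<in> F"
    then show "\<exists>N. f ^ N \<in> {r \<in> R. r * b \<in> R}" using b[OF f] F(2) subalg_power[OF R, of f] by auto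
  qed
  then show ?thesis by simp
qed

end

context seed
begin

lemma x_inj: assumes "i < N" "j < N" "x i = x j" shows "i = j"
proof (rule ccontr)
  assume "i \<noteq> j"
  then have "D i (x j) = 0" using D_x assms by simp
  then show False using D_x[OF assms(1,1)] x_nz[OF assms(1)] assms(3) by simp
qed

lemma lower_localization:
  assumes i: "i \<in> S" and S: "S \<subseteq> {..<n}" and b: "b \<in> lower (S - {i})"
  shows "\<exists>p. x i ^ p * b \<in> lower S"
proof -
  have iN: "i < N" using i S by auto
  have xi: "x i \<in> lower S" using x_lower(1)[OF iN] .
  have up: "x i ^ (p + q) * b \<in> lower S" if "x i ^ p * b \<in> lower S" for p q b
    using subalg_mult[OF subalg_lower subalg_power[OF subalg_lower xi, of q] that] by (simp add: power_add mult_ac)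
  show ?thesis using b unfolding lower_def[of "S - {i}"]
  proof (induction rule: gen_induct)
    case (const c) then show ?case by (intro exI[of _ 0]) simp
  next
    case (incl h)
    then consider g where "g < N" "h = x g" | g where "g < N" "g \<notin> S" "h = inverse (x g)" | "h = inverse (x i)" | l where "l \<in> S" "h = x' l" by auto
    then show ?case
    proof cases
      case 1 then show ?thesis using x_lower(1) by (intro exI[of _ 0]) simp
    next
      case 2 then show ?thesis using x_lower(2) by (intro exI[of _ 0]) simp
    next
      case 3 then show ?thesis using x_nz[OF iN] by (intro exI[of _ 1]) simp
    next
      case 4 then show ?thesis using x_lower(3) by (intro exI[of _ 0]) simp
    qed
  next
    case (add a b)
    then obtain p q where pq: "x i ^ p * a \<in> lower S" "x i ^ q * b \<in> lower S" by blast
    have "x i ^ (p + q) * (a + b) = x i ^ (p + q) * a + x i ^ (q + p) * b" by (simp add: distrib_left add.commute)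
    then show ?case using subalg_add[OF subalg_lower up[OF pq(1), of q] up[OF pq(2), of p]] by metis
  next
    case (mult a b)
    then obtain p q where pq: "x i ^ p * a \<in> lower S" "x i ^ q * b \<in> lower S" by blast
    have "x i ^ (p + q) * (a * b) = (x i ^ p * a) * (x i ^ q * b)" by (simp only: power_add mult_ac)
    then show ?case using subalg_mult[OF subalg_lower pq] by metis
  qed
qed

text \<open>Modulo \<open>x i\<close> the exchange relation reads \<open>pos i = - neg i\<close>. As \<open>i\<close> is a source, \<open>pos i\<close> is a product of frozen
  variables and hence a unit, while \<open>x j\<close> divides \<open>neg i\<close>.\<close>

lemma source_comaximal:
  assumes S: "S \<subseteq> {..<n}" and ij: "i \<in> S" "j \<in> S" "B $$ (i, j) > 0" and source: "\<And>l. l \<in> S \<Longrightarrow> B $$ (l, i) \<le> 0"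
  shows "comaximal (lower S) {x i, x j}"
  unfolding comaximal_def
proof (intro allI impI)
  fix I assume I: "ideal_in (lower S) I" "{x i, x j} \<subseteq> I"
  have ijn: "i < n" "j < n" "i < N" "j < N" using ij S by auto
  have mult: "r * a \<in> I" if "r \<in> lower S" "a \<in> I" for r a using I that by (auto simp: ideal_in_def)
  have "P i \<in> I" unfolding P_eq[OF ijn(1)] using mult[OF x_lower(3)[OF ij(1)], of "x i"] I by (simp add: mult.commute)
  moreover have "neg i \<in> I"
  proof -
    let ?e = "\<lambda>l. nat (max (- B $$ (l, i)) 0)"
    have "B $$ (j, i) < 0" using skew[of j i] ijn ij by simp
    then obtain e where e: "?e j = Suc e" by (cases "?e j") auto
    have "neg i = x j ^ ?e j * (\<Prod>l\<in>{..<N} - {j}. x l ^ ?e l)"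
      unfolding neg_def using ijn by (intro prod.remove) auto
    also have "\<dots> = (x j ^ e * (\<Prod>l\<in>{..<N} - {j}. x l ^ ?e l)) * x j" unfolding e by (simp add: mult_ac)
    also have "\<dots> \<in> I" using x_lower(1) I ijn by (intro mult) (auto intro!: subalg_mult subalg_power subalg_prod)
    finally show ?thesis .
  qed
  then have "\<iota> (-1) * neg i \<in> I" by (intro mult) simp_all
  ultimately have "P i + \<iota> (-1) * neg i \<in> I" using I by (auto simp: ideal_in_def)
  then have "pos i \<in> I" by (simp add: P_def hom_distribs)
  moreover have "inverse (pos i) \<in> lower S"
    unfolding pos_def
  proof (rule subalg_inverse_prod_power[OF subalg_lower])
    fix l assume "l \<in> {..<N}" "nat (max (B $$ (l, i)) 0) > 0"
    then show "inverse (x l) \<in> lower S" using source[of l] x_lower(2)[of l S] by fastforce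
  qed
  ultimately have "inverse (pos i) * pos i \<in> I" by (intro mult)
  then show "1 \<in> I" by simp
qed

text \<open>The two properties of the coordinate ring that are needed of a chart. Both are local on the spectrum.\<close>

definition good_chart :: "nat set \<Rightarrow> bool" where
  "good_chart S \<longleftrightarrow> torsion_free (lower S) \<and>
    (\<forall>v. extends_to Tor v \<longrightarrow> (\<forall>i\<in>S. extends_to (Tor' i) v) \<longrightarrow> extends_to (lower S) v)"

text \<open>A finite acyclic quiver with an edge has a source \<open>i\<close> with an edge to some \<open>j\<close>. Inverting \<open>x i\<close> or \<open>x j\<close> freezes that vertex, and the
  two localizations cover.\<close>

theorem acyclic_good_chart:
  assumes S: "S \<subseteq> {..<n}" "acyclic (quiver S B)" shows "good_chart S"
proof -
  have "finite S" using S finite_subset by blast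
  then show ?thesis using S
  proof (induction S rule: finite_psubset_induct)
    case (psubset S)
    let ?q = "quiver S B"
    show ?case
    proof (cases "?q = {}")
      case True
      have "B $$ (i, j) = 0" if "i \<in> S" "j \<in> S" for i j
      proof -
        have "\<not> B $$ (i, j) > 0" "\<not> B $$ (j, i) > 0" using True that by (auto simp: quiver_def)
        moreover have "B $$ (i, j) = - B $$ (j, i)" using psubset.prems that by (intro skew) auto
        ultimately show ?thesis by simp
      qed
      then have "isolated S" using psubset.prems by (auto simp: isolated_def)
      then show ?thesis using isolated_torsion_free isolated_extends by (auto simp: good_chart_def)
    next
      case False
      have "?q \<subseteq> S \<times> S" by (auto simp: quiver_def)
      then have "finite ?q" using psubset.hyps finite_subset by (metis finite_SigmaI)
      then have "wf ?q" using psubset.prems(2) by (rule finite_acyclic_wf)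
      moreover obtain e where "e \<in> Domain ?q" using False by fastforce
      \<comment> \<open>A minimal vertex among those with an outgoing edge is a source, and has an edge to some \<open>j\<close>.\<close>
      ultimately obtain i where i: "i \<in> Domain ?q" "\<And>l. (l, i) \<in> ?q \<Longrightarrow> l \<notin> Domain ?q" by (rule wfE_min) blast
      then obtain j where j: "(i, j) \<in> ?q" by blast
      have ij: "i \<in> S" "j \<in> S" "B $$ (i, j) > 0" using j by (auto simp: quiver_def)
      have ijn: "i < n" "j < n" using ij psubset.prems by auto
      have source: "B $$ (l, i) \<le> 0" if "l \<in> S" for l
      proof (rule ccontr)
        assume "\<not> B $$ (l, i) \<le> 0"
        then have "(l, i) \<in> ?q" using that ij by (simp add: quiver_def)
        then show False using i(2)[of l] by blast
      qed
      have neq: "x i \<noteq> x j" using x_inj[of i j] ijn ij(3) skew_diag[of i] by auto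
      have cm: "comaximal (lower S) {x i, x j}" by (rule source_comaximal[OF psubset.prems(1) ij source])
      have sub: "good_chart (S - {l})" if "l \<in> S" for l
      proof (rule psubset.IH)
        show "acyclic (quiver (S - {l}) B)" using psubset.prems(2) by (rule acyclic_subset) (auto simp: quiver_def)
      qed (use that psubset.prems in auto)
      define Q where "Q f = (if f = x i then lower (S - {i}) else lower (S - {j}))" for f
      have Q: "f \<in> {x i, x j} \<Longrightarrow> \<exists>l\<in>S. f = x l \<and> Q f = lower (S - {l})" for f
        using neq ij by (auto simp: Q_def)
      have loc: "lower S \<subseteq> Q f \<and> (\<forall>b\<in>Q f. \<exists>p. f ^ p * b \<in> lower S)" if f: "f \<in> {x i, x j}" for f
      proof -
        obtain l where l: "l \<in> S" "f = x l" "Q f = lower (S - {l})" using Q[OF f] by blast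
        show ?thesis unfolding l(3) unfolding l(2)
          using lower_subset[of "S - {l}" S] lower_localization[OF l(1) psubset.prems(1)] psubset.prems(1) by blast
      qed
      have F: "{x i, x j} \<subseteq> lower S" "0 \<notin> {x i, x j}" using x_lower(1) ijn x_nz by auto
      have "torsion_free (lower S)"
      proof (rule torsion_free_local[OF subalg_lower cm F(1), of Q])
        fix f assume f: "f \<in> {x i, x j}"
        obtain l where l: "l \<in> S" "Q f = lower (S - {l})" using Q[OF f] by blast
        have "torsion_free (Q f)" using sub[OF l(1)] l(2) by (simp add: good_chart_def)
        then show "torsion_free (Q f) \<and> lower S \<subseteq> Q f \<and> (\<forall>b\<in>Q f. \<exists>p. f ^ p * b \<in> lower S)" using loc[OF f] by simp
      qed
      moreover have "extends_to (lower S) v" if v: "extends_to Tor v" "\<forall>i\<in>S. extends_to (Tor' i) v" for v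
      proof (rule extends_local'[OF subalg_lower cm F(1,2), of Q])
        fix f assume f: "f \<in> {x i, x j}"
        obtain l where l: "l \<in> S" "Q f = lower (S - {l})" using Q[OF f] by blast
        show "subalg (Q f) \<and> lower S \<subseteq> Q f \<and> (\<forall>b\<in>Q f. \<exists>p. f ^ p * b \<in> lower S)" using loc[OF f] l by simp
        show "extends_to (Q f) v" using sub[OF l(1)] v unfolding l(2) good_chart_def by blast
      qed
      ultimately show ?thesis by (simp add: good_chart_def)
    qed
  qed
qed

section \<open>Mutation of seeds\<close>

lemma mutate_mat_dims [simp]: "dim_row (mutate_mat k B) = N" "dim_col (mutate_mat k B) = n"
  by (simp_all add: mutate_mat_def)

lemma mutate_mat_entry: "i < N \<Longrightarrow> j < n \<Longrightarrow> mutate_mat k B $$ (i, j) = (if i = k \<or> j = k then - B $$ (i, j)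
     else B $$ (i, j) + max (B $$ (i, k)) 0 * max (B $$ (k, j)) 0 - min (B $$ (i, k)) 0 * min (B $$ (k, j)) 0)"
  by (simp add: mutate_mat_def)

lemma max_uminus: "max (- a) 0 = - min a (0::int)" and min_uminus: "min (- a) 0 = - max a (0::int)"
  by auto

lemma mutate_mutate: assumes k: "k < n" shows "mutate k (mutate k (x, B)) = (x, B)"
proof -
  have kN: "k < N" using k by simp
  have "mutate_mat k (mutate_mat k B) = B"
  proof (rule eq_matI)
    fix i j assume "i < dim_row B" "j < dim_col B"
    then have ij: "i < N" "j < n" by auto
    show "mutate_mat k (mutate_mat k B) $$ (i, j) = B $$ (i, j)"
      using ij k kN unfolding mutate_mat_def by (simp add: max_uminus min_uminus)
  qed (auto simp: mutate_mat_def)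
  moreover have "(\<Prod>i<N. (x(k := x' k)) i ^ nat (max (mutate_mat k B $$ (i, k)) 0)) = neg k"
    unfolding neg_def by (intro prod.cong) (auto simp: mutate_mat_entry k skew_diag)
  moreover have "(\<Prod>i<N. (x(k := x' k)) i ^ nat (max (- mutate_mat k B $$ (i, k)) 0)) = pos k"
    unfolding pos_def by (intro prod.cong) (auto simp: mutate_mat_entry k skew_diag)
  moreover have "(neg k + pos k) / x' k = x k"
    using x_nz[OF kN] P_nz[OF k] by (simp add: x'_def P_def add.commute)
  ultimately show ?thesis unfolding mutate_seed by (simp add: mutate_def)
qed

lemma independent_mutate: assumes k: "k < n" shows "independent_columns (mutate_mat k B)"
  unfolding independent_columns_def
proof (intro allI impI)
  fix c :: "nat \<Rightarrow> rat" and l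
  let ?B = "\<lambda>i j. rat_of_int (B $$ (i, j))"
  assume c: "\<forall>i<dim_row (mutate_mat k B). (\<Sum>j<dim_col (mutate_mat k B). c j * of_int (mutate_mat k B $$ (i, j))) = 0" and l: "l < dim_col (mutate_mat k B)"
  have kN: "k < N" using k by simp
  define \<alpha> where "\<alpha> = (\<Sum>j<n. c j * max (?B k j) 0)"
  define \<beta> where "\<beta> = (\<Sum>j<n. c j * min (?B k j) 0)"
  have row_k: "(\<Sum>j<n. c j * ?B k j) = 0"
  proof -
    have "0 = (\<Sum>j<n. c j * of_int (mutate_mat k B $$ (k, j)))" using c kN by simp
    also have "\<dots> = - (\<Sum>j<n. c j * ?B k j)" using kN by (simp add: mutate_mat_entry sum_negf)
    finally show ?thesis by simp
  qed
  have "\<alpha> + \<beta> = (\<Sum>j<n. c j * ?B k j)"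
    unfolding \<alpha>_def \<beta>_def sum.distrib[symmetric] by (intro sum.cong) (auto simp: max_def min_def)
  then have \<beta>: "\<beta> = - \<alpha>" using row_k by (simp add: eq_neg_iff_add_eq_0 add.commute)
  define d where "d j = (if j = k then \<alpha> - c k else c j)" for j
  have "(\<Sum>j<n. d j * ?B i j) = 0" if i: "i < N" for i
  proof (cases "i = k")
    case True
    have "(\<Sum>j<n. d j * ?B k j) = (\<Sum>j<n. c j * ?B k j)"
      using skew_diag[OF k] by (intro sum.cong) (auto simp: d_def)
    then show ?thesis using row_k True by simp
  next
    case False
    have "0 = (\<Sum>j<n. c j * of_int (mutate_mat k B $$ (i, j)))" using c i by simp
    also have "\<dots> = (\<Sum>j<n. (if j = k then - c j else c j) * ?B i j + max (?B i k) 0 * (c j * max (?B k j) 0) - min (?B i k) 0 * (c j * min (?B k j) 0))"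
      using i False skew_diag[OF k] by (intro sum.cong) (auto simp: mutate_mat_entry algebra_simps of_int_max of_int_min)
    also have "\<dots> = (\<Sum>j<n. (if j = k then - c j else c j) * ?B i j) + max (?B i k) 0 * \<alpha> - min (?B i k) 0 * \<beta>"
      by (simp add: sum.distrib sum_subtractf \<alpha>_def \<beta>_def sum_distrib_left)
    also have "\<dots> = (\<Sum>j<n. (if j = k then - c j else c j) * ?B i j) + \<alpha> * ?B i k"
      by (simp add: \<beta> max_def min_def algebra_simps)
    also have "\<alpha> * ?B i k = (\<Sum>j<n. if j = k then \<alpha> * ?B i j else 0)" using k by simp
    also have "(\<Sum>j<n. (if j = k then - c j else c j) * ?B i j) + \<dots> = (\<Sum>j<n. d j * ?B i j)"
      unfolding sum.distrib[symmetric] by (intro sum.cong) (auto simp: d_def algebra_simps)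
    finally show ?thesis by simp
  qed
  then have d: "d j = 0" if "j < n" for j using independent that by (auto simp: independent_columns_def)
  have c0: "c j = 0" if "j < n" "j \<noteq> k" for j using d[OF that(1)] that(2) by (simp add: d_def)
  have "\<alpha> = 0" unfolding \<alpha>_def using c0 skew_diag[OF k] by (intro sum.neutral) force
  then have "c k = 0" using d[OF k] by (simp add: d_def)
  then show "c l = 0" using c0 l by (cases "l = k") auto
qed

text \<open>The logarithmic vector fields of the mutated cluster. From \<open>x k * x' k = P k\<close> and \<open>D' k i (x' k) = 0\<close> for \<open>i \<noteq> k\<close> it follows that
  \<open>D' k i\<close> has to scale \<open>x k\<close> by \<open>D i (P k) / P k\<close>.\<close>

definition D' :: "nat \<Rightarrow> nat \<Rightarrow> 'f \<Rightarrow> 'f" where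
  "D' k i b = (if i = k then - 1 * D k b else D i b + D i (P k) / P k * D k b)"

lemma D_x': assumes "i < N" "k < n" shows "D i (x' k) = D i (P k) / x k - (if i = k then x' k else 0)"
proof -
  have kN: "k < N" using assms by simp
  have "D i (P k) = x k * D i (x' k) + x' k * D i (x k)" unfolding P_eq[OF assms(2)] by (rule der_mult[OF D[OF assms(1)]])
  then show ?thesis using x_nz[OF kN] D_x[OF assms(1) kN] by (auto simp: field_simps)
qed

lemma coords_mutate: assumes k: "k < n" shows "coords N (x(k := x' k)) (D' k)"
  unfolding coords_def
proof (intro conjI allI impI)
  have kN: "k < N" using k by simp
  have DkP: "D k (P k) = 0" using D_P0[OF kN skew_diag[OF k]] .
  fix i assume i: "i < N"
  show "derivation (D' k i)"
  proof (cases "i = k")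
    case True
    then have "D' k i = (\<lambda>b. - 1 * D k b)" by (intro ext) (simp add: D'_def)
    then show ?thesis using derivation_smult[OF D[OF kN]] by metis
  next
    case False
    then have "D' k i = (\<lambda>b. D i b + D i (P k) / P k * D k b)" by (intro ext) (simp add: D'_def)
    then show ?thesis using derivation_add[OF D[OF i] derivation_smult[OF D[OF kN]]] by metis
  qed
  fix j assume j: "j < N"
  show "D' k i ((x(k := x' k)) j) = (if i = j then (x(k := x' k)) j else 0)"
  proof (cases "j = k")
    case True
    then show ?thesis using D_x'[OF i k] D_x'[OF kN k] DkP x_nz[OF kN] P_nz[OF k] by (auto simp: D'_def x'_def)
  next
    case False
    then show ?thesis using D_x[OF i j] D_x[OF kN j] by (auto simp: D'_def)
  qed
next
  fix j assume "j < N" then show "(x(k := x' k)) j \<noteq> 0" using x_nz x'_nz[OF k] by simp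
next
  have kN: "k < N" using k by simp
  let ?X = "(x(k := x' k)) ` {..<N}"
  let ?K = "generate_field class_ring (range \<iota> \<union> ?X)"
  have add: "a + b \<in> ?K" and mult: "a * b \<in> ?K" if "a \<in> ?K" "b \<in> ?K" for a b
    using generate_field.eng_add[OF that] generate_field.eng_mult[OF that] by (simp_all add: class_ring_simps)
  have inv: "inverse a \<in> ?K" if "a \<in> ?K" "a \<noteq> 0" for a
    using generate_field.m_inv[OF that(1)] that(2) by (simp add: class_ring_simps)
  have K': "subalg ?K" unfolding subalg_def using add mult by (auto intro: generate_field.incl)
  have xK: "x g \<in> ?K" if "g < N" "g \<noteq> k" for g using that by (intro generate_field.incl) (auto intro!: image_eqI[of _ _ g])
  have "others k \<subseteq> ?K" using xK inv x_nz by (auto simp: others_def)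
  then have "P k \<in> ?K" using P_others[OF k] gen_least[OF K'] by blast
  moreover have x'K: "x' k \<in> ?K" using kN by (intro generate_field.incl) (auto intro!: image_eqI[of _ _ k])
  moreover have "x k = P k * inverse (x' k)" using P_eq[OF k] x'_nz[OF k] by simp
  ultimately have xk: "x k \<in> ?K" using mult inv x'_nz[OF k] by simp
  have "b \<in> ?K" for b
  proof (induction b rule: field_gen_induct[OF K])
    case (1 c) then show ?case using K' by simp
  next
    case (2 h)
    then obtain g where "g < N" "h = x g" by auto
    then show ?case using xK xk by (cases "g = k") auto
  next
    case (3 a b) then show ?case by (rule add)
  next
    case (4 a b) then show ?case by (rule mult)
  next
    case (5 a) then show ?case by (rule inv)
  qed
  then show "?K = UNIV" by auto
qed

theorem seed_mutate: assumes k: "k < n" shows "seed \<iota> n m (x(k := x' k)) (mutate_mat k B) (D' k)"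
proof
  show "mutate_mat k B \<in> carrier_mat (n + m) n" by (simp add: mutate_mat_def)
  show "independent_columns (mutate_mat k B)" by (rule independent_mutate[OF k])
  show "coords (n + m) (x(k := x' k)) (D' k)" by (rule coords_mutate[OF k])
  fix i j assume ij: "i < n" "j < n"
  then show "mutate_mat k B $$ (i, j) = - mutate_mat k B $$ (j, i)"
    using skew[of i j] skew[of k i] skew[of k j] k by (auto simp: mutate_mat_entry max_uminus min_uminus)
qed

section \<open>Rank two\<close>

text \<open>Only the leading term matters modulo \<open>u\<close>.\<close>

lemma power_add_multiple:
  assumes R: "subalg R" and "A \<in> R" "u \<in> R" "r \<in> R"
  shows "\<exists>q\<in>R. (A + u * r) ^ b = A ^ b + u * q"
proof (induction b)
  case 0 then show ?case using R by (intro bexI[of _ 0]) auto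
next
  case (Suc b)
  then obtain q where q: "q \<in> R" "(A + u * r) ^ b = A ^ b + u * q" by blast
  have "(A + u * r) ^ Suc b = A ^ Suc b + u * (A * q + r * A ^ b + u * r * q)" by (simp only: power_Suc q(2)) (simp add: algebra_simps)
  moreover have "A * q + r * A ^ b + u * r * q \<in> R" using assms q by (auto intro!: subalg_add subalg_mult subalg_power)
  ultimately show ?case by blast
qed

lemma nat_positive_parts:
  "(e::int) = a + int c \<Longrightarrow> nat (max e 0) + nat (max (- a) 0) = nat (max (- e) 0) + nat (max a 0) + c"
  by (cases "e \<ge> 0"; cases "a \<ge> 0") auto

text \<open>The exponents \<open>ej\<close>, \<open>ek\<close> are the columns \<open>j\<close> and \<open>k\<close> up to a common sign, chosen such that \<open>ej k > 0\<close>, and \<open>e\<close> is column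
  \<open>j\<close> after the mutation at \<open>k\<close>. Write \<open>U + V\<close> for the exchange polynomial at \<open>j\<close> after this mutation. The variable \<open>x' k\<close> occurs in \<open>V\<close> with
  exponent \<open>b\<close>, so \<open>x k ^ b\<close> turns it into a power of \<open>P k = A + x j * r\<close>. Modulo \<open>x j\<close> the result is a multiple of \<open>P j\<close>,
  which is \<open>x j * x' j\<close>; therefore it is divisible by \<open>x j\<close> in \<open>lower {j, k}\<close>.\<close>

lemma rank_two_exchange:
  fixes ej ek e :: "nat \<Rightarrow> int"
  assumes jk: "j < n" "k < n" "j \<noteq> k" and R: "lower {j, k} = R"
    and Pj: "P j = (\<Prod>i<N. x i ^ nat (max (ej i) 0)) + (\<Prod>i<N. x i ^ nat (max (- ej i) 0))"
    and Pk: "P k = (\<Prod>i<N. x i ^ nat (max (ek i) 0)) + (\<Prod>i<N. x i ^ nat (max (- ek i) 0))"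
    and b: "b > 0" "ej k = int b" "ek j = - int b" "ej j = 0" "ek k = 0"
    and e: "\<And>i. i < N \<Longrightarrow> e i = (if i = k then - int b else ej i + max (ek i) 0 * int b)"
  shows "\<exists>p. x k ^ p * (((\<Prod>i<N. (x(k := x' k)) i ^ nat (max (e i) 0)) + (\<Prod>i<N. (x(k := x' k)) i ^ nat (max (- e i) 0))) / x j) \<in> R"
proof -
  have jkN: "j < N" "k < N" using jk by auto
  have Rs: "subalg R" using R by auto
  have xR: "x i \<in> R" if "i < N" for i using x_lower(1)[OF that] R by auto
  have polyR: "(\<Prod>i\<in>I. x i ^ f i) \<in> R" if "I \<subseteq> {..<N}" for I and f :: "nat \<Rightarrow> nat" using xR that by (intro subalg_prod subalg_power Rs) auto
  define U where "U = (\<Prod>i<N. (x(k := x' k)) i ^ nat (max (e i) 0))"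
  define V where "V = (\<Prod>i<N. (x(k := x' k)) i ^ nat (max (- e i) 0))"
  define w where "w i = (if i = k then 0 else nat (max (- e i) 0))" for i
  define W where "W = (\<Prod>i<N. x i ^ w i)"
  define A where "A = (\<Prod>i<N. x i ^ nat (max (ek i) 0))"
  define Mj where "Mj = (\<Prod>i<N. x i ^ nat (max (ej i) 0))"
  define Nj where "Nj = (\<Prod>i<N. x i ^ nat (max (- ej i) 0))"
  have Vw: "V = x' k ^ b * W"
  proof -
    have "V = x' k ^ b * (\<Prod>i\<in>{..<N} - {k}. (x(k := x' k)) i ^ nat (max (- e i) 0))"
      unfolding V_def using jkN e[OF jkN(2)] by (subst prod.remove[of _ k]) auto
    also have "(\<Prod>i\<in>{..<N} - {k}. (x(k := x' k)) i ^ nat (max (- e i) 0)) = (\<Prod>i\<in>{..<N} - {k}. x i ^ w i)"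
      by (intro prod.cong) (auto simp: w_def)
    also have "\<dots> = W" unfolding W_def using jkN by (subst prod.remove[of "{..<N}" k]) (auto simp: w_def)
    finally show ?thesis .
  qed
  have Uid: "x k ^ b * U * Nj = W * Mj * A ^ b"
  proof -
    have "x k ^ b = (\<Prod>i<N. x i ^ (if i = k then b else 0))"
    proof -
      have "(\<Prod>i<N. x i ^ (if i = k then b else 0)) = (\<Prod>i<N. if i = k then x i ^ b else 1)" by (intro prod.cong) auto
      then show ?thesis using jkN by simp
    qed
    moreover have "U = (\<Prod>i<N. x i ^ nat (max (e i) 0))"
      unfolding U_def using e[OF jkN(2)] by (intro prod.cong) auto
    ultimately have "x k ^ b * U * Nj = (\<Prod>i<N. x i ^ ((if i = k then b else 0) + nat (max (e i) 0) + nat (max (- ej i) 0)))"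
      by (simp add: Nj_def prod.distrib power_add)
    also have "\<dots> = (\<Prod>i<N. x i ^ (w i + nat (max (ej i) 0) + nat (max (ek i) 0) * b))"
    proof (intro prod.cong refl arg_cong2[of _ _ _ _ "(^)"])
      fix i assume "i \<in> {..<N}"
      then have i: "i < N" by simp
      show "(if i = k then b else 0) + nat (max (e i) 0) + nat (max (- ej i) 0) = w i + nat (max (ej i) 0) + nat (max (ek i) 0) * b"
      proof (cases "i = k")
        case True then show ?thesis using e[OF i] b by (simp add: w_def)
      next
        case False
        have "e i = ej i + int (nat (max (ek i) 0) * b)" using e[OF i] False by simp
        from nat_positive_parts[OF this] show ?thesis using False by (simp only: w_def if_False add_0)
      qed
    qed
    also have "\<dots> = W * Mj * A ^ b"
      by (simp add: W_def Mj_def A_def prod.distrib power_add power_mult prod_power_distrib)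
    finally show ?thesis .
  qed
  obtain r where r: "r \<in> R" "(\<Prod>i<N. x i ^ nat (max (- ek i) 0)) = x j * r"
  proof -
    have "(\<Prod>i<N. x i ^ nat (max (- ek i) 0)) = x j ^ b * (\<Prod>i\<in>{..<N} - {j}. x i ^ nat (max (- ek i) 0))"
      using jkN b by (subst prod.remove[of _ j]) auto
    also have "\<dots> = x j * (x j ^ (b - 1) * (\<Prod>i\<in>{..<N} - {j}. x i ^ nat (max (- ek i) 0)))"
      using b(1) power_Suc[of "x j" "b - 1"] by (simp add: mult.assoc)
    finally have e: "(\<Prod>i<N. x i ^ nat (max (- ek i) 0)) = \<dots>" .
    show thesis
      by (rule that[OF _ e]) (use xR jkN polyR in \<open>auto intro!: subalg_mult subalg_power Rs\<close>)
  qed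
  have AR: "A \<in> R" "W \<in> R" using polyR by (auto simp: A_def W_def)
  obtain q where q: "q \<in> R" "(A + x j * r) ^ b = A ^ b + x j * q"
    using power_add_multiple[OF Rs AR(1) xR[OF jkN(1)] r(1)] by blast
  have Pk': "x k * x' k = A + x j * r" using P_eq[OF jk(2)] Pk r by (simp add: A_def)
  have Pj': "x j * x' j = Mj + Nj" using P_eq[OF jk(1)] Pj by (simp add: Mj_def Nj_def)
  have Nj_nz: "Nj \<noteq> 0" using x_nz by (auto simp: Nj_def)
  have NjR: "inverse Nj \<in> R"
    unfolding Nj_def
  proof (rule subalg_inverse_prod_power[OF Rs])
    fix i assume i: "i \<in> {..<N}" "nat (max (- ej i) 0) > 0"
    then have "i \<notin> {j, k}" using b by auto
    then show "inverse (x i) \<in> R" using x_lower(2)[of i "{j, k}"] i R by auto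
  qed
  have "x k ^ b * (U + V) * Nj = W * Mj * A ^ b + (x k * x' k) ^ b * W * Nj"
    unfolding Vw power_mult_distrib using Uid by (simp add: algebra_simps)
  also have "\<dots> = W * (A ^ b * (Mj + Nj)) + x j * (q * W * Nj)"
    unfolding Pk' q(2) by (simp add: algebra_simps)
  also have "\<dots> = x j * (W * (A ^ b * x' j + q * Nj))"
    unfolding Pj'[symmetric] by (simp add: algebra_simps)
  finally have "x k ^ b * ((U + V) / x j) * Nj = W * (A ^ b * x' j + q * Nj)"
    using x_nz[OF jkN(1)] by (simp add: field_simps)
  then have "x k ^ b * ((U + V) / x j) = W * (A ^ b * x' j + q * Nj) * inverse Nj"
    using Nj_nz by (simp add: field_simps)
  also have "\<dots> = W * (A ^ b * x' j * inverse Nj + q)" using Nj_nz by (simp add: field_simps)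
  also have "\<dots> \<in> R" using AR q(1) NjR x_lower(3)[of j "{j, k}"] R by (auto intro!: subalg_mult subalg_add subalg_power Rs)
  finally show ?thesis unfolding U_def V_def by blast
qed

text \<open>Membership is checked after multiplication by powers of \<open>x j\<close> and of \<open>x k\<close>, which generate the unit ideal when \<open>j\<close> and \<open>k\<close> are
  joined. Multiplication by \<open>x j\<close> leaves the exchange polynomial of the mutated seed.\<close>

theorem rank_two_variable:
  assumes jk: "j < n" "k < n" "j \<noteq> k"
  shows "fst (mutate j (mutate k (x, B))) j \<in> lower {j, k}"
proof -
  let ?B = "mutate_mat k B" and ?x = "x(k := x' k)"
  have jkN: "j < N" "k < N" using jk by auto
  have m: "fst (mutate j (mutate k (x, B))) j = ((\<Prod>i<N. ?x i ^ nat (max (?B $$ (i, j)) 0)) + (\<Prod>i<N. ?x i ^ nat (max (- ?B $$ (i, j)) 0))) / x j"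
    unfolding mutate_seed using jk by (simp add: mutate_def)
  have Bjk: "B $$ (j, k) = - B $$ (k, j)" using skew[OF jk(1,2)] .
  show ?thesis
  proof (cases "B $$ (k, j) = 0")
    case True
    have "?B $$ (i, j) = B $$ (i, j)" if "i < N" for i
      using that True jk by (auto simp: mutate_mat_entry)
    then have "(\<Prod>i<N. ?x i ^ nat (max (?B $$ (i, j)) 0)) = pos j" "(\<Prod>i<N. ?x i ^ nat (max (- ?B $$ (i, j)) 0)) = neg j"
      unfolding pos_def neg_def using True by (auto intro!: prod.cong)
    then have "fst (mutate j (mutate k (x, B))) j = x' j" unfolding m by (simp add: x'_def P_def)
    then show ?thesis using x_lower(3)[of j "{j, k}"] by simp
  next
    case False
    let ?R = "lower {j, k}"
    have cm: "comaximal ?R {x j, x k}"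
    proof (cases "B $$ (k, j) > 0")
      case True
      have "comaximal ?R {x k, x j}"
        using True Bjk skew_diag[of k] jk by (intro source_comaximal) auto
      then show ?thesis by (simp add: insert_commute)
    next
      case f: False
      show ?thesis using False f Bjk skew_diag[of j] jk by (intro source_comaximal) auto
    qed
    show ?thesis
    proof (rule membership_local[OF subalg_lower cm])
      show "{x j, x k} \<subseteq> ?R" using x_lower(1) jkN by auto
      fix f assume "f \<in> {x j, x k}"
      then consider "f = x j" | "f = x k" by auto
      then show "\<exists>p. f ^ p * fst (mutate j (mutate k (x, B))) j \<in> ?R"
      proof cases
        case 1
        have xR: "?x i \<in> ?R" if "i < N" for i using x_lower(1)[OF that] x_lower(3)[of k "{j, k}"] by auto
        have pR: "(\<Prod>i<N. ?x i ^ e i) \<in> ?R" for e using xR by (intro subalg_prod subalg_power subalg_lower) (simp only: lessThan_iff)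
        have "x j ^ 1 * fst (mutate j (mutate k (x, B))) j = (\<Prod>i<N. ?x i ^ nat (max (?B $$ (i, j)) 0)) + (\<Prod>i<N. ?x i ^ nat (max (- ?B $$ (i, j)) 0))"
          unfolding m using x_nz[OF jkN(1)] by simp
        also have "\<dots> \<in> ?R" by (intro subalg_add[OF subalg_lower] pR)
        finally show ?thesis using 1 by blast
      next
        case 2
        have "\<exists>p. x k ^ p * (((\<Prod>i<N. ?x i ^ nat (max (?B $$ (i, j)) 0)) + (\<Prod>i<N. ?x i ^ nat (max (- ?B $$ (i, j)) 0))) / x j) \<in> ?R"
        proof (cases "B $$ (k, j) > 0")
          case True
          show ?thesis
          proof (rule rank_two_exchange[OF jk refl, where ej = "\<lambda>i. B $$ (i, j)" and ek = "\<lambda>i. B $$ (i, k)" and b = "nat (B $$ (k, j))" and e = "\<lambda>i. ?B $$ (i, j)"])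
            fix i assume i: "i < N"
            show "?B $$ (i, j) = (if i = k then - int (nat (B $$ (k, j))) else B $$ (i, j) + max (B $$ (i, k)) 0 * int (nat (B $$ (k, j))))"
              using True i jk by (auto simp: mutate_mat_entry)
          qed (use True Bjk skew_diag jk in \<open>auto simp: P_def pos_def neg_def\<close>)
        next
          case f: False
          have "\<exists>p. x k ^ p * (((\<Prod>i<N. ?x i ^ nat (max (- ?B $$ (i, j)) 0)) + (\<Prod>i<N. ?x i ^ nat (max (- (- ?B $$ (i, j))) 0))) / x j) \<in> ?R"
          proof (rule rank_two_exchange[OF jk refl, where ej = "\<lambda>i. - B $$ (i, j)" and ek = "\<lambda>i. - B $$ (i, k)" and b = "nat (- B $$ (k, j))" and e = "\<lambda>i. - ?B $$ (i, j)"])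
            fix i assume i: "i < N"
            show "- ?B $$ (i, j) = (if i = k then - int (nat (- B $$ (k, j))) else - B $$ (i, j) + max (- B $$ (i, k)) 0 * int (nat (- B $$ (k, j))))"
              using False f i jk by (auto simp: mutate_mat_entry max_uminus)
          qed (use False f Bjk skew_diag jk in \<open>auto simp: P_def pos_def neg_def add.commute\<close>)
          then show ?thesis by (simp add: add.commute)
        qed
        then show ?thesis unfolding m using 2 by simp
      qed
    qed
  qed
qed

end

section \<open>Mutation classes and the Laurent phenomenon\<close>

context complex_field
begin

text \<open>Having logarithmic vector fields and independent columns, in addition to skew-symmetry. Unlike the conditions on a seed in the
  definition, this is easily seen to be preserved by mutation.\<close>

definition good_seed :: "nat \<Rightarrow> nat \<Rightarrow> 'f seed \<Rightarrow> bool" where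
  "good_seed n m s \<longleftrightarrow> (\<exists>D. seed \<iota> n m (fst s) (snd s) D)"

text \<open>Regularity on the cluster torus and its neighbors: the condition that will be shown to be independent of the
  torus.\<close>

definition regular_near :: "nat \<Rightarrow> ('f \<times> 'f list) list \<Rightarrow> 'f seed \<Rightarrow> bool" where
  "regular_near n v s \<longleftrightarrow> extends_to (torus_ring \<iota> s) v \<and> (\<forall>i<n. extends_to (torus_ring \<iota> (mutate i s)) v)"

end

context seed
begin

text \<open>The roles of the two seeds are exchanged: the variable \<open>x' j\<close> is obtained from the seed mutated at \<open>k\<close> by mutating first
  at \<open>k\<close>, back to the original seed, and then at \<open>j\<close>.\<close>

lemma mutated_lower:
  assumes jk: "j < n" "k < n" "j \<noteq> k" shows "lower {j, k} \<subseteq> torus_ring \<iota> (mutate j (mutate k (x, B)))"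
proof -
  interpret t: seed \<iota> n m "x(k := x' k)" "mutate_mat k B" "D' k" by (rule seed_mutate[OF jk(2)])
  have inv: "mutate k (x(k := x' k), mutate_mat k B) = (x, B)" using mutate_mutate[OF jk(2)] unfolding mutate_seed .
  have tx': "t.x' k = x k" using t.mutate_seed[of k] unfolding inv by (auto simp: fun_eq_iff split: if_splits)
  have kN: "k < N" using jk by simp
  have x: "x l \<in> t.lower {j, k}" if "l < N" for l
    using t.x_lower(3)[of k "{j, k}"] t.x_lower(1)[OF that, of "{j, k}"] tx' by (cases "l = k") auto
  moreover have "inverse (x g) \<in> t.lower {j, k}" if "g < N" "g \<notin> {j, k}" for g
    using t.x_lower(2)[OF that] that by simp
  moreover have "x' i \<in> t.lower {j, k}" if "i \<in> {j, k}" for i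
  proof (cases "i = k")
    case True then show ?thesis using t.x_lower(1)[OF kN, of "{j, k}"] by simp
  next
    case False
    have "fst (mutate j (mutate k (x(k := x' k), mutate_mat k B))) j \<in> t.lower {j, k}" by (rule t.rank_two_variable[OF jk])
    then show ?thesis unfolding inv mutate_seed using that False by simp
  qed
  ultimately have "lower {j, k} \<subseteq> t.lower {j, k}" unfolding lower_def by (intro gen_least) auto
  also have "t.lower {j, k} \<subseteq> t.Tor' j" using jk by (intro t.lower_Tor') auto
  finally show ?thesis unfolding t.Tor'_def mutate_seed .
qed

lemma acyclic_pair: assumes "j < n" "k < n" shows "acyclic (quiver {j, k} B)"
proof -
  have e: "B $$ (j, k) = - B $$ (k, j)" using skew[OF assms] .
  consider "B $$ (j, k) \<ge> 0" | "B $$ (k, j) \<ge> 0" using e by linarith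
  then have "\<exists>a b. quiver {j, k} B \<subseteq> {(a, b)} \<and> (a \<noteq> b \<or> quiver {j, k} B = {})"
  proof cases
    case 1
    have "quiver {j, k} B \<subseteq> {(j, k)}" using 1 e skew_diag assms by (auto simp: quiver_def)
    moreover have "quiver {j, k} B = {}" if "j = k" using that skew_diag assms by (auto simp: quiver_def)
    ultimately show ?thesis by blast
  next
    case 2
    have "quiver {j, k} B \<subseteq> {(k, j)}" using 2 e skew_diag assms by (auto simp: quiver_def)
    moreover have "quiver {j, k} B = {}" if "j = k" using that skew_diag assms by (auto simp: quiver_def)
    ultimately show ?thesis by blast
  qed
  then obtain a b where ab: "quiver {j, k} B \<subseteq> {(a, b)}" "a \<noteq> b \<or> quiver {j, k} B = {}" by blast
  show ?thesis
  proof (cases "a = b")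
    case False
    then have "acyclic {(a, b)}" by (simp add: acyclic_insert wf_acyclic)
    then show ?thesis using ab(1) by (rule acyclic_subset)
  next
    case True
    then show ?thesis using ab(2) by (simp add: acyclic_def)
  qed
qed

text \<open>The torus reached by the mutations at \<open>k\<close> and \<open>j\<close> lies in the acyclic chart with mutable directions \<open>j\<close> and \<open>k\<close>, to which the form
  extends by the acyclic case.\<close>

lemma regular_near_mutate_aux:
  assumes k: "k < n" and v: "regular_near n v (x, B)" shows "regular_near n v (mutate k (x, B))"
  unfolding regular_near_def
proof (intro conjI allI impI)
  show "extends_to (torus_ring \<iota> (mutate k (x, B))) v" using v k by (simp add: regular_near_def)
  fix j assume j: "j < n"
  show "extends_to (torus_ring \<iota> (mutate j (mutate k (x, B)))) v"
  proof (cases "j = k")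
    case True
    then show ?thesis using v mutate_mutate[OF k] by (simp add: regular_near_def)
  next
    case False
    have "good_chart {j, k}" using acyclic_pair[OF j k] j k by (intro acyclic_good_chart) auto
    then have "extends_to (lower {j, k}) v"
      using v j k by (auto simp: good_chart_def regular_near_def Tor_def Tor'_def)
    then show ?thesis using mutated_lower[OF j k False] by (rule extends_mono)
  qed
qed

lemma regular_near_variable: assumes i: "i < N" shows "regular_near n [(x i, [])] (x, B)"
proof -
  have "x i \<in> Tor' j" if "j < n" for j using lower_Tor'[of "{j}" j] x_lower(1)[OF i, of "{j}"] that by auto
  then show ?thesis using x_Tor(1)[OF i] by (auto simp: regular_near_def Tor_def Tor'_def extends_function_iff[OF subalg_Tor[unfolded Tor_def]]
      extends_function_iff[OF subalg_Tor'[unfolded Tor'_def]])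
qed

end

context complex_field
begin

lemma good_seed_mutate: assumes "good_seed n m s" "k < n" shows "good_seed n m (mutate k s)" "mutate k (mutate k s) = s"
  "regular_near n v s \<Longrightarrow> regular_near n v (mutate k s)"
proof -
  obtain D where D: "seed \<iota> n m (fst s) (snd s) D" using assms by (auto simp: good_seed_def)
  interpret seed \<iota> n m "fst s" "snd s" D by (rule D)
  show "good_seed n m (mutate k s)" using seed_mutate[OF assms(2)] mutate_seed[of k] by (auto simp: good_seed_def)
  show "mutate k (mutate k s) = s" using mutate_mutate[OF assms(2)] by simp
  show "regular_near n v s \<Longrightarrow> regular_near n v (mutate k s)" using regular_near_mutate_aux[OF assms(2)] by simp
qed

lemma regular_near_mutate_iff: assumes "good_seed n m s" "k < n" shows "regular_near n v (mutate k s) \<longleftrightarrow> regular_near n v s"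
  using good_seed_mutate[OF assms] good_seed_mutate(3)[OF good_seed_mutate(1)[OF assms] assms(2), of v] by auto

lemma class_mono: "t \<in> mutation_class S s \<Longrightarrow> S \<subseteq> T \<Longrightarrow> t \<in> mutation_class T s"
  by (induction rule: mutation_class.induct) (auto intro: mutation_class.intros)

lemma class_trans: "u \<in> mutation_class S t \<Longrightarrow> t \<in> mutation_class S s \<Longrightarrow> u \<in> mutation_class S s"
  by (induction rule: mutation_class.induct) (auto intro: mutation_class.intros)

lemma class_good: "t \<in> mutation_class S s \<Longrightarrow> S \<subseteq> {..<n} \<Longrightarrow> good_seed n m s \<Longrightarrow> good_seed n m t"
  by (induction rule: mutation_class.induct) (auto intro: good_seed_mutate)

lemma class_regular_near: "t \<in> mutation_class S s \<Longrightarrow> S \<subseteq> {..<n} \<Longrightarrow> good_seed n m s \<Longrightarrow> regular_near n v t \<longleftrightarrow> regular_near n v s"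
proof (induction rule: mutation_class.induct)
  case (step t k)
  have "good_seed n m t" "k < n" using class_good[OF step(1,4,5)] step by auto
  then show ?case using regular_near_mutate_iff step by blast
qed simp

lemma class_frozen: "t \<in> mutation_class S s \<Longrightarrow> g \<notin> S \<Longrightarrow> fst t g = fst s g"
  by (induction rule: mutation_class.induct) (auto simp: mutate_def split: prod.splits)

lemma good_seed_dims: "good_seed n m s \<Longrightarrow> dim_row (snd s) = n + m \<and> dim_col (snd s) = n"
  by (auto simp: good_seed_def seed_def seed_axioms_def)

lemma subalg_torus [simp]: "subalg (torus_ring \<iota> t)"
  by (simp add: torus_ring_def)

text \<open>A cluster variable, as a form of degree 0, is regular on the tori of its own seed and of the neighbors.\<close>

theorem laurent_phenomenon:
  assumes s: "good_seed n m s" and t: "t \<in> mutation_class {..<n} s" "u \<in> mutation_class {..<n} s" and i: "i < n + m"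
  shows "fst t i \<in> torus_ring \<iota> u"
proof -
  obtain D where D: "seed \<iota> n m (fst t) (snd t) D" using class_good[OF t(1) _ s] by (auto simp: good_seed_def)
  have "regular_near n [(fst t i, [])] t" using seed.regular_near_variable[OF D i] by simp
  then have "regular_near n [(fst t i, [])] u" using class_regular_near[OF t(1) _ s] class_regular_near[OF t(2) _ s] by simp
  then show ?thesis by (simp add: regular_near_def extends_function_iff)
qed

lemma cluster_algebra_torus:
  assumes s: "good_seed n m s" and t: "t \<in> mutation_class {..<n} s"
  shows "cluster_algebra \<iota> {..<n} s \<subseteq> torus_ring \<iota> t"
  unfolding cluster_algebra_def
proof (rule gen_least)
  have dims: "dim_row (snd s) = n + m" "dim_row (snd t) = n + m" using good_seed_dims[OF s] good_seed_dims[OF class_good[OF t _ s]] by auto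
  have "inverse (fst s i) \<in> torus_ring \<iota> t" if "i < n + m" "i \<notin> {..<n}" for i
    using class_frozen[OF t that(2)] that(1) unfolding torus_ring_def dims by (intro gen_incl UnI2 image_eqI[of _ _ i]) auto
  then show "{x i |x B i. (x, B) \<in> mutation_class {..<n} s \<and> i < dim_row (snd s)} \<union> {inverse (fst s i) |i. i < dim_row (snd s) \<and> i \<notin> {..<n}} \<subseteq> torus_ring \<iota> t"
    using laurent_phenomenon[OF s _ t] unfolding dims by fastforce
qed simp

section \<open>Acyclic cluster charts\<close>

text \<open>The cluster variables of the chart are regular on the torus of \<open>u\<close> and its neighbors by the Laurent
  phenomenon, hence lie in the lower bound of \<open>u\<close> by the acyclic case. The converse inclusion is clear from the generators.\<close>

lemma chart_eq_lower:
  assumes s: "good_seed n m s" and t: "t \<in> mutation_class {..<n} s" and S: "S \<subseteq> {..<n}"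
    and u: "u \<in> mutation_class S t" "acyclic (quiver S (snd u))"
  shows "\<exists>D. seed \<iota> n m (fst u) (snd u) D \<and> seed.good_chart \<iota> n m (fst u) (snd u) S \<and> cluster_algebra \<iota> S t = seed.lower \<iota> n m (fst u) (snd u) S"
proof -
  have us: "u \<in> mutation_class {..<n} s" using class_trans[OF class_mono[OF u(1) S] t] .
  obtain D where Du: "seed \<iota> n m (fst u) (snd u) D" using class_good[OF us _ s] by (auto simp: good_seed_def)
  interpret seed \<iota> n m "fst u" "snd u" D by (rule Du)
  have dims: "dim_row (snd t) = N" using good_seed_dims[OF class_good[OF t _ s]] by simp
  have chart: "good_chart S" by (rule acyclic_good_chart[OF S u(2)])
  have frozen: "fst t g = fst u g" if "g \<notin> S" for g using class_frozen[OF u(1) that] by simp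
  have mut: "mutate i u = ((fst u)(i := x' i), mutate_mat i (snd u))" for i using mutate_seed[of i] by simp
  have "cluster_algebra \<iota> S t \<subseteq> lower S"
    unfolding cluster_algebra_def dims
  proof (rule gen_least)
    have "y i \<in> lower S" if yC: "(y, C) \<in> mutation_class S t" and i: "i < N" for y C i
    proof -
      have w: "(y, C) \<in> mutation_class {..<n} s" using class_trans[OF class_mono[OF yC S] t] .
      have "y i \<in> Tor" using laurent_phenomenon[OF s w us i] by (simp add: Tor_def)
      moreover have "y i \<in> Tor' j" if "j \<in> S" for j
      proof -
        have "mutate j u \<in> mutation_class {..<n} s" using us that S by (auto intro: mutation_class.step)
        then show ?thesis using laurent_phenomenon[OF s w _ i] by (simp add: Tor'_def)
      qed
      ultimately have "extends_to Tor [(y i, [])]" "\<forall>j\<in>S. extends_to (Tor' j) [(y i, [])]" by (simp_all add: extends_function_iff)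
      then have "extends_to (lower S) [(y i, [])]" using chart unfolding good_chart_def by blast
      then show ?thesis by (simp add: extends_function_iff)
    qed
    then show "{x i |x B i. (x, B) \<in> mutation_class S t \<and> i < N} \<union> {inverse (fst t i) |i. i < N \<and> i \<notin> S} \<subseteq> lower S"
      using frozen x_lower(2) by auto
  qed simp
  moreover have "lower S \<subseteq> cluster_algebra \<iota> S t"
    unfolding lower_def
  proof (rule gen_least)
    show "subalg (cluster_algebra \<iota> S t)" by (simp add: cluster_algebra_def)
    have "fst u g \<in> cluster_algebra \<iota> S t" if "g < N" for g
      unfolding cluster_algebra_def dims using u(1) that by (intro gen_incl UnI1) (auto intro!: exI[of _ "fst u"] exI[of _ "snd u"])
    moreover have "inverse (fst u g) \<in> cluster_algebra \<iota> S t" if "g < N" "g \<notin> S" for g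
      unfolding cluster_algebra_def dims using frozen[OF that(2)] that by (intro gen_incl) auto
    moreover have "x' i \<in> cluster_algebra \<iota> S t" if "i \<in> S" for i
    proof -
      have "mutate i u \<in> mutation_class S t" using u(1) that by (rule mutation_class.step)
      then have "((fst u)(i := x' i), mutate_mat i (snd u)) \<in> mutation_class S t" by (simp add: mut)
      moreover have "i < N" using that S by auto
      moreover have "x' i = ((fst u)(i := x' i)) i" by simp
      ultimately show ?thesis unfolding cluster_algebra_def dims by (intro gen_incl UnI1) blast
    qed
    ultimately show "fst u ` {..<N} \<union> {inverse (fst u g) |g. g < N \<and> g \<notin> S} \<union> x' ` S \<subseteq> cluster_algebra \<iota> S t" by auto
  qed
  ultimately show ?thesis using Du chart by blast
qed

section \<open>Coverings by principal open sets\<close>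

lemma subalg_cring: "subalg R \<Longrightarrow> cring (class_ring\<lparr>carrier := R\<rparr>)"
proof -
  assume R: "subalg R"
  show ?thesis
  proof (rule cringI)
    show "abelian_group (class_ring\<lparr>carrier := R\<rparr>)"
    proof (rule abelian_groupI)
      fix a assume "a \<in> carrier (class_ring\<lparr>carrier := R\<rparr>)"
      then show "\<exists>b\<in>carrier (class_ring\<lparr>carrier := R\<rparr>). b \<oplus>\<^bsub>class_ring\<lparr>carrier := R\<rparr>\<^esub> a = \<zero>\<^bsub>class_ring\<lparr>carrier := R\<rparr>\<^esub>"
        using R by (intro bexI[of _ "- a"]) (auto intro: subalg_uminus)
    qed (use R in \<open>auto intro: subalg_add simp: add_ac\<close>)
    show "comm_monoid (class_ring\<lparr>carrier := R\<rparr>)"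
      by (rule comm_monoidI) (use R in \<open>auto intro: subalg_mult simp: mult_ac\<close>)
  qed (use R in \<open>auto simp: distrib_right\<close>)
qed

lemma spec_proper:
  assumes q: "q \<in> spec R" and f: "f \<in> q" "inverse f \<in> R" "f \<noteq> 0" shows False
proof -
  interpret primeideal q "class_ring\<lparr>carrier := R\<rparr>" using q by (simp add: spec_def)
  have "inverse f * f \<in> q" using I_l_closed[of f "inverse f"] f by simp
  then have "1 \<in> q" using f by simp
  then have "q = carrier (class_ring\<lparr>carrier := R\<rparr>)" by (intro one_imp_carrier) simp
  then show False using I_notcarr by simp
qed

text \<open>By Zorn's lemma there is a maximal ideal over \<open>I\<close>.\<close>

lemma exists_prime:
  assumes R: "subalg R" and I: "ideal_in R I" "1 \<notin> I"
  shows "\<exists>p\<in>spec R. I \<subseteq> p"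
proof -
  let ?A = "{J. ideal_in R J \<and> I \<subseteq> J \<and> 1 \<notin> J}"
  have "\<exists>M\<in>?A. \<forall>X\<in>?A. M \<subseteq> X \<longrightarrow> X = M"
  proof (rule subset_Zorn_nonempty)
    show "?A \<noteq> {}" using I by auto
    fix C assume C: "C \<noteq> {}" "subset.chain ?A C"
    have CA: "J \<in> C \<Longrightarrow> ideal_in R J \<and> I \<subseteq> J \<and> 1 \<notin> J" for J using C(2) by (auto simp: subset.chain_def)
    have "ideal_in R (\<Union>C)"
      unfolding ideal_in_def
    proof (intro conjI ballI)
      show "\<Union>C \<subseteq> R" using CA unfolding ideal_in_def by blast
      show "0 \<in> \<Union>C" using CA C(1) unfolding ideal_in_def by blast
    next
      fix a b assume "a \<in> \<Union>C" "b \<in> \<Union>C"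
      then obtain J L where JL: "J \<in> C" "a \<in> J" "L \<in> C" "b \<in> L" by auto
      then have "J \<subseteq> L \<or> L \<subseteq> J" using C(2) by (auto simp: subset.chain_def)
      then show "a + b \<in> \<Union>C" using JL CA[OF JL(1)] CA[OF JL(3)] unfolding ideal_in_def by blast
    next
      fix r a assume "r \<in> R" "a \<in> \<Union>C"
      then show "r * a \<in> \<Union>C" using CA unfolding ideal_in_def by blast
    qed
    then show "\<Union>C \<in> ?A" using CA C(1) by blast
  qed
  then obtain M where M0: "M \<in> ?A" "\<forall>X\<in>?A. M \<subseteq> X \<longrightarrow> X = M" by blast
  have M: "ideal_in R M" "I \<subseteq> M" "1 \<notin> M" using M0(1) by auto
  have M4: "X = M" if "ideal_in R X" "1 \<notin> X" "M \<subseteq> X" for X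
  proof -
    have "X \<in> ?A" using that M(2) by blast
    then show ?thesis using M0(2) that(3) by blast
  qed
  have Mr: "M \<subseteq> R" "0 \<in> M" "\<And>a b. a \<in> M \<Longrightarrow> b \<in> M \<Longrightarrow> a + b \<in> M" "\<And>r a. r \<in> R \<Longrightarrow> a \<in> M \<Longrightarrow> r * a \<in> M"
    using M(1) by (auto simp: ideal_in_def)
  have Mr5: "a * r \<in> M" if "r \<in> R" "a \<in> M" for r a using Mr(4)[OF that] by (simp add: mult.commute)
  interpret R: cring "class_ring\<lparr>carrier := R\<rparr>" by (rule subalg_cring[OF R])
  have Mneg: "- a \<in> M" if aM: "a \<in> M" for a
  proof -
    have "\<iota> (-1) * a \<in> M" by (rule Mr(4)[OF subalg_const[OF R] aM])
    then show ?thesis by (simp add: hom_distribs)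
  qed
  have inv: "a_inv (class_ring\<lparr>carrier := R\<rparr>) a = - a" if "a \<in> R" for a
    using R.minus_equality[of "- a" a] that R by (simp add: subalg_uminus)
  have "primeideal M (class_ring\<lparr>carrier := R\<rparr>)"
  proof (rule primeidealI)
    show "ideal M (class_ring\<lparr>carrier := R\<rparr>)"
    proof (rule idealI)
      show "ring (class_ring\<lparr>carrier := R\<rparr>)" by (rule R.ring_axioms)
      show "subgroup M (add_monoid (class_ring\<lparr>carrier := R\<rparr>))"
      proof (rule subgroup.intro)
        fix a assume "a \<in> M"
        then show "inv\<^bsub>add_monoid (class_ring\<lparr>carrier := R\<rparr>)\<^esub> a \<in> M"
          using inv[of a] Mneg Mr(1) by (auto simp: a_inv_def)
      qed (use Mr in auto)
    qed (use Mr Mr5 in auto)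
    show "cring (class_ring\<lparr>carrier := R\<rparr>)" by (rule R.cring_axioms)
    show "carrier (class_ring\<lparr>carrier := R\<rparr>) \<noteq> M" using M(3) R by auto
    fix a b assume ab: "a \<in> carrier (class_ring\<lparr>carrier := R\<rparr>)" "b \<in> carrier (class_ring\<lparr>carrier := R\<rparr>)" "a \<otimes>\<^bsub>class_ring\<lparr>carrier := R\<rparr>\<^esub> b \<in> M"
    show "a \<in> M \<or> b \<in> M"
    proof (rule disjCI)
      assume b: "b \<notin> M"
      let ?X = "{c + r * b |c r. c \<in> M \<and> r \<in> R}"
      have X: "c + r * b \<in> ?X" if "c \<in> M" "r \<in> R" for c r using that by blast
      have "ideal_in R ?X"
        unfolding ideal_in_def
      proof (intro conjI ballI)
        have "b \<in> R" using ab by simp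
        then show "?X \<subseteq> R" using Mr(1) subalg_add[OF R] subalg_mult[OF R] by blast
        show "0 \<in> ?X" using X[OF Mr(2) subalg_0[OF R]] by simp
      next
        fix p q assume "p \<in> ?X" "q \<in> ?X"
        then obtain c r d s where h: "p = c + r * b" "q = d + s * b" "c \<in> M" "r \<in> R" "d \<in> M" "s \<in> R" by blast
        have "p + q = (c + d) + (r + s) * b" by (simp add: h algebra_simps)
        then show "p + q \<in> ?X" using X[OF Mr(3)[OF h(3,5)] subalg_add[OF R h(4,6)]] by simp
      next
        fix t p assume t: "t \<in> R" and "p \<in> ?X"
        then obtain c r where h: "p = c + r * b" "c \<in> M" "r \<in> R" by blast
        have "t * p = t * c + (t * r) * b" by (simp add: h algebra_simps)
        then show "t * p \<in> ?X" using X[OF Mr(4)[OF t h(2)] subalg_mult[OF R t h(3)]] by simp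
      qed
      moreover have "M \<subseteq> ?X" using X[OF _ subalg_0[OF R]] by auto
      moreover have "b \<in> ?X" using X[OF Mr(2) subalg_1[OF R]] by simp
      ultimately have "1 \<in> ?X" using M4[of ?X] b by blast
      then obtain c r where cr: "1 = c + r * b" "c \<in> M" "r \<in> R" by blast
      have aR: "a \<in> R" and abM: "a * b \<in> M" using ab by simp_all
      have "a = a * (c + r * b)" by (simp flip: cr(1))
      also have "\<dots> = a * c + r * (a * b)" by (simp add: algebra_simps)
      also have "\<dots> \<in> M" by (rule Mr(3)[OF Mr(4)[OF aR cr(2)] Mr(4)[OF cr(3) abM]])
      finally show "a \<in> M" .
    qed
  qed
  then show ?thesis using M(2) by (auto simp: spec_def)
qed

text \<open>A prime containing all \<open>f c\<close> would come from a prime of some \<open>Q c\<close>, where \<open>f c\<close> is a unit.\<close>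

lemma spec_cover_comaximal:
  assumes R: "subalg R" and cover: "spec R \<subseteq> (\<Union>c\<in>C. (\<lambda>q. q \<inter> R) ` spec (Q c))"
    and f: "\<And>c. c \<in> C \<Longrightarrow> inverse (f c) \<in> Q c \<and> f c \<noteq> 0"
  shows "comaximal R (f ` C)"
  unfolding comaximal_def
proof (intro allI impI, rule ccontr)
  fix I assume I: "ideal_in R I" "f ` C \<subseteq> I" "1 \<notin> I"
  obtain p where p: "p \<in> spec R" "I \<subseteq> p" using exists_prime[OF R I(1,3)] by blast
  then obtain c q where c: "c \<in> C" "q \<in> spec (Q c)" "p = q \<inter> R" using cover by blast
  then have "f c \<in> q" using I p by blast
  then show False using spec_proper[OF c(2)] f[OF c(1)] by blast
qed

lemma localization_by_inverses:
  assumes A: "subalg A" and J: "finite J" "\<And>i. i \<in> J \<Longrightarrow> x i \<in> A \<and> x i \<noteq> 0" and b: "b \<in> subalgebra_gen \<iota> (A \<union> {inverse (x i) |i. i \<in> J})"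
  shows "\<exists>p. (\<Prod>i\<in>J. x i) ^ p * b \<in> A"
proof -
  let ?f = "\<Prod>i\<in>J. x i"
  have fA: "?f \<in> A" using J by (intro subalg_prod A) auto
  have up: "?f ^ (p + q) * b \<in> A" if "?f ^ p * b \<in> A" for p q b
    using subalg_mult[OF A subalg_power[OF A fA, of q] that] by (simp add: power_add mult_ac)
  show ?thesis using b
  proof (induction rule: gen_induct)
    case (const c) then show ?case using A by (intro exI[of _ 0]) simp
  next
    case (incl h)
    then consider "h \<in> A" | i where "i \<in> J" "h = inverse (x i)" by auto
    then show ?case
    proof cases
      case 1 then show ?thesis by (intro exI[of _ 0]) simp
    next
      case 2
      have "?f * h = (\<Prod>i\<in>J - {i}. x i)" using 2 J by (simp add: prod.remove[of J i])
      also have "\<dots> \<in> A" using J by (intro subalg_prod A) auto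
      finally show ?thesis by (intro exI[of _ 1]) simp
    qed
  next
    case (add a b)
    then obtain p q where pq: "?f ^ p * a \<in> A" "?f ^ q * b \<in> A" by blast
    have "?f ^ (p + q) * (a + b) = ?f ^ (p + q) * a + ?f ^ (q + p) * b" by (simp add: distrib_left add.commute)
    then show ?case using subalg_add[OF A up[OF pq(1), of q] up[OF pq(2), of p]] by metis
  next
    case (mult a b)
    then obtain p q where pq: "?f ^ p * a \<in> A" "?f ^ q * b \<in> A" by blast
    have "?f ^ (p + q) * (a * b) = (?f ^ p * a) * (?f ^ q * b)" by (simp only: power_add mult_ac)
    then show ?case using subalg_mult[OF A pq] by metis
  qed
qed

end

context complex_field
begin

text \<open>The chart of a pair \<open>(t, S)\<close> is the localization at the product of the cluster variables of \<open>t\<close> in the mutable directions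
  outside \<open>S\<close>. The charts are lower bounds of acyclic seeds, for which both claims are known, and the forms are glued
  along the cover.\<close>

theorem locally_acyclic_forms:
  assumes s: "good_seed n m s" and la: "locally_acyclic \<iota> s"
  defines "A \<equiv> cluster_algebra \<iota> {..<n} s"
  shows "torsion_free A" "regular_near n v s \<Longrightarrow> extends_to A v"
proof -
  have mut: "mutable s = {..<n}" using good_seed_dims[OF s] by simp
  have subA: "subalg A" by (simp add: A_def cluster_algebra_def)
  obtain C where C0: "\<forall>(t, S)\<in>C. t \<in> mutation_class {..<n} s \<and> is_cluster_chart \<iota> A t S \<and> acyclic_cluster S t"
    "spec A = (\<Union>(t, S)\<in>C. (\<lambda>q. q \<inter> A) ` spec (cluster_algebra \<iota> S t))"
    using la unfolding locally_acyclic_def Let_def mut A_def[symmetric] by (elim exE conjE)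
  have C: "t \<in> mutation_class {..<n} s \<and> is_cluster_chart \<iota> A t S \<and> acyclic_cluster S t" if h: "(t, S) \<in> C" for t S
    using bspec[OF C0(1) h] by simp
  define f where "f = (\<lambda>(t :: 'f seed, S). \<Prod>i\<in>{..<n} - S. fst t i)"
  define Q where "Q = (\<lambda>(t :: 'f seed, S). cluster_algebra \<iota> S t)"
  have chart: "f c \<in> A \<and> f c \<noteq> 0 \<and> inverse (f c) \<in> Q c \<and> A \<subseteq> Q c \<and> (\<forall>b\<in>Q c. \<exists>p. f c ^ p * b \<in> A) \<and> subalg (Q c) \<and>
     torsion_free (Q c) \<and> (regular_near n v s \<longrightarrow> extends_to (Q c) v)" if "c \<in> C" for c v
  proof -
    obtain t S where c: "c = (t, S)" by (cases c)
    have t: "t \<in> mutation_class {..<n} s" "is_cluster_chart \<iota> A t S" "acyclic_cluster S t" using C[of t S] that c by simp_all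
    have gt: "good_seed n m t" using class_good[OF t(1) _ s] by simp
    obtain D where D: "seed \<iota> n m (fst t) (snd t) D" using gt by (auto simp: good_seed_def)
    have S: "S \<subseteq> {..<n}" and AS: "cluster_algebra \<iota> S t = subalgebra_gen \<iota> (A \<union> {inverse (fst t i) |i. i \<in> {..<n} - S})"
      using t(2) good_seed_dims[OF gt] by (auto simp: is_cluster_chart_def)
    have tA: "fst t i \<in> A" if "i < n + m" for i
      unfolding A_def cluster_algebra_def using t(1) that good_seed_dims[OF s]
      by (intro gen_incl UnI1) (auto intro!: exI[of _ "fst t"] exI[of _ "snd t"])
    have tnz: "fst t i \<noteq> 0" if "i < n + m" for i using seed.x_nz[OF D that] .
    have Qc: "Q c = subalgebra_gen \<iota> (A \<union> {inverse (fst t i) |i. i \<in> {..<n} - S})" by (simp add: Q_def c AS)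
    have fc: "f c = (\<Prod>i\<in>{..<n} - S. fst t i)" by (simp add: f_def c)
    have f1: "f c \<in> A" unfolding fc by (rule subalg_prod[OF subA]) (simp add: tA)
    have f2: "f c \<noteq> 0" unfolding fc by (simp add: tnz)
    have "inverse (f c) = (\<Prod>i\<in>{..<n} - S. inverse (fst t i))" by (simp add: f_def c flip: prod_inversef[unfolded comp_def])
    also have "\<dots> \<in> Q c" unfolding Qc by (rule subalg_prod[OF subalg_gen]) (auto intro: gen_incl)
    finally have f3: "inverse (f c) \<in> Q c" .
    have AQ: "A \<subseteq> Q c" unfolding Qc by (auto intro: gen_incl)
    have loc: "\<forall>b\<in>Q c. \<exists>p. f c ^ p * b \<in> A"
      using localization_by_inverses[OF subA, of "{..<n} - S" "fst t"] tA tnz unfolding Qc fc by simp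
    obtain u where u: "u \<in> mutation_class S t" "acyclic (quiver S (snd u))" using t(3) by (auto simp: acyclic_cluster_def)
    obtain E where E: "seed \<iota> n m (fst u) (snd u) E" "seed.good_chart \<iota> n m (fst u) (snd u) S" "cluster_algebra \<iota> S t = seed.lower \<iota> n m (fst u) (snd u) S"
      using chart_eq_lower[OF s t(1) S u] by blast
    interpret u: seed \<iota> n m "fst u" "snd u" E by (rule E(1))
    have ul: "cluster_algebra \<iota> S t = u.lower S" by (rule E(3))
    have ug: "u.good_chart S" by (rule E(2))
    have us: "u \<in> mutation_class {..<n} s" using class_trans[OF class_mono[OF u(1) S] t(1)] .
    have "extends_to (Q c) v" if v: "regular_near n v s"
    proof -
      have "regular_near n v u" using class_regular_near[OF us _ s] v by simp
      then show ?thesis using ug S unfolding Q_def c u.good_chart_def by (simp add: ul regular_near_def u.Tor_def u.Tor'_def subset_iff)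
    qed
    moreover have "torsion_free (Q c)" using ug unfolding Q_def c u.good_chart_def by (simp add: ul)
    moreover have "subalg (Q c)" unfolding Q_def c by (simp add: AS)
    ultimately show ?thesis using f1 f2 f3 AQ loc by blast
  qed
  have "spec A \<subseteq> (\<Union>c\<in>C. (\<lambda>q. q \<inter> A) ` spec (Q c))" unfolding C0(2) Q_def by (simp add: case_prod_unfold)
  then have cm: "comaximal A (f ` C)" using chart by (intro spec_cover_comaximal[OF subA]) auto
  have fA: "f ` C \<subseteq> A" "0 \<notin> f ` C" using chart by auto
  define c where "c h = (SOME c. c \<in> C \<and> f c = h)" for h
  have c: "c h \<in> C" "f (c h) = h" if "h \<in> f ` C" for h
    using someI_ex[of "\<lambda>c. c \<in> C \<and> f c = h"] that unfolding c_def by auto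
  have loc: "A \<subseteq> Q (c h) \<and> (\<forall>b\<in>Q (c h). \<exists>p. h ^ p * b \<in> A)" if "h \<in> f ` C" for h
    using chart[OF c(1)[OF that]] c(2)[OF that] by simp
  show "torsion_free A"
    by (rule torsion_free_local[OF subA cm fA(1), of "\<lambda>h. Q (c h)"]) (use chart c loc in simp)
  show "extends_to A v" if v: "regular_near n v s"
  proof (rule extends_local'[OF subA cm fA, of "\<lambda>h. Q (c h)"])
    fix h assume h: "h \<in> f ` C"
    show "subalg (Q (c h)) \<and> A \<subseteq> Q (c h) \<and> (\<forall>b\<in>Q (c h). \<exists>p. h ^ p * b \<in> A)" using loc[OF h] chart[OF c(1)[OF h]] by simp
    show "extends_to (Q (c h)) v" using chart[OF c(1)[OF h], of v] v by simp
  qed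
qed

end

section \<open>Standard forms and residues\<close>

context complex_field
begin

text \<open>The symbol of \<open>c dx\<^sub>i\<^sub>1 / x\<^sub>i\<^sub>1 \<and> \<dots>\<close>. Working with symbols of this shape, rather than with their classes, keeps track of the indices in
  \<open>I\<close> that occur.\<close>

definition dlog_entry :: "(nat \<Rightarrow> 'f) \<Rightarrow> nat set \<Rightarrow> 'f \<Rightarrow> 'f list \<Rightarrow> bool" where
  "dlog_entry x I a bs \<longleftrightarrow> (\<exists>c is. set is \<subseteq> I \<and> a = \<iota> c * (\<Prod>i\<leftarrow>is. inverse (x i)) \<and> bs = map x is)"

definition dlog_list :: "(nat \<Rightarrow> 'f) \<Rightarrow> nat set \<Rightarrow> ('f \<times> 'f list) list \<Rightarrow> bool" where
  "dlog_list x I v \<longleftrightarrow> (\<forall>(a, bs)\<in>set v. dlog_entry x I a bs)"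

text \<open>The exterior product \<open>dlog b \<and> v\<close>.\<close>

definition dwedge :: "'f \<Rightarrow> ('f \<times> 'f list) list \<Rightarrow> ('f \<times> 'f list) list" where
  "dwedge b v = fwedge b (fmul (inverse b) v)"

lemma dlog_list_Nil [simp]: "dlog_list x I []"
  and dlog_list_append [simp]: "dlog_list x I (v @ w) \<longleftrightarrow> dlog_list x I v \<and> dlog_list x I w"
  by (simp_all add: dlog_list_def ball_Un)

lemma dlog_list_Cons: "dlog_list x I ((a, bs) # v) \<longleftrightarrow> dlog_entry x I a bs \<and> dlog_list x I v"
  by (simp add: dlog_list_def)

lemma dlog_entryI: "set js \<subseteq> I \<Longrightarrow> dlog_entry x I (\<iota> c * (\<Prod>i\<leftarrow>js. inverse (x i))) (map x js)"
  unfolding dlog_entry_def by blast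

lemma dlog_entryE:
  assumes "dlog_entry x I a bs"
  obtains c js where "set js \<subseteq> I" "a = \<iota> c * (\<Prod>i\<leftarrow>js. inverse (x i))" "bs = map x js"
  using assms unfolding dlog_entry_def by blast

lemma dlog_list_ConsE:
  assumes "dlog_list x I (p # v)"
  obtains c js where "set js \<subseteq> I" "p = (\<iota> c * (\<Prod>i\<leftarrow>js. inverse (x i)), map x js)" "dlog_list x I v"
proof -
  obtain a bs where p: "p = (a, bs)" by (cases p)
  have e: "dlog_entry x I a bs" and v: "dlog_list x I v" using assms unfolding p dlog_list_Cons by simp_all
  show thesis by (rule dlog_entryE[OF e]) (rule that, simp_all add: p v)
qed

lemma dlog_list_fmul: "dlog_list x I v \<Longrightarrow> dlog_list x I (fmul (\<iota> c) v)"
proof (induction v)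
  case (Cons p v)
  obtain d js where d: "set js \<subseteq> I" "p = (\<iota> d * (\<Prod>i\<leftarrow>js. inverse (x i)), map x js)" "dlog_list x I v"
    using Cons.prems by (rule dlog_list_ConsE)
  have "dlog_entry x I (\<iota> c * (\<iota> d * (\<Prod>i\<leftarrow>js. inverse (x i)))) (map x js)"
    using dlog_entryI[OF d(1), of x "c * d"] by (simp add: hom_distribs mult.assoc)
  then show ?case using Cons.IH[OF d(3)] unfolding d(2) by (simp add: fmul_def dlog_list_Cons)
qed (simp add: fmul_def)

lemma dlog_list_neg: "dlog_list x I v \<Longrightarrow> dlog_list x I (fmul (-1) v)"
  using dlog_list_fmul[of x I v "-1"] by (simp add: hom_distribs)

lemma dlog_list_dwedge: "dlog_list x I v \<Longrightarrow> i \<in> I \<Longrightarrow> dlog_list x I (dwedge (x i) v)"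
proof (induction v)
  case (Cons p v)
  obtain d js where d: "set js \<subseteq> I" "p = (\<iota> d * (\<Prod>i\<leftarrow>js. inverse (x i)), map x js)" "dlog_list x I v"
    using Cons.prems(1) by (rule dlog_list_ConsE)
  have "set (i # js) \<subseteq> I" using d(1) Cons.prems(2) by simp
  from dlog_entryI[OF this, of x d] have "dlog_entry x I (inverse (x i) * (\<iota> d * (\<Prod>i\<leftarrow>js. inverse (x i)))) (x i # map x js)" by (simp add: mult_ac)
  then show ?case using Cons.IH[OF d(3) Cons.prems(2)] unfolding d(2) by (simp add: dwedge_def fmul_def fwedge_def dlog_list_Cons)
qed (simp add: dwedge_def fmul_def fwedge_def)

lemma dlog_list_concat: "(\<And>v. v \<in> set vs \<Longrightarrow> dlog_list x I v) \<Longrightarrow> dlog_list x I (concat vs)"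
  by (induction vs) auto

lemma dlog_list_mono: assumes "dlog_list x I v" "I \<subseteq> J" shows "dlog_list x J v"
proof -
  have "dlog_entry x J a bs" if "dlog_entry x I a bs" for a bs
    using that
  proof (rule dlog_entryE)
    fix c js assume "set js \<subseteq> I" "a = \<iota> c * (\<Prod>i\<leftarrow>js. inverse (x i))" "bs = map x js"
    then show ?thesis using dlog_entryI[of js J x c] assms(2) by simp
  qed
  then show ?thesis using assms(1) unfolding dlog_list_def by fast
qed

lemma dlog_list_cong: assumes "dlog_list x I v" "\<And>i. i \<in> I \<Longrightarrow> x i = x' i" shows "dlog_list x' I v"
proof -
  have "dlog_entry x' I a bs" if e: "dlog_entry x I a bs" for a bs
  proof -
    obtain c js where c: "set js \<subseteq> I" "a = \<iota> c * (\<Prod>i\<leftarrow>js. inverse (x i))" "bs = map x js" using e by (rule dlog_entryE)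
    have "map x js = map x' js" "map (\<lambda>i. inverse (x i)) js = map (\<lambda>i. inverse (x' i)) js" using c(1) assms(2) by auto
    then show ?thesis using dlog_entryI[OF c(1), of x' c] unfolding c(2,3) by metis
  qed
  then show ?thesis using assms(1) unfolding dlog_list_def by fast
qed

lemma dlog_list_part: "dlog_list x I v \<Longrightarrow> dlog_list x I (part k v)"
  unfolding dlog_list_def part_def by simp

lemma fmul_commute: "fmul (-1) (fwedge b (fmul c v)) = fmul c (fmul (-1) (fwedge b v))"
  by (induction v) (auto simp: fmul_def fwedge_def)

lemma contr1_fmul: "contr1 E (c * a) bs = fmul c (contr1 E a bs)"
proof (induction bs)
  case (Cons b bs)
  then show ?case by (simp only: contr1.simps fmul_commute) (simp add: fmul_def mult_ac)
qed (simp add: fmul_def)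

lemma contr_fmul: "contr E (fmul c v) = fmul c (contr E v)"
  by (induction v) (auto simp: contr1_fmul, auto simp: fmul_def contr1_fmul)

lemma contr1_scaled: "contr1 (\<lambda>b. h * E b) a bs = fmul h (contr1 E a bs)"
proof (induction bs)
  case (Cons b bs)
  then show ?case by (simp only: contr1.simps fmul_commute) (simp add: fmul_def mult_ac)
qed (simp add: fmul_def)

lemma contr_scaled: "contr (\<lambda>b. h * E b) v = fmul h (contr E v)"
  by (induction v) (auto simp: contr1_scaled, auto simp: fmul_def)

lemma dlog_list_contr1:
  assumes E: "\<forall>i\<in>I. E (x i) = \<iota> (e i) * x i \<and> x i \<noteq> 0"
  shows "set js \<subseteq> I \<Longrightarrow> dlog_list x I (contr1 E (\<iota> c * (\<Prod>i\<leftarrow>js. inverse (x i))) (map x js))"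
proof (induction js)
  case (Cons j js)
  let ?a = "\<iota> c * (\<Prod>i\<leftarrow>js. inverse (x i))"
  have j: "j \<in> I" "set js \<subseteq> I" using Cons.prems by auto
  have a: "\<iota> c * (\<Prod>i\<leftarrow>j # js. inverse (x i)) = inverse (x j) * ?a" by simp
  have "contr1 E (inverse (x j) * ?a) (map x (j # js)) = (inverse (x j) * ?a * E (x j), map x js) # fmul (-1) (dwedge (x j) (contr1 E ?a (map x js)))"
    by (simp add: dwedge_def contr1_fmul)
  moreover have "inverse (x j) * ?a * E (x j) = \<iota> (c * e j) * (\<Prod>i\<leftarrow>js. inverse (x i))"
    using bspec[OF E j(1)] by (simp add: hom_distribs)
  moreover have "dlog_list x I (fmul (-1) (dwedge (x j) (contr1 E ?a (map x js))))"
    by (rule dlog_list_neg[OF dlog_list_dwedge[OF Cons.IH[OF j(2)] j(1)]])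
  ultimately show ?case unfolding a by (simp only: dlog_list_Cons dlog_entryI[OF j(2)] simp_thms)
qed simp

lemma dlog_list_contr:
  assumes E: "\<forall>i\<in>I. E (x i) = \<iota> (e i) * x i \<and> x i \<noteq> 0"
  shows "dlog_list x I v \<Longrightarrow> dlog_list x I (contr E v)"
proof (induction v)
  case (Cons p v)
  obtain d js where d: "set js \<subseteq> I" "p = (\<iota> d * (\<Prod>i\<leftarrow>js. inverse (x i)), map x js)" "dlog_list x I v"
    using Cons.prems by (rule dlog_list_ConsE)
  show ?case using dlog_list_contr1[OF E d(1)] Cons.IH[OF d(3)] unfolding d(2) by simp
qed simp

lemma over_dlog_list:
  assumes R: "subalg R" and x: "\<And>i. i \<in> I \<Longrightarrow> x i \<in> R \<and> inverse (x i) \<in> R" and v: "dlog_list x I v"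
  shows "over R v"
  using v
proof (induction v)
  case (Cons p v)
  obtain d js where d: "set js \<subseteq> I" "p = (\<iota> d * (\<Prod>i\<leftarrow>js. inverse (x i)), map x js)" "dlog_list x I v"
    using Cons.prems by (rule dlog_list_ConsE)
  have "set js \<subseteq> I \<Longrightarrow> (\<Prod>i\<leftarrow>js. inverse (x i)) \<in> R" by (induction js) (use R x in \<open>auto intro: subalg_mult\<close>)
  then have "\<iota> d * (\<Prod>i\<leftarrow>js. inverse (x i)) \<in> R" using d(1) R by (intro subalg_mult) auto
  moreover have "set (map x js) \<subseteq> R" using d(1) x by auto
  ultimately show ?case using Cons.IH[OF d(3)] unfolding d(2) by (simp only: over_Cons simp_thms)
qed simp

lemma pair_dwedge: "pair G (dwedge b v) = pair (\<lambda>a bs. G (inverse b * a) (b # bs)) v"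
  by (simp add: dwedge_def pair_fwedge pair_fmul)

lemma pair_concat: "pair G (concat vs) = (\<Sum>v\<leftarrow>vs. pair G v)"
  by (induction vs) auto

lemma pair_plus: "pair (\<lambda>a bs. G a bs + H a bs) v = pair G v + pair H v"
  by (induction v) (auto simp: pair_def)

lemma pair_sum: "finite I \<Longrightarrow> pair (\<lambda>a bs. \<Sum>i\<in>I. G i a bs) v = (\<Sum>i\<in>I. pair (G i) v)"
proof (induction I rule: finite_induct)
  case empty then show ?case by (induction v) (auto simp: pair_def)
qed (simp add: pair_plus)

lemma pair_times: "pair (\<lambda>a bs. c * G a bs) v = c * pair G v"
  by (induction v) (auto simp: pair_def distrib_left)

lemma eqv_dwedge: "eqv UNIV v w \<Longrightarrow> eqv UNIV (dwedge b v) (dwedge b w)"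
  unfolding dwedge_def by (intro eqv_fwedge eqv_fmul) auto

lemma eqv_dwedge_swap: "eqv UNIV (dwedge b (dwedge c v)) (fmul (-1) (dwedge c (dwedge b v)))"
  unfolding eqv_def
proof (intro allI impI)
  fix G assume G: "alt UNIV G"
  have "pair G (dwedge b (dwedge c v)) = pair (\<lambda>a bs. - G (inverse c * (inverse b * a)) (c # b # bs)) v"
    unfolding pair_dwedge
    using alt_swap[OF G, of _ b c "[]"] by (intro pair_cong[of UNIV]) (auto simp: mult_ac)
  then show "pair G (dwedge b (dwedge c v)) = pair G (fmul (-1) (dwedge c (dwedge b v)))"
    using pair_times[of "-1" "\<lambda>a bs. G (inverse c * (inverse b * a)) (c # b # bs)" v] by (simp add: pair_neg[OF G] pair_dwedge mult_ac)
qed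

lemma eqv_dwedge_twice: "eqv UNIV (dwedge b (dwedge b v)) []"
  unfolding eqv_def
proof (intro allI impI)
  fix G assume G: "alt UNIV G"
  have "pair G (dwedge b (dwedge b v)) = pair (\<lambda>a bs. 0 * G a bs) v"
    unfolding pair_dwedge
    using alt_alternating[OF G, of _ b "[]" "[]"] by (intro pair_cong[of UNIV]) auto
  then show "pair G (dwedge b (dwedge b v)) = pair G []" by (simp only: pair_times) simp
qed

lemma dwedge_append [simp]: "dwedge b (v @ w) = dwedge b v @ dwedge b w"
  and fmul_append [simp]: "fmul b (v @ w) = fmul b v @ fmul b w"
  by (simp_all add: dwedge_def fmul_def fwedge_def)

lemma eqv_dwedge_divide:
  assumes "u \<noteq> 0" "w \<noteq> 0" shows "eqv UNIV (dwedge (u / w) v) (dwedge u v @ fmul (-1) (dwedge w v))"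
  unfolding eqv_def
proof (intro allI impI)
  fix G assume G: "alt UNIV G"
  have "pair G (dwedge (u / w) v) = pair (\<lambda>a bs. G (inverse u * a) (u # bs) + (-1) * G (inverse w * a) (w # bs)) v"
    unfolding pair_dwedge using alt_dlog_divide[OF _ G, of _ _ u w] assms by (intro pair_cong[of UNIV]) (auto simp: mult.commute)
  then show "pair G (dwedge (u / w) v) = pair G (dwedge u v @ fmul (-1) (dwedge w v))"
    by (simp only: pair_append pair_neg[OF G over_UNIV] pair_dwedge pair_plus pair_times) simp
qed

lemma eqv_dwedge_mult:
  assumes "u \<noteq> 0" "w \<noteq> 0" shows "eqv UNIV (dwedge (u * w) v) (dwedge u v @ dwedge w v)"
  unfolding eqv_def
proof (intro allI impI)
  fix G assume G: "alt UNIV G"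
  have "pair G (dwedge (u * w) v) = pair (\<lambda>a bs. G (inverse u * a) (u # bs) + G (inverse w * a) (w # bs)) v"
    unfolding pair_dwedge using alt_dlog_mult[OF _ G, of _ _ u w] assms by (intro pair_cong[of UNIV]) (auto simp: mult.commute)
  then show "pair G (dwedge (u * w) v) = pair G (dwedge u v @ dwedge w v)"
    by (simp only: pair_append pair_dwedge pair_plus)
qed

text \<open>This is \<open>d(1 + y) = dy = y dlog y\<close>.\<close>

lemma eqv_dwedge_1_plus:
  assumes "y \<noteq> 0" shows "eqv UNIV (dwedge (1 + y) v) (fmul (y / (1 + y)) (dwedge y v))"
  unfolding eqv_def
proof (intro allI impI)
  fix G assume G: "alt UNIV G"
  have d: "G a ((1 + y) # bs) = G a (y # bs)" for a bs
    using alt_d_add[OF G, of a 1 y "[]" bs] alt_const[OF G, of a "[]" bs 1] by simp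
  have "inverse (1 + y) * a = inverse y * (y / (1 + y) * a)" for a using assms by (simp add: field_simps)
  then show "pair G (dwedge (1 + y) v) = pair G (fmul (y / (1 + y)) (dwedge y v))"
    unfolding pair_fmul pair_dwedge using assms d by (intro pair_cong[of UNIV]) (auto simp: mult.left_commute field_simps)
qed

lemma eqv_dwedge_prod:
  fixes r :: nat
  assumes "\<And>i. i < r \<Longrightarrow> u i \<noteq> 0" "\<And>i. i < r \<Longrightarrow> e i > 0 \<Longrightarrow> i \<in> I" "dlog_list u I v"
  shows "\<exists>w. dlog_list u I w \<and> eqv UNIV (dwedge (\<Prod>i<r. u i ^ e i) v) w"
proof -
  let ?w = "concat (map (\<lambda>i. fmul (\<iota> (of_nat (e i))) (dwedge (u i) v)) (filter (\<lambda>i. e i > 0) [0..<r]))"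
  have "dlog_list u I ?w" using assms(2,3) by (intro dlog_list_concat) (auto intro!: dlog_list_fmul dlog_list_dwedge)
  moreover have "eqv UNIV (dwedge (\<Prod>i<r. u i ^ e i) v) ?w"
    unfolding eqv_def
  proof (intro allI impI)
    fix G assume G: "alt UNIV G"
    have "pair G (dwedge (\<Prod>i<r. u i ^ e i) v) = pair (\<lambda>a bs. \<Sum>i<r. of_nat (e i) * G (inverse (u i) * a) (u i # bs)) v"
      unfolding pair_dwedge using alt_dlog_prod[OF _ G, of _ _ "{..<r}" e u] assms(1) by (intro pair_cong[of UNIV]) (auto simp: mult.commute)
    also have "\<dots> = (\<Sum>i<r. of_nat (e i) * pair G (dwedge (u i) v))" by (simp add: pair_sum pair_times pair_dwedge)
    also have "\<dots> = (\<Sum>i\<in>{i\<in>{0..<r}. e i > 0}. of_nat (e i) * pair G (dwedge (u i) v))" by (intro sum.mono_neutral_right) auto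
    also have "\<dots> = pair G ?w"
      by (simp add: pair_concat comp_def pair_scale[OF G] sum_list_distinct_conv_sum_set)
    finally show "pair G (dwedge (\<Prod>i<r. u i ^ e i) v) = pair G ?w" .
  qed
  ultimately show ?thesis by blast
qed

lemma eqv_neg: "eqv UNIV v w \<Longrightarrow> eqv UNIV (fmul (-1) v) (fmul (-1) w)"
  by (rule eqv_fmul) auto

text \<open>The factors \<open>dlog (x k)\<close> are moved to the front and collected; products in which it occurs twice vanish.\<close>

lemma split_dlog_list:
  assumes v: "dlog_list x I v"
  shows "\<exists>v0 v1. dlog_list x (I - {k}) v0 \<and> dlog_list x (I - {k}) v1 \<and> eqv UNIV v (v0 @ dwedge (x k) v1)"
proof -
  let ?P = "\<lambda>v. \<exists>v0 v1. dlog_list x (I - {k}) v0 \<and> dlog_list x (I - {k}) v1 \<and> eqv UNIV v (v0 @ dwedge (x k) v1)"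
  have app: "?P (v @ w)" if vw: "?P v" "?P w" for v w
  proof -
    obtain v0 v1 w0 w1 where h: "dlog_list x (I - {k}) v0" "dlog_list x (I - {k}) v1" "eqv UNIV v (v0 @ dwedge (x k) v1)"
      "dlog_list x (I - {k}) w0" "dlog_list x (I - {k}) w1" "eqv UNIV w (w0 @ dwedge (x k) w1)" using vw by blast
    have "eqv UNIV (v @ w) ((v0 @ w0) @ dwedge (x k) (v1 @ w1))" using h(3,6) by (simp add: eqv_def)
    then show ?thesis using h by (intro exI[of _ "v0 @ w0"] exI[of _ "v1 @ w1"]) simp
  qed
  have one: "?P [(\<iota> c * (\<Prod>i\<leftarrow>js. inverse (x i)), map x js)]" if "set js \<subseteq> I" for c js
    using that
  proof (induction js)
    case Nil
    have "dlog_list x (I - {k}) [(\<iota> c, [])]" using dlog_entryI[of "[]" "I - {k}" x c] by (simp add: dlog_list_Cons)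
    then show ?case by (intro exI[of _ "[(\<iota> c, [])]"] exI[of _ "[]"]) (simp add: dwedge_def fmul_def fwedge_def)
  next
    case (Cons j js)
    let ?v = "[(\<iota> c * (\<Prod>i\<leftarrow>js. inverse (x i)), map x js)]"
    have e: "[(\<iota> c * (\<Prod>i\<leftarrow>j # js. inverse (x i)), map x (j # js))] = dwedge (x j) ?v" by (simp add: dwedge_def fmul_def fwedge_def mult_ac)
    obtain v0 v1 where h: "dlog_list x (I - {k}) v0" "dlog_list x (I - {k}) v1" "eqv UNIV ?v (v0 @ dwedge (x k) v1)"
      using Cons by auto
    have h3: "eqv UNIV (dwedge (x j) ?v) (dwedge (x j) v0 @ dwedge (x j) (dwedge (x k) v1))" using eqv_dwedge[OF h(3), of "x j"] by simp
    show ?case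
    proof (cases "j = k")
      case True
      have "eqv UNIV (dwedge (x j) ?v) ([] @ dwedge (x k) v0)"
        using h3 eqv_dwedge_twice[of "x k" v1] unfolding True eqv_def by simp
      then show ?thesis unfolding e using h(1) dlog_list_Nil by blast
    next
      case False
      then have j: "j \<in> I - {k}" using Cons.prems by auto
      have "eqv UNIV (dwedge (x j) ?v) (dwedge (x j) v0 @ dwedge (x k) (fmul (-1) (dwedge (x j) v1)))"
        unfolding eqv_def
      proof (intro allI impI)
        fix G assume G: "alt UNIV G"
        have "pair G (dwedge (x k) (fmul (-1) (dwedge (x j) v1))) = pair G (fmul (-1) (dwedge (x k) (dwedge (x j) v1)))"
          by (simp add: pair_dwedge pair_fmul mult_ac)
        then show "pair G (dwedge (x j) ?v) = pair G (dwedge (x j) v0 @ dwedge (x k) (fmul (-1) (dwedge (x j) v1)))"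
          using h3 eqv_dwedge_swap[of "x j" "x k" v1] G unfolding eqv_def by simp
      qed
      then show ?thesis unfolding e using dlog_list_dwedge[OF h(1) j] dlog_list_neg[OF dlog_list_dwedge[OF h(2) j]] by blast
    qed
  qed
  show ?thesis using v
  proof (induction v)
    case Nil show ?case by (intro exI[of _ "[]"]) (simp add: dwedge_def fmul_def fwedge_def)
  next
    case (Cons p v)
    obtain d js where d: "set js \<subseteq> I" "p = (\<iota> d * (\<Prod>i\<leftarrow>js. inverse (x i)), map x js)" "dlog_list x I v"
      using Cons.prems by (rule dlog_list_ConsE)
    show ?case using app[OF one[OF d(1), of d] Cons.IH[OF d(3)]] unfolding d(2) append.simps .
  qed
qed

text \<open>The inverse would be a finite sum of weight components \<open>g c\<close>, and comparison of weights in \<open>(1 + y) g = 1\<close> gives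
  \<open>g c = - y g (c - 1)\<close> for \<open>c \<noteq> 0\<close>. So a nonzero component of weight \<open>0\<close> propagates to all positive weights and one of weight \<open>- 1\<close> to all negative
  weights, contradicting finiteness.\<close>

lemma geometric_not_unit:
  assumes E: "derivation E" and H: "\<And>h. h \<in> H \<Longrightarrow> \<exists>c. eigen E c h"
    and y: "eigen E 1 y" "y \<noteq> 0" "1 + y \<noteq> 0"
  shows "inverse (1 + y) \<notin> subalgebra_gen \<iota> H"
proof
  assume y': "inverse (1 + y) \<in> subalgebra_gen \<iota> H"
  have dec: "\<exists>I g. finite I \<and> (\<forall>c. g c \<in> subalgebra_gen \<iota> H \<and> eigen E c (g c)) \<and> (\<forall>c. c \<notin> I \<longrightarrow> g c = 0) \<and> inverse (1 + y) = (\<Sum>c\<in>I. g c)"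
    by (rule eigen_decomposition[OF E _ y']) (rule H)
  obtain I g where g0: "finite I" "\<forall>c. g c \<in> subalgebra_gen \<iota> H \<and> eigen E c (g c)" "\<forall>c. c \<notin> I \<longrightarrow> g c = 0" "inverse (1 + y) = (\<Sum>c\<in>I. g c)"
    using dec by (elim exE conjE)
  have g: "finite I" "\<And>c. eigen E c (g c)" "\<And>c. c \<notin> I \<Longrightarrow> g c = 0" "inverse (1 + y) = (\<Sum>c\<in>I. g c)"
    using g0 by blast+
  define J where "J = insert 0 (I \<union> (\<lambda>c. c + 1) ` I)"
  define h where "h c = g c + y * g (c - 1) - (if c = 0 then 1 else 0)" for c
  have J: "finite J" "I \<subseteq> J" "(\<lambda>c. c + 1) ` I \<subseteq> J" "0 \<in> J" using g(1) by (auto simp: J_def)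
  have "(\<Sum>c\<in>J. g c) = inverse (1 + y)" unfolding g(4) by (rule sum.mono_neutral_right[OF J(1,2)]) (simp add: g(3))
  moreover have "(\<Sum>c\<in>J. g (c - 1)) = inverse (1 + y)"
  proof -
    have "(\<Sum>c\<in>J. g (c - 1)) = (\<Sum>c\<in>(\<lambda>c. c + 1) ` I. g (c - 1))"
    proof (intro sum.mono_neutral_right ballI)
      fix c assume c: "c \<in> J - (\<lambda>c. c + 1) ` I"
      have "c - 1 \<notin> I"
      proof
        assume "c - 1 \<in> I" then have "(c - 1) + 1 \<in> (\<lambda>c. c + 1) ` I" by (rule imageI)
        then show False using c by simp
      qed
      then show "g (c - 1) = 0" by (rule g(3))
    qed (use J in simp_all)
    also have "\<dots> = (\<Sum>c\<in>I. g c)" by (subst sum.reindex) auto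
    finally show ?thesis using g(4) by simp
  qed
  moreover have "(\<Sum>c\<in>J. if c = 0 then 1 else 0) = (1::'f)" using J by simp
  ultimately have "sum h J = inverse (1 + y) + y * inverse (1 + y) - 1"
    unfolding h_def sum_subtractf sum.distrib sum_distrib_left[symmetric] by simp
  also have "\<dots> = (1 + y) * inverse (1 + y) - 1" by (simp add: distrib_right)
  finally have h0: "sum h J = 0" using y(3) by simp
  have he: "eigen E c (h c)" for c
  proof -
    have 1: "eigen E c (y * g (c - 1))" using eigen_mult[OF E y(1) g(2)[of "c - 1"]] by simp
    have 2: "eigen E c (g c + y * g (c - 1))" by (rule eigen_add[OF E g(2) 1])
    show ?thesis
    proof (cases "c = 0")
      case True
      have "E 1 = 0" by (rule der_1[OF E])
      then show ?thesis using 2 True der_diff[OF E, of "g 0 + y * g (-1)" 1] by (simp add: eigen_def h_def)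
    qed (use 2 in \<open>simp add: h_def\<close>)
  qed
  have hJ: "h c = 0" if "c \<in> J" for c
    using eigen_components[OF E subspace_zero _ J(1), of id h c] he h0 that der_0[OF E] by simp
  have hz: "h c = 0" if "c \<noteq> 0" for c
  proof (cases "c \<in> J")
    case False
    then have "c \<notin> I" "c - 1 \<notin> I" using J by (force simp: image_iff)+
    then show ?thesis using g(3) that by (simp add: h_def)
  qed (rule hJ)
  have step: "g c = - y * g (c - 1)" if "c \<noteq> 0" for c using hz[OF that] that by (simp add: h_def add_eq_0_iff)
  have inj: "inj (\<lambda>k::nat. of_nat k :: complex)" "inj (\<lambda>k::nat. - 1 - of_nat k :: complex)" by (auto simp: inj_def)
  have "g 0 = 0"
  proof (rule ccontr)
    assume g0: "g 0 \<noteq> 0"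
    have "g (of_nat k) \<noteq> 0" for k
    proof (induction k)
      case (Suc k)
      have "g (of_nat (Suc k)) = - y * g (of_nat (Suc k) - 1)" by (rule step) (simp del: of_nat_Suc)
      then show ?case using Suc y(2) by simp
    qed (use g0 in simp)
    then have "range (\<lambda>k::nat. of_nat k :: complex) \<subseteq> I" using g(3) by blast
    then show False using g(1) inj(1) finite_subset finite_imageD by blast
  qed
  moreover have "g (-1) = 0"
  proof (rule ccontr)
    assume g0: "g (-1) \<noteq> 0"
    have "g (- 1 - of_nat k) \<noteq> 0" for k
    proof (induction k)
      case (Suc k)
      have "(- 1 - of_nat k :: complex) \<noteq> 0"
      proof
        assume "(- 1 - of_nat k :: complex) = 0"
        moreover have "of_nat (Suc k) = - (- 1 - of_nat k :: complex)" by simp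
        ultimately have "of_nat (Suc k) = (0::complex)" by (simp only: minus_zero)
        then show False by (simp only: of_nat_eq_0_iff)
      qed
      then have "g (- 1 - of_nat k) = - y * g (- 1 - of_nat k - 1)" by (rule step)
      then show ?case using Suc by (auto simp: algebra_simps)
    qed (use g0 in simp)
    then have "range (\<lambda>k::nat. - 1 - of_nat k :: complex) \<subseteq> I" using g(3) by blast
    then show False using g(1) inj(2) finite_subset finite_imageD by blast
  qed
  ultimately show False using hJ[OF J(4)] by (simp add: h_def)
qed

end

context seed
begin

lemma isolated_empty: "isolated {}" by (simp add: isolated_def)

lemma D_Tor: assumes i: "i < N" and b: "b \<in> Tor" shows "D i b \<in> Tor"
proof (rule der_gen_closed[OF D[OF i] subalg_Tor])
  show "b \<in> subalgebra_gen \<iota> (x ` {..<N} \<union> (\<lambda>i. inverse (x i)) ` {..<N})"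
    "subalgebra_gen \<iota> (x ` {..<N} \<union> (\<lambda>i. inverse (x i)) ` {..<N}) \<subseteq> Tor" using b by (simp_all add: Tor_gen)
  have Dx: "D i (x j) \<in> Tor" if "j < N" for j using D_x[OF i that] x_Tor(1)[OF that] by simp
  fix h assume "h \<in> x ` {..<N} \<union> (\<lambda>i. inverse (x i)) ` {..<N}"
  then consider j where "j < N" "h = x j" | j where "j < N" "h = inverse (x j)" by blast
  then show "D i h \<in> Tor"
  proof cases
    case 1 then show ?thesis using Dx by simp
  next
    case 2
    show ?thesis unfolding 2(2) by (rule der_gen_inverse_closed[OF D[OF i] subalg_Tor Dx[OF 2(1)] x_Tor(2)[OF 2(1)]])
  qed
qed

lemma not_unit_1_plus_y: assumes "k < n" shows "inverse (1 + y k) \<notin> Tor"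
  unfolding Tor_gen
proof (rule geometric_not_unit[OF derivation_weighted])
  fix h assume "h \<in> x ` {..<N} \<union> (\<lambda>i. inverse (x i)) ` {..<N}"
  then show "\<exists>c. eigen (weighted (dual k)) c h"
    using eigen_weighted[of _ "dual k"] eigen_inverse[OF derivation_weighted, of "dual k"] by auto
qed (use eigen_dual_y[OF assms assms] one_plus_y[OF assms] in simp_all)

lemma eqv_const_0: "eqv UNIV [(\<iota> 0, [])] []"
  unfolding eqv_def
proof (intro allI impI)
  fix G assume "alt UNIV G"
  then have "G 0 [] = 0" by (rule alt_zero) simp_all
  then show "pair G [(\<iota> 0, [])] = pair G []" by simp
qed

text \<open>Contraction with \<open>D i\<close> commutes with multiplication by \<open>u\<close>, preserves regularity on the torus, and maps standard forms to standard forms of lower degree. So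
  all these contractions vanish by induction, and Euler's identity for the coordinates of the torus (the frame of the empty isolated set) gives the form. In
  degree 0 the form is a constant \<open>c\<close>, and \<open>u c\<close> is regular only if \<open>c = 0\<close>.\<close>

lemma residue_vanishes:
  assumes u: "u \<notin> Tor"
  shows "dlog_list x {..<N} v \<Longrightarrow> homog d v \<Longrightarrow> extends_to Tor (fmul u v) \<Longrightarrow> eqv UNIV v []"
proof (induction d arbitrary: v)
  case 0
  have "\<exists>c. eqv UNIV v [(\<iota> c, [])]" using 0(1,2)
  proof (induction v)
    case Nil
    show ?case by (rule exI[of _ 0]) (rule eqv_sym[OF eqv_const_0])
  next
    case (Cons p v)
    obtain a bs where p0: "p = (a, bs)" by (cases p)
    have p: "p = (a, [])" using Cons.prems(2) unfolding p0 by simp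
    obtain c js where c': "set js \<subseteq> {..<N}" "p = (\<iota> c * (\<Prod>i\<leftarrow>js. inverse (x i)), map x js)" and v: "dlog_list x {..<N} v"
      using Cons.prems(1) by (rule dlog_list_ConsE)
    have c: "a = \<iota> c" using c'(2) unfolding p by simp
    obtain d where d: "eqv UNIV v [(\<iota> d, [])]" using Cons.IH[OF v] Cons.prems(2) unfolding p by auto
    have "eqv UNIV (p # v) [(\<iota> (c + d), [])]"
      unfolding eqv_def
    proof (intro allI impI)
      fix G assume G: "alt UNIV G"
      have "pair G v = G (\<iota> d) []" using d G by (simp add: eqv_def)
      moreover have "G (\<iota> c + \<iota> d) [] = G (\<iota> c) [] + G (\<iota> d) []" by (rule alt_add[OF G]) simp_all
      ultimately show "pair G (p # v) = pair G [(\<iota> (c + d), [])]" by (simp add: p c hom_distribs)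
    qed
    then show ?case by blast
  qed
  then obtain c where c: "eqv UNIV v [(\<iota> c, [])]" by blast
  have "eqv UNIV (fmul u v) [(u * \<iota> c, [])]" using eqv_fmul[OF _ c, of u] by (simp add: fmul_def)
  then have "extends_to Tor [(u * \<iota> c, [])]" using extends_eqv 0(3) by blast
  then have uc: "u * \<iota> c \<in> Tor" by (simp add: extends_function_iff)
  have "c = 0"
  proof (rule ccontr)
    assume "c \<noteq> 0"
    then have "u = \<iota> (inverse c) * (u * \<iota> c)" by (simp add: hom_distribs)
    also have "\<dots> \<in> Tor" by (rule subalg_mult[OF subalg_Tor subalg_const[OF subalg_Tor] uc])
    finally show False using u by simp
  qed
  then show ?case using eqv_trans[OF c] eqv_const_0 by simp
next
  case (Suc d)
  have z: "eqv UNIV (contr (D i) v) []" if i: "i < N" for i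
  proof (rule Suc.IH)
    show "dlog_list x {..<N} (contr (D i) v)"
      using D_x[OF i] x_nz by (intro dlog_list_contr[where e = "\<lambda>j. if i = j then 1 else 0"] Suc.prems(1)) simp
    show "homog d (contr (D i) v)" by (rule homog_contr[OF Suc.prems(2)])
    show "extends_to Tor (fmul u (contr (D i) v))"
      using over_contr_extends[OF Suc.prems(3) _ D[OF i], of] D_Tor[OF i] by (simp add: contr_fmul)
  qed
  show ?case
    unfolding eqv_def
  proof (intro allI impI)
    fix G assume G: "alt UNIV G"
    have "of_nat (Suc d) * pair G v = (\<Sum>(E, \<beta>)\<leftarrow>FS {}. pair (\<lambda>a bs. G a (\<beta> # bs)) (contr E v))"
      using frame_euler_pair[OF _ frame_UNIV[OF isolated_empty] G over_UNIV Suc.prems(2)] by simp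
    also have "\<dots> = (\<Sum>(E, \<beta>)\<leftarrow>FS {}. 0)"
    proof (rule sum_list_pair_cong)
      fix E \<beta> assume "(E, \<beta>) \<in> set (FS {})"
      then obtain g where g: "g < N" "E = E3 {} g" using set_FS[OF isolated_empty] by blast
      have E: "E = (\<lambda>b. inverse (x g) * D g b)" by (simp add: g(2) fun_eq_iff E3_def[OF isolated_empty])
      have "eqv UNIV (contr E v) []" unfolding E contr_scaled using eqv_fmul[OF _ z[OF g(1)], of "inverse (x g)"] by (simp add: fmul_def)
      then show "pair (\<lambda>a bs. G a (\<beta> # bs)) (contr E v) = 0" using alt_fwedge[OF G, of \<beta>] by (simp add: eqv_def)
    qed
    finally show "pair G v = pair G []" by (simp del: of_nat_Suc)
  qed
qed

text \<open>The variable \<open>x k\<close> does not occur in \<open>y k\<close>, and mutation at \<open>k\<close> changes the sign of column \<open>k\<close>.\<close>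

lemma mutated_y: assumes "k < n" shows "seed.y n m (x(k := x' k)) (mutate_mat k B) k = inverse (y k)"
proof -
  interpret s: seed \<iota> n m "x(k := x' k)" "mutate_mat k B" "D' k" by (rule seed_mutate[OF assms])
  have B': "mutate_mat k B $$ (i, k) = - B $$ (i, k)" if "i < N" for i using that assms by (simp add: mutate_mat_def)
  have "s.pos k = neg k" unfolding s.pos_def neg_def
    by (intro prod.cong) (auto simp: B' skew_diag assms)
  moreover have "s.neg k = pos k" unfolding s.neg_def pos_def
    by (intro prod.cong) (auto simp: B' skew_diag assms)
  ultimately show ?thesis by (simp add: s.y_def y_def)
qed

text \<open>The form \<open>v\<close> is \<open>v0 + dlog (x k) \<and> v1\<close> with \<open>v0\<close> and \<open>v1\<close> standard in the variables common to both clusters. Rewriting \<open>dlog (x k)\<close> in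
  terms of \<open>x' k\<close> leaves the nonstandard summand \<open>u dlog (y k) \<and> v1\<close>, which is regular on the neighbor only if it is 0.\<close>

theorem standard_mutate:
  assumes k: "k < n" and v: "dlog_list x {..<N} v" and e: "extends_to (Tor' k) v"
  shows "\<exists>w. dlog_list (x(k := x' k)) {..<N} w \<and> eqv UNIV v w"
proof -
  let ?x = "x(k := x' k)" and ?I = "{..<N} - {k}"
  interpret s: seed \<iota> n m ?x "mutate_mat k B" "D' k" by (rule seed_mutate[OF k])
  have Tor': "s.Tor = Tor' k" by (simp add: s.Tor_def Tor'_def mutate_seed)
  define u where "u = y k / (1 + y k)"
  have u: "u \<notin> Tor' k"
  proof -
    \<comment> \<open>The inverse of \<open>y k\<close> is the corresponding element of the mutated seed, for which \<open>not_unit_1_plus_y\<close> applies on \<open>Tor' k\<close>.\<close>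
    have "inverse (1 + s.y k) = u" using one_plus_y[OF k] by (simp add: mutated_y[OF k] u_def field_simps)
    then show ?thesis using s.not_unit_1_plus_y[OF k] by (simp add: Tor')
  qed
  obtain v0 v1 where s: "dlog_list x ?I v0" "dlog_list x ?I v1" "eqv UNIV v (v0 @ dwedge (x k) v1)"
    using split_dlog_list[OF v, of k] by blast
  have B: "B $$ (k, k) = 0" by (rule skew_diag[OF k])
  have exps: "i \<in> ?I" if "i < N" "nat (max (B $$ (i, k)) 0) > 0 \<or> nat (max (- B $$ (i, k)) 0) > 0" for i using that B by (cases "i = k") auto
  obtain w1 where w1: "dlog_list x ?I w1" "eqv UNIV (dwedge (pos k) v1) w1"
    using eqv_dwedge_prod[of N x "\<lambda>i. nat (max (B $$ (i, k)) 0)" ?I v1] s(2) exps x_nz unfolding pos_def by blast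
  obtain w2 where w2: "dlog_list x ?I w2" "eqv UNIV (dwedge (neg k) v1) w2"
    using eqv_dwedge_prod[of N x "\<lambda>i. nat (max (- B $$ (i, k)) 0)" ?I v1] s(2) exps x_nz unfolding neg_def by blast
  define \<sigma> where "\<sigma> = v0 @ fmul (-1) (dwedge (x' k) v1) @ w2"
  define \<tau> where "\<tau> = w1 @ fmul (-1) w2"
  have I: "dlog_list x ?I w \<Longrightarrow> dlog_list ?x {..<N} w" for w
    by (rule dlog_list_mono[OF dlog_list_cong[of x ?I]]) auto
  have \<sigma>: "dlog_list ?x {..<N} \<sigma>"
    using I[OF s(1)] I[OF w2(1)] dlog_list_neg[OF dlog_list_dwedge[OF I[OF s(2)], of k]] k by (simp add: \<sigma>_def)
  have \<tau>: "dlog_list ?x {..<N} \<tau>" using I[OF w1(1)] dlog_list_neg[OF I[OF w2(1)]] by (simp add: \<tau>_def)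
  have decomposition: "eqv UNIV v (\<sigma> @ fmul u \<tau>)"
    unfolding eqv_def
  proof (intro allI impI)
    fix G assume G: "alt UNIV G"
    have xk: "x k = P k / x' k" using P_eq[OF k] x'_nz[OF k] by simp
    have 1: "pair G (dwedge (x k) v1) = pair G (dwedge (P k) v1) - pair G (dwedge (x' k) v1)"
      using eqv_dwedge_divide[OF P_nz[OF k] x'_nz[OF k], of v1] G unfolding xk[symmetric] by (simp add: eqv_def pair_neg[OF G])
    have 2: "pair G (dwedge (P k) v1) = pair G (dwedge (neg k) v1) + pair G (dwedge (1 + y k) v1)"
      using eqv_dwedge_mult[OF neg_nz one_plus_y[OF k], of k v1] G unfolding P_y by (simp add: eqv_def)
    have 3: "pair G (dwedge (1 + y k) v1) = pair G (fmul u (dwedge (y k) v1))"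
      using eqv_dwedge_1_plus[OF y_nz, of k v1] G unfolding u_def by (simp add: eqv_def)
    have "eqv UNIV (dwedge (y k) v1) \<tau>"
      using eqv_trans[OF eqv_dwedge_divide[OF pos_nz neg_nz, of k k v1] eqv_append[OF w1(2) eqv_neg[OF w2(2)]]] by (simp add: y_def \<tau>_def)
    then have 4: "pair G (fmul u (dwedge (y k) v1)) = pair G (fmul u \<tau>)" using eqv_fmul[of UNIV "dwedge (y k) v1" \<tau> u] G by (simp add: eqv_def)
    have "pair G v = pair G v0 + pair G (dwedge (x k) v1)" using s(3) G by (simp add: eqv_def)
    moreover have "pair G (dwedge (neg k) v1) = pair G w2" using w2(2) G by (simp add: eqv_def)
    ultimately show "pair G v = pair G (\<sigma> @ fmul u \<tau>)" by (simp add: 1 2 3 4 \<sigma>_def pair_neg[OF G])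
  qed
  have "over (Tor' k) \<sigma>"
  proof (rule over_dlog_list[OF _ _ \<sigma>])
    fix i assume "i \<in> {..<N}" then show "?x i \<in> Tor' k \<and> inverse (?x i) \<in> Tor' k" using s.x_Tor[of i] by (simp add: Tor')
  qed simp
  then have e\<sigma>: "extends_to (Tor' k) (fmul (-1) \<sigma>)"
    using subalg_uminus[of "Tor' k" 1] by (intro extends_fmul extends_over) auto
  have "eqv UNIV (v @ fmul (-1) \<sigma>) (fmul u \<tau>)"
    using decomposition by (simp add: eqv_def pair_neg[of UNIV])
  then have e\<tau>: "extends_to (Tor' k) (fmul u \<tau>)" using extends_append[OF e e\<sigma>] extends_eqv by blast
  have "eqv UNIV \<tau> []"
  proof (rule eqv_by_parts)
    fix d
    have "part d (fmul u \<tau>) = fmul u (part d \<tau>)" by (induction \<tau>) (auto simp: part_def fmul_def)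
    then have "extends_to s.Tor (fmul u (part d \<tau>))" using extends_part[OF e\<tau>, of d] by (simp add: Tor')
    then show "eqv UNIV (part d \<tau>) (part d [])"
      using s.residue_vanishes[OF _ dlog_list_part[OF \<tau>] homog_part] u by (simp add: Tor' part_def)
  qed
  then have "eqv UNIV (fmul u \<tau>) []" using eqv_fmul[of UNIV \<tau> "[]" u] by (simp add: fmul_def)
  then have "eqv UNIV v \<sigma>" using decomposition by (simp add: eqv_def)
  then show ?thesis using \<sigma> by blast
qed

end

section \<open>The module of regular forms\<close>

lemma free_space_simps [simp]:
  "carrier (free_space S) = {p. Poly_Mapping.keys p \<subseteq> S}" "add (free_space S) = (+)" "zero (free_space S) = 0"
  "smult (free_space S) = pscale"
  by (simp_all add: free_space_def)

lemma keys_add_subset: "Poly_Mapping.keys p \<subseteq> S \<Longrightarrow> Poly_Mapping.keys q \<subseteq> S \<Longrightarrow> Poly_Mapping.keys (p + q) \<subseteq> S"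
  using Poly_Mapping.keys_add[of p q] by blast

lemma keys_pscale_subset: "Poly_Mapping.keys p \<subseteq> S \<Longrightarrow> Poly_Mapping.keys (pscale c p :: 's \<Rightarrow>\<^sub>0 complex) \<subseteq> S"
  by (auto simp: in_keys_iff)

lemma module_free_space: "module class_ring (free_space S)"
proof (rule moduleI)
  show "cring (class_ring :: complex ring)" by (rule domain.axioms(1)[OF field.axioms(1)[OF class_field]])
  show "abelian_group (free_space S)"
  proof (rule abelian_groupI)
    fix p assume "p \<in> carrier (free_space S)"
    then show "\<exists>q\<in>carrier (free_space S). q \<oplus>\<^bsub>free_space S\<^esub> p = \<zero>\<^bsub>free_space S\<^esub>"
      by (intro bexI[of _ "- p"]) simp_all
  qed (simp_all add: keys_add_subset add_ac)
qed (simp_all add: class_ring_simps keys_pscale_subset pm.scale_left_distrib pm.scale_right_distrib)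

context complex_field
begin

lemma form_symbol_keys: "a \<in> R \<Longrightarrow> set bs \<subseteq> R \<Longrightarrow> Poly_Mapping.keys (form_symbol a bs) \<subseteq> R \<times> lists R"
  by (auto simp: form_symbol_def)

definition symbols :: "'f set \<Rightarrow> ('f \<times> 'f list \<Rightarrow>\<^sub>0 complex) set" where
  "symbols R = {p. Poly_Mapping.keys p \<subseteq> R \<times> lists R}"

lemma symbols_subspace: "pm.subspace (symbols R)"
  unfolding pm.subspace_def symbols_def by (simp add: keys_add_subset keys_pscale_subset)

lemma form_relations_symbols: assumes R: "subalg R" shows "form_relations \<iota> R \<subseteq> symbols R"
proof
  have s: "form_symbol a bs \<in> symbols R" if "a \<in> R" "bs \<in> lists R" for a bs
    using form_symbol_keys[of a R bs] that by (auto simp: symbols_def)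
  have c: "Poly_Mapping.single (a, bs) c \<in> symbols R" if "a \<in> R" "bs \<in> lists R" for a bs and c :: complex
    using pm.subspace_scale[OF symbols_subspace s[OF that], of c] by (simp add: form_symbol_def flip: pm_single)
  note sub = pm.subspace_diff[OF symbols_subspace] pm.subspace_add[OF symbols_subspace]
  have l: "us @ b # vs \<in> lists R" if "us \<in> lists R" "b \<in> R" "vs \<in> lists R" for us b vs using that by simp
  fix r assume "r \<in> form_relations \<iota> R"
  then show "r \<in> symbols R"
  proof cases
    case (scale a bs c)
    show ?thesis unfolding scale(1) by (intro sub s c subalg_mult[OF R] scale(2,3) subalg_const[OF R])
  next
    case (add a a' bs)
    show ?thesis unfolding add(1) by (intro sub s subalg_add[OF R] add(2-4))
  next
    case (d_const a us vs c)
    show ?thesis unfolding d_const(1) by (intro s l d_const(2-4) subalg_const[OF R])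
  next
    case (d_add a b b' us vs)
    show ?thesis unfolding d_add(1) by (intro sub s l d_add(2-6) subalg_add[OF R])
  next
    case (d_mult a b b' us vs)
    show ?thesis unfolding d_mult(1) by (intro sub s l d_mult(2-6) subalg_mult[OF R])
  next
    case (alternating a b us vs ws)
    show ?thesis unfolding alternating(1) by (intro s l alternating(2-6))
  qed
qed

text \<open>The span in the module of the definition and the span in the vector space of all symbols agree because the relations only
  involve symbols over \<open>R\<close>.\<close>

lemma null_forms_span: assumes R: "subalg R" shows "null_forms \<iota> R = pm.span (form_relations \<iota> R)"
proof -
  interpret M: module class_ring "free_space (R \<times> lists R)" by (rule module_free_space)
  have rel: "form_relations \<iota> R \<subseteq> carrier (free_space (R \<times> lists R))"
    using form_relations_symbols[OF R] by (simp add: symbols_def)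
  have "pm.span (form_relations \<iota> R) \<subseteq> symbols R"
    by (rule pm.span_minimal[OF form_relations_symbols[OF R] symbols_subspace])
  then have "submodule class_ring (pm.span (form_relations \<iota> R)) (free_space (R \<times> lists R))"
    by (intro submodule.intro M.module_axioms) (auto simp: symbols_def pm.span_add pm.span_scale pm.span_zero)
  then have "null_forms \<iota> R \<subseteq> pm.span (form_relations \<iota> R)"
    unfolding null_forms_def by (rule M.span_is_subset[OF pm.span_superset])
  moreover have "pm.span (form_relations \<iota> R) \<subseteq> null_forms \<iota> R"
  proof (rule pm.span_minimal)
    show "form_relations \<iota> R \<subseteq> null_forms \<iota> R" unfolding null_forms_def by (rule M.in_own_span[OF rel])
    have sub: "submodule class_ring (null_forms \<iota> R) (free_space (R \<times> lists R))"
      unfolding null_forms_def by (rule M.span_is_submodule[OF rel])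
    show "pm.subspace (null_forms \<iota> R)"
      unfolding pm.subspace_def
      using submodule.zero_closed[OF sub] submodule.m_closed[OF sub] submodule.smult_closed[OF sub] by simp
  qed
  ultimately show ?thesis by blast
qed

definition symbol_class :: "'f set \<Rightarrow> ('f \<times> 'f list \<Rightarrow>\<^sub>0 complex) \<Rightarrow> ('f \<times> 'f list \<Rightarrow>\<^sub>0 complex) set" where
  "symbol_class R p = {h + p |h. h \<in> null_forms \<iota> R}"

text \<open>From here on the classes that make up \<open>forms \<iota> R\<close> are handled through representing lists.\<close>

definition form :: "'f set \<Rightarrow> ('f \<times> 'f list) list \<Rightarrow> ('f \<times> 'f list \<Rightarrow>\<^sub>0 complex) set" where
  "form R v = symbol_class R (to_poly v)"

lemma coset_symbol_class: "null_forms \<iota> R +>\<^bsub>free_space S\<^esub> p = symbol_class R p"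
  by (auto simp: a_r_coset_def' symbol_class_def)

context fixes R assumes R: "subalg R" begin

lemma null_add: "p \<in> null_forms \<iota> R \<Longrightarrow> q \<in> null_forms \<iota> R \<Longrightarrow> p + q \<in> null_forms \<iota> R"
  and null_diff: "p \<in> null_forms \<iota> R \<Longrightarrow> q \<in> null_forms \<iota> R \<Longrightarrow> p - q \<in> null_forms \<iota> R"
  and null_scale: "p \<in> null_forms \<iota> R \<Longrightarrow> pscale c p \<in> null_forms \<iota> R"
  and null_0: "0 \<in> null_forms \<iota> R"
  unfolding null_forms_span[OF R] by (simp_all add: pm.span_add pm.span_diff pm.span_scale pm.span_zero)

lemma in_symbol_class_iff: "q \<in> symbol_class R p \<longleftrightarrow> q - p \<in> null_forms \<iota> R"
  unfolding symbol_class_def by (auto intro!: exI[of _ "q - p"])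

lemma symbol_class_eq_iff: "symbol_class R p = symbol_class R q \<longleftrightarrow> p - q \<in> null_forms \<iota> R"
proof
  assume "symbol_class R p = symbol_class R q"
  then have "p \<in> symbol_class R q" using null_0 in_symbol_class_iff[of p p] by simp
  then show "p - q \<in> null_forms \<iota> R" by (simp add: in_symbol_class_iff)
next
  assume h: "p - q \<in> null_forms \<iota> R"
  have "r - p \<in> null_forms \<iota> R \<longleftrightarrow> r - q \<in> null_forms \<iota> R" for r
    using null_add[of "r - p" "p - q"] null_diff[of "r - q" "p - q"] h by auto
  then show "symbol_class R p = symbol_class R q" by (auto simp: in_symbol_class_iff)
qed

lemma symbol_class_add: "symbol_class R p <+>\<^bsub>free_space S\<^esub> symbol_class R q = symbol_class R (p + q)"
proof -
  have "(\<exists>h\<in>symbol_class R p. \<exists>k\<in>symbol_class R q. r = h + k) \<longleftrightarrow> r \<in> symbol_class R (p + q)" for r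
  proof
    assume "\<exists>h\<in>symbol_class R p. \<exists>k\<in>symbol_class R q. r = h + k"
    then obtain h k where hk: "h - p \<in> null_forms \<iota> R" "k - q \<in> null_forms \<iota> R" "r = h + k" by (auto simp: in_symbol_class_iff)
    have "r - (p + q) = (h - p) + (k - q)" by (simp add: hk(3))
    then show "r \<in> symbol_class R (p + q)" using null_add[OF hk(1,2)] by (simp only: in_symbol_class_iff)
  next
    assume "r \<in> symbol_class R (p + q)"
    then have "r - q \<in> symbol_class R p" "q \<in> symbol_class R q" using null_0 by (simp_all add: in_symbol_class_iff diff_diff_eq add.commute)
    then show "\<exists>h\<in>symbol_class R p. \<exists>k\<in>symbol_class R q. r = h + k" by (intro bexI[of _ "r - q"] bexI[of _ q]) simp_all
  qed
  then show ?thesis unfolding set_add_def' by auto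
qed

lemma symbol_class_scale: "(\<Union>v\<in>symbol_class R p. null_forms \<iota> R +>\<^bsub>free_space S\<^esub> (pscale c v)) = symbol_class R (pscale c p)"
proof -
  have "symbol_class R (pscale c v) = symbol_class R (pscale c p)" if "v \<in> symbol_class R p" for v
    using that null_scale[of "v - p" c] by (simp add: symbol_class_eq_iff in_symbol_class_iff pm.scale_right_diff_distrib)
  moreover have "p \<in> symbol_class R p" using null_0 by (simp add: in_symbol_class_iff)
  ultimately show ?thesis unfolding coset_symbol_class by blast
qed

lemma null_forms_iff: "p \<in> null_forms \<iota> R \<longleftrightarrow> (\<forall>G. alt R G \<longrightarrow> evaluate (\<lambda>(a, bs). G a bs) p = 0)"
  unfolding null_forms_span[OF R] by (rule span_relations_iff)

lemma form_eq_iff: "form R v = form R w \<longleftrightarrow> eqv R v w"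
  unfolding form_def symbol_class_eq_iff null_forms_iff eqv_def by (simp add: evaluate_diff evaluate_to_poly)

lemma to_poly_symbols: "over R v \<Longrightarrow> to_poly v \<in> symbols R"
proof (induction v)
  case (Cons p v)
  obtain a bs where p: "p = (a, bs)" by (cases p)
  have "form_symbol a bs \<in> symbols R" using Cons.prems form_symbol_keys[of a R bs] by (simp add: p symbols_def)
  then show ?case using pm.subspace_add[OF symbols_subspace _ Cons.IH, of "form_symbol a bs"] Cons.prems by (simp add: p to_poly_def)
qed (simp add: to_poly_def pm.subspace_0[OF symbols_subspace])

text \<open>A coefficient \<open>c\<close> of the symbol \<open>(a, bs)\<close> is absorbed into the function \<open>a\<close>.\<close>

lemma symbol_class_symbols: assumes "p \<in> symbols R" shows "\<exists>v. over R v \<and> symbol_class R p = form R v"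
proof -
  obtain ks where ks: "distinct ks" "set ks = Poly_Mapping.keys p" using finite_distinct_list[of "Poly_Mapping.keys p"] by auto
  define v where "v = map (\<lambda>(a, bs). (\<iota> (Poly_Mapping.lookup p (a, bs)) * a, bs)) ks"
  have k: "a \<in> R \<and> set bs \<subseteq> R" if "(a, bs) \<in> set ks" for a bs using that assms ks(2) by (force simp: symbols_def)
  have "over R v" unfolding over_def v_def using k R by (auto intro!: subalg_mult)
  moreover have "symbol_class R p = form R v"
    unfolding form_def symbol_class_eq_iff null_forms_iff
  proof (intro allI impI)
    fix G assume G: "alt R G"
    have "pair G v = (\<Sum>(a, bs)\<leftarrow>ks. G (\<iota> (Poly_Mapping.lookup p (a, bs)) * a) bs)"
      by (simp add: pair_def v_def comp_def case_prod_unfold)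
    also have "\<dots> = (\<Sum>(a, bs)\<leftarrow>ks. Poly_Mapping.lookup p (a, bs) * G a bs)"
      using k by (intro sum_list_pair_cong alt_scale[OF G]) blast+
    also have "\<dots> = evaluate (\<lambda>(a, bs). G a bs) p"
      unfolding evaluate_def by (simp add: sum_list_distinct_conv_sum_set[OF ks(1)] ks(2) case_prod_unfold)
    finally show "evaluate (\<lambda>(a, bs). G a bs) (p - to_poly v) = 0" by (simp add: evaluate_diff evaluate_to_poly)
  qed
  ultimately show ?thesis by blast
qed

lemma carrier_forms: "carrier (forms \<iota> R) = {form R v |v. over R v}"
proof -
  have "carrier (forms \<iota> R) = symbol_class R ` symbols R"
    by (auto simp: forms_def quotient_module_def A_RCOSETS_def' coset_symbol_class symbols_def)
  also have "\<dots> = {form R v |v. over R v}"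
    using symbol_class_symbols to_poly_symbols unfolding form_def by blast
  finally show ?thesis .
qed

lemma form_add: "form R v \<oplus>\<^bsub>forms \<iota> R\<^esub> form R w = form R (v @ w)"
  by (simp add: forms_def quotient_module_def form_def symbol_class_add to_poly_def)

lemma form_zero: "\<zero>\<^bsub>forms \<iota> R\<^esub> = form R []"
  by (simp add: forms_def quotient_module_def form_def symbol_class_def to_poly_def)

lemma form_smult: assumes v: "over R v" shows "c \<odot>\<^bsub>forms \<iota> R\<^esub> form R v = form R (fmul (\<iota> c) v)"
proof -
  have "c \<odot>\<^bsub>forms \<iota> R\<^esub> form R v = symbol_class R (pscale c (to_poly v))"
    by (simp add: forms_def quotient_module_def form_def symbol_class_scale)
  also have "\<dots> = form R (fmul (\<iota> c) v)"
    unfolding form_def symbol_class_eq_iff null_forms_iff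
    by (simp add: evaluate_diff evaluate_scale evaluate_to_poly pair_scale[OF _ v])
  finally show ?thesis .
qed

lemma elem_form_eq: "elem_form \<iota> R a bs = form R [(a, bs)]"
  by (simp add: elem_form_def coset_symbol_class form_def to_poly_def)

lemma module_forms: "module class_ring (forms \<iota> R)"
proof (rule moduleI)
  show "cring (class_ring :: complex ring)" by (rule domain.axioms(1)[OF field.axioms(1)[OF class_field]])
  have ov: "over R (fmul (\<iota> c) v)" if "over R v" for c v by (rule over_fmul[OF R that subalg_const[OF R]])
  have E: "form R v = form R w" if "\<And>G. alt R G \<Longrightarrow> pair G v = pair G w" for v w using that by (simp add: form_eq_iff eqv_def)
  show "abelian_group (forms \<iota> R)"
  proof (rule abelian_groupI)
    fix X assume "X \<in> carrier (forms \<iota> R)"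
    then obtain v where v: "over R v" "X = form R v" by (auto simp: carrier_forms)
    have "form R (fmul (\<iota> (-1)) v @ v) = form R []" using v(1) by (intro E) (simp add: pair_scale)
    then show "\<exists>Y\<in>carrier (forms \<iota> R). Y \<oplus>\<^bsub>forms \<iota> R\<^esub> X = \<zero>\<^bsub>forms \<iota> R\<^esub>"
      using ov[OF v(1)] by (intro bexI[of _ "form R (fmul (\<iota> (-1)) v)"]) (auto simp: form_add form_zero v(2) carrier_forms)
  next
    fix X Y assume "X \<in> carrier (forms \<iota> R)" "Y \<in> carrier (forms \<iota> R)"
    then obtain v w where vw: "X = form R v" "Y = form R w" by (auto simp: carrier_forms)
    show "X \<oplus>\<^bsub>forms \<iota> R\<^esub> Y = Y \<oplus>\<^bsub>forms \<iota> R\<^esub> X" unfolding vw form_add by (rule E) simp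
  qed (auto simp: carrier_forms form_add form_zero intro: over_append[THEN iffD2])
  fix c X assume "X \<in> carrier (forms \<iota> R)"
  then obtain v where v: "over R v" "X = form R v" by (auto simp: carrier_forms)
  show "c \<odot>\<^bsub>forms \<iota> R\<^esub> X \<in> carrier (forms \<iota> R)" using ov[OF v(1)] v by (auto simp: form_smult carrier_forms)
  show "\<one>\<^bsub>class_ring\<^esub> \<odot>\<^bsub>forms \<iota> R\<^esub> X = X"
    unfolding v(2) form_smult[OF v(1)] by (simp add: fmul_1)
  fix d
  show "(c \<oplus>\<^bsub>class_ring\<^esub> d) \<odot>\<^bsub>forms \<iota> R\<^esub> X = c \<odot>\<^bsub>forms \<iota> R\<^esub> X \<oplus>\<^bsub>forms \<iota> R\<^esub> d \<odot>\<^bsub>forms \<iota> R\<^esub> X"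
    unfolding v(2) form_smult[OF v(1)] form_add by (rule E) (simp add: pair_scale[OF _ v(1)] distrib_right del: hom_add)
  show "(c \<otimes>\<^bsub>class_ring\<^esub> d) \<odot>\<^bsub>forms \<iota> R\<^esub> X = c \<odot>\<^bsub>forms \<iota> R\<^esub> (d \<odot>\<^bsub>forms \<iota> R\<^esub> X)"
    unfolding v(2) form_smult[OF v(1)] form_smult[OF ov[OF v(1)]]
    by (rule E) (simp add: pair_scale[OF _ v(1)] pair_scale[OF _ ov[OF v(1)]] del: hom_mult)
  fix Y assume "Y \<in> carrier (forms \<iota> R)"
  then obtain w where w: "over R w" "Y = form R w" by (auto simp: carrier_forms)
  have vw: "over R (v @ w)" using v(1) w(1) by simp
  show "c \<odot>\<^bsub>forms \<iota> R\<^esub> (X \<oplus>\<^bsub>forms \<iota> R\<^esub> Y) = c \<odot>\<^bsub>forms \<iota> R\<^esub> X \<oplus>\<^bsub>forms \<iota> R\<^esub> c \<odot>\<^bsub>forms \<iota> R\<^esub> Y"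
    unfolding v(2) w(2) form_add form_smult[OF v(1)] form_smult[OF w(1)] form_smult[OF vw] by simp
qed

text \<open>The operations on classes are concatenation and scaling of lists.\<close>

lemma submodule_formsI:
  assumes "S \<subseteq> {v. over R v}" "[] \<in> S" "\<And>v w. v \<in> S \<Longrightarrow> w \<in> S \<Longrightarrow> v @ w \<in> S" "\<And>c v. v \<in> S \<Longrightarrow> fmul (\<iota> c) v \<in> S"
  shows "submodule class_ring (form R ` S) (forms \<iota> R)"
proof (rule submodule.intro[OF module_forms])
  show "form R ` S \<subseteq> carrier (forms \<iota> R)" using assms(1) by (auto simp: carrier_forms)
  show "\<zero>\<^bsub>forms \<iota> R\<^esub> \<in> form R ` S" using assms(2) by (simp add: form_zero)
next
  fix X Y assume "X \<in> form R ` S" "Y \<in> form R ` S"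
  then obtain v w where "v \<in> S" "X = form R v" "w \<in> S" "Y = form R w" by blast
  then show "X \<oplus>\<^bsub>forms \<iota> R\<^esub> Y \<in> form R ` S" using assms(3)[of v w] by (simp add: form_add)
next
  fix c X assume "X \<in> form R ` S"
  then obtain v where "v \<in> S" "X = form R v" by blast
  then show "c \<odot>\<^bsub>forms \<iota> R\<^esub> X \<in> form R ` S" using assms(1,4) by (auto simp: form_smult)
qed

lemma vectorspace_formsI:
  assumes "submodule class_ring S (forms \<iota> R)" shows "vectorspace class_ring ((forms \<iota> R)\<lparr>carrier := S\<rparr>)"
  using module.submodule_is_module[OF module_forms assms] class_field by (rule vectorspace.intro)

end

lemma null_forms_mono: assumes "subalg R" "subalg Q" "R \<subseteq> Q" shows "null_forms \<iota> R \<subseteq> null_forms \<iota> Q"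
  using alt_subset[OF _ assms(3)] by (auto simp: null_forms_iff[OF assms(1)] null_forms_iff[OF assms(2)])

text \<open>Relations over \<open>R\<close> are relations over \<open>Q\<close>, so all representatives of a class over \<open>R\<close> have the same class over \<open>Q\<close>.\<close>

lemma form_restrict_form: assumes R: "subalg R" and Q: "subalg Q" and RQ: "R \<subseteq> Q"
  shows "form_restrict \<iota> Q (form R v) = form Q v"
proof -
  have "symbol_class Q p = symbol_class Q (to_poly v)" if "p \<in> symbol_class R (to_poly v)" for p
    using that null_forms_mono[OF R Q RQ] by (auto simp: in_symbol_class_iff[OF R] symbol_class_eq_iff[OF Q])
  moreover have "to_poly v \<in> symbol_class R (to_poly v)" using null_0[OF R] by (simp add: in_symbol_class_iff[OF R])
  ultimately show ?thesis unfolding form_restrict_def coset_symbol_class form_def by blast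
qed

lemma form_extends_iff:
  assumes R: "subalg R" and Q: "subalg Q"
  shows "form_extends \<iota> R Q (form R v) \<longleftrightarrow> (\<exists>w. over Q w \<and> eqv (subalgebra_gen \<iota> (R \<union> Q)) w v)"
proof -
  let ?U = "subalgebra_gen \<iota> (R \<union> Q)"
  have U: "subalg ?U" by simp
  have RU: "R \<subseteq> ?U" "Q \<subseteq> ?U" by (auto intro: gen_incl)
  have "form_extends \<iota> R Q (form R v) \<longleftrightarrow> (\<exists>w. over Q w \<and> form_restrict \<iota> ?U (form Q w) = form_restrict \<iota> ?U (form R v))"
    unfolding form_extends_def carrier_forms[OF Q] by blast
  then show ?thesis unfolding form_restrict_form[OF R U RU(1)] form_restrict_form[OF Q U RU(2)] form_eq_iff[OF U] .
qed

end

section \<open>Standard forms on the variety\<close>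

context complex_field
begin

lemma eqv_difference: "subalg R \<Longrightarrow> over R v \<Longrightarrow> over R w \<Longrightarrow> eqv R (v @ fmul (-1) w) [] \<longleftrightarrow> eqv R v w"
  by (simp add: eqv_def pair_neg)

lemma torsion_free_eqv:
  assumes "torsion_free R" "subalg R" "over R v" "over R w" "eqv UNIV v w" shows "eqv R v w"
proof -
  have "over R (fmul (-1) w)" using assms(2,4) subalg_uminus[of R 1] by (intro over_fmul) simp_all
  then have "over R (v @ fmul (-1) w)" using assms(3) by simp
  moreover have "eqv UNIV (v @ fmul (-1) w) []" using assms(5) by (simp add: eqv_difference)
  ultimately show ?thesis using assms(1-4) eqv_difference unfolding torsion_free_def by blast
qed

lemma torus_variables: assumes "i < dim_row (snd t)" shows "fst t i \<in> torus_ring \<iota> t \<and> inverse (fst t i) \<in> torus_ring \<iota> t"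
  unfolding torus_ring_def using assms by (simp add: gen_incl)

text \<open>The span of the forms \<open>dlog_form\<close> is compared with the set on the right through the minimality of spans in one
  direction and by induction on the list in the other.\<close>

lemma standard_on_torus_eq: "standard_on_torus \<iota> t = form (torus_ring \<iota> t) ` {v. dlog_list (fst t) {..<dim_row (snd t)} v}"
proof -
  let ?T = "torus_ring \<iota> t" and ?S = "{v. dlog_list (fst t) {..<dim_row (snd t)} v}"
  let ?X = "{dlog_form \<iota> t is |is. set is \<subseteq> {..<dim_row (snd t)}}"
  interpret M: module class_ring "forms \<iota> ?T" by (rule module_forms) simp
  have one: "(\<Prod>i\<leftarrow>js. inverse (fst t i)) = \<iota> 1 * (\<Prod>i\<leftarrow>js. inverse (fst t i))" for js by simp
  have over: "over ?T v" if "v \<in> ?S" for v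
  proof (rule over_dlog_list[OF subalg_torus])
    show "dlog_list (fst t) {..<dim_row (snd t)} v" using that by simp
  qed (simp add: torus_variables)
  have dl: "dlog_form \<iota> t js = form ?T [(\<iota> 1 * (\<Prod>i\<leftarrow>js. inverse (fst t i)), map (fst t) js)]" for js
    by (simp add: dlog_form_def elem_form_eq)
  have single: "[(\<iota> c * (\<Prod>i\<leftarrow>js. inverse (fst t i)), map (fst t) js)] \<in> ?S" if "set js \<subseteq> {..<dim_row (snd t)}" for c js
    using dlog_entryI[OF that, of "fst t" c] by (simp only: dlog_list_Cons dlog_list_Nil mem_Collect_eq simp_thms)
  have sub: "submodule class_ring (form ?T ` ?S) (forms \<iota> ?T)"
    by (rule submodule_formsI) (use over in \<open>simp_all add: dlog_list_fmul subset_iff\<close>)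
  have X: "?X \<subseteq> form ?T ` ?S" using single dl by blast
  then have XM: "?X \<subseteq> carrier (forms \<iota> ?T)" using submodule.subset[OF sub] by blast
  have span: "submodule class_ring (standard_on_torus \<iota> t) (forms \<iota> ?T)"
    unfolding standard_on_torus_def by (rule M.span_is_submodule[OF XM])
  have "standard_on_torus \<iota> t \<subseteq> form ?T ` ?S"
    unfolding standard_on_torus_def by (rule M.span_is_subset[OF X sub])
  moreover have "form ?T v \<in> standard_on_torus \<iota> t" if "v \<in> ?S" for v
    using that[unfolded mem_Collect_eq]
  proof (induction v)
    case Nil
    show ?case using submodule.zero_closed[OF span] by (simp add: form_zero)
  next
    case (Cons p v)
    obtain c js where d: "set js \<subseteq> {..<dim_row (snd t)}" "p = (\<iota> c * (\<Prod>i\<leftarrow>js. inverse (fst t i)), map (fst t) js)" and v: "dlog_list (fst t) {..<dim_row (snd t)} v"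
      using Cons.prems by (rule dlog_list_ConsE)
    let ?w = "[(\<iota> 1 * (\<Prod>i\<leftarrow>js. inverse (fst t i)), map (fst t) js)]"
    have "form ?T ?w \<in> standard_on_torus \<iota> t"
      using M.in_own_span[OF XM] d(1) dl unfolding standard_on_torus_def by blast
    then have "c \<odot>\<^bsub>forms \<iota> ?T\<^esub> form ?T ?w \<in> standard_on_torus \<iota> t" using submodule.smult_closed[OF span, of c] by simp
    then have "form ?T (fmul (\<iota> c) ?w) \<in> standard_on_torus \<iota> t" unfolding form_smult[OF subalg_torus over[OF single[OF d(1)]]] .
    moreover have "fmul (\<iota> c) ?w = [p]" by (simp add: fmul_def d(2))
    ultimately have "form ?T [p] \<in> standard_on_torus \<iota> t" by (simp only:)
    then have "form ?T [p] \<oplus>\<^bsub>forms \<iota> ?T\<^esub> form ?T v \<in> standard_on_torus \<iota> t" by (rule submodule.m_closed[OF span _ Cons.IH[OF v]])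
    then show ?case unfolding form_add[OF subalg_torus] by simp
  qed
  ultimately show ?thesis by blast
qed

lemma torus_torsion_free: assumes "good_seed n m t" shows "torsion_free (torus_ring \<iota> t)"
proof -
  obtain D where D: "seed \<iota> n m (fst t) (snd t) D" using assms by (auto simp: good_seed_def)
  interpret seed \<iota> n m "fst t" "snd t" D by (rule D)
  show ?thesis using isolated_torsion_free[OF isolated_empty] Tor_lower by (simp add: Tor_def)
qed

definition standard_at :: "nat \<Rightarrow> nat \<Rightarrow> ('f \<times> 'f list) list \<Rightarrow> 'f seed \<Rightarrow> bool" where
  "standard_at n m v t \<longleftrightarrow> (\<exists>w. dlog_list (fst t) {..<n + m} w \<and> eqv UNIV v w)"

lemma standard_at_mutate:
  assumes t: "good_seed n m t" and k: "k < n" and v: "regular_near n v t" "standard_at n m v t"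
  shows "standard_at n m v (mutate k t)"
proof -
  obtain D where D: "seed \<iota> n m (fst t) (snd t) D" using t by (auto simp: good_seed_def)
  interpret seed \<iota> n m "fst t" "snd t" D by (rule D)
  obtain w where w: "dlog_list (fst t) {..<n + m} w" "eqv UNIV v w" using v(2) by (auto simp: standard_at_def)
  have "extends_to (Tor' k) v" using v(1) k by (simp add: regular_near_def Tor'_def)
  then have "extends_to (Tor' k) w" using extends_eqv w(2) by blast
  then obtain u where u: "dlog_list ((fst t)(k := x' k)) {..<n + m} u" "eqv UNIV w u"
    using standard_mutate[OF k w(1)] by blast
  have "fst (mutate k t) = (fst t)(k := x' k)" using mutate_seed[of k] by simp
  then show ?thesis unfolding standard_at_def using u(1) eqv_trans[OF w(2) u(2)] by (intro exI[of _ u]) simp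
qed

text \<open>Mutation is an involution, so \<open>standard_at_mutate\<close> applies in both directions; the regularity that it needs holds near all seeds of the
  class.\<close>

lemma class_standard_at:
  assumes s: "good_seed n m s" and v: "regular_near n v s"
  shows "u \<in> mutation_class {..<n} s \<Longrightarrow> standard_at n m v u \<longleftrightarrow> standard_at n m v s"
proof (induction rule: mutation_class.induct)
  case (step t k)
  have t: "good_seed n m t" using class_good[OF step(1) _ s] by simp
  have k: "k < n" using step(2) by simp
  have vt: "regular_near n v t" using class_regular_near[OF step(1) _ s] v by simp
  have "standard_at n m v (mutate k t) \<longleftrightarrow> standard_at n m v t"
    using standard_at_mutate[OF t k vt] good_seed_mutate[OF t k]
      standard_at_mutate[OF good_seed_mutate(1)[OF t k] k good_seed_mutate(3)[OF t k vt]] by auto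
  then show ?case using step.IH by simp
qed simp

lemma is_seed_imp_good_seed:
  assumes "is_seed \<iota> n m s" "full_rank (snd s)" shows "good_seed n m s"
proof -
  obtain x B where s: "s = (x, B)" by (cases s)
  have h: "B \<in> carrier_mat (n + m) n" "\<forall>i<n. \<forall>j<n. B $$ (i, j) = - B $$ (j, i)"
    "alg_independent \<iota> (n + m) x" "generate_field class_ring (range \<iota> \<union> x ` {..<n + m}) = UNIV"
    using assms(1) unfolding is_seed_def s prod.case by blast+
  have "full_rank B" using assms(2) by (simp add: s)
  then have ind: "independent_columns B" by (rule full_rank_independent_columns)
  obtain D where D: "coords (n + m) x D" using coords_exist[OF h(3,4)] by blast
  have "seed \<iota> n m x B D"
  proof (intro seed.intro complex_field_axioms seed_axioms.intro)
    show "B $$ (i, j) = - B $$ (j, i)" if "i < n" "j < n" for i j using h(2) that by blast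
  qed (rule h(1) ind D)+
  then show ?thesis unfolding good_seed_def s fst_conv snd_conv by blast
qed

text \<open>Both sides are described by lists: \<open>SV\<close> for forms on the variety and \<open>SW\<close> for forms on the torus. An element \<open>v\<close> of
  \<open>SW\<close> is regular near \<open>t\<close>, hence equal to a form \<open>a\<close> over \<open>A\<close> as a rational form. Equality as rational forms carries over to the
  tori because their rings are torsion free.\<close>

theorem standard_forms_restrict:
  assumes s: "good_seed n m s" and la: "locally_acyclic \<iota> s" and t: "t \<in> mutation_class {..<n} s"
  defines "A \<equiv> cluster_algebra \<iota> {..<n} s" and "T \<equiv> torus_ring \<iota> t"
  defines "V \<equiv> (forms \<iota> A)\<lparr>carrier := standard_on_variety \<iota> s\<rparr>"
    and "W \<equiv> (forms \<iota> T)\<lparr>carrier := standard_extending \<iota> t\<rparr>"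
    and "\<rho> \<equiv> form_restrict \<iota> T"
  shows "linear_map class_ring V W \<rho> \<and> bij_betw \<rho> (carrier V) (carrier W)"
proof -
  let ?C = "mutation_class {..<n} s" and ?T = "\<lambda>u. torus_ring \<iota> u" and ?T' = "\<lambda>k. torus_ring \<iota> (mutate k t)"
  let ?U = "\<lambda>k. subalgebra_gen \<iota> (T \<union> ?T' k)"
  have dims: "dim_row (snd u) = n + m \<and> dim_col (snd u) = n" if "u \<in> ?C" for u
    using good_seed_dims[OF class_good[OF that _ s]] by simp
  have sC: "s \<in> ?C" by (rule mutation_class.base)
  have subA: "subalg A" by (simp add: A_def cluster_algebra_def)
  have subT: "subalg T" by (simp add: T_def)
  have AT: "A \<subseteq> ?T u" if "u \<in> ?C" for u unfolding A_def by (rule cluster_algebra_torus[OF s that])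
  have ATt: "A \<subseteq> T" unfolding T_def by (rule AT[OF t])
  have tfA: "torsion_free A" unfolding A_def by (rule locally_acyclic_forms(1)[OF s la])
  have tfT: "torsion_free (?T u)" if "u \<in> ?C" for u by (rule torus_torsion_free[OF class_good[OF that _ s]]) simp
  have tk: "mutate k t \<in> ?C" if "k < n" for k using mutation_class.step[OF t] that by simp
  have overT: "over (?T u) v" if "dlog_list (fst u) {..<n + m} v" "u \<in> ?C" for u v
    by (rule over_dlog_list[OF subalg_torus _ that(1)]) (use torus_variables[of _ u] dims[OF that(2)] in simp)
  have mutable: "mutable u = {..<n}" if "u \<in> ?C" for u using dims[OF that] by simp
  have std: "standard_on_torus \<iota> u = form (?T u) ` {v. dlog_list (fst u) {..<n + m} v}" if "u \<in> ?C" for u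
    using standard_on_torus_eq[of u] dims[OF that] by simp
  define SV where "SV = {v. over A v \<and> (\<forall>u\<in>?C. standard_at n m v u)}"
  define SW where "SW = {v. dlog_list (fst t) {..<n + m} v \<and> (\<forall>k<n. \<exists>w. over (?T' k) w \<and> eqv (?U k) w v)}"
  have near_iff: "form (?T u) v \<in> standard_on_torus \<iota> u \<longleftrightarrow> standard_at n m v u" if u: "u \<in> ?C" and v: "over (?T u) v" for u v
  proof
    assume "form (?T u) v \<in> standard_on_torus \<iota> u"
    then obtain w where w: "dlog_list (fst u) {..<n + m} w" "eqv (?T u) v w" by (auto simp: std[OF u] form_eq_iff)
    then show "standard_at n m v u" using eqv_mono[OF w(2), of UNIV] by (auto simp: standard_at_def)
  next
    assume "standard_at n m v u"
    then obtain w where w: "dlog_list (fst u) {..<n + m} w" "eqv UNIV v w" by (auto simp: standard_at_def)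
    have "eqv (?T u) v w" by (rule torsion_free_eqv[OF tfT[OF u] _ v overT[OF w(1) u] w(2)]) simp
    then have "form (?T u) v = form (?T u) w" by (simp add: form_eq_iff)
    then show "form (?T u) v \<in> standard_on_torus \<iota> u" using w(1) by (simp add: std[OF u])
  qed
  have V: "standard_on_variety \<iota> s = form A ` SV"
  proof -
    have "form_restrict \<iota> (?T u) (form A v) \<in> standard_on_torus \<iota> u \<longleftrightarrow> standard_at n m v u" if "u \<in> ?C" "over A v" for u v
      unfolding form_restrict_form[OF subA subalg_torus AT[OF that(1)]]
      by (rule near_iff[OF that(1) over_mono[OF that(2) AT[OF that(1)]]])
    then have "{\<omega> \<in> carrier (forms \<iota> A). \<forall>u\<in>?C. form_restrict \<iota> (?T u) \<omega> \<in> standard_on_torus \<iota> u} = form A ` SV"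
      unfolding carrier_forms[OF subA] SV_def by blast
    then show ?thesis unfolding standard_on_variety_def mutable[OF sC] A_def[symmetric] .
  qed
  have W: "standard_extending \<iota> t = form T ` SW"
    unfolding standard_extending_def std[OF t] mutable[OF t] T_def[symmetric] SW_def
    by (auto simp: form_extends_iff[OF subT subalg_torus])
  have neg: "eqv (?U k) (fmul (\<iota> c) w) (fmul (\<iota> c) v)" if "eqv (?U k) w v" for k c v w
    using that by (intro eqv_fmul) simp_all
  have subV: "submodule class_ring (form A ` SV) (forms \<iota> A)"
  proof (rule submodule_formsI[OF subA])
    have "standard_at n m [] u" for u using eqv_refl dlog_list_Nil unfolding standard_at_def by blast
    then show "[] \<in> SV" by (simp add: SV_def)
    have "standard_at n m (v @ w) u" if h: "standard_at n m v u" "standard_at n m w u" for u v w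
    proof -
      obtain v' w' where vw: "dlog_list (fst u) {..<n + m} v'" "eqv UNIV v v'" "dlog_list (fst u) {..<n + m} w'" "eqv UNIV w w'"
        using h unfolding standard_at_def by blast
      show ?thesis unfolding standard_at_def using vw eqv_append[OF vw(2,4)] by (intro exI[of _ "v' @ w'"]) simp
    qed
    then show "v @ w \<in> SV" if "v \<in> SV" "w \<in> SV" for v w using that by (simp add: SV_def)
    have "standard_at n m (fmul (\<iota> c) v) u" if h: "standard_at n m v u" for c u v
    proof -
      obtain w where w: "dlog_list (fst u) {..<n + m} w" "eqv UNIV v w" using h unfolding standard_at_def by blast
      show ?thesis unfolding standard_at_def using dlog_list_fmul[OF w(1)] eqv_fmul[OF subalg_UNIV w(2) UNIV_I] by blast
    qed
    then show "fmul (\<iota> c) v \<in> SV" if "v \<in> SV" for c v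
      using that over_fmul[OF subA _ subalg_const[OF subA]] by (simp add: SV_def)
  qed (auto simp: SV_def)
  have subW: "submodule class_ring (form T ` SW) (forms \<iota> T)"
  proof (rule submodule_formsI[OF subT])
    show "SW \<subseteq> {v. over T v}" using overT[OF _ t] by (auto simp: SW_def T_def)
    show "[] \<in> SW" unfolding SW_def by (auto intro: exI[of _ "[]"])
    show "v @ w \<in> SW" if h: "v \<in> SW" "w \<in> SW" for v w
      unfolding SW_def
    proof (intro CollectI conjI allI impI)
      show "dlog_list (fst t) {..<n + m} (v @ w)" using h by (simp add: SW_def)
      fix k assume "k < n"
      then obtain v' w' where "over (?T' k) v'" "eqv (?U k) v' v" "over (?T' k) w'" "eqv (?U k) w' w" using h unfolding SW_def by blast
      then show "\<exists>u. over (?T' k) u \<and> eqv (?U k) u (v @ w)" using eqv_append by (intro exI[of _ "v' @ w'"]) simp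
    qed
    show "fmul (\<iota> c) v \<in> SW" if h: "v \<in> SW" for c v
      unfolding SW_def
    proof (intro CollectI conjI allI impI)
      show "dlog_list (fst t) {..<n + m} (fmul (\<iota> c) v)" using h by (simp add: SW_def dlog_list_fmul)
      fix k assume "k < n"
      then obtain w where w: "over (?T' k) w" "eqv (?U k) w v" using h unfolding SW_def by blast
      show "\<exists>u. over (?T' k) u \<and> eqv (?U k) u (fmul (\<iota> c) v)"
        using over_fmul[OF subalg_torus w(1), of "\<iota> c"] neg[OF w(2)] by (intro exI[of _ "fmul (\<iota> c) w"]) simp
    qed
  qed
  have \<rho>: "\<rho> (form A v) = form T v" for v unfolding \<rho>_def by (rule form_restrict_form[OF subA subT ATt])
  have maps: "form T v \<in> form T ` SW" if v: "v \<in> SV" for v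
  proof -
    have oA: "over A v" and near: "standard_at n m v t" using v t by (auto simp: SV_def)
    have "form T v \<in> standard_on_torus \<iota> t" using near_iff[OF t] over_mono[OF oA ATt] near by (simp add: T_def)
    then obtain w where w: "dlog_list (fst t) {..<n + m} w" "form T v = form T w" by (auto simp: std[OF t] T_def)
    have "\<exists>u. over (?T' k) u \<and> eqv (?U k) u w" if "k < n" for k
    proof -
      have "eqv (?U k) v w" using w(2) unfolding form_eq_iff[OF subT] by (rule eqv_mono) (auto intro: gen_incl)
      then show ?thesis using over_mono[OF oA AT[OF tk[OF that]]] by blast
    qed
    then show ?thesis using w by (auto simp: SW_def)
  qed
  have vsV: "vectorspace class_ring V" unfolding V_def V by (rule vectorspace_formsI[OF subA subV])
  have vsW: "vectorspace class_ring W" unfolding W_def W by (rule vectorspace_formsI[OF subT subW])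
  have "linear_map class_ring V W \<rho>"
  proof (intro linear_map.intro mod_hom.intro mod_hom_axioms.intro vsV vsW vectorspace.axioms(1))
    show "\<rho> \<in> LinearCombinations.module_hom class_ring V W"
      unfolding module_hom_def
    proof (intro CollectI conjI allI impI)
      show "\<rho> \<in> carrier V \<rightarrow> carrier W" using maps by (auto simp: V_def W_def V W \<rho>)
    next
      fix X Y assume "X \<in> carrier V \<and> Y \<in> carrier V"
      then obtain v w where "X = form A v" "Y = form A w" by (auto simp: V_def V)
      then show "\<rho> (X \<oplus>\<^bsub>V\<^esub> Y) = \<rho> X \<oplus>\<^bsub>W\<^esub> \<rho> Y" by (simp add: V_def W_def form_add[OF subA] form_add[OF subT] \<rho>)
    next
      fix c :: complex and X assume "c \<in> carrier class_ring \<and> X \<in> carrier V"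
      then obtain v where v: "X = form A v" "over A v" by (auto simp: V_def V SV_def)
      show "\<rho> (c \<odot>\<^bsub>V\<^esub> X) = c \<odot>\<^bsub>W\<^esub> \<rho> X"
        using over_mono[OF v(2) ATt] by (simp add: v(1) V_def W_def form_smult[OF subA v(2)] form_smult[OF subT] \<rho>)
    qed
  qed
  moreover have "bij_betw \<rho> (carrier V) (carrier W)"
    unfolding bij_betw_def
  proof
    show "inj_on \<rho> (carrier V)"
    proof (rule inj_onI)
      fix X Y assume "X \<in> carrier V" "Y \<in> carrier V" and e: "\<rho> X = \<rho> Y"
      then obtain v w where v: "X = form A v" "over A v" and w: "Y = form A w" "over A w" by (auto simp: V_def V SV_def)
      have "eqv T v w" using e by (simp add: v(1) w(1) \<rho> form_eq_iff[OF subT])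
      then have "eqv UNIV v w" by (rule eqv_mono) simp
      then have "eqv A v w" by (rule torsion_free_eqv[OF tfA subA v(2) w(2)])
      then show "X = Y" by (simp add: v(1) w(1) form_eq_iff[OF subA])
    qed
    show "\<rho> ` carrier V = carrier W"
    proof
      show "\<rho> ` carrier V \<subseteq> carrier W" using maps by (auto simp: V_def W_def V W \<rho>)
      show "carrier W \<subseteq> \<rho> ` carrier V"
      proof
        fix X assume "X \<in> carrier W"
        then obtain v where v: "v \<in> SW" "X = form T v" by (auto simp: W_def W)
        have dv: "dlog_list (fst t) {..<n + m} v" using v(1) by (simp add: SW_def)
        have ov: "over T v" using overT[OF dv t] by (simp add: T_def)
        have "regular_near n v t"
          unfolding regular_near_def T_def[symmetric]
        proof (intro conjI allI impI)
          show "extends_to T v" by (rule extends_over[OF ov])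
          fix k assume "k < n"
          then obtain w where w: "over (?T' k) w" "eqv (?U k) w v" using v(1) unfolding SW_def by blast
          then show "extends_to (?T' k) v" using eqv_sym[OF eqv_mono[OF w(2), of UNIV]] by (auto simp: extends_to_def)
        qed
        then have near: "regular_near n v s" using class_regular_near[OF t _ s] by simp
        obtain a where a: "over A a" "eqv UNIV v a" using locally_acyclic_forms(2)[OF s la near] unfolding extends_to_def A_def by blast
        have "standard_at n m v t" unfolding standard_at_def by (rule exI[of _ v]) (simp add: dv)
        then have "standard_at n m v u" if "u \<in> ?C" for u
          using class_standard_at[OF s near t] class_standard_at[OF s near that] by simp
        then have "standard_at n m a u" if "u \<in> ?C" for u
          using that eqv_trans[OF eqv_sym[OF a(2)]] unfolding standard_at_def by blast
        then have aV: "a \<in> SV" using a(1) by (simp add: SV_def)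
        have "eqv T v a" unfolding T_def
          by (rule torsion_free_eqv[OF tfT[OF t] _ _ _ a(2)]) (use ov over_mono[OF a(1) ATt] in \<open>simp_all add: T_def\<close>)
        then have "X = \<rho> (form A a)" by (simp add: v(2) \<rho> form_eq_iff[OF subT])
        then show "X \<in> \<rho> ` carrier V" using aV by (auto simp: V_def V)
      qed
    qed
  qed
  ultimately show ?thesis ..
qed

end

theorem proposition9p6:
  fixes \<iota> :: "complex \<Rightarrow> 'f::field" and n m :: nat and s t :: "'f seed"
  assumes "field_hom \<iota>"
    and "is_seed \<iota> n m s"
    and "full_rank (snd s)"
    and "locally_acyclic \<iota> s"
    and "t \<in> mutation_class {..<n} s"
  defines "V \<equiv> (forms \<iota> (cluster_algebra \<iota> {..<n} s))\<lparr>carrier := standard_on_variety \<iota> s\<rparr>"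
    and "W \<equiv> (forms \<iota> (torus_ring \<iota> t))\<lparr>carrier := standard_extending \<iota> t\<rparr>"
    and "\<rho> \<equiv> form_restrict \<iota> (torus_ring \<iota> t)"
  shows "linear_map class_ring V W \<rho> \<and> bij_betw \<rho> (carrier V) (carrier W)"
proof -
  interpret complex_field \<iota> using assms(1) by (rule complex_field.intro)
  show ?thesis
    unfolding V_def W_def \<rho>_def
    by (rule standard_forms_restrict[OF is_seed_imp_good_seed[OF assms(2,3)] assms(4,5)])
qed

end
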